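(* Let $X\subseteq \mathbb P^r$ be an integral projective variety of dimension $3$. Let $D_1,\dots,D_l$ be pairwise distinct effective Cartier divisors of $X$, each an integral surface linearly equivalent to a multiple of the general hyperplane section $H$ of $X$, with degrees $s_1\leq s_2\leq\dots\leq s_l$; let $r_1,\dots,r_l$ be positive integers, and let $$S=r_1D_1+r_2D_2+\dots+r_lD_l.$$ Put $s=s_1$, let $\pi_1$ be the sectional genus of $D_1$, and put $\deg S=r_1s_1+\dots+r_ls_l$. Let $d>30(\deg S)^7$ be an integer, and assume there exists a curve contained in $S$ of degree $d$ and arithmetic genus strictly greater than $$\frac{d^2}{2s}+\frac{d}{2s}\left(2\pi_1-2-s-\frac{1}{2}\right).$$ Then $$G(S,d)=G^*(S,d).$$ Moreover, if $C$ is a curve contained in $S$ of degree $d$, then $$p_a(C)=G(S,d)\quad \Longrightarrow \quad C\in \mathcal C^*(S,d).$$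
   Context: The base field is $\mathbb C$. A curve is a projective scheme of dimension $1$ (not necessarily reduced, irreducible, or Cohen-Macaulay); its arithmetic genus is $p_a(C)=1-\chi(\mathcal O_C)$. Degrees are taken with respect to the given embedding in $\mathbb P^r$. Effective Cartier divisors of $X$ are identified with the associated closed subschemes of $X$. If $f_i$ is a local generator of the ideal sheaf of $D_i$ in $X$, then $S=r_1D_1+\dots+r_lD_l$ denotes the effective Cartier divisor with local generator $f_1^{r_1}f_2^{r_2}\cdots f_l^{r_l}$, regarded as a closed subscheme (a projective surface) of $X$; a curve contained in $S$ is a closed subscheme of $S$ of dimension $1$. The sectional genus of an integral surface in $\mathbb P^r$ is the arithmetic genus of its general hyperplane section. For an integer $d>0$, $\mathcal C(S,d)$ is the set of all curves of degree $d$ contained in $S$, and $\mathcal C^*(S,d)$ is the set of all curves of degree $d$ contained in some integral component $D_i$ of $S$ of minimal degree $s$. Set $$G(S,d)=\max\{p_a(C): C\in\mathcal C(S,d)\},\qquad G^*(S,d)=\max\{p_a(C): C\in\mathcal C^*(S,d)\}.$$ *)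

theory Defs
  imports
    Complex_Main
    "HOL-Library.Poly_Mapping"
    "HOL-Library.Function_Algebras"
    "HOL-Library.Extended_Nat"
    "HOL-Library.Cardinality"
    "HOL-Computational_Algebra.Polynomial"
    "HOL-Computational_Algebra.Fraction_Field"
    "HOL-Algebra.Ideal"
begin

section \<open>Closed subschemes of projective space\<close>

text \<open>
  The homogeneous coordinate ring of complex projective $r$-space is the polynomial ring with
  variables indexed by a finite type with $r + 1$ elements.  The order on the index type
  makes the polynomial ring an instance of \<^class>\<open>idom\<close> and fixes the signs in the Cech
  complex.

  A closed subscheme is represented by its saturated homogeneous ideal; this is the usual
  bijection between closed subschemes of projective space and saturated homogeneous ideals.
  Inclusion of subschemes is reverse inclusion of ideals.
\<close>

type_synonym 'n mpoly = "('n \<Rightarrow>\<^sub>0 nat) \<Rightarrow>\<^sub>0 complex"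

definition poly_ring :: "('n::{finite,linorder}) mpoly ring" where
  "poly_ring = \<lparr>carrier = UNIV, mult = (*), one = 1, zero = 0, add = (+)\<rparr>"

definition forms :: "nat \<Rightarrow> ('n::{finite,linorder}) mpoly set" where
  "forms t = {p. \<forall>m\<in>Poly_Mapping.keys p. (\<Sum>i\<in>UNIV. Poly_Mapping.lookup m i) = t}"

definition coord :: "'n::{finite,linorder} \<Rightarrow> 'n mpoly" where
  "coord i = Poly_Mapping.single (Poly_Mapping.single i 1) 1"

definition linear_form :: "('n::{finite,linorder} \<Rightarrow> complex) \<Rightarrow> 'n mpoly" where
  "linear_form a = (\<Sum>i\<in>UNIV. Poly_Mapping.single (Poly_Mapping.single i 1) (a i))"

definition eval_mpoly :: "('n::{finite,linorder}) mpoly \<Rightarrow> ('n \<Rightarrow> complex) \<Rightarrow> complex" where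
  "eval_mpoly p a =
    (\<Sum>m\<in>Poly_Mapping.keys p.
      Poly_Mapping.lookup p m * (\<Prod>i\<in>UNIV. a i ^ Poly_Mapping.lookup m i))"

definition homogeneous_ideal :: "('n::{finite,linorder}) mpoly set \<Rightarrow> bool" where
  "homogeneous_ideal I \<longleftrightarrow>
    ideal I poly_ring \<and> I = genideal poly_ring (I \<inter> (\<Union>t. forms t))"

definition saturation :: "('n::{finite,linorder}) mpoly set \<Rightarrow> 'n mpoly set" where
  "saturation I = {f. \<exists>k. \<forall>g\<in>forms k. g * f \<in> I}"

definition closed_subscheme :: "('n::{finite,linorder}) mpoly set \<Rightarrow> bool" where
  "closed_subscheme I \<longleftrightarrow> homogeneous_ideal I \<and> saturation I = I"

text \<open>
  Integral closed subschemes, and likewise (not necessarily closed) points, of projective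
  space: homogeneous prime ideals not containing the irrelevant ideal.
\<close>

definition integral_subscheme :: "('n::{finite,linorder}) mpoly set \<Rightarrow> bool" where
  "integral_subscheme P \<longleftrightarrow>
    homogeneous_ideal P \<and> primeideal P poly_ring \<and> \<not> forms 1 \<subseteq> P"

definition points :: "('n::{finite,linorder}) mpoly set \<Rightarrow> 'n mpoly set set" where
  "points I = {P. integral_subscheme P \<and> I \<subseteq> P}"

text \<open>
  Supremum of the lengths of chains of irreducible closed subsets, that is, the topological
  dimension, except that the empty scheme also gets the value 0.
\<close>

definition scheme_dim :: "('n::{finite,linorder}) mpoly set \<Rightarrow> enat" where
  "scheme_dim I =
    Sup {enat n | n. \<exists>p :: nat \<Rightarrow> 'n mpoly set.
      (\<forall>i\<le>n. p i \<in> points I) \<and> (\<forall>i<n. p i \<subset> p (Suc i))}"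


section \<open>Hilbert polynomial and degree\<close>

text \<open>
  The dimension of $V/W$, for complex subspaces $W \subseteq V$ of a vector space with scalar
  multiplication \<open>sc\<close>; meaningful only if this dimension is finite.
\<close>

definition quot_dim ::
  "(complex \<Rightarrow> 'v \<Rightarrow> 'v) \<Rightarrow> 'v::ab_group_add set \<Rightarrow> 'v set \<Rightarrow> nat" where
  "quot_dim sc V W =
    (THE n. \<exists>B. B \<subseteq> V \<and> finite B \<and> card B = n \<and>
      (\<forall>v\<in>V. \<exists>a. v - (\<Sum>b\<in>B. sc (a b) b) \<in> W) \<and>
      (\<forall>a. (\<Sum>b\<in>B. sc (a b) b) \<in> W \<longrightarrow> (\<forall>b\<in>B. a b = 0)))"

definition hilbert_function :: "('n::{finite,linorder}) mpoly set \<Rightarrow> nat \<Rightarrow> nat" where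
  "hilbert_function I t =
    quot_dim (\<lambda>c p. Poly_Mapping.single 0 c * p) (forms t) (I \<inter> forms t)"

definition hilbert_polynomial :: "('n::{finite,linorder}) mpoly set \<Rightarrow> real poly" where
  "hilbert_polynomial I =
    (THE p. \<forall>\<^sub>F t in sequentially. poly p (real t) = real (hilbert_function I t))"

definition scheme_degree :: "('n::{finite,linorder}) mpoly set \<Rightarrow> real" where
  "scheme_degree I =
    fact (degree (hilbert_polynomial I)) * lead_coeff (hilbert_polynomial I)"


section \<open>Euler characteristic and arithmetic genus\<close>

text \<open>
  Cohomology of the structure sheaf, computed by the Cech complex of the standard affine
  cover.  For a nonempty set of indices $\sigma$, \<open>cech_local J \<sigma>\<close> is the degree-zero part of the
  localisation of $J$ at $\prod_{i \in \sigma} x_i$, inside the field of rational functions.  With $R$ the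
  polynomial ring, the cochains of $R/I$ are represented as \<open>cech_cochains UNIV p\<close> modulo
  \<open>cech_cochains I p\<close>; cocycles and coboundaries below are their preimages in
  \<open>cech_cochains UNIV p\<close>.
\<close>

definition cech_local ::
  "('n::{finite,linorder}) mpoly set \<Rightarrow> 'n set \<Rightarrow> 'n mpoly fract set" where
  "cech_local J \<sigma> =
    {Fract a ((\<Prod>i\<in>\<sigma>. coord i) ^ k) | a k. a \<in> J \<and> a \<in> forms (k * card \<sigma>)}"

definition cech_cochains ::
  "('n::{finite,linorder}) mpoly set \<Rightarrow> nat \<Rightarrow> ('n set \<Rightarrow> 'n mpoly fract) set" where
  "cech_cochains J p =
    {c. \<forall>\<sigma>. if card \<sigma> = p + 1 then c \<sigma> \<in> cech_local J \<sigma> else c \<sigma> = 0}"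

definition cech_coboundary ::
  "('n::{finite,linorder} set \<Rightarrow> 'n mpoly fract) \<Rightarrow> ('n set \<Rightarrow> 'n mpoly fract)" where
  "cech_coboundary c = (\<lambda>\<sigma>. \<Sum>i\<in>\<sigma>. (-1) ^ card {j\<in>\<sigma>. j < i} * c (\<sigma> - {i}))"

definition cech_cocycles ::
  "('n::{finite,linorder}) mpoly set \<Rightarrow> nat \<Rightarrow> ('n set \<Rightarrow> 'n mpoly fract) set" where
  "cech_cocycles I p =
    {c \<in> cech_cochains UNIV p. cech_coboundary c \<in> cech_cochains I (p + 1)}"

definition cech_coboundaries ::
  "('n::{finite,linorder}) mpoly set \<Rightarrow> nat \<Rightarrow> ('n set \<Rightarrow> 'n mpoly fract) set" where
  "cech_coboundaries I p =
    {cech_coboundary b + e | b e.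
      b \<in> (case p of 0 \<Rightarrow> {0} | Suc q \<Rightarrow> cech_cochains UNIV q) \<and> e \<in> cech_cochains I p}"

definition cohomology_dim :: "('n::{finite,linorder}) mpoly set \<Rightarrow> nat \<Rightarrow> nat" where
  "cohomology_dim I p =
    quot_dim (\<lambda>z c \<sigma>. Fract (Poly_Mapping.single 0 z) 1 * c \<sigma>)
      (cech_cocycles I p) (cech_coboundaries I p)"

definition euler_characteristic :: "('n::{finite,linorder}) mpoly set \<Rightarrow> int" where
  "euler_characteristic I = (\<Sum>p<CARD('n). (-1) ^ p * int (cohomology_dim I p))"

definition arithmetic_genus :: "('n::{finite,linorder}) mpoly set \<Rightarrow> int" where
  "arithmetic_genus C = 1 - euler_characteristic C"


section \<open>General hyperplane sections\<close>

text \<open>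
  \<open>Q\<close> holds for the linear forms in a nonempty Zariski open subset of the dual projective space.
\<close>

definition general_hyperplane :: "(('n::{finite,linorder}) mpoly \<Rightarrow> bool) \<Rightarrow> bool" where
  "general_hyperplane Q \<longleftrightarrow>
    (\<exists>t. \<exists>F\<in>forms t. F \<noteq> (0 :: 'n mpoly) \<and>
      (\<forall>a. a \<noteq> 0 \<and> eval_mpoly F a \<noteq> 0 \<longrightarrow> Q (linear_form a)))"

definition hyperplane_section ::
  "('n::{finite,linorder}) mpoly set \<Rightarrow> 'n mpoly \<Rightarrow> 'n mpoly set" where
  "hyperplane_section I h = saturation (genideal poly_ring (insert h I))"

definition sectional_genus :: "('n::{finite,linorder}) mpoly set \<Rightarrow> int" where
  "sectional_genus D =
    (THE g. general_hyperplane (\<lambda>h. arithmetic_genus (hyperplane_section D h) = g))"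


section \<open>Effective Cartier divisors\<close>

text \<open>
  The local ring of projective space at \<open>P\<close> and the stalk at \<open>P\<close> of the ideal sheaf of \<open>I\<close>, both
  inside the field of rational functions.  The local ring of \<open>X\<close> at \<open>P\<close> is \<open>local_ring P\<close> modulo
  \<open>local_ideal X P\<close>.  If \<open>X\<close> is integral, taking \<open>P = X\<close> gives the function field of \<open>X\<close>.
\<close>

definition local_ring :: "('n::{finite,linorder}) mpoly set \<Rightarrow> 'n mpoly fract set" where
  "local_ring P = {Fract a b | a b t. a \<in> forms t \<and> b \<in> forms t \<and> b \<notin> P}"

definition local_units :: "('n::{finite,linorder}) mpoly set \<Rightarrow> 'n mpoly fract set" where
  "local_units P = {Fract a b | a b t. a \<in> forms t \<and> b \<in> forms t \<and> a \<notin> P \<and> b \<notin> P}"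

definition local_ideal ::
  "('n::{finite,linorder}) mpoly set \<Rightarrow> 'n mpoly set \<Rightarrow> 'n mpoly fract set" where
  "local_ideal I P = {Fract a b | a b t. a \<in> I \<and> a \<in> forms t \<and> b \<in> forms t \<and> b \<notin> P}"

text \<open>The class of \<open>f\<close> generates the ideal of \<open>D\<close> in the local ring of \<open>X\<close> at \<open>P\<close>.\<close>

definition local_generator ::
  "('n::{finite,linorder}) mpoly set \<Rightarrow> 'n mpoly set \<Rightarrow> 'n mpoly set \<Rightarrow> 'n mpoly fract \<Rightarrow> bool" where
  "local_generator X D P f \<longleftrightarrow>
    f \<in> local_ring P \<and>
    local_ideal D P = {g * f + e | g e. g \<in> local_ring P \<and> e \<in> local_ideal X P}"

definition effective_cartier_divisor ::
  "('n::{finite,linorder}) mpoly set \<Rightarrow> 'n mpoly set \<Rightarrow> bool" where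
  "effective_cartier_divisor X D \<longleftrightarrow>
    closed_subscheme D \<and> X \<subseteq> D \<and>
    (\<forall>P\<in>points X. \<exists>f. local_generator X D P f \<and>
      (\<forall>g\<in>local_ring P. g * f \<in> local_ideal X P \<longrightarrow> g \<in> local_ideal X P))"

text \<open>
  For integral \<open>X\<close>: the Cartier divisor \<open>D - k H\<close> is the divisor of a nonzero rational function
  \<open>\<phi>\<close> on \<open>X\<close>.
\<close>

definition linearly_equivalent_to_multiple ::
  "('n::{finite,linorder}) mpoly set \<Rightarrow> 'n mpoly set \<Rightarrow> int \<Rightarrow> 'n mpoly set \<Rightarrow> bool" where
  "linearly_equivalent_to_multiple X D k H \<longleftrightarrow>
    effective_cartier_divisor X D \<and> effective_cartier_divisor X H \<and>
    (\<exists>\<phi>\<in>local_ring X - local_ideal X X. \<forall>P\<in>points X. \<forall>f h.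
      local_generator X D P f \<and> local_generator X H P h \<longrightarrow>
      (\<exists>u\<in>local_units P. f - u * \<phi> * h powi k \<in> local_ideal X X))"

text \<open>\<open>S\<close> is the divisor $m_1 D_1 + \dots + m_l D_l$ on \<open>X\<close>; this determines \<open>S\<close>.\<close>

definition is_divisor_sum ::
  "('n::{finite,linorder}) mpoly set \<Rightarrow> nat \<Rightarrow> (nat \<Rightarrow> nat) \<Rightarrow> (nat \<Rightarrow> 'n mpoly set) \<Rightarrow>
    'n mpoly set \<Rightarrow> bool" where
  "is_divisor_sum X l m D S \<longleftrightarrow>
    effective_cartier_divisor X S \<and>
    (\<forall>P\<in>points X. \<forall>f. (\<forall>i\<in>{1..l}. local_generator X (D i) P (f i)) \<longrightarrow>
      local_generator X S P (\<Prod>i\<in>{1..l}. f i ^ m i))"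


section \<open>Curves of given degree and maximal genus\<close>

definition curves :: "('n::{finite,linorder}) mpoly set \<Rightarrow> int \<Rightarrow> 'n mpoly set set" where
  "curves S d =
    {C. closed_subscheme C \<and> S \<subseteq> C \<and> scheme_dim C = 1 \<and> scheme_degree C = real_of_int d}"

definition curves_star ::
  "nat \<Rightarrow> (nat \<Rightarrow> ('n::{finite,linorder}) mpoly set) \<Rightarrow> int \<Rightarrow> 'n mpoly set set" where
  "curves_star l D d =
    {C. \<exists>i\<in>{1..l}. (\<forall>j\<in>{1..l}. scheme_degree (D i) \<le> scheme_degree (D j)) \<and> C \<in> curves (D i) d}"

text \<open>
  \<open>max_genus\<close> is unspecified if there is no maximum.  The set of genera is in general infinite
  (unbounded below), so \<^const>\<open>Max\<close> would not be appropriate.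
\<close>

definition has_max_genus :: "('n::{finite,linorder}) mpoly set set \<Rightarrow> bool" where
  "has_max_genus \<C> \<longleftrightarrow> (\<exists>C\<in>\<C>. \<forall>C'\<in>\<C>. arithmetic_genus C' \<le> arithmetic_genus C)"

definition max_genus :: "('n::{finite,linorder}) mpoly set set \<Rightarrow> int" where
  "max_genus \<C> = (GREATEST g. g \<in> arithmetic_genus ` \<C>)"

definition G :: "('n::{finite,linorder}) mpoly set \<Rightarrow> int \<Rightarrow> int" where
  "G S d = max_genus (curves S d)"

definition G_star :: "nat \<Rightarrow> (nat \<Rightarrow> ('n::{finite,linorder}) mpoly set) \<Rightarrow> int \<Rightarrow> int" where
  "G_star l D d = max_genus (curves_star l D d)"

end

theory Submission
  imports Defs "HOL-Library.Set_Algebras"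
begin

text \<open>
  Everything is read off Hilbert polynomials: Cech cohomology gives \<open>p\<^sub>a(C) = 1 - P\<^sub>C(0)\<close>.  If \<open>D \<sim> k H\<close> on \<open>X\<close>, then
  \<open>P\<^sub>C(t) = P\<^sub>B(t) + P\<^sub>R(t - k)\<close> for the section \<open>B = C \<inter> D\<close> and the residual \<open>R = C : D\<close>, and taking residuals along all
  components of \<open>S\<close> exhausts a curve in \<open>S\<close>.  Castelnuovo's argument, applied to the generic member of a pencil of
  hyperplane sections (which is integral over \<open>\<complex>(u)\<close>), bounds the genus of a curve of degree \<open>\<delta>\<close> on an integral surface of
  degree \<open>s\<close> and sectional genus \<open>\<pi>\<close> by \<open>\<delta>\<^sup>2 / 2s + \<delta> (2\<pi> - 2 - s) / 2s + O(s\<^sup>4)\<close>.  For large \<open>d\<close> the coefficient \<open>1 / 2s\<close>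
  decides, so a curve of large genus has a section of degree \<open>d\<close> by a component of minimal degree.  The residual then
  has finite length, and it lowers the genus unless it is empty.
\<close>

section \<open>Dimensions of quotient spaces\<close>

text \<open>A linear equivalence \<open>D \<sim> k H\<close> is condensed into one fraction
  \<open>A / B\<close> of forms, a rational section of O(k) on \<open>X\<close>, and residuals
  become multiplication by it. \<open>X\<close> may fail to be projectively normal, so such
  statements hold only in high degrees; saturation and Hilbert polynomials absorb the finite
  defects. Curves may carry isolated or embedded points; the positivity used to compare a curve with
  its section is that a constant Hilbert polynomial is nonnegative. Linear equivalence has a second
  use: the degree of a component determines \<open>k\<close>, hence its Hilbert polynomial and
  sectional genus, so all components of minimal degree give the same bound. The final estimate is a
  dichotomy. If all sections by minimal components have degree below d/2, the leading coefficient
  1/2s drops to 1/2(s+1), a quadratic loss. Otherwise a residual of degree e > 0 costs at least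
  ed/2s; half of this pays for the slack d/4s in the assumed genus, the other half for the remaining
  errors.\<close>

locale quotient_space = vector_space scale
  for scale :: "'a::field \<Rightarrow> 'b::ab_group_add \<Rightarrow> 'b" (infixr "*s" 75)
begin

text \<open>The map is the identity minus a projection onto \<open>W\<close>. It turns independence
  modulo \<open>W\<close> into ordinary independence, so the exchange lemma applies to
  quotients.\<close>

lemma ex_projection:
  assumes "subspace W"
  shows "\<exists>f. Vector_Spaces.linear scale scale f \<and> (\<forall>x. f x = 0 \<longleftrightarrow> x \<in> W)"
proof -
  interpret p: vector_space_pair scale scale by unfold_locales
  obtain C where C: "C \<subseteq> W" "independent C" "W \<subseteq> span C"
    using basis_exists[of W] by metis
  obtain g where g: "Vector_Spaces.linear scale scale g" "\<forall>x\<in>C. g x = x" "g ` UNIV \<subseteq> span C"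
    using p.linear_independent_extend_subspace[OF C(2), of "\<lambda>x. x"] by auto
  have WC: "W = span C"
    using C span_minimal[OF C(1) assms] by blast
  have "g x = x" if "x \<in> W" for x
  proof (rule p.linear_eq_on[OF g(1) linear_id[unfolded id_def]])
    show "x \<in> span C" using that WC by simp
  qed (use g(2) in auto)
  moreover have "Vector_Spaces.linear scale scale (\<lambda>x. x - g x)"
    by (rule p.linear_compose_sub[OF linear_id[unfolded id_def] g(1)])
  ultimately show ?thesis
    using g(3) WC by (intro exI[of _ "\<lambda>x. x - g x"]) auto
qed

text \<open>A basis of V/W by representatives. Quotients are never formed as types: pairs of sets in
  one ambient space keep filtrations and connecting maps inside a single vector space.\<close>

definition qbasis :: "'b set \<Rightarrow> 'b set \<Rightarrow> 'b set \<Rightarrow> bool" where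
  "qbasis B V W \<longleftrightarrow> finite B \<and> B \<subseteq> V \<and> V \<subseteq> span (B \<union> W) \<and>
    (\<forall>a. (\<Sum>b\<in>B. scale (a b) b) \<in> W \<longrightarrow> (\<forall>b\<in>B. a b = 0))"

definition qfin :: "'b set \<Rightarrow> 'b set \<Rightarrow> bool" where
  "qfin V W \<longleftrightarrow> (\<exists>B. finite B \<and> V \<subseteq> span (B \<union> W))"

definition qd :: "'b set \<Rightarrow> 'b set \<Rightarrow> nat" where
  "qd V W = card (SOME B. qbasis B V W)"

lemma qbasis_indep: "qbasis B V W \<Longrightarrow> (\<Sum>b\<in>B. scale (a b) b) \<in> W \<Longrightarrow> b \<in> B \<Longrightarrow> a b = 0"
  by (auto simp: qbasis_def)

lemma qbasis_notin:
  assumes B: "qbasis B V W" and x: "x \<in> B"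
  shows "x \<notin> W"
proof
  assume xW: "x \<in> W"
  let ?a = "\<lambda>z. if z = x then 1 else 0"
  have "(\<Sum>b\<in>B. scale (?a b) b) = (\<Sum>b\<in>{x}. scale (?a b) b)"
    by (rule sum.mono_neutral_right) (use B x in \<open>auto simp: qbasis_def\<close>)
  then have "(\<Sum>b\<in>B. scale (?a b) b) \<in> W" using xW by simp
  from qbasis_indep[OF B this x] show False by simp
qed

lemma mem_span_Un_subspace:
  assumes "subspace W" "finite B"
  shows "v \<in> span (B \<union> W) \<longleftrightarrow> (\<exists>a. v - (\<Sum>b\<in>B. scale (a b) b) \<in> W)"
proof
  assume "v \<in> span (B \<union> W)"
  then obtain x w where "v = x + w" "x \<in> span B" "w \<in> W"
    using assms(1) by (auto simp: span_Un span_eq_iff[THEN iffD2])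
  then show "\<exists>a. v - (\<Sum>b\<in>B. scale (a b) b) \<in> W"
    using span_finite[OF assms(2)] by (smt (verit) add_diff_cancel_left' image_iff)
next
  assume "\<exists>a. v - (\<Sum>b\<in>B. scale (a b) b) \<in> W"
  then obtain a where "v - (\<Sum>b\<in>B. scale (a b) b) \<in> W" by blast
  then have "(\<Sum>b\<in>B. scale (a b) b) + (v - (\<Sum>b\<in>B. scale (a b) b)) \<in> span (B \<union> W)"
    by (intro span_add span_sum span_scale) (auto intro: span_base)
  then show "v \<in> span (B \<union> W)" by simp
qed

lemma qbasis_card_le:
  assumes "subspace W" "finite B" "B \<subseteq> span (C \<union> W)" "finite C"
    and "\<And>a. (\<Sum>b\<in>B. scale (a b) b) \<in> W \<Longrightarrow> (\<forall>b\<in>B. a b = 0)"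
  shows "card B \<le> card C"
proof -
  interpret p: vector_space_pair scale scale by unfold_locales
  obtain f where f: "Vector_Spaces.linear scale scale f" "\<And>x. f x = 0 \<longleftrightarrow> x \<in> W"
    using ex_projection[OF assms(1)] by blast
  interpret f: Vector_Spaces.linear scale scale f by fact
  have inj: "inj_on f B"
  proof (rule inj_onI, rule ccontr)
    fix x y assume xy: "x \<in> B" "y \<in> B" "f x = f y" "x \<noteq> y"
    let ?a = "\<lambda>z. if z = x then 1 else if z = y then -1 else 0"
    have "(\<Sum>b\<in>B. scale (?a b) b) = (\<Sum>b\<in>{x,y}. scale (?a b) b)"
      by (rule sum.mono_neutral_right) (use assms(2) xy in auto)
    also have "\<dots> = x - y" using xy by simp
    also have "\<dots> \<in> W" using f(2)[of "x - y"] xy by (simp add: f.diff)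
    finally have "(\<Sum>b\<in>B. scale (?a b) b) \<in> W" .
    from bspec[OF assms(5)[OF this] xy(1)] show False by simp
  qed
  have ind: "independent (f ` B)"
  proof (rule independent_if_scalars_zero)
    show "finite (f ` B)" using assms(2) by simp
    fix u x assume u: "(\<Sum>x\<in>f ` B. scale (u x) x) = 0" "x \<in> f ` B"
    have "f (\<Sum>b\<in>B. scale (u (f b)) b) = 0"
      using u(1) by (simp add: f.sum f.scale sum.reindex[OF inj])
    then have "\<forall>b\<in>B. u (f b) = 0" using f(2) assms(5)[of "\<lambda>b. u (f b)"] by simp
    then show "u x = 0" using u(2) by auto
  qed
  have "f ` B \<subseteq> span (f ` C)"
  proof safe
    fix b assume "b \<in> B"
    then obtain a where "b - (\<Sum>c\<in>C. scale (a c) c) \<in> W"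
      using assms(3) mem_span_Un_subspace[OF assms(1,4)] by blast
    then have "f b = (\<Sum>c\<in>C. scale (a c) (f c))"
      using f(2)[of "b - (\<Sum>c\<in>C. scale (a c) c)"] by (simp add: f.diff f.sum f.scale)
    then show "f b \<in> span (f ` C)"
      by (auto intro!: span_sum span_scale intro: span_base)
  qed
  then have "card (f ` B) \<le> card (f ` C)"
    using independent_span_bound[OF _ ind] assms(4) by blast
  then show ?thesis
    using card_image[OF inj] card_image_le[OF assms(4), of f] by linarith
qed

lemma qd_eq:
  assumes "subspace W" "qbasis B V W"
  shows "qd V W = card B"
proof -
  have "qbasis (SOME B. qbasis B V W) V W" using assms(2) by (rule someI)
  moreover have "card B1 \<le> card B2" if "qbasis B1 V W" "qbasis B2 V W" for B1 B2
    using that by (intro qbasis_card_le[OF assms(1)]) (auto simp: qbasis_def)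
  ultimately show ?thesis unfolding qd_def using assms(2) by (intro antisym)
qed

lemma qbasis_imp_qfin: "qbasis B V W \<Longrightarrow> qfin V W"
  by (auto simp: qbasis_def qfin_def)

text \<open>A finite set spanning \<open>V\<close> modulo \<open>W\<close> bounds the size of sets
  independent modulo \<open>W\<close>, so a largest such set exists in \<open>V\<close>, and
  maximality makes it span.\<close>

lemma ex_qbasis:
  assumes "subspace W" "qfin V W"
  obtains B where "qbasis B V W"
proof -
  obtain C where C: "finite C" "V \<subseteq> span (C \<union> W)" using assms(2) by (auto simp: qfin_def)
  define P where "P B \<longleftrightarrow> finite B \<and> B \<subseteq> V \<and>
    (\<forall>a. (\<Sum>b\<in>B. scale (a b) b) \<in> W \<longrightarrow> (\<forall>b\<in>B. a b = 0))" for B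
  have "P {}" by (simp add: P_def)
  moreover have "card B \<le> card C" if "P B" for B
  proof (rule qbasis_card_le[OF assms(1) _ _ C(1)])
    show "B \<subseteq> span (C \<union> W)" using that C(2) by (auto simp: P_def)
  qed (use that in \<open>simp_all add: P_def\<close>)
  ultimately obtain B where B: "P B" "\<And>B'. P B' \<Longrightarrow> card B' \<le> card B"
    using ex_has_greatest_nat[of P "{}" card "Suc (card C)"] by (metis le_imp_less_Suc)
  have "v \<in> span (B \<union> W)" if v: "v \<in> V" for v
  proof (rule ccontr)
    assume nv: "v \<notin> span (B \<union> W)"
    then have "v \<notin> B" by (auto intro: span_base)
    have "P (insert v B)" unfolding P_def
    proof (intro conjI allI impI)
      show "finite (insert v B)" "insert v B \<subseteq> V" using B(1) v by (auto simp: P_def)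
      fix a assume "(\<Sum>b\<in>insert v B. scale (a b) b) \<in> W"
      then have s: "scale (a v) v + (\<Sum>b\<in>B. scale (a b) b) \<in> W"
        using B(1) \<open>v \<notin> B\<close> by (simp add: P_def)
      have "a v = 0"
      proof (rule ccontr)
        assume a: "a v \<noteq> 0"
        have "scale (inverse (a v)) (scale (a v) v + (\<Sum>b\<in>B. scale (a b) b)) \<in> W"
          using s assms(1) subspace_scale by blast
        then have "v - (\<Sum>b\<in>B. scale (- (inverse (a v) * a b)) b) \<in> W"
          using a by (simp add: scale_right_distrib scale_sum_right sum_negf)
        then show False
          using nv mem_span_Un_subspace[OF assms(1), of B v] B(1)
          by (metis (no_types) P_def)
      qed
      then show "\<forall>b\<in>insert v B. a b = 0" using s B(1) by (simp add: P_def)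
    qed
    then have "card (insert v B) \<le> card B" using B(2) by blast
    then show False using \<open>v \<notin> B\<close> B(1) by (simp add: P_def)
  qed
  then have "qbasis B V W" using B(1) by (auto simp: qbasis_def P_def)
  then show ?thesis using that by blast
qed

lemma qbasis_trans:
  assumes "subspace V" "subspace W" "W \<subseteq> V" "V \<subseteq> U" "qbasis B1 V W" "qbasis B2 U V"
  shows "qbasis (B1 \<union> B2) U W \<and> B1 \<inter> B2 = {}"
proof -
  note q = assms(5,6)[unfolded qbasis_def]
  have dis: "B1 \<inter> B2 = {}"
  proof safe
    fix x assume x: "x \<in> B1" "x \<in> B2"
    then show "x \<in> {}" using q qbasis_notin[OF assms(6)] by auto
  qed
  have "span (B1 \<union> W) \<subseteq> span (B1 \<union> B2 \<union> W)"
    by (rule span_mono) auto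
  then have "V \<subseteq> span (B1 \<union> B2 \<union> W)" using q by blast
  then have "span (B2 \<union> V) \<subseteq> span (B1 \<union> B2 \<union> W)"
    by (intro span_minimal) (auto intro: span_base)
  then have "U \<subseteq> span (B1 \<union> B2 \<union> W)" using q by blast
  moreover have "\<forall>b\<in>B1 \<union> B2. a b = 0" if a: "(\<Sum>b\<in>B1 \<union> B2. scale (a b) b) \<in> W" for a
  proof -
    have s: "(\<Sum>b\<in>B1. scale (a b) b) + (\<Sum>b\<in>B2. scale (a b) b) \<in> W"
      using a q dis by (simp add: sum.union_disjoint)
    have "(\<Sum>b\<in>B1. scale (a b) b) \<in> V"
      using q assms(1) by (intro subspace_sum subspace_scale) auto
    then have "(\<Sum>b\<in>B2. scale (a b) b) \<in> V"
      using s assms(1,3) by (metis add_diff_cancel_left' subsetD subspace_diff)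
    note 2 = qbasis_indep[OF assms(6) this]
    then have "(\<Sum>b\<in>B1. scale (a b) b) \<in> W" using s by simp
    then show ?thesis using 2 qbasis_indep[OF assms(5)] by auto
  qed
  ultimately show ?thesis using dis q assms(4) by (auto simp: qbasis_def)
qed

lemma qfin_subset: "qfin U W \<Longrightarrow> V \<subseteq> U \<Longrightarrow> qfin V W"
  by (auto simp: qfin_def)

lemma qfin_mono: "qfin U W \<Longrightarrow> W \<subseteq> V \<Longrightarrow> qfin U V"
  unfolding qfin_def using span_mono[OF Un_mono[OF subset_refl]] by (meson order_trans)

lemma
  assumes "subspace V" "subspace W" "W \<subseteq> V" "V \<subseteq> U"
  shows qfin_trans: "qfin V W \<Longrightarrow> qfin U V \<Longrightarrow> qfin U W"
    and qd_trans: "qfin V W \<Longrightarrow> qfin U V \<Longrightarrow> qd U W = qd U V + qd V W"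
proof -
  assume "qfin V W" "qfin U V"
  then obtain B1 B2 where B: "qbasis B1 V W" "qbasis B2 U V"
    using ex_qbasis assms by metis
  note q = qbasis_trans[OF assms B]
  show "qfin U W" using q qbasis_imp_qfin by blast
  have "card (B1 \<union> B2) = card B1 + card B2"
    using q B by (intro card_Un_disjoint) (auto simp: qbasis_def)
  then show "qd U W = qd U V + qd V W"
    using q B assms qd_eq by (metis add.commute)
qed

lemma qd_trans':
  assumes "subspace V" "subspace W" "W \<subseteq> V" "V \<subseteq> U" "qfin U W"
  shows "qd U W = qd U V + qd V W"
  using assms qd_trans qfin_subset qfin_mono by metis

lemma qd_self [simp]: "qd V V = 0" and qfin_self [simp]: "qfin V V"
proof -
  have "qbasis {} V V" by (auto simp: qbasis_def intro: span_base)
  then have B: "qbasis (SOME B. qbasis B V V) V V" by (rule someI[where P = "\<lambda>B. qbasis B V V"])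
  have "A = {}" if "qbasis A V V" for A using qbasis_notin[OF that] that by (auto simp: qbasis_def)
  from this[OF B] have "(SOME B. qbasis B V V) = {}" .
  then show "qd V V = 0" unfolding qd_def by (simp only: card.empty)
  show "qfin V V" unfolding qfin_def by (intro exI[of _ "{}"]) (auto intro: span_base)
qed

lemma qd_eq_0:
  assumes "subspace V" "subspace W" "W \<subseteq> V" "qfin V W"
  shows "qd V W = 0 \<longleftrightarrow> V = W"
proof
  assume 0: "qd V W = 0"
  obtain B where B: "qbasis B V W" using ex_qbasis assms by metis
  then have "B = {}" using 0 qd_eq[OF assms(2) B] by (auto simp: qbasis_def)
  then have "V \<subseteq> span W" using B by (auto simp: qbasis_def)
  then show "V = W" using assms by (metis span_eq_iff subset_antisym)
qed auto

lemma subspace_set_plus: "subspace A \<Longrightarrow> subspace B \<Longrightarrow> subspace (A + B)"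
proof -
  have "A + B = {x + y |x y. x \<in> A \<and> y \<in> B}" by (auto simp: set_plus_def)
  then show "subspace A \<Longrightarrow> subspace B \<Longrightarrow> subspace (A + B)" using subspace_sums[of A B] by simp
qed

text \<open>First isomorphism theorem: \<open>g\<close> induces an isomorphism from V modulo the
  preimage of \<open>W\<close> onto (g V + W)/W. The dimension shifts below, in exact sequences and
  in residuals, are instances of it.\<close>

lemma
  assumes g: "Vector_Spaces.linear scale scale g" and "subspace V" "subspace W"
  shows qfin_image: "qfin (g ` V + W) W \<longleftrightarrow> qfin V {v \<in> V. g v \<in> W}" (is "?L \<longleftrightarrow> ?R")
    and qd_image: "qfin V {v \<in> V. g v \<in> W} \<Longrightarrow> qd (g ` V + W) W = qd V {v \<in> V. g v \<in> W}"
proof -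
  interpret g: Vector_Spaces.linear scale scale g by fact
  let ?V = "{v \<in> V. g v \<in> W}"
  have sV: "subspace ?V"
    using assms(2,3) by (auto simp: subspace_def g.add g.scale)
  have sgW: "subspace (g ` V + W)"
    using assms(2,3) g.subspace_image by (intro subspace_set_plus) auto
  have q: "qbasis (g ` B) (g ` V + W) W \<and> inj_on g B" if B: "qbasis B V ?V" for B
  proof -
    note B' = B[unfolded qbasis_def]
    have ind: "\<forall>b\<in>B. a b = 0" if "(\<Sum>b\<in>B. scale (a b) (g b)) \<in> W" for a
    proof -
      have "(\<Sum>b\<in>B. scale (a b) b) \<in> V"
        using B' assms(2) by (intro subspace_sum subspace_scale) auto
      then have "(\<Sum>b\<in>B. scale (a b) b) \<in> ?V" using that by (simp add: g.sum g.scale)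
      then show ?thesis using qbasis_indep[OF B] by auto
    qed
    have inj: "inj_on g B"
    proof (rule inj_onI, rule ccontr)
      fix x y assume xy: "x \<in> B" "y \<in> B" "g x = g y" "x \<noteq> y"
      let ?a = "\<lambda>z. if z = x then 1 else if z = y then -1 else 0"
      have "(\<Sum>b\<in>B. scale (?a b) (g b)) = (\<Sum>b\<in>{x,y}. scale (?a b) (g b))"
        by (rule sum.mono_neutral_right) (use B' xy in auto)
      also have "\<dots> = 0" using xy by simp
      finally have "(\<Sum>b\<in>B. scale (?a b) (g b)) \<in> W" using subspace_0[OF assms(3)] by simp
      from bspec[OF ind[OF this] xy(1)] show False by simp
    qed
    have "qbasis (g ` B) (g ` V + W) W" unfolding qbasis_def
    proof (intro conjI allI impI)
      show "finite (g ` B)" using B' by simp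
      show "g ` B \<subseteq> g ` V + W"
      proof
        fix x assume "x \<in> g ` B"
        then have "x + 0 \<in> g ` V + W" using B' subspace_0[OF assms(3)] by (intro set_plus_intro) auto
        then show "x \<in> g ` V + W" by simp
      qed
      show "g ` V + W \<subseteq> span (g ` B \<union> W)"
      proof
        fix x assume "x \<in> g ` V + W"
        then obtain v w where x: "x = g v + w" "v \<in> V" "w \<in> W" by (auto elim!: set_plus_elim)
        obtain a where "v - (\<Sum>b\<in>B. scale (a b) b) \<in> ?V"
          using x(2) B' mem_span_Un_subspace[OF sV, of B v] by blast
        then have "g v - (\<Sum>b\<in>B. scale (a b) (g b)) \<in> W" by (simp add: g.diff g.sum g.scale)
        then have "x - (\<Sum>b\<in>B. scale (a b) (g b)) \<in> W"
          using x assms(3) by (metis (no_types) add_diff_eq diff_add_eq subspace_add)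
        then have "(\<Sum>b\<in>B. scale (a b) (g b)) + (x - (\<Sum>b\<in>B. scale (a b) (g b))) \<in> span (g ` B \<union> W)"
          by (intro span_add span_sum span_scale) (auto intro: span_base)
        then show "x \<in> span (g ` B \<union> W)" by simp
      qed
      fix a assume a: "(\<Sum>b\<in>g ` B. scale (a b) b) \<in> W"
      then have "(\<Sum>b\<in>B. scale (a (g b)) (g b)) \<in> W" by (simp add: sum.reindex[OF inj])
      then show "\<forall>b\<in>g ` B. a b = 0" using ind[of "\<lambda>b. a (g b)"] by simp
    qed
    then show ?thesis using inj by blast
  qed
  show "qd (g ` V + W) W = qd V ?V" if "qfin V ?V"
  proof -
    obtain B where B: "qbasis B V ?V" by (rule ex_qbasis[OF sV \<open>qfin V ?V\<close>])
    have "qd (g ` V + W) W = card (g ` B)" using qd_eq[OF assms(3)] q[OF B] by simp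
    also have "\<dots> = card B" using q[OF B] card_image by blast
    also have "\<dots> = qd V ?V" using qd_eq[OF sV B] by simp
    finally show ?thesis .
  qed
  show "?L \<longleftrightarrow> ?R"
  proof
    assume ?R
    then obtain B where "qbasis B V ?V" by (rule ex_qbasis[OF sV])
    then show ?L using q qbasis_imp_qfin by blast
  next
    assume ?L
    then obtain C where C: "qbasis C (g ` V + W) W" by (rule ex_qbasis[OF assms(3)])
    note C' = C[unfolded qbasis_def]
    have "\<forall>c\<in>C. \<exists>v\<in>V. c - g v \<in> W"
    proof
      fix c assume "c \<in> C"
      then have "c \<in> g ` V + W" using C' by blast
      then obtain v w where "c = g v + w" "v \<in> V" "w \<in> W" by (auto elim!: set_plus_elim)
      then show "\<exists>v\<in>V. c - g v \<in> W" by (intro bexI[of _ v]) simp_all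
    qed
    then obtain v where v: "\<And>c. c \<in> C \<Longrightarrow> v c \<in> V \<and> c - g (v c) \<in> W" by metis
    have "V \<subseteq> span (v ` C \<union> ?V)"
    proof
      fix x assume x: "x \<in> V"
      have "g x + 0 \<in> g ` V + W" using x subspace_0[OF assms(3)] by (intro set_plus_intro) auto
      then obtain a where a: "g x - (\<Sum>c\<in>C. scale (a c) c) \<in> W"
        using C' mem_span_Un_subspace[OF assms(3), of C "g x"] by auto
      have "(\<Sum>c\<in>C. scale (a c) (c - g (v c))) \<in> W"
        using v assms(3) by (intro subspace_sum subspace_scale) auto
      then have "g x - (\<Sum>c\<in>C. scale (a c) c) + (\<Sum>c\<in>C. scale (a c) (c - g (v c))) \<in> W"
        using a assms(3) subspace_add by blast
      then have "g (x - (\<Sum>c\<in>C. scale (a c) (v c))) \<in> W"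
        by (simp add: g.diff g.sum g.scale scale_right_diff_distrib sum_subtractf)
      moreover have "x - (\<Sum>c\<in>C. scale (a c) (v c)) \<in> V"
        using x v assms(2) by (intro subspace_diff subspace_sum subspace_scale) auto
      ultimately have "(\<Sum>c\<in>C. scale (a c) (v c)) + (x - (\<Sum>c\<in>C. scale (a c) (v c))) \<in> span (v ` C \<union> ?V)"
        by (intro span_add span_sum span_scale) (auto intro: span_base)
      then show "x \<in> span (v ` C \<union> ?V)" by simp
    qed
    then show ?R using C' unfolding qfin_def by (meson finite_imageI)
  qed
qed

end

lemma quot_dim_eq_qd:
  fixes sc :: "complex \<Rightarrow> 'v::ab_group_add \<Rightarrow> 'v"
  assumes "quotient_space sc" "module.subspace sc W" "quotient_space.qfin sc V W"
  shows "quot_dim sc V W = quotient_space.qd sc V W"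
proof -
  interpret quotient_space sc by fact
  have *: "(B \<subseteq> V \<and> finite B \<and> card B = n \<and>
      (\<forall>v\<in>V. \<exists>a. v - (\<Sum>b\<in>B. sc (a b) b) \<in> W) \<and>
      (\<forall>a. (\<Sum>b\<in>B. sc (a b) b) \<in> W \<longrightarrow> (\<forall>b\<in>B. a b = 0))) \<longleftrightarrow> qbasis B V W \<and> card B = n" for B n
    using mem_span_Un_subspace[OF assms(2), of B] unfolding qbasis_def by (cases "finite B") blast+
  obtain B where B: "qbasis B V W" using ex_qbasis assms by metis
  show ?thesis unfolding quot_dim_def *
    using B qd_eq[OF assms(2)] by (intro the_equality) metis+
qed

section \<open>Graded ideals\<close>

text \<open>
  Homogeneous ideals are handled as families of graded pieces.  Degrees are integers, so that twists need no
  truncated subtraction.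
\<close>

type_synonym ('n, 'k) mpol = "('n \<Rightarrow>\<^sub>0 nat) \<Rightarrow>\<^sub>0 'k"
type_synonym ('n, 'k) fam = "int \<Rightarrow> ('n, 'k) mpol set"
type_synonym 'n cfam = "('n, complex) fam"

abbreviation "lookup \<equiv> Poly_Mapping.lookup"
abbreviation "keys \<equiv> Poly_Mapping.keys"
abbreviation "single \<equiv> Poly_Mapping.single"

definition mdeg :: "('n::{finite,linorder} \<Rightarrow>\<^sub>0 nat) \<Rightarrow> nat" where
  "mdeg m = (\<Sum>i\<in>UNIV. lookup m i)"

definition hf :: "('n::{finite,linorder}, 'k::field) fam" where
  "hf t = {p. \<forall>m\<in>keys p. int (mdeg m) = t}"

definition var :: "'n::{finite,linorder} \<Rightarrow> ('n, 'k::field) mpol" where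
  "var i = single (single i 1) 1"

abbreviation const :: "'k::field \<Rightarrow> ('n::{finite,linorder}, 'k) mpol" where
  "const c \<equiv> single 0 c"

lemma forms_eq_hf: "forms t = hf (int t)"
  by (simp add: forms_def hf_def mdeg_def del: of_nat_sum)

lemma coord_eq_var: "coord i = var i"
  by (simp add: coord_def var_def)

lemma mdeg_add: "mdeg (a + b) = mdeg a + mdeg b"
  by (simp add: mdeg_def lookup_add sum.distrib)

lemma mdeg_0 [simp]: "mdeg 0 = 0"
  by (simp add: mdeg_def)

lemma mdeg_single [simp]: "mdeg (single i k) = k"
  by (simp add: mdeg_def lookup_single when_def)

lemma finite_mdeg: "finite {m :: 'n::{finite,linorder} \<Rightarrow>\<^sub>0 nat. mdeg m = t}"
proof -
  have fin: "finite {f :: 'n \<Rightarrow> nat. \<forall>x. f x \<in> {..t}}"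
    using finite_set_of_finite_funs[of "UNIV :: 'n set" "{..t}" 0] by simp
  have le: "lookup m x \<le> mdeg m" for m :: "'n \<Rightarrow>\<^sub>0 nat" and x
    unfolding mdeg_def by (rule member_le_sum) auto
  have "finite (lookup ` {m :: 'n \<Rightarrow>\<^sub>0 nat. mdeg m = t})"
    by (rule finite_subset[OF _ fin]) (use le in auto)
  then show ?thesis
    by (rule finite_imageD) (simp add: inj_on_def)
qed

lemma sum_monomials:
  "p = (\<Sum>m\<in>keys p. single m (lookup p m))"
  by (rule poly_mapping_eqI) (auto simp: lookup_sum lookup_single when_def in_keys_iff)

lemma lookup_single_mult:
  fixes f :: "('n::{finite,linorder}, 'k::field) mpol"
  shows "lookup (single q c * f) (q + m) = c * lookup f m"
proof -
  have "single q c * f =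
      (\<Sum>k\<in>keys f. single (q + k) (c * lookup f k))"
    by (subst (1) sum_monomials[of f]) (simp add: sum_distrib_left mult_single)
  then show ?thesis
    by (auto simp: lookup_sum lookup_single when_def in_keys_iff)
qed

lemma hf_zero [simp]: "0 \<in> hf t"
  by (simp add: hf_def)

lemma hf_add: "f \<in> hf t \<Longrightarrow> g \<in> hf t \<Longrightarrow> f + g \<in> hf t"
  using keys_add[of f g] by (auto simp: hf_def)

lemma hf_mult: "f \<in> hf a \<Longrightarrow> g \<in> hf b \<Longrightarrow> f * g \<in> hf (a + b)"
  using keys_mult[of f g] by (fastforce simp: hf_def mdeg_add)

lemma hf_single: "int (mdeg m) = t \<Longrightarrow> single m c \<in> hf t"
  by (auto simp: hf_def)

lemma hf_const [simp]: "const c \<in> hf 0"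
  by (rule hf_single) simp

lemma hf_one [simp]: "1 \<in> hf 0"
  using hf_const[of 1] by simp

lemma hf_var [simp]: "var i \<in> hf 1"
  unfolding var_def by (rule hf_single) simp

lemma var_nonzero [simp]: "var i \<noteq> 0"
  unfolding var_def by (metis lookup_single_eq lookup_zero zero_neq_one)

lemma hf_smult: "f \<in> hf t \<Longrightarrow> const c * f \<in> hf t"
  using hf_mult[OF hf_const, of f t c] by simp

lemma hf_uminus: "f \<in> hf t \<Longrightarrow> - f \<in> hf t"
  by (auto simp: hf_def in_keys_iff)

lemma hf_diff: "f \<in> hf t \<Longrightarrow> g \<in> hf t \<Longrightarrow> f - g \<in> hf t"
  using hf_add[OF _ hf_uminus, of f t g] by simp

lemma hf_sum: "(\<And>x. x \<in> A \<Longrightarrow> f x \<in> hf t) \<Longrightarrow> sum f A \<in> hf t"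
  by (induction A rule: infinite_finite_induct) (auto intro: hf_add)

lemma hf_neg: "t < 0 \<Longrightarrow> hf t = {0}"
  by (auto simp: hf_def in_keys_iff intro!: poly_mapping_eqI)

lemma hf_power: "f \<in> hf t \<Longrightarrow> f ^ k \<in> hf (int k * t)"
  by (induction k) (auto simp: algebra_simps dest: hf_mult)

text \<open>A monomial of positive degree is divisible by a variable; choosing one for each monomial
  splits the form.\<close>

lemma hf_Suc:
  assumes "f \<in> hf (t + 1)" "t \<ge> 0"
  shows "\<exists>g. (\<forall>i. g i \<in> hf t) \<and> f = (\<Sum>i\<in>UNIV. var i * g i)"
proof -
  have "\<exists>i. lookup m i \<noteq> 0" if "m \<in> keys f" for m
  proof (rule ccontr)
    assume "\<not> ?thesis"
    then have "mdeg m = 0" by (simp add: mdeg_def)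
    then show False using that assms by (auto simp: hf_def)
  qed
  then obtain v where v: "\<And>m. m \<in> keys f \<Longrightarrow> lookup m (v m) \<noteq> 0" by metis
  define r where "r m = m - single (v m) 1" for m
  have r: "m = single (v m) 1 + r m" if "m \<in> keys f" for m
    unfolding r_def using v[OF that]
    by (auto intro!: poly_mapping_eqI simp: lookup_add lookup_minus lookup_single when_def)
  define g where "g i = (\<Sum>m\<in>{m\<in>keys f. v m = i}.
    single (r m) (lookup f m))" for i
  have "g i \<in> hf t" for i unfolding g_def
  proof (rule hf_sum, rule hf_single)
    fix m assume m: "m \<in> {m \<in> keys f. v m = i}"
    then have "mdeg m = 1 + mdeg (r m)" using r[of m] mdeg_add[of "single (v m) 1" "r m"] by simp
    then show "int (mdeg (r m)) = t" using m assms by (auto simp: hf_def)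
  qed
  moreover have "f = (\<Sum>i\<in>UNIV. var i * g i)"
  proof -
    have "(\<Sum>i\<in>UNIV. var i * g i) = (\<Sum>i\<in>UNIV. \<Sum>m\<in>{m\<in>keys f. v m = i}.
        single m (lookup f m))"
      unfolding g_def sum_distrib_left var_def
      by (intro sum.cong refl) (use r in \<open>auto simp: mult_single\<close>)
    also have "\<dots> = (\<Sum>m\<in>keys f. single m (lookup f m))"
      by (rule sum.group) auto
    finally show ?thesis using sum_monomials[of f] by simp
  qed
  ultimately show ?thesis by blast
qed

interpretation mp: quotient_space "\<lambda>c p. const c * (p :: ('n::{finite,linorder}, 'k::field) mpol)"
proof
qed (simp_all add: distrib_left distrib_right single_add mult_single mult.assoc[symmetric])

lemma mp_subspaceI:
  assumes "0 \<in> V" "\<And>f g. f \<in> V \<Longrightarrow> g \<in> V \<Longrightarrow> f + g \<in> V" "\<And>c f. f \<in> V \<Longrightarrow> const c * f \<in> V"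
  shows "mp.subspace V"
  using assms by (simp add: mp.subspace_def)

lemma subspace_hf: "mp.subspace (hf t)"
  by (rule mp_subspaceI) (auto intro: hf_add hf_smult)

lemma linear_times: "Vector_Spaces.linear (\<lambda>c p. const c * p) (\<lambda>c p. const c * p)
    ((*) (f :: ('n::{finite,linorder}, 'k::field) mpol))"
  by unfold_locales (auto simp: algebra_simps)

lemma qfin_hf:
  fixes W :: "('n::{finite,linorder}, 'k::field) mpol set"
  shows "mp.qfin (hf t) W"
proof -
  define B :: "('n, 'k) mpol set"
    where "B = (\<lambda>m. single m 1) ` {m. mdeg m = nat t}"
  have "finite B" unfolding B_def using finite_mdeg by blast
  moreover have "hf t \<subseteq> mp.span (B \<union> W)"
  proof
    fix f :: "('n, 'k) mpol" assume f: "f \<in> hf t"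
    have "(\<Sum>m\<in>keys f. const (lookup f m) * single m 1) \<in> mp.span (B \<union> W)"
    proof (intro mp.span_sum mp.span_scale mp.span_base UnI1)
      fix m assume "m \<in> keys f"
      then have "int (mdeg m) = t" using f by (simp add: hf_def)
      then show "single m 1 \<in> B" by (auto simp: B_def)
    qed
    then show "f \<in> mp.span (B \<union> W)" using sum_monomials[of f] by (simp add: mult_single)
  qed
  ultimately show ?thesis unfolding mp.qfin_def by blast
qed

definition gideal :: "('n::{finite,linorder}, 'k::field) fam \<Rightarrow> bool" where
  "gideal I \<longleftrightarrow> (\<forall>t. I t \<subseteq> hf t \<and> 0 \<in> I t \<and> (\<forall>f\<in>I t. \<forall>g\<in>I t. f + g \<in> I t)) \<and>
    (\<forall>t e. \<forall>f\<in>I t. \<forall>g\<in>hf e. g * f \<in> I (e + t))"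

lemma gidealI:
  assumes "\<And>t f. f \<in> I t \<Longrightarrow> f \<in> hf t" "\<And>t. 0 \<in> I t"
    "\<And>t f g. f \<in> I t \<Longrightarrow> g \<in> I t \<Longrightarrow> f + g \<in> I t"
    "\<And>t e f g. f \<in> I t \<Longrightarrow> g \<in> hf e \<Longrightarrow> g * f \<in> I (e + t)"
  shows "gideal I"
  using assms by (auto simp: gideal_def)

lemma gideal_hf: "gideal I \<Longrightarrow> f \<in> I t \<Longrightarrow> f \<in> hf t"
  and gideal_zero: "gideal I \<Longrightarrow> 0 \<in> I t"
  and gideal_add: "gideal I \<Longrightarrow> f \<in> I t \<Longrightarrow> g \<in> I t \<Longrightarrow> f + g \<in> I t"
  and gideal_mult: "gideal I \<Longrightarrow> f \<in> I t \<Longrightarrow> g \<in> hf e \<Longrightarrow> g * f \<in> I (e + t)"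
  by (auto simp: gideal_def)

lemma gideal_mult': "gideal I \<Longrightarrow> f \<in> I t \<Longrightarrow> g \<in> hf e \<Longrightarrow> u = e + t \<Longrightarrow> g * f \<in> I u"
  using gideal_mult by blast

lemma gideal_mult_right: "gideal I \<Longrightarrow> f \<in> I t \<Longrightarrow> g \<in> hf e \<Longrightarrow> u = t + e \<Longrightarrow> f * g \<in> I u"
  using gideal_mult[of I f t g e] by (simp add: mult.commute add.commute)

lemma gideal_smult: "gideal I \<Longrightarrow> f \<in> I t \<Longrightarrow> const c * f \<in> I t"
  using gideal_mult'[OF _ _ hf_const, of I f t t c] by simp

lemma gideal_uminus: "gideal I \<Longrightarrow> f \<in> I t \<Longrightarrow> - f \<in> I t"
  using gideal_smult[of I f t "-1"] by (simp add: single_uminus)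

lemma gideal_diff: "gideal I \<Longrightarrow> f \<in> I t \<Longrightarrow> g \<in> I t \<Longrightarrow> f - g \<in> I t"
  using gideal_add[of I f t "- g"] gideal_uminus[of I g t] by simp

lemma gideal_sum: "gideal I \<Longrightarrow> (\<And>x. x \<in> A \<Longrightarrow> f x \<in> I t) \<Longrightarrow> sum f A \<in> I t"
  by (induction A rule: infinite_finite_induct) (auto intro: gideal_add gideal_zero)

lemma subspace_gideal: "gideal I \<Longrightarrow> mp.subspace (I t)"
  by (rule mp_subspaceI) (auto intro: gideal_add gideal_zero gideal_smult)

lemma gideal_UNIV: "gideal hf"
  by (rule gidealI) (auto intro: hf_add hf_mult)

lemma gideal_eq_UNIV: "gideal I \<Longrightarrow> 1 \<in> I 0 \<Longrightarrow> I = hf"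
  using gideal_mult'[of I 1 0] gideal_hf[of I] by (fastforce simp: fun_eq_iff)

lemma gideal_Suc:
  assumes I: "gideal I" and "\<And>i. var i * f \<in> I (t + 1)" and k: "k \<ge> 1" and g: "g \<in> hf k"
  shows "g * f \<in> I (t + k)"
proof -
  obtain h where h: "\<And>i. h i \<in> hf (k - 1)" "g = (\<Sum>i\<in>UNIV. var i * h i)"
    using hf_Suc[of g "k - 1"] k g by auto
  have "(\<Sum>i\<in>UNIV. h i * (var i * f)) \<in> I (t + k)"
    by (intro gideal_sum I gideal_mult'[OF I assms(2) h(1)]) simp
  also have "(\<Sum>i\<in>UNIV. h i * (var i * f)) = g * f"
    by (simp add: h(2) sum_distrib_right sum_distrib_left ac_simps)
  finally show ?thesis .
qed

text \<open>\<open>colon I e f\<close> is the ideal quotient I : f, and \<open>padd I e f\<close>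
  below is I + (f). The degree \<open>e\<close> is carried along because \<open>f\<close> does not
  determine it when f = 0.\<close>

definition colon :: "('n::{finite,linorder}, 'k::field) fam \<Rightarrow> int \<Rightarrow> ('n, 'k) mpol \<Rightarrow> ('n, 'k) fam" where
  "colon I e f t = {g \<in> hf t. f * g \<in> I (e + t)}"

definition padd :: "('n::{finite,linorder}, 'k::field) fam \<Rightarrow> int \<Rightarrow> ('n, 'k) mpol \<Rightarrow> ('n, 'k) fam" where
  "padd I e f t = {a + f * g | a g. a \<in> I t \<and> g \<in> hf (t - e)}"

definition sat :: "('n::{finite,linorder}, 'k::field) fam \<Rightarrow> ('n, 'k) fam" where
  "sat I t = {f \<in> hf t. \<exists>k::nat. \<forall>g\<in>hf (int k). g * f \<in> I (t + int k)}"

definition colon_ideal :: "('n::{finite,linorder}, 'k::field) fam \<Rightarrow> ('n, 'k) fam \<Rightarrow> ('n, 'k) fam" where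
  "colon_ideal I J t = {g \<in> hf t. \<forall>e. \<forall>y\<in>J e. y * g \<in> I (e + t)}"

definition isum :: "('n::{finite,linorder}, 'k::field) fam \<Rightarrow> ('n, 'k) fam \<Rightarrow> ('n, 'k) fam" where
  "isum I J t = {a + b | a b. a \<in> I t \<and> b \<in> J t}"

lemma gideal_colon:
  fixes I :: "('n::{finite,linorder}, 'k::field) fam"
  assumes I: "gideal I" and f: "f \<in> hf e"
  shows "gideal (colon I e f)"
proof (rule gidealI)
  fix t a and g h :: "('n, 'k) mpol" assume "g \<in> colon I e f t" "h \<in> hf a"
  then show "h * g \<in> colon I e f (a + t)"
    using gideal_mult'[OF I, of "f * g" "e + t" h a "e + (a + t)"] hf_mult[of h a g t]
    by (auto simp: colon_def algebra_simps)
qed (use I in \<open>auto simp: colon_def gideal_zero gideal_add distrib_left intro: hf_add\<close>)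

lemma gideal_padd:
  fixes I :: "('n::{finite,linorder}, 'k::field) fam"
  assumes I: "gideal I" and f: "f \<in> hf e"
  shows "gideal (padd I e f)"
proof (rule gidealI)
  fix t g assume "g \<in> padd I e f t"
  then show "g \<in> hf t" using gideal_hf[OF I] hf_mult[OF f] by (fastforce simp: padd_def intro: hf_add)
next
  fix t show "0 \<in> padd I e f t"
    using gideal_zero[OF I] by (force simp: padd_def)
next
  fix t g h assume "g \<in> padd I e f t" "h \<in> padd I e f t"
  then obtain a b c d where "g = a + f * b" "h = c + f * d" "a \<in> I t" "c \<in> I t" "b \<in> hf (t - e)" "d \<in> hf (t - e)"
    by (auto simp: padd_def)
  moreover from this have "g + h = (a + c) + f * (b + d)" by (simp add: algebra_simps)
  ultimately show "g + h \<in> padd I e f t" unfolding padd_def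
    using gideal_add[OF I] hf_add by blast
next
  fix t u and g h :: "('n, 'k) mpol" assume "g \<in> padd I e f t" "h \<in> hf u"
  then obtain a b where ab: "g = a + f * b" "a \<in> I t" "b \<in> hf (t - e)" "h \<in> hf u"
    by (auto simp: padd_def)
  then have "h * g = h * a + f * (h * b)" by (simp add: algebra_simps)
  moreover have "h * a \<in> I (u + t)" using gideal_mult[OF I] ab by blast
  moreover have "h * b \<in> hf (u + t - e)" using hf_mult[of h u b "t - e"] ab by (simp add: algebra_simps)
  ultimately show "h * g \<in> padd I e f (u + t)" unfolding padd_def by blast
qed

lemma gideal_isum:
  fixes I :: "('n::{finite,linorder}, 'k::field) fam"
  assumes I: "gideal I" and J: "gideal J"
  shows "gideal (isum I J)"
proof (rule gidealI)
  fix t g assume "g \<in> isum I J t"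
  then show "g \<in> hf t" using gideal_hf[OF I] gideal_hf[OF J] by (auto simp: isum_def intro: hf_add)
next
  fix t show "0 \<in> isum I J t"
    using gideal_zero[OF I] gideal_zero[OF J] by (force simp: isum_def)
next
  fix t g h assume "g \<in> isum I J t" "h \<in> isum I J t"
  then obtain a b c d where "g = a + b" "h = c + d" "a \<in> I t" "c \<in> I t" "b \<in> J t" "d \<in> J t"
    by (auto simp: isum_def)
  moreover from this have "g + h = (a + c) + (b + d)" by (simp add: algebra_simps)
  ultimately show "g + h \<in> isum I J t" unfolding isum_def
    using gideal_add[OF I] gideal_add[OF J] by blast
next
  fix t u and g h :: "('n, 'k) mpol" assume "g \<in> isum I J t" "h \<in> hf u"
  then obtain a b where ab: "g = a + b" "a \<in> I t" "b \<in> J t" "h \<in> hf u"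
    by (auto simp: isum_def)
  then have "h * g = h * a + h * b" by (simp add: algebra_simps)
  then show "h * g \<in> isum I J (u + t)" unfolding isum_def
    using gideal_mult[OF I] gideal_mult[OF J] ab by blast
qed

lemma gideal_colon_ideal:
  fixes I :: "('n::{finite,linorder}, 'k::field) fam"
  assumes I: "gideal I"
  shows "gideal (colon_ideal I J)"
proof (rule gidealI)
  fix t a and g h :: "('n, 'k) mpol" assume gh: "g \<in> colon_ideal I J t" "h \<in> hf a"
  have "y * (h * g) \<in> I (e + (a + t))" if "y \<in> J e" for e y
    using gideal_mult'[OF I, of "y * g" "e + t" h a "e + (a + t)"] gh that
    by (auto simp: colon_ideal_def mult.left_commute)
  then show "h * g \<in> colon_ideal I J (a + t)"
    using gh by (auto simp: colon_ideal_def hf_mult)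
qed (use I in \<open>auto simp: colon_ideal_def gideal_zero gideal_add distrib_left intro: hf_add\<close>)

lemma le_isum: "gideal J \<Longrightarrow> I \<le> isum I J" "gideal I \<Longrightarrow> J \<le> isum I J"
  unfolding le_fun_def isum_def
  by (auto intro: exI[of _ 0] dest: gideal_zero)
    (metis add_0 add_0_right gideal_zero)+

lemma isum_least: "gideal K \<Longrightarrow> I \<le> K \<Longrightarrow> J \<le> K \<Longrightarrow> isum I J \<le> K"
  unfolding le_fun_def isum_def using gideal_add by blast

lemma le_padd: "I \<le> padd I e f"
  unfolding le_fun_def padd_def by (force intro: exI[of _ 0])

lemma mem_padd: "gideal I \<Longrightarrow> f \<in> padd I e f e"
  unfolding padd_def using gideal_zero[of I e] by (force intro: exI[of _ 1])

lemma padd_least: "gideal K \<Longrightarrow> I \<le> K \<Longrightarrow> f \<in> K e \<Longrightarrow> padd I e f \<le> K"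
  by (auto simp: padd_def le_fun_def intro!: gideal_add[of K] gideal_mult_right[of K f e])

lemma le_colon: "gideal I \<Longrightarrow> f \<in> hf e \<Longrightarrow> I \<le> colon I e f"
  unfolding le_fun_def colon_def using gideal_hf gideal_mult by fastforce

definition H :: "('n::{finite,linorder}, 'k::field) fam \<Rightarrow> int \<Rightarrow> nat" where
  "H I t = mp.qd (hf t) (I t)"

text \<open>With R the polynomial ring, this is the degree \<open>t\<close> part of 0 -> R/(I :
  f)(-e) -> R/I -> R/(I + (f)) -> 0. Integer degrees make it valid for \<open>t < e\<close> as well,
  where the left term vanishes.\<close>

lemma H_exact:
  assumes I: "gideal I" and f: "f \<in> hf e"
  shows "H I t = H (colon I e f) (t - e) + H (padd I e f) t"
proof -
  have eq: "padd I e f t = (*) f ` hf (t - e) + I t"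
    by (auto simp: padd_def set_plus_def image_iff) (metis add.commute)+
  have "H I t = mp.qd (hf t) (padd I e f t) + mp.qd (padd I e f t) (I t)"
    unfolding H_def using gideal_padd[OF I f] I le_padd[of I e f]
    by (intro mp.qd_trans' subspace_gideal qfin_hf) (auto simp: le_fun_def gideal_hf)
  also have "mp.qd (padd I e f t) (I t) = mp.qd (hf (t - e)) {v \<in> hf (t - e). f * v \<in> I t}"
    unfolding eq by (intro mp.qd_image linear_times subspace_hf subspace_gideal I qfin_hf)
  also have "{v \<in> hf (t - e). f * v \<in> I t} = colon I e f (t - e)" by (auto simp: colon_def)
  finally show ?thesis by (simp add: H_def)
qed

lemma H_mono:
  assumes "gideal I" "gideal J" "I \<le> J"
  shows "H J t \<le> H I t"
  using mp.qd_trans'[of "J t" "I t" "hf t"] assms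
  by (simp add: H_def subspace_gideal le_funD gideal_hf subsetI qfin_hf)

lemma H_eq_iff:
  assumes "gideal I" "gideal J" "I t \<subseteq> J t"
  shows "H J t = H I t \<longleftrightarrow> I t = J t"
  using mp.qd_trans'[of "J t" "I t" "hf t"] assms
    mp.qd_eq_0[of "J t" "I t", OF _ _ _ mp.qfin_subset[OF qfin_hf[of t]]]
  by (simp add: H_def subspace_gideal gideal_hf subsetI qfin_hf) metis

lemma H_eq_0: "gideal I \<Longrightarrow> H I t = 0 \<longleftrightarrow> I t = hf t"
  unfolding H_def
  by (subst mp.qd_eq_0) (auto simp: subspace_gideal subspace_hf gideal_hf qfin_hf)

lemma H_neg: "gideal I \<Longrightarrow> t < 0 \<Longrightarrow> H I t = 0"
  using hf_neg[of t] gideal_zero[of I t] gideal_hf[of I _ t] by (subst H_eq_0) auto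

section \<open>Chain conditions and saturation\<close>

lemma nat_mono_subseq:
  fixes s :: "nat \<Rightarrow> nat"
  shows "\<exists>r :: nat \<Rightarrow> nat. strict_mono r \<and> mono (\<lambda>n. s (r n))"
proof -
  obtain r :: "nat \<Rightarrow> nat" where r: "strict_mono r" "monoseq (\<lambda>n. s (r n))" using seq_monosub[of s] by blast
  show ?thesis
  proof (cases "\<forall>m n. m \<le> n \<longrightarrow> s (r m) \<le> s (r n)")
    case True
    then show ?thesis using r(1) by (intro exI[of _ r]) (auto simp: mono_def)
  next
    case False
    then have dec: "s (r n) \<le> s (r m)" if "m \<le> n" for m n using r(2) that by (auto simp: monoseq_def)
    \<comment> \<open>A weakly decreasing sequence of naturals is constant from its minimum on, so
      its tail is weakly increasing too.\<close>
    obtain N where N: "\<And>n. s (r N) \<le> s (r n)"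
      using ex_has_least_nat[of "\<lambda>_. True" 0 "\<lambda>n. s (r n)"] by auto
    have "s (r (n + N)) = s (r N)" for n using N[of "n + N"] dec[of N "n + N"] by simp
    then have "mono (\<lambda>n. s ((\<lambda>n. r (n + N)) n))" by (simp add: mono_def)
    moreover have "strict_mono (\<lambda>n. r (n + N))" using r(1) by (simp add: strict_mono_def)
    ultimately show ?thesis by blast
  qed
qed

lemma dickson:
  fixes m :: "nat \<Rightarrow> ('n::finite \<Rightarrow>\<^sub>0 nat)"
  shows "\<exists>i j. i < j \<and> (\<forall>x. lookup (m i) x \<le> lookup (m j) x)"
proof -
  have "\<exists>r :: nat \<Rightarrow> nat. strict_mono r \<and> (\<forall>x\<in>A. mono (\<lambda>n. lookup (m (r n)) x))"
    if "finite A" for A :: "'n set"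
    using that
  proof induction
    case empty
    show ?case by (auto intro: exI[of _ id] simp: strict_mono_def)
  next
    case (insert x A)
    then obtain r :: "nat \<Rightarrow> nat" where r: "strict_mono r" "\<forall>x\<in>A. mono (\<lambda>n. lookup (m (r n)) x)" by blast
    obtain q :: "nat \<Rightarrow> nat" where q: "strict_mono q" "mono (\<lambda>n. lookup (m (r (q n))) x)"
      using nat_mono_subseq[of "\<lambda>n. lookup (m (r n)) x"] by blast
    have "strict_mono (r \<circ> q)" using r q by (simp add: strict_mono_def)
    moreover have "\<forall>y\<in>insert x A. mono (\<lambda>n. lookup (m ((r \<circ> q) n)) y)"
      using r q by (simp add: mono_def strict_mono_less_eq)
    ultimately show ?case by blast
  qed
  from this[of UNIV] obtain r :: "nat \<Rightarrow> nat" where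
    r: "strict_mono r" "\<And>x. mono (\<lambda>n. lookup (m (r n)) x)" by auto
  show ?thesis
    by (rule exI[of _ "r 0"], rule exI[of _ "r 1"]) (use r in \<open>simp add: strict_mono_def mono_def\<close>)
qed

text \<open>At each strict step take, in one degree where the pieces differ, a new form with least
  leading monomial. By Dickson's lemma an earlier leading monomial divides a later one; subtracting
  a multiple gives a new form with smaller leading monomial. Minima are taken within one degree,
  where only finitely many monomials compete.\<close>

lemma gideal_ascending_chain:
  fixes F :: "nat \<Rightarrow> ('n::{finite,linorder}, 'k::field) fam"
  assumes gi: "\<And>k. gideal (F k)" and mono: "\<And>k. F k \<le> F (Suc k)"
  shows "\<exists>k. F (Suc k) = F k"
proof (rule ccontr)
  assume "\<not> ?thesis"
  then have ne: "F (Suc k) \<noteq> F k" for k by blast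
  have le: "F i \<le> F j" if "i \<le> j" for i j using that mono by (rule lift_Suc_mono_le[rotated])
  have "\<exists>t. F (Suc k) t - F k t \<noteq> {}" for k
    using ne[of k] mono[of k] unfolding le_fun_def fun_eq_iff by blast
  then obtain t where t: "\<And>k. F (Suc k) (t k) - F k (t k) \<noteq> {}" by metis
  define lm :: "('n, 'k) mpol \<Rightarrow> _" where "lm f = Max (keys f)" for f
  have nz: "f \<noteq> 0" if "f \<in> F (Suc k) (t k) - F k (t k)" for k f
    using that gideal_zero[OF gi] by auto
  have lm_in: "lm f \<in> keys f" if "f \<noteq> 0" for f
    unfolding lm_def using that by (intro Max_in) (auto simp: keys_eq_empty)
  have lm_le: "m \<le> lm f" if "m \<in> keys f" for m f
    unfolding lm_def using that by simp
  have lm_deg: "int (mdeg (lm f)) = t k" if "f \<in> F (Suc k) (t k) - F k (t k)" for k f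
    using lm_in[OF nz[OF that]] gideal_hf[OF gi, of f "Suc k" "t k"] that by (auto simp: hf_def)
  have "\<exists>f. f \<in> F (Suc k) (t k) - F k (t k) \<and> (\<forall>g\<in>F (Suc k) (t k) - F k (t k). lm f \<le> lm g)" for k
  proof -
    have "lm ` (F (Suc k) (t k) - F k (t k)) \<subseteq> {m. mdeg m = nat (t k)}" using lm_deg[of _ k] by force
    then have fin: "finite (lm ` (F (Suc k) (t k) - F k (t k)))" using finite_mdeg finite_subset by blast
    have ne: "lm ` (F (Suc k) (t k) - F k (t k)) \<noteq> {}" using t[of k] by blast
    obtain f where "f \<in> F (Suc k) (t k) - F k (t k)" "lm f = Min (lm ` (F (Suc k) (t k) - F k (t k)))"
      using Min_in[OF fin ne] by (auto simp del: Min_in)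
    then show ?thesis using Min_le[OF fin] by (intro exI[of _ f]) simp
  qed
  then obtain f where f: "\<And>k. f k \<in> F (Suc k) (t k) - F k (t k)"
    "\<And>k g. g \<in> F (Suc k) (t k) - F k (t k) \<Longrightarrow> lm (f k) \<le> lm g" by metis
  obtain i j where ij: "i < j"
    "\<And>x. lookup (lm (f i)) x \<le> lookup (lm (f j)) x"
    using dickson[of "\<lambda>k. lm (f k)"] by auto
  define q where "q = lm (f j) - lm (f i)"
  have q: "lm (f j) = q + lm (f i)"
    by (rule poly_mapping_eqI) (use ij in \<open>simp add: q_def lookup_add lookup_minus\<close>)
  define c where "c = lookup (f j) (lm (f j)) / lookup (f i) (lm (f i))"
  define s where "s = single q c * f i"
  have "int (mdeg q) + t i = t j"
    using lm_deg[OF f(1)[of i]] lm_deg[OF f(1)[of j]] q by (simp add: mdeg_add)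
  then have "s \<in> F (Suc i) (t j)" unfolding s_def
    using f(1)[of i] by (intro gideal_mult'[OF gi _ hf_single[OF refl]]) auto
  then have s: "s \<in> F j (t j)" using le[of "Suc i" j] ij by (auto simp: le_fun_def)
  have g: "f j - s \<in> F (Suc j) (t j) - F j (t j)"
  proof (intro DiffI notI)
    show "f j - s \<in> F (Suc j) (t j)"
      using f(1)[of j] s mono[of j] by (intro gideal_diff gi) (auto simp: le_fun_def)
    assume "f j - s \<in> F j (t j)"
    from gideal_add[OF gi this s] show False using f(1)[of j] by simp
  qed
  have "lookup (f i) (lm (f i)) \<noteq> 0"
    using lm_in[OF nz[OF f(1)]] by (simp add: in_keys_iff)
  then have "lookup s (lm (f j)) = lookup (f j) (lm (f j))"
    unfolding s_def by (subst q) (simp add: lookup_single_mult c_def)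
  then have "lookup (f j - s) (lm (f j)) = 0" by (simp add: lookup_minus)
  then have "lm (f j - s) \<noteq> lm (f j)" using lm_in[OF nz[OF g]] by (auto simp: in_keys_iff)
  moreover have "m \<le> lm (f j)" if "m \<in> keys (f j - s)" for m
  proof -
    have "m \<in> keys (f j) \<or> m \<in> keys s" using that keys_diff[of "f j" s] by auto
    then show ?thesis
    proof
      assume "m \<in> keys s"
      then obtain m' where "m = q + m'" "m' \<in> keys (f i)"
        using keys_mult[of "single q c" "f i"] by (auto simp: s_def split: if_splits)
      then show ?thesis using lm_le[of m' "f i"] q by (simp add: add_left_mono)
    qed (rule lm_le)
  qed
  then have "lm (f j - s) \<le> lm (f j)" using lm_in[OF nz[OF g]] by blast
  ultimately show False using f(2)[OF g] by simp
qed

text \<open>A chain that never stabilises has a subchain of strict steps, which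
  \<open>gideal_ascending_chain\<close> excludes.\<close>

lemma gideal_chain_stable:
  fixes F :: "nat \<Rightarrow> ('n::{finite,linorder}, 'k::field) fam"
  assumes gi: "\<And>k. gideal (F k)" and mono: "\<And>k. F k \<le> F (Suc k)"
  shows "\<exists>N. \<forall>k\<ge>N. F k = F N"
proof (rule ccontr)
  assume "\<not> ?thesis"
  then have "\<exists>k>N. F k \<noteq> F N" for N by (metis le_neq_implies_less)
  then obtain r where r: "\<And>N. r N > N" "\<And>N. F (r N) \<noteq> F N" by metis
  define u where "u k = (r ^^ k) 0" for k
  have "F i \<le> F j" if "i \<le> j" for i j using that mono by (rule lift_Suc_mono_le[rotated])
  then have "\<And>k. F (u k) \<le> F (u (Suc k))" using r(1) by (simp add: u_def less_imp_le)
  from gideal_ascending_chain[of "\<lambda>k. F (u k)", OF gi this] show False using r(2) by (auto simp: u_def)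
qed

definition gideal_gt :: "(('n::{finite,linorder}, 'k::field) fam \<times> _) set" where
  "gideal_gt = {(J, I). gideal I \<and> gideal J \<and> I < J}"

lemma wf_gideal_gt: "wf (gideal_gt :: (('n::{finite,linorder}, 'k::field) fam \<times> _) set)"
proof (rule ccontr)
  assume "\<not> wf (gideal_gt :: (('n, 'k) fam \<times> _) set)"
  then obtain F :: "nat \<Rightarrow> ('n, 'k) fam" where F: "\<And>k. (F (Suc k), F k) \<in> gideal_gt" unfolding wf_iff_no_infinite_down_chain by auto
  then have "gideal (F k)" "F k < F (Suc k)" for k by (auto simp: gideal_gt_def)
  then show False using gideal_ascending_chain[of F] by (metis less_le order_less_imp_le)
qed

lemma gideal_maximal:
  assumes "gideal I" "Q I"
  shows "\<exists>J. gideal J \<and> I \<le> J \<and> Q J \<and> (\<forall>K. gideal K \<longrightarrow> J < K \<longrightarrow> \<not> Q K)"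
proof -
  obtain J where J: "J \<in> {J. gideal J \<and> I \<le> J \<and> Q J}"
    "\<And>K. (K, J) \<in> gideal_gt \<Longrightarrow> K \<notin> {J. gideal J \<and> I \<le> J \<and> Q J}"
    using wfE_min[OF wf_gideal_gt, of I "{J. gideal J \<and> I \<le> J \<and> Q J}"] assms by blast
  then show ?thesis by (intro exI[of _ J]) (auto simp: gideal_gt_def)
qed

lemma gideal_sup_hf:
  assumes I: "gideal I" "f \<in> hf t" "\<forall>g\<in>hf (int k). g * f \<in> I (t + int k)" "k \<le> k'"
  shows "\<forall>g\<in>hf (int k'). g * f \<in> I (t + int k')"
  using assms(4)
proof (induction k' rule: dec_induct)
  case (step n)
  show ?case
  proof
    fix g :: "('a, 'b) mpol" assume "g \<in> hf (int (Suc n))"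
    then obtain h where h: "\<And>i. h i \<in> hf (int n)" "g = (\<Sum>i\<in>UNIV. var i * h i)"
      using hf_Suc[of g "int n"] by (auto simp: add.commute)
    have "(\<Sum>i\<in>UNIV. var i * (h i * f)) \<in> I (t + int (Suc n))"
      by (intro gideal_sum I gideal_mult'[OF I(1) _ hf_var, of _ "t + int n"])
        (use step.IH h in auto)
    then show "g * f \<in> I (t + int (Suc n))" by (simp add: h(2) sum_distrib_right mult.assoc)
  qed
qed (use assms in auto)

definition sat_step :: "('n::{finite,linorder}, 'k::field) fam \<Rightarrow> nat \<Rightarrow> ('n, 'k) fam" where
  "sat_step I k t = {f \<in> hf t. \<forall>g\<in>hf (int k). g * f \<in> I (t + int k)}"

lemma gideal_sat_step:
  fixes I :: "('n::{finite,linorder}, 'k::field) fam"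
  assumes I: "gideal I"
  shows "gideal (sat_step I k)"
proof (rule gidealI)
  fix t e and f g :: "('n, 'k) mpol" assume fg: "f \<in> sat_step I k t" "g \<in> hf e"
  have "h * (g * f) \<in> I (e + t + int k)" if "h \<in> hf (int k)" for h
    using gideal_mult'[OF I, of "h * f" "t + int k" g e] fg that by (auto simp: sat_step_def ac_simps)
  then show "g * f \<in> sat_step I k (e + t)" using fg by (auto simp: sat_step_def hf_mult)
qed (use I in \<open>auto simp: sat_step_def gideal_zero gideal_add distrib_left intro: hf_add\<close>)

lemma sat_step_mono: "gideal I \<Longrightarrow> k \<le> k' \<Longrightarrow> sat_step I k \<le> sat_step I k'"
  using gideal_sup_hf[of I _ _ k k'] by (auto simp: le_fun_def sat_step_def)

lemma sat_eq_sat_step: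
  assumes "gideal I"
  shows "\<exists>N. \<forall>k\<ge>N. sat I = sat_step I k"
proof -
  obtain N where N: "\<And>k. k \<ge> N \<Longrightarrow> sat_step I k = sat_step I N"
    using gideal_chain_stable[of "sat_step I", OF gideal_sat_step[OF assms] sat_step_mono[OF assms]] by auto
  have "sat I = sat_step I N"
  proof (rule ext, safe)
    fix t f assume "f \<in> sat I t"
    then obtain k where "f \<in> sat_step I k t" by (auto simp: sat_def sat_step_def)
    then have "f \<in> sat_step I (max k N) t" using sat_step_mono[OF assms, of k "max k N"] by (auto simp: le_fun_def)
    then show "f \<in> sat_step I N t" using N[of "max k N"] by simp
  qed (auto simp: sat_def sat_step_def)
  then show ?thesis using N by metis
qed

lemma gideal_sat: "gideal I \<Longrightarrow> gideal (sat I)"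
  using sat_eq_sat_step gideal_sat_step by (metis order_refl)

lemma le_sat: "gideal I \<Longrightarrow> I \<le> sat I"
proof (rule le_funI, rule subsetI)
  fix t f assume I: "gideal I" and f: "f \<in> I t"
  then have "\<forall>g\<in>hf (int 0). g * f \<in> I (t + int 0)" by (auto intro: gideal_mult')
  then show "f \<in> sat I t" using gideal_hf[OF I f] unfolding sat_def by blast
qed

lemma sat_mono: "I \<le> J \<Longrightarrow> sat I \<le> sat J"
  unfolding le_fun_def sat_def by blast

lemma sat_eventually:
  fixes I :: "('n::{finite,linorder}, 'k::field) fam"
  assumes I: "gideal I"
  shows "\<exists>t0. \<forall>t\<ge>t0. sat I t = I t"
proof -
  \<comment> \<open>\<open>J N\<close> collects the forms whose multiples in degrees
    \<open>\<ge> N\<close> lie in \<open>I\<close>. It grows with \<open>N\<close> and equals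
    \<open>I\<close> in degrees \<open>\<ge> N\<close>; every element of \<open>sat I\<close> lies
    in some \<open>J N\<close>, so stability of the chain bounds the degrees where
    \<open>sat I\<close> and \<open>I\<close> differ.\<close>
  define J where "J N t = {f \<in> hf t. \<forall>e\<ge>0. t + e \<ge> int N \<longrightarrow> (\<forall>g\<in>hf e. g * f \<in> I (t + e))}" for N t
  have J: "gideal (J N)" for N
  proof (rule gidealI)
    fix t e and f g :: "('n, 'k) mpol" assume fg: "f \<in> J N t" "g \<in> hf e"
    show "g * f \<in> J N (e + t)"
    proof (cases "e \<ge> 0")
      case True
      have "h * (g * f) \<in> I (e + t + e')" if "e' \<ge> 0" "e + t + e' \<ge> int N" "h \<in> hf e'" for h e'
      proof -
        have "(h * g) * f \<in> I (t + (e' + e))"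
          using fg hf_mult[OF that(3) fg(2)] that True by (simp add: J_def)
        then show ?thesis by (simp add: ac_simps)
      qed
      then show ?thesis using fg by (auto simp: J_def hf_mult)
    next
      case False
      then have "g = 0" using fg(2) hf_neg[of e] by (metis not_le singletonD)
      then show ?thesis using gideal_zero[OF I] by (simp add: J_def)
    qed
  qed (use I in \<open>auto simp: J_def gideal_zero gideal_add distrib_left intro: hf_add\<close>)
  moreover have "J N \<le> J (Suc N)" for N by (auto simp: J_def le_fun_def)
  ultimately obtain N where N: "\<And>k. k \<ge> N \<Longrightarrow> J k = J N" using gideal_chain_stable[of J] by metis
  have "sat I t \<subseteq> I t" if "t \<ge> int N" for t
  proof
    fix f assume "f \<in> sat I t"
    then obtain k where f: "f \<in> hf t" "\<forall>g\<in>hf (int k). g * f \<in> I (t + int k)" by (auto simp: sat_def)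
    have "g * f \<in> I (t + e)" if "e \<ge> 0" "t + e \<ge> int (max N (nat (t + int k)))" "g \<in> hf e" for g e
      using gideal_sup_hf[OF I f, of "nat e"] that by auto
    then have "f \<in> J (max N (nat (t + int k))) t" using f(1) by (simp add: J_def)
    then have "f \<in> J N t" using N[of "max N (nat (t + int k))"] by simp
    then have "1 * f \<in> I (t + 0)" unfolding J_def using that hf_one by (auto simp del: mult_1)
    then show "f \<in> I t" by simp
  qed
  then show ?thesis using le_sat[OF I] by (intro exI[of _ "int N"]) (auto simp: le_fun_def)
qed

lemma sat_sat:
  assumes I: "gideal I"
  shows "sat (sat I) = sat I"
proof (rule antisym)
  obtain t0 where t0: "\<And>t. t \<ge> t0 \<Longrightarrow> sat I t = I t" using sat_eventually[OF I] by blast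
  show "sat (sat I) \<le> sat I"
  proof (rule le_funI, rule subsetI)
    fix t f assume "f \<in> sat (sat I) t"
    then obtain k where k: "f \<in> hf t" "\<forall>g\<in>hf (int k). g * f \<in> sat I (t + int k)" by (auto simp: sat_def)
    have "\<forall>g\<in>hf (int (max k (nat (t0 - t)))). g * f \<in> sat I (t + int (max k (nat (t0 - t))))"
      by (rule gideal_sup_hf[OF gideal_sat[OF I] k]) simp
    moreover have "t + int (max k (nat (t0 - t))) \<ge> t0" by simp
    ultimately show "f \<in> sat I t" using k(1) t0 unfolding sat_def by blast
  qed
qed (rule le_sat[OF gideal_sat[OF I]])

lemma sat_memI:
  assumes I: "gideal I" "sat I = I" and f: "f \<in> hf t" "\<And>g. g \<in> hf (int k) \<Longrightarrow> g * f \<in> I (t + int k)"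
  shows "f \<in> I t"
proof -
  have "f \<in> sat I t" using f by (auto simp: sat_def)
  then show ?thesis using I(2) by simp
qed

lemma sat_mem_varI:
  assumes I: "gideal I" "sat I = I" and f: "f \<in> hf t" "\<And>i. var i * f \<in> I (t + 1)"
  shows "f \<in> I t"
  by (rule sat_memI[OF I f(1), of 1]) (use gideal_Suc[OF I(1) f(2)] in simp)

text \<open>The irrelevant ideal satisfies this definition. Where a point of projective space is
  meant, a variable outside \<open>P\<close> is given separately, as in
  \<open>var i \<notin> P 1\<close>.\<close>

definition gprime :: "('n::{finite,linorder}, 'k::field) fam \<Rightarrow> bool" where
  "gprime P \<longleftrightarrow> gideal P \<and> 1 \<notin> P 0 \<and>
    (\<forall>a b. \<forall>f\<in>hf a. \<forall>g\<in>hf b. f * g \<in> P (a + b) \<longrightarrow> f \<in> P a \<or> g \<in> P b)"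

lemma gprimeD: "gprime P \<Longrightarrow> f \<in> hf a \<Longrightarrow> g \<in> hf b \<Longrightarrow> f * g \<in> P (a + b) \<Longrightarrow> f \<in> P a \<or> g \<in> P b"
  and gprime_gideal: "gprime P \<Longrightarrow> gideal P"
  by (auto simp: gprime_def)

lemma gprime_power: "gprime P \<Longrightarrow> f \<in> hf a \<Longrightarrow> f ^ k \<in> P (int k * a) \<Longrightarrow> f \<in> P a"
proof (induction k)
  case (Suc k)
  then have "f * f ^ k \<in> P (a + int k * a)" by (simp add: algebra_simps)
  then show ?case using Suc gprimeD[of P f a "f ^ k" "int k * a"] hf_power by blast
qed (simp add: gprime_def)

text \<open>Maximal annihilators are prime; there are only finitely many of them, so over an infinite
  field the linear forms of degree 1 are not covered by their union.\<close>

lemma subspace_avoidance: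
  fixes F :: "('n::{finite,linorder}, 'k::field) mpol set set"
  assumes "infinite (UNIV :: 'k set)" "finite F" "\<And>W. W \<in> F \<Longrightarrow> mp.subspace W" "mp.subspace V" "V \<subseteq> \<Union>F"
  shows "\<exists>W\<in>F. V \<subseteq> W"
  using assms(2,3,5)
proof (induction F)
  case empty
  then show ?case using mp.subspace_0[OF assms(4)] by auto
next
  case (insert W F)
  show ?case
  proof (cases "V \<subseteq> \<Union>F")
    case True
    then show ?thesis using insert by auto
  next
    case False
    then obtain v where v: "v \<in> V" "v \<notin> \<Union>F" "v \<in> W" using insert.prems by blast
    have "w \<in> W" if w: "w \<in> V" for w
    proof (rule ccontr)
      assume nw: "w \<notin> W"
      have sW: "mp.subspace W" using insert.prems by simp
      \<comment> \<open>The line through \<open>w\<close> in direction \<open>v\<close> misses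
        \<open>W\<close>, so infinitely many of its points fall into finitely many subspaces; two
        points in the same one put \<open>v\<close> there.\<close>
      have "\<exists>U\<in>F. w + const c * v \<in> U" for c
      proof -
        have "w + const c * v \<in> V" using w v assms(4) by (simp add: mp.subspace_add mp.subspace_scale)
        moreover have "w + const c * v \<notin> W"
          using nw mp.subspace_diff[OF sW _ mp.subspace_scale[OF sW v(3)], of "w + const c * v" c] by auto
        ultimately show ?thesis using insert.prems by blast
      qed
      then obtain U where U: "\<And>c. U c \<in> F" "\<And>c. w + const c * v \<in> U c" by metis
      then have "finite (range U)" using insert.hyps by (meson finite_subset image_subsetI)
      then have "\<not> inj U" using assms(1) finite_imageD by blast
      then obtain a b where ab: "a \<noteq> b" "U a = U b" by (auto simp: inj_def)
      have sU: "mp.subspace (U a)" using U insert.prems by simp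
      have "(w + const a * v) - (w + const b * v) \<in> U a"
        using U(2)[of a] U(2)[of b] ab by (intro mp.subspace_diff[OF sU]) auto
      then have "const (inverse (a - b)) * (const (a - b) * v) \<in> U a"
        by (intro mp.subspace_scale[OF sU, of "const (a - b) * v"]) (simp add: single_diff left_diff_distrib)
      then have "v \<in> U a" using ab by (simp add: mult.assoc[symmetric] mult_single)
      then show False using v U(1) by blast
    qed
    then show ?thesis by blast
  qed
qed

definition maximal_colons :: "('n::{finite,linorder}, 'k::field) fam \<Rightarrow> (int \<times> ('n, 'k) mpol) set" where
  "maximal_colons I = {(e, f). f \<in> hf e \<and> f \<notin> I e \<and> (\<forall>e' f'. f' \<in> hf e' \<longrightarrow> f' \<notin> I e' \<longrightarrow> \<not> colon I e f < colon I e' f')}"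

lemma maximal_colonsD:
  assumes "(e, f) \<in> maximal_colons I"
  shows "f \<in> hf e" "f \<notin> I e" "f' \<in> hf e' \<Longrightarrow> f' \<notin> I e' \<Longrightarrow> \<not> colon I e f < colon I e' f'"
  using assms by (auto simp: maximal_colons_def)

text \<open>If \<open>h\<close> does not kill \<open>f\<close> modulo \<open>I\<close>, then I : f
  is contained in I : fh, and maximality makes them equal; whatever kills \<open>fh\<close>
  therefore kills \<open>f\<close>.\<close>

lemma maximal_colon_prime:
  assumes I: "gideal I" and ef: "(e, f) \<in> maximal_colons I"
  shows "gprime (colon I e f)"
  unfolding gprime_def
proof (intro conjI allI ballI impI)
  note f = maximal_colonsD(1,2)[OF ef] and max = maximal_colonsD(3)[OF ef]
  show "gideal (colon I e f)" by (rule gideal_colon[OF I f(1)])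
  show "1 \<notin> colon I e f 0" using f by (simp add: colon_def)
  fix a b g h assume gh: "g \<in> hf a" "h \<in> hf b" "g * h \<in> colon I e f (a + b)"
  show "g \<in> colon I e f a \<or> h \<in> colon I e f b"
  proof (rule disjCI)
    assume nh: "h \<notin> colon I e f b"
    have fh: "f * h \<in> hf (e + b)" "f * h \<notin> I (e + b)" using f gh nh by (auto simp: colon_def hf_mult)
    have "colon I e f \<le> colon I (e + b) (f * h)"
    proof (rule le_funI, rule subsetI)
      fix t x assume "x \<in> colon I e f t"
      then show "x \<in> colon I (e + b) (f * h) t"
        using gideal_mult'[OF I, of "f * x" "e + t" h b] gh(2) by (auto simp: colon_def ac_simps)
    qed
    then have "colon I e f = colon I (e + b) (f * h)" using max[OF fh] by (simp add: less_le)
    moreover have "g \<in> colon I (e + b) (f * h) a" using gh by (auto simp: colon_def ac_simps)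
    ultimately show "g \<in> colon I e f a" by simp
  qed
qed

lemma le_maximal_colon:
  assumes I: "gideal I" and f: "f \<in> hf e" "f \<notin> I e"
  obtains e' f' where "colon I e f \<le> colon I e' f'" "(e', f') \<in> maximal_colons I"
proof -
  define Q where "Q J \<longleftrightarrow> (\<exists>e f. J = colon I e f \<and> f \<in> hf e \<and> f \<notin> I e)" for J
  have "Q (colon I e f)" using f by (auto simp: Q_def)
  then obtain J where J: "colon I e f \<le> J" "Q J" "\<And>K. gideal K \<Longrightarrow> J < K \<Longrightarrow> \<not> Q K"
    using gideal_maximal[OF gideal_colon[OF I f(1)], of Q] by blast
  obtain e' g where g: "J = colon I e' g" "g \<in> hf e'" "g \<notin> I e'" using J(2) by (auto simp: Q_def)
  have "(e', g) \<in> maximal_colons I"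
    using J(3)[OF gideal_colon[OF I]] g by (auto simp: Q_def maximal_colons_def)
  then show ?thesis using that g(1) J(1) by blast
qed

lemma finite_maximal_colons:
  fixes I :: "('n::{finite,linorder}, 'k::field) fam"
  assumes I: "gideal I"
  shows "finite ((\<lambda>(e, f). colon I e f) ` maximal_colons I)" (is "finite ?M")
proof (rule ccontr)
  assume "infinite ?M"
  then obtain P :: "nat \<Rightarrow> _" where P: "inj P" "range P \<subseteq> ?M" using infinite_countable_subset by blast
  then have "\<forall>k. \<exists>e f. P k = colon I e f \<and> (e, f) \<in> maximal_colons I" by fastforce
  then obtain e f where ef: "\<And>k. P k = colon I (e k) (f k)" "\<And>k. (e k, f k) \<in> maximal_colons I" by metis
  note ef = ef(1) maximal_colonsD[OF ef(2)] ef(2)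
  have prime: "gprime (P k)" for k unfolding ef(1) by (rule maximal_colon_prime[OF I ef(5)])
  have nle: "\<exists>t. \<not> P i t \<subseteq> P j t" if "i \<noteq> j" for i j
  proof -
    have "\<not> P i < P j" unfolding ef(1) by (rule ef(4)[OF ef(2,3)])
    moreover have "P i \<noteq> P j" using P(1) that by (simp add: inj_eq)
    ultimately show ?thesis by (auto simp: less_le le_fun_def)
  qed
  \<comment> \<open>\<open>J k\<close> is the quotient of \<open>I\<close> by the common elements of
    \<open>P 0\<close>, ..., \<open>P (k - 1)\<close>. Where the chain stops, at \<open>N\<close>,
    these common elements already annihilate \<open>f N\<close>; but a product of elements of the
    \<open>P j\<close> chosen outside \<open>P N\<close> does not.\<close>
  define J where "J k t = {h \<in> hf t. \<forall>u p. (\<forall>j<k. p \<in> P j u) \<longrightarrow> p \<in> hf u \<longrightarrow> p * h \<in> I (u + t)}" for k t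
  have "gideal (J k)" for k
  proof (rule gidealI)
    fix t a and g h :: "('n, 'k) mpol" assume gh: "g \<in> J k t" "h \<in> hf a"
    have "p * (h * g) \<in> I (u + (a + t))" if "\<forall>j<k. p \<in> P j u" "p \<in> hf u" for u p
    proof -
      have "p * g \<in> I (u + t)" using gh that by (simp add: J_def)
      from gideal_mult'[OF I this gh(2), of "u + (a + t)"] show ?thesis by (simp add: mult.left_commute)
    qed
    then show "h * g \<in> J k (a + t)" using gh by (auto simp: J_def hf_mult)
  qed (use I in \<open>auto simp: J_def gideal_zero gideal_add distrib_left intro: hf_add\<close>)
  moreover have "J k \<le> J (Suc k)" for k by (auto simp: J_def le_fun_def)
  ultimately obtain N where N: "J (Suc N) = J N" using gideal_ascending_chain[of J] by blast
  have "f N \<in> J (Suc N) (e N)"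
    using ef by (auto simp: J_def colon_def mult.commute add.commute)
  then have fN: "f N \<in> J N (e N)" using N by simp
  have "\<exists>u p. p \<in> hf u \<and> (\<forall>j<k. p \<in> P j u) \<and> p \<notin> P N u" if "k \<le> N" for k
    using that
  proof (induction k)
    case 0
    show ?case using prime[of N] hf_one by (intro exI[of _ 0] exI[of _ 1]) (auto simp: gprime_def)
  next
    case (Suc k)
    then obtain u p where p: "p \<in> hf u" "\<forall>j<k. p \<in> P j u" "p \<notin> P N u" by auto
    obtain v q where q: "q \<in> P k v" "q \<notin> P N v" using nle[of k N] Suc.prems by auto
    have q': "q \<in> hf v" using q prime gprime_gideal gideal_hf by blast
    have "q * p \<in> hf (v + u)" using hf_mult[OF q' p(1)] .
    moreover have "q * p \<in> P j (v + u)" if "j < Suc k" for j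
      using that p q q' gideal_mult[OF gprime_gideal[OF prime[of j]], of p u q v]
        gideal_mult_right[OF gprime_gideal[OF prime[of j]], of q v p u] by (cases "j = k") auto
    moreover have "q * p \<notin> P N (v + u)" using gprimeD[OF prime q' p(1)] q(2) p(3) by blast
    ultimately show ?case by blast
  qed
  from this[of N] obtain u p where p: "p \<in> hf u" "\<forall>j<N. p \<in> P j u" "p \<notin> P N u" by auto
  then have "p * f N \<in> I (u + e N)" using fN by (simp add: J_def)
  then show False using p by (simp add: ef(1) colon_def ac_simps)
qed

text \<open>If the maximal annihilators covered all linear forms, one of them would contain every
  variable and annihilate some form outside \<open>I\<close>; saturation forbids exactly
  this.\<close>

lemma ex_linear_nonzerodivisor:
  fixes I :: "('n::{finite,linorder}, 'k::field) fam"
  assumes inf: "infinite (UNIV :: 'k set)" and I: "gideal I" "sat I = I"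
  shows "\<exists>l\<in>hf 1. \<forall>t. \<forall>f\<in>hf t. l * f \<in> I (1 + t) \<longrightarrow> f \<in> I t"
proof (rule ccontr)
  assume neg: "\<not> ?thesis"
  define M where "M = (\<lambda>(e, f). colon I e f) ` maximal_colons I"
  have finM: "finite M" unfolding M_def by (rule finite_maximal_colons[OF I(1)])
  have "hf 1 \<subseteq> \<Union>((\<lambda>P. P 1) ` M)"
  proof
    fix l :: "('n, 'k) mpol" assume l: "l \<in> hf 1"
    then obtain t f where f: "f \<in> hf t" "l * f \<in> I (1 + t)" "f \<notin> I t" using neg by blast
    then obtain e g where g: "colon I t f \<le> colon I e g" "(e, g) \<in> maximal_colons I"
      using le_maximal_colon[OF I(1) f(1,3)] by metis
    then have "colon I e g \<in> M" unfolding M_def by force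
    moreover have "l \<in> colon I e g 1" using g(1) l f by (auto simp: le_fun_def colon_def mult.commute[of l] add.commute)
    ultimately show "l \<in> \<Union>((\<lambda>P. P 1) ` M)" by blast
  qed
  then obtain P where P: "P \<in> M" "hf 1 \<subseteq> P 1"
    using subspace_avoidance[OF inf, of "(\<lambda>P. P 1) ` M" "hf 1"] finM subspace_hf
      subspace_gideal[OF gideal_colon[OF I(1)]] by (fastforce simp: M_def dest: maximal_colonsD)
  then obtain e f where f: "P = colon I e f" "f \<in> hf e" "f \<notin> I e" by (auto simp: M_def dest: maximal_colonsD)
  have "var i * f \<in> I (e + 1)" for i
    using subsetD[OF P(2) hf_var[of i]] by (simp add: f(1) colon_def mult.commute[of "var i"])
  then have "f \<in> I e" by (rule sat_mem_varI[OF I f(2)])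
  then show False using f by simp
qed

section \<open>Long exact sequences\<close>

context quotient_space
begin

text \<open>Cocycles, coboundaries and cohomology of the quotient complex A/B, as preimages in
  \<open>A\<close>: a cocycle needs \<open>d c\<close> only in \<open>B\<close>, and the
  coboundaries contain \<open>B\<close>.\<close>

definition cocyc :: "('b \<Rightarrow> 'b) \<Rightarrow> (nat \<Rightarrow> 'b set) \<Rightarrow> (nat \<Rightarrow> 'b set) \<Rightarrow> nat \<Rightarrow> 'b set" where
  "cocyc d A B p = {c \<in> A p. d c \<in> B (Suc p)}"

definition cobnd :: "('b \<Rightarrow> 'b) \<Rightarrow> (nat \<Rightarrow> 'b set) \<Rightarrow> (nat \<Rightarrow> 'b set) \<Rightarrow> nat \<Rightarrow> 'b set" where
  "cobnd d A B p = (case p of 0 \<Rightarrow> B 0 | Suc q \<Rightarrow> {d a + b | a b. a \<in> A q \<and> b \<in> B (Suc q)})"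

definition cohom :: "('b \<Rightarrow> 'b) \<Rightarrow> (nat \<Rightarrow> 'b set) \<Rightarrow> (nat \<Rightarrow> 'b set) \<Rightarrow> nat \<Rightarrow> nat" where
  "cohom d A B p = qd (cocyc d A B p) (cobnd d A B p)"

definition subcomplex :: "('b \<Rightarrow> 'b) \<Rightarrow> (nat \<Rightarrow> 'b set) \<Rightarrow> bool" where
  "subcomplex d A \<longleftrightarrow> (\<forall>p. subspace (A p) \<and> (\<forall>c\<in>A p. d c \<in> A (Suc p)))"

lemma cobnd_Suc: "cobnd d A B (Suc q) = d ` A q + B (Suc q)"
  by (auto simp: cobnd_def set_plus_def)

lemma subspace_cocyc_cobnd:
  assumes d: "Vector_Spaces.linear scale scale d" and A: "subcomplex d A" and B: "subcomplex d B"
  shows "subspace (cocyc d A B p)" "subspace (cobnd d A B p)"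
proof -
  interpret d: Vector_Spaces.linear scale scale d by fact
  have s: "subspace (A q)" "subspace (B q)" for q using A B by (auto simp: subcomplex_def)
  show "subspace (cocyc d A B p)"
    using s[of p] s[of "Suc p"] by (auto simp: cocyc_def subspace_def d.add d.scale d.zero)
  show "subspace (cobnd d A B p)"
  proof (cases p)
    case (Suc q)
    then show ?thesis using s d.subspace_image by (simp add: cobnd_Suc subspace_set_plus)
  qed (use s in \<open>simp add: cobnd_def\<close>)
qed

lemma cobnd_subset_cocyc:
  assumes d: "Vector_Spaces.linear scale scale d" and A: "subcomplex d A" and B: "subcomplex d B"
    and dd: "\<forall>p. \<forall>c\<in>A p. d (d c) = 0" and le: "\<And>p. B p \<subseteq> A p"
  shows "cobnd d A B p \<subseteq> cocyc d A B p"
proof -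
  interpret d: Vector_Spaces.linear scale scale d by fact
  have s: "subspace (A q)" for q using A by (auto simp: subcomplex_def)
  show ?thesis
  proof (cases p)
    case 0
    then show ?thesis using le B by (auto simp: cobnd_def cocyc_def subcomplex_def)
  next
    case (Suc q)
    have "d a + b \<in> cocyc d A B p" if "a \<in> A q" "b \<in> B p" for a b
    proof -
      have "d a \<in> A p" "b \<in> A p" "d b \<in> B (Suc p)" using that A B le[of p] Suc by (auto simp: subcomplex_def)
      then show ?thesis using subspace_add[OF s] dd that(1) by (simp add: cocyc_def d.add)
    qed
    then show ?thesis using Suc by (auto simp: cobnd_def)
  qed
qed

text \<open>The long exact sequence of 0 -> V/U -> W/U -> W/V -> 0 in preimages. \<open>K\<close> is
  the kernel of H(V/U) -> H(W/U), \<open>M\<close> the image of this map and the kernel of the next,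
  \<open>N\<close> the image in H(W/V) and the kernel of the connecting map, which \<open>d\<close>
  itself induces. The equations at the end have the shape that \<open>qfin_image\<close> and
  \<open>qd_image\<close> consume.\<close>

lemma cohom_exact:
  assumes d: "Vector_Spaces.linear scale scale d"
    and U: "subcomplex d U" and V: "subcomplex d V" and W: "subcomplex d W"
    and dd: "\<forall>p. \<forall>c\<in>W p. d (d c) = 0"
    and le: "\<And>p. U p \<subseteq> V p" "\<And>p. V p \<subseteq> W p"
  defines "K \<equiv> \<lambda>p. cocyc d V U p \<inter> cobnd d W U p"
    and "M \<equiv> \<lambda>p. cocyc d V U p + cobnd d W U p"
    and "N \<equiv> \<lambda>p. cocyc d W U p + cobnd d W V p"
  shows "cobnd d V U p \<subseteq> K p" "K p \<subseteq> cocyc d V U p"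
    and "cobnd d W U p \<subseteq> M p" "M p \<subseteq> cocyc d W U p"
    and "cobnd d W V p \<subseteq> N p" "N p \<subseteq> cocyc d W V p"
    and "subspace (K p)" "subspace (M p)" "subspace (N p)"
    and "K 0 = cobnd d V U 0"
    and "id ` cocyc d V U p + cobnd d W U p = M p" "{v \<in> cocyc d V U p. id v \<in> cobnd d W U p} = K p"
    and "id ` cocyc d W U p + cobnd d W V p = N p" "{v \<in> cocyc d W U p. id v \<in> cobnd d W V p} = M p"
    and "d ` cocyc d W V p + cobnd d V U (Suc p) = K (Suc p)"
      "{v \<in> cocyc d W V p. d v \<in> cobnd d V U (Suc p)} = N p"
proof -
  let ?ZV = "cocyc d V U" and ?BV = "cobnd d V U" and ?ZU = "cocyc d W U" and ?BU = "cobnd d W U" and ?ZW = "cocyc d W V" and ?BW = "cobnd d W V"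
  interpret d: Vector_Spaces.linear scale scale d by fact
  have s: "subspace (U q)" "subspace (V q)" "subspace (W q)" for q
    using U V W by (auto simp: subcomplex_def)
  have dU: "c \<in> U q \<Longrightarrow> d c \<in> U (Suc q)" and dV: "c \<in> V q \<Longrightarrow> d c \<in> V (Suc q)"
    and dW: "c \<in> W q \<Longrightarrow> d c \<in> W (Suc q)" for c q
    using U V W by (auto simp: subcomplex_def)
  note sc = subspace_cocyc_cobnd[OF d V U] subspace_cocyc_cobnd[OF d W U] subspace_cocyc_cobnd[OF d W V]
  have le': "U p \<subseteq> W p" for p using le[of p] by blast
  have VU: "?BV p \<subseteq> ?ZV p" for p by (rule cobnd_subset_cocyc[OF d V U _ le(1)]) (use dd le in blast)
  have WU: "?BU p \<subseteq> ?ZU p" for p by (rule cobnd_subset_cocyc[OF d W U dd le'])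
  have WV: "?BW p \<subseteq> ?ZW p" for p by (rule cobnd_subset_cocyc[OF d W V dd le(2)])
  have mono: "?BV p \<subseteq> ?BU p" "?BU p \<subseteq> ?BW p"
    "?ZV p \<subseteq> ?ZU p" "?ZU p \<subseteq> ?ZW p" for p
    unfolding cobnd_def cocyc_def using le by (auto split: nat.split; blast)+
  have plus_le: "A \<subseteq> A + B" if "subspace B" for A B
    using subspace_0[OF that] set_plus_intro[of _ A 0 B] by fastforce
  have plus_le': "B \<subseteq> A + B" if "subspace A" for A B
    using plus_le[OF that, of B] by (simp add: add.commute)
  have plus_least: "A + B \<subseteq> C" if "A \<subseteq> C" "B \<subseteq> C" "subspace C" for A B C
    using that by (auto elim!: set_plus_elim intro: subspace_add)
  show "?BV p \<subseteq> K p" "K p \<subseteq> ?ZV p" using VU mono by (auto simp: K_def)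
  show "?BU p \<subseteq> M p" unfolding M_def by (rule plus_le'[OF sc(1)])
  show "M p \<subseteq> ?ZU p" unfolding M_def by (intro plus_least mono WU sc)
  show "?BW p \<subseteq> N p" unfolding N_def by (rule plus_le'[OF sc(3)])
  show "N p \<subseteq> ?ZW p" unfolding N_def by (intro plus_least mono WV sc)
  show "subspace (K p)" "subspace (M p)" "subspace (N p)"
    unfolding K_def M_def N_def using sc by (auto intro: subspace_inter subspace_set_plus)
  show "K 0 = ?BV 0" unfolding K_def using VU[of 0] by (auto simp: cobnd_def)
  show "id ` ?ZV p + ?BU p = M p" "{v \<in> ?ZV p. id v \<in> ?BU p} = K p"
    "id ` ?ZU p + ?BW p = N p"
    by (auto simp: M_def K_def N_def)
  show "{v \<in> ?ZU p. id v \<in> ?BW p} = M p"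
  proof (rule antisym)
    show "M p \<subseteq> {v \<in> ?ZU p. id v \<in> ?BW p}"
    proof -
      have "?ZV p \<subseteq> ?BW p"
      proof (cases p)
        case (Suc q)
        show ?thesis
          using plus_le'[OF d.subspace_image[OF s(3)], of "V (Suc q)" q] by (auto simp: Suc cobnd_Suc cocyc_def)
      qed (auto simp: cobnd_def cocyc_def)
      then have "M p \<subseteq> ?BW p" unfolding M_def by (intro plus_least mono sc)
      moreover have "M p \<subseteq> ?ZU p" unfolding M_def by (intro plus_least mono WU sc)
      ultimately show ?thesis by auto
    qed
    show "{v \<in> ?ZU p. id v \<in> ?BW p} \<subseteq> M p"
    proof
      fix v assume v: "v \<in> {v \<in> ?ZU p. id v \<in> ?BW p}"
      show "v \<in> M p"
      proof (cases p)
        case 0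
        then have "v \<in> ?ZV p" using v by (auto simp: cocyc_def cobnd_def)
        then show ?thesis unfolding M_def using plus_le[OF sc(4)] by blast
      next
        case (Suc q)
        then obtain w x where wx: "v = d w + x" "w \<in> W q" "x \<in> V p" using v by (auto simp: cobnd_def)
        have "d x = d v" using wx dd by (simp add: d.add)
        then have "x \<in> ?ZV p" using v wx by (simp add: cocyc_def)
        moreover have "d w \<in> ?BU p"
          using wx subspace_0[OF s(1), of p] Suc by (force simp: cobnd_def)
        ultimately show ?thesis unfolding M_def wx(1) by (subst add.commute) (rule set_plus_intro)
      qed
    qed
  qed
  show "d ` ?ZW p + ?BV (Suc p) = K (Suc p)"
  proof (rule antisym)
    have "d ` ?ZW p \<subseteq> K (Suc p)"
    proof
      fix y assume "y \<in> d ` ?ZW p"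
      then obtain w where w: "y = d w" "w \<in> W p" "d w \<in> V (Suc p)" by (auto simp: cocyc_def)
      then show "y \<in> K (Suc p)"
        using dd w(2) subspace_0[OF s(1)] by (force simp: K_def cocyc_def cobnd_def)
    qed
    moreover have "?BV (Suc p) \<subseteq> K (Suc p)" using VU mono by (auto simp: K_def)
    ultimately show "d ` ?ZW p + ?BV (Suc p) \<subseteq> K (Suc p)"
      by (intro plus_least) (auto simp: K_def intro: subspace_inter sc)
    show "K (Suc p) \<subseteq> d ` ?ZW p + ?BV (Suc p)"
    proof
      fix z assume z: "z \<in> K (Suc p)"
      then obtain w u where wu: "z = d w + u" "w \<in> W p" "u \<in> U (Suc p)" by (auto simp: K_def cobnd_def)
      have "d w \<in> V (Suc p)"
        using z wu le(1)[of "Suc p"] subspace_diff[OF s(2), of z "Suc p" u] by (auto simp: K_def cocyc_def)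
      then have "d w \<in> d ` ?ZW p" using wu by (auto simp: cocyc_def)
      moreover have "u \<in> ?BV (Suc p)"
        using wu subspace_0[OF s(2), of p] d.zero by (force simp: cobnd_def)
      ultimately show "z \<in> d ` ?ZW p + ?BV (Suc p)"
        unfolding wu(1) by (rule set_plus_intro)
    qed
  qed
  show "{v \<in> ?ZW p. d v \<in> ?BV (Suc p)} = N p"
  proof (rule antisym)
    have "?ZU p \<subseteq> {v \<in> ?ZW p. d v \<in> ?BV (Suc p)}"
      using mono(4) subspace_0[OF s(2), of p] d.zero by (force simp: cobnd_def cocyc_def)
    moreover have "?BW p \<subseteq> {v \<in> ?ZW p. d v \<in> ?BV (Suc p)}"
    proof
      fix v assume v: "v \<in> ?BW p"
      have "\<exists>x\<in>V p. d v = d x"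
      proof (cases p)
        case (Suc q)
        then obtain w x where "v = d w + x" "w \<in> W q" "x \<in> V p" using v by (auto simp: cobnd_def)
        then show ?thesis using dd by (auto simp: d.add)
      qed (use v in \<open>auto simp: cobnd_def\<close>)
      then have "d v \<in> ?BV (Suc p)" using subspace_0[OF s(1)] by (force simp: cobnd_def)
      then show "v \<in> {v \<in> ?ZW p. d v \<in> ?BV (Suc p)}" using WV v by blast
    qed
    moreover have "subspace {v \<in> ?ZW p. d v \<in> ?BV (Suc p)}"
      using sc(5)[of p] sc(2)[of "Suc p"] by (auto simp: subspace_def d.add d.scale d.zero)
    ultimately show "N p \<subseteq> {v \<in> ?ZW p. d v \<in> ?BV (Suc p)}"
      unfolding N_def by (rule plus_least)
    show "{v \<in> ?ZW p. d v \<in> ?BV (Suc p)} \<subseteq> N p"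
    proof
      fix v assume v: "v \<in> {v \<in> ?ZW p. d v \<in> ?BV (Suc p)}"
      then obtain x u where xu: "d v = d x + u" "x \<in> V p" "u \<in> U (Suc p)" by (auto simp: cobnd_def)
      have "v - x \<in> W p"
        using v xu le(2)[of p] subspace_diff[OF s(3), of v p x] by (auto simp: cocyc_def)
      moreover have "d (v - x) = u" using xu by (simp add: d.diff)
      ultimately have "v - x \<in> ?ZU p" using xu by (simp add: cocyc_def)
      moreover have "x \<in> ?BW p"
      proof (cases p)
        case (Suc q)
        then show ?thesis using xu subspace_0[OF s(3), of q] d.zero by (force simp: cobnd_def)
      qed (use xu in \<open>simp add: cobnd_def\<close>)
      ultimately have "(v - x) + x \<in> N p" unfolding N_def by (rule set_plus_intro)
      then show "v \<in> N p" by simp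
    qed
  qed
qed

lemma
  assumes d: "Vector_Spaces.linear scale scale d"
    and U: "subcomplex d U" and V: "subcomplex d V" and W: "subcomplex d W"
    and dd: "\<forall>p. \<forall>c\<in>W p. d (d c) = 0"
    and le: "\<And>p. U p \<subseteq> V p" "\<And>p. V p \<subseteq> W p"
    and fin: "\<And>p. qfin (cocyc d W V p) (cobnd d W V p)"
  shows cohom_fin_total: "(\<And>p. qfin (cocyc d V U p) (cobnd d V U p)) \<Longrightarrow> qfin (cocyc d W U p) (cobnd d W U p)"
    and cohom_fin_sub: "(\<And>p. qfin (cocyc d W U p) (cobnd d W U p)) \<Longrightarrow> qfin (cocyc d V U p) (cobnd d V U p)"
    and cohom_le: "(\<And>p. qfin (cocyc d V U p) (cobnd d V U p)) \<Longrightarrow>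
      cohom d W U p \<le> cohom d V U p + cohom d W V p"
    and cohom_euler: "(\<And>p. qfin (cocyc d V U p) (cobnd d V U p)) \<Longrightarrow> W (Suc n) = {0} \<Longrightarrow>
      (\<Sum>p\<le>n. (-1) ^ p * int (cohom d W U p)) =
      (\<Sum>p\<le>n. (-1) ^ p * int (cohom d V U p)) + (\<Sum>p\<le>n. (-1) ^ p * int (cohom d W V p))"
proof -
  let ?ZV = "cocyc d V U" and ?BV = "cobnd d V U" and ?ZU = "cocyc d W U" and ?BU = "cobnd d W U" and ?ZW = "cocyc d W V" and ?BW = "cobnd d W V"
  define K where "K p = ?ZV p \<inter> ?BU p" for p
  define M where "M p = ?ZV p + ?BU p" for p
  define N where "N p = ?ZU p + ?BW p" for p
  note ex = cohom_exact[OF d U V W dd le, folded K_def M_def N_def]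
  note sc = subspace_cocyc_cobnd[OF d V U] subspace_cocyc_cobnd[OF d W U] subspace_cocyc_cobnd[OF d W V]
  have i1: "qfin (M p) (?BU p) \<longleftrightarrow> qfin (?ZV p) (K p)"
    "qfin (?ZV p) (K p) \<Longrightarrow> qd (M p) (?BU p) = qd (?ZV p) (K p)" for p
    using qfin_image[OF linear_id sc(1)[of p] sc(4)[of p]] qd_image[OF linear_id sc(1)[of p] sc(4)[of p]]
    unfolding ex(11,12) by auto
  have i2: "qfin (N p) (?BW p) \<longleftrightarrow> qfin (?ZU p) (M p)"
    "qfin (?ZU p) (M p) \<Longrightarrow> qd (N p) (?BW p) = qd (?ZU p) (M p)" for p
    using qfin_image[OF linear_id sc(3)[of p] sc(6)[of p]] qd_image[OF linear_id sc(3)[of p] sc(6)[of p]]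
    unfolding ex(13,14) by auto
  have i3: "qfin (K (Suc p)) (?BV (Suc p)) \<longleftrightarrow> qfin (?ZW p) (N p)"
    "qfin (?ZW p) (N p) \<Longrightarrow> qd (K (Suc p)) (?BV (Suc p)) = qd (?ZW p) (N p)" for p
    using qfin_image[OF d sc(5)[of p] sc(2)[of "Suc p"]] qd_image[OF d sc(5)[of p] sc(2)[of "Suc p"]]
    unfolding ex(15,16) by auto
  have fN: "qfin (?ZW p) (N p)" "qfin (N p) (?BW p)" for p
    using fin[of p] qfin_mono[OF _ ex(5)] qfin_subset[OF _ ex(6)] by auto
  have fK: "qfin (K p) (?BV p)" for p
    using i3(1) fN(1) ex(10) by (cases p) auto
  have fZM: "qfin (?ZU p) (M p)" for p using i2(1) fN(2) by blast
  show tot: "qfin (?ZU p) (?BU p)"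
    if f: "\<And>p. qfin (?ZV p) (?BV p)" for p
  proof -
    have "qfin (?ZV p) (K p)" using f qfin_mono[OF _ ex(1)] by blast
    then have "qfin (M p) (?BU p)" using i1(1) by blast
    then show ?thesis using qfin_trans[OF ex(8) sc(4) ex(3,4)] fZM by blast
  qed
  show "qfin (?ZV p) (?BV p)"
    if "\<And>p. qfin (?ZU p) (?BU p)"
  proof -
    have "qfin (M p) (?BU p)" using that[of p] qfin_subset[OF _ ex(4)] by blast
    then have "qfin (?ZV p) (K p)" using i1(1) by blast
    then show ?thesis using qfin_trans[OF ex(7) sc(2) ex(1,2)] fK by blast
  qed
  \<comment> \<open>\<open>r p\<close> is the rank of the connecting map arriving in degree
    \<open>p\<close>. These ranks cancel in the alternating sum except at the two ends, where they
    vanish.\<close>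
  define r where "r p = qd (K p) (?BV p)" for p
  have eq: "int (cohom d W U p) = int (cohom d V U p) + int (cohom d W V p) - int (r p) - int (r (Suc p))"
    if f: "\<And>p. qfin (?ZV p) (?BV p)" for p
  proof -
    have "cohom d W U p = qd (?ZU p) (M p) + qd (M p) (?BU p)"
      unfolding cohom_def by (rule qd_trans'[OF ex(8) sc(4) ex(3,4) tot[OF f]])
    moreover have "cohom d V U p = qd (?ZV p) (K p) + r p"
      unfolding cohom_def r_def by (rule qd_trans'[OF ex(7) sc(2) ex(1,2) f])
    moreover have "cohom d W V p = qd (?ZW p) (N p) + qd (N p) (?BW p)"
      unfolding cohom_def by (rule qd_trans'[OF ex(9) sc(6) ex(5,6) fin])
    moreover have "qd (M p) (?BU p) = qd (?ZV p) (K p)"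
      using i1(2) f qfin_mono[OF _ ex(1)] by blast
    moreover have "qd (N p) (?BW p) = qd (?ZU p) (M p)" using i2(2) fZM by blast
    moreover have "r (Suc p) = qd (?ZW p) (N p)" unfolding r_def using i3(2) fN by blast
    ultimately show ?thesis by simp
  qed
  show "cohom d W U p \<le> cohom d V U p + cohom d W V p"
    if f: "\<And>p. qfin (?ZV p) (?BV p)" using eq[OF f, of p] by linarith
  show "(\<Sum>p\<le>n. (-1) ^ p * int (cohom d W U p)) =
      (\<Sum>p\<le>n. (-1) ^ p * int (cohom d V U p)) + (\<Sum>p\<le>n. (-1) ^ p * int (cohom d W V p))"
    if f: "\<And>p. qfin (?ZV p) (?BV p)" and n: "W (Suc n) = {0}"
  proof -
    have "(\<Sum>p\<le>k. (-1) ^ p * int (cohom d W U p)) =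
      (\<Sum>p\<le>k. (-1) ^ p * int (cohom d V U p)) + (\<Sum>p\<le>k. (-1) ^ p * int (cohom d W V p))
       - int (r 0) - (-1) ^ k * int (r (Suc k))" for k
      by (induction k) (simp_all add: eq[OF f] algebra_simps)
    moreover have "r 0 = 0" by (simp add: r_def ex(10))
    moreover have "r (Suc n) = 0"
    proof -
      have "?ZV (Suc n) \<subseteq> {0}" using le(2)[of "Suc n"] n by (auto simp: cocyc_def)
      then have "K (Suc n) = ?BV (Suc n)"
        using ex(1,2)[of "Suc n"] subspace_0[OF sc(2)] by blast
      then show ?thesis by (simp add: r_def)
    qed
    ultimately show ?thesis by simp
  qed
qed

end

section \<open>Cech cohomology and Hilbert polynomials\<close>

abbreviation fscale :: "complex \<Rightarrow> ('n::{finite,linorder} set \<Rightarrow> 'n mpoly fract) \<Rightarrow> ('n set \<Rightarrow> 'n mpoly fract)" where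
  "fscale z c \<equiv> (\<lambda>\<sigma>. Fract (const z) 1 * c \<sigma>)"

interpretation fv: quotient_space "\<lambda>z (c :: 'n::{finite,linorder} set \<Rightarrow> 'n mpoly fract). fscale z c"
proof
  fix a b :: complex and x :: "'n set \<Rightarrow> 'n mpoly fract"
  have "Fract (const (a + b)) 1 = Fract (const a) 1 + (Fract (const b) 1 :: 'n mpoly fract)"
    by (simp add: single_add)
  then show "fscale (a + b) x = fscale a x + fscale b x"
    by (simp only: plus_fun_def distrib_right)
qed (simp_all add: fun_eq_iff distrib_left mult.assoc[symmetric] mult_single One_fract_def[symmetric])

definition Xs :: "'n::{finite,linorder} set \<Rightarrow> 'n mpoly" where "Xs \<sigma> = (\<Prod>i\<in>\<sigma>. var i)"

lemma Xs_nonzero [simp]: "Xs \<sigma> \<noteq> 0"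
  by (simp add: Xs_def)

lemma Xs_insert: "i \<notin> \<sigma> \<Longrightarrow> Xs (insert i \<sigma>) = var i * Xs \<sigma>"
  by (simp add: Xs_def)

lemma Xs_hf: "Xs \<sigma> \<in> hf (int (card \<sigma>))"
proof -
  have "finite \<sigma>" by simp
  then show ?thesis by (induction \<sigma>) (auto simp: Xs_insert algebra_simps dest: hf_mult[OF hf_var] simp: Xs_def[of "{}"])
qed

lemma Xs_power_hf: "Xs \<sigma> ^ k \<in> hf (int (k * card \<sigma>))"
  using hf_power[OF Xs_hf, of \<sigma> k] by simp

definition cechl :: "'n::{finite,linorder} cfam \<Rightarrow> int \<Rightarrow> 'n set \<Rightarrow> 'n mpoly fract set" where
  "cechl J t \<sigma> = {Fract a (Xs \<sigma> ^ k) | a k. a \<in> J (int (k * card \<sigma>) + t)}"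

text \<open>The index is \<open>card \<sigma> = p\<close>, one more than the usual Cech degree, and
  \<open>\<sigma> = {}\<close> contributes the graded piece \<open>J t\<close> itself. The
  cohomology of \<open>cechC hf\<close> modulo \<open>cechC I\<close> is thus the local cohomology
  of R/I at the irrelevant ideal. It vanishes for large \<open>t\<close> in every index, so one
  induction can treat all indices alike.\<close>

definition cechC :: "'n::{finite,linorder} cfam \<Rightarrow> int \<Rightarrow> nat \<Rightarrow> ('n set \<Rightarrow> 'n mpoly fract) set" where
  "cechC J t p = {c. \<forall>\<sigma>. if card \<sigma> = p then c \<sigma> \<in> cechl J t \<sigma> else c \<sigma> = 0}"

lemma cechlI: "a \<in> J (int (k * card \<sigma>) + t) \<Longrightarrow> Fract a (Xs \<sigma> ^ k) \<in> cechl J t \<sigma>"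
  by (auto simp: cechl_def)

lemma Fract_cancel: "(c :: 'a::idom) \<noteq> 0 \<Longrightarrow> Fract (a * c) (b * c) = Fract a b"
  using mult_fract_cancel[of c a b] by (simp add: mult.commute)

text \<open>Exponents of the denominator can be enlarged at will, which gives any two elements a
  common denominator.\<close>

lemma cechl_raise:
  assumes J: "gideal J" and x: "x \<in> cechl J t \<sigma>"
  shows "\<exists>k0. \<forall>k\<ge>k0. \<exists>a\<in>J (int (k * card \<sigma>) + t). x = Fract a (Xs \<sigma> ^ k)"
proof -
  obtain a k0 where a: "x = Fract a (Xs \<sigma> ^ k0)" "a \<in> J (int (k0 * card \<sigma>) + t)"
    using x by (auto simp: cechl_def)
  have "\<exists>a\<in>J (int (k * card \<sigma>) + t). x = Fract a (Xs \<sigma> ^ k)" if "k \<ge> k0" for k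
  proof (rule bexI)
    show "x = Fract (a * Xs \<sigma> ^ (k - k0)) (Xs \<sigma> ^ k)"
      using Fract_cancel[of "Xs \<sigma> ^ (k - k0)" a "Xs \<sigma> ^ k0"] that a(1) by (simp add: power_add[symmetric])
    show "a * Xs \<sigma> ^ (k - k0) \<in> J (int (k * card \<sigma>) + t)"
      by (rule gideal_mult_right[OF J a(2) Xs_power_hf]) (use that in \<open>simp add: algebra_simps of_nat_diff\<close>)
  qed
  then show ?thesis by blast
qed

lemma cechl_zero: "gideal J \<Longrightarrow> 0 \<in> cechl J t \<sigma>"
  using cechlI[of 0 J 0 \<sigma> t] gideal_zero[of J] by (simp add: fract_collapse)

lemma cechl_add:
  assumes J: "gideal J" and "x \<in> cechl J t \<sigma>" "y \<in> cechl J t \<sigma>"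
  shows "x + y \<in> cechl J t \<sigma>"
proof -
  obtain k1 where k1: "\<And>k. k \<ge> k1 \<Longrightarrow> \<exists>a\<in>J (int (k * card \<sigma>) + t). x = Fract a (Xs \<sigma> ^ k)"
    using cechl_raise[OF assms(1,2)] by blast
  obtain k2 where k2: "\<And>k. k \<ge> k2 \<Longrightarrow> \<exists>a\<in>J (int (k * card \<sigma>) + t). y = Fract a (Xs \<sigma> ^ k)"
    using cechl_raise[OF assms(1,3)] by blast
  obtain a b where ab: "a \<in> J (int (max k1 k2 * card \<sigma>) + t)" "x = Fract a (Xs \<sigma> ^ max k1 k2)"
    "b \<in> J (int (max k1 k2 * card \<sigma>) + t)" "y = Fract b (Xs \<sigma> ^ max k1 k2)"
    using k1[of "max k1 k2"] k2[of "max k1 k2"] by auto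
  have "x + y = Fract (a + b) (Xs \<sigma> ^ max k1 k2)"
    using ab Fract_cancel[of "Xs \<sigma> ^ max k1 k2" "a + b" "Xs \<sigma> ^ max k1 k2"] by (simp add: distrib_right)
  then show ?thesis using gideal_add[OF J ab(1,3)] by (auto intro: cechlI)
qed

lemma cechl_mult:
  assumes J: "gideal J" and "x \<in> cechl J t \<sigma>" "f \<in> hf e"
  shows "Fract f 1 * x \<in> cechl J (e + t) \<sigma>"
proof -
  obtain a k where a: "x = Fract a (Xs \<sigma> ^ k)" "a \<in> J (int (k * card \<sigma>) + t)"
    using assms(2) by (auto simp: cechl_def)
  have "f * a \<in> J (int (k * card \<sigma>) + (e + t))"
    by (rule gideal_mult'[OF J a(2) assms(3)]) simp
  then show ?thesis using cechlI[of "f * a" J k \<sigma> "e + t"] a(1) by simp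
qed

lemma cechl_scale: "gideal J \<Longrightarrow> x \<in> cechl J t \<sigma> \<Longrightarrow> Fract (const z) 1 * x \<in> cechl J t \<sigma>"
  using cechl_mult[of J x t \<sigma> "const z" 0] by simp

lemma cechl_sign:
  assumes "gideal J" "x \<in> cechl J t \<sigma>"
  shows "(-1) ^ k * x \<in> cechl J t \<sigma>"
  using cechl_scale[OF assms, of "-1"] assms
  by (cases "even k") (simp_all add: single_uminus One_fract_def[symmetric] flip: minus_fract)

lemma cechl_sum:
  assumes "gideal J" "\<And>x. x \<in> A \<Longrightarrow> f x \<in> cechl J t \<sigma>"
  shows "sum f A \<in> cechl J t \<sigma>"
  using assms(2) by (induction A rule: infinite_finite_induct) (auto intro: cechl_add cechl_zero assms(1))

lemma cechl_face:
  assumes J: "gideal J" and i: "i \<in> \<sigma>" and x: "x \<in> cechl J t (\<sigma> - {i})"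
  shows "x \<in> cechl J t \<sigma>"
proof -
  obtain a k where a: "x = Fract a (Xs (\<sigma> - {i}) ^ k)" "a \<in> J (int (k * card (\<sigma> - {i})) + t)"
    using x by (auto simp: cechl_def)
  have X: "Xs \<sigma> = Xs (\<sigma> - {i}) * var i"
    using Xs_insert[of i "\<sigma> - {i}"] i by (simp add: insert_absorb mult.commute)
  have c: "card \<sigma> = Suc (card (\<sigma> - {i}))" using i card_Suc_Diff1[of \<sigma> i] by simp
  have "x = Fract (a * var i ^ k) (Xs \<sigma> ^ k)"
    using a(1) Fract_cancel[of "var i ^ k" a] by (simp add: X power_mult_distrib)
  moreover have "a * var i ^ k \<in> J (int (k * card \<sigma>) + t)"
    by (rule gideal_mult_right[OF J a(2) hf_power[OF hf_var]]) (simp add: c algebra_simps)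
  ultimately show ?thesis by (auto intro: cechlI)
qed

lemma linear_coboundary:
  "Vector_Spaces.linear (\<lambda>z c. fscale z c) (\<lambda>z c. fscale z c) (cech_coboundary :: ('n::{finite,linorder} set \<Rightarrow> 'n mpoly fract) \<Rightarrow> _)"
  by unfold_locales
    (auto simp: cech_coboundary_def fun_eq_iff sum.distrib distrib_left distrib_right sum_distrib_left ac_simps)

lemma cechC_subspace: "gideal J \<Longrightarrow> fv.subspace (cechC J t p)"
  by (auto simp: fv.subspace_def cechC_def cechl_zero cechl_add cechl_scale)

lemma cechC_coboundary:
  assumes J: "gideal J" and c: "c \<in> cechC J t p"
  shows "cech_coboundary c \<in> cechC J t (Suc p)"
proof -
  have "cech_coboundary c \<sigma> \<in> cechl J t \<sigma>" if "card \<sigma> = Suc p" for \<sigma>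
    unfolding cech_coboundary_def
  proof (intro cechl_sum J cechl_sign)
    fix i assume i: "i \<in> \<sigma>"
    then have "card (\<sigma> - {i}) = p" using that by simp
    then show "c (\<sigma> - {i}) \<in> cechl J t \<sigma>" using c i cechl_face[OF J i] by (auto simp: cechC_def)
  qed
  moreover have "cech_coboundary c \<sigma> = 0" if "card \<sigma> \<noteq> Suc p" for \<sigma>
  proof -
    have "c (\<sigma> - {i}) = 0" if "i \<in> \<sigma>" for i
    proof -
      have "card (\<sigma> - {i}) \<noteq> p" using that \<open>card \<sigma> \<noteq> Suc p\<close> card_Suc_Diff1[of \<sigma> i] by auto
      then show ?thesis using c by (auto simp: cechC_def)
    qed
    then show ?thesis by (simp add: cech_coboundary_def)
  qed
  ultimately show ?thesis by (auto simp: cechC_def)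
qed

lemma cechC_subcomplex: "gideal J \<Longrightarrow> fv.subcomplex cech_coboundary (cechC J t)"
  by (auto simp: fv.subcomplex_def cechC_subspace cechC_coboundary)

lemma cechC_mono:
  assumes "J \<le> J'"
  shows "cechC J t p \<subseteq> cechC J' t p"
proof -
  have "cechl J t \<sigma> \<subseteq> cechl J' t \<sigma>" for \<sigma> using assms unfolding cechl_def le_fun_def by blast
  then show ?thesis unfolding cechC_def by (auto split: if_splits)
qed

abbreviation pos :: "'n::linorder \<Rightarrow> 'n set \<Rightarrow> nat" where
  "pos i \<sigma> \<equiv> card {j\<in>\<sigma>. j < i}"

lemma pos_remove:
  fixes i :: "'n::{finite,linorder}"
  shows "j \<in> \<sigma> \<Longrightarrow> j < i \<Longrightarrow> pos i \<sigma> = Suc (pos i (\<sigma> - {j}))"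
    and "\<not> j < i \<Longrightarrow> pos i (\<sigma> - {j}) = pos i \<sigma>"
proof -
  have *: "{k \<in> \<sigma> - {j}. k < i} = {k \<in> \<sigma>. k < i} - {j}" by auto
  show "j \<in> \<sigma> \<Longrightarrow> j < i \<Longrightarrow> pos i \<sigma> = Suc (pos i (\<sigma> - {j}))"
    unfolding * by (subst card_Suc_Diff1) auto
  show "\<not> j < i \<Longrightarrow> pos i (\<sigma> - {j}) = pos i \<sigma>"
    by (rule arg_cong[of _ _ card]) auto
qed

text \<open>Removing two indices in either order gives opposite signs, so the double sum
  \<open>S\<close> equals \<open>- S\<close>; it vanishes because 2 is nonzero.\<close>

lemma coboundary_coboundary: "cech_coboundary (cech_coboundary c) = 0"
proof
  fix \<sigma> :: "'a set"
  define s :: "'a \<Rightarrow> 'a set \<Rightarrow> 'a mpoly fract" where "s i \<tau> = (-1) ^ pos i \<tau>" for i \<tau>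
  define f where "f i j = s i \<sigma> * (s j (\<sigma> - {i}) * c (\<sigma> - {i} - {j}))" for i j
  define S where "S = (\<Sum>i\<in>\<sigma>. \<Sum>j\<in>\<sigma> - {i}. f i j)"
  have swap: "f j i = - f i j" if ij: "i \<in> \<sigma>" "j \<in> \<sigma>" "j < i" for i j
    using pos_remove(1)[of j \<sigma> i] pos_remove(2)[of i j \<sigma>] ij
    by (simp add: f_def s_def Diff_insert2[symmetric] insert_commute)
  then have anti: "f j i = - f i j" if "i \<in> \<sigma>" "j \<in> \<sigma>" "j \<noteq> i" for i j
    using that by (metis minus_minus neqE)
  have r: "\<sigma> - {i} = {j \<in> \<sigma>. i \<noteq> j}" "\<sigma> - {i} = {j \<in> \<sigma>. j \<noteq> i}" for i by auto
  have "S = (\<Sum>i\<in>\<sigma>. \<Sum>j\<in>{j \<in> \<sigma>. i \<noteq> j}. f i j)" unfolding S_def r(1) ..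
  also have "\<dots> = (\<Sum>j\<in>\<sigma>. \<Sum>i\<in>{i \<in> \<sigma>. i \<noteq> j}. f i j)" by (rule sum.swap_restrict) auto
  also have "\<dots> = (\<Sum>j\<in>\<sigma>. \<Sum>i\<in>\<sigma> - {j}. f i j)" unfolding r(2) ..
  also have "\<dots> = (\<Sum>j\<in>\<sigma>. \<Sum>i\<in>\<sigma> - {j}. - f j i)"
    by (intro sum.cong refl anti) auto
  also have "\<dots> = - S" by (simp add: S_def sum_negf)
  finally have "Fract 2 1 * S = 0"
    by (metis (no_types) add.right_inverse mult_2 Fract_of_nat_eq of_nat_numeral)
  moreover have "Fract (2 :: 'a mpoly) 1 \<noteq> 0" by (simp add: Zero_fract_def eq_fract)
  ultimately have "S = 0" by simp
  then show "cech_coboundary (cech_coboundary c) \<sigma> = 0 \<sigma>"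
    by (simp add: cech_coboundary_def S_def f_def s_def sum_distrib_left)
qed

definition shift :: "'n::{finite,linorder} mpoly \<Rightarrow> ('n set \<Rightarrow> 'n mpoly fract) \<Rightarrow> ('n set \<Rightarrow> 'n mpoly fract)" where
  "shift f c = (\<lambda>\<sigma>. Fract f 1 * c \<sigma>)"

lemma linear_shift: "Vector_Spaces.linear (\<lambda>z c. fscale z c) (\<lambda>z c. fscale z c) (shift f)"
  by unfold_locales (auto simp: shift_def fun_eq_iff algebra_simps)

lemma shift_coboundary: "cech_coboundary (shift f c) = shift f (cech_coboundary c)"
  by (simp add: cech_coboundary_def shift_def fun_eq_iff sum_distrib_left ac_simps)

lemma shift_add: "shift f (a + b) = shift f a + shift f b"
  and shift_diff: "shift f (a - b) = shift f a - shift f b"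
  by (simp_all add: shift_def fun_eq_iff algebra_simps)

lemma shift_shift: "shift f (shift g c) = shift (f * g) c"
  by (simp add: shift_def fun_eq_iff mult.assoc[symmetric])

lemma shift_one [simp]: "shift 1 c = c"
  by (simp add: shift_def One_fract_def[symmetric])

lemma cechC_shift: "gideal J \<Longrightarrow> c \<in> cechC J t p \<Longrightarrow> f \<in> hf e \<Longrightarrow> u = e + t \<Longrightarrow> shift f c \<in> cechC J u p"
  by (auto simp: cechC_def shift_def cechl_mult)

lemma cechC_padd:
  assumes I: "gideal I" and f: "f \<in> hf e"
  shows "cechC (padd I e f) t p = shift f ` cechC hf (t - e) p + cechC I t p"
proof (rule antisym)
  have J: "gideal (padd I e f)" by (rule gideal_padd[OF I f])
  show "shift f ` cechC hf (t - e) p + cechC I t p \<subseteq> cechC (padd I e f) t p"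
  proof
    fix c assume "c \<in> shift f ` cechC hf (t - e) p + cechC I t p"
    then obtain w u where wu: "c = shift f w + u" "w \<in> cechC hf (t - e) p" "u \<in> cechC I t p"
      by (auto elim!: set_plus_elim)
    have "shift f w \<in> cechC (padd I e f) t p"
    proof -
      have "Fract f 1 * x \<in> cechl (padd I e f) t \<sigma>" if "x \<in> cechl hf (t - e) \<sigma>" for x \<sigma>
      proof -
        obtain a k where a: "x = Fract a (Xs \<sigma> ^ k)" "a \<in> hf (int (k * card \<sigma>) + (t - e))"
          using \<open>x \<in> _\<close> by (auto simp: cechl_def)
        have "f * a \<in> padd I e f (int (k * card \<sigma>) + t)"
          by (rule gideal_mult_right[OF J mem_padd[OF I] a(2)]) simp
        then show ?thesis using a(1) by (auto intro: cechlI)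
      qed
      then show ?thesis using wu(2) by (auto simp: cechC_def shift_def)
    qed
    moreover have "u \<in> cechC (padd I e f) t p" using wu(3) cechC_mono[OF le_padd] by blast
    ultimately show "c \<in> cechC (padd I e f) t p"
      unfolding wu(1) using fv.subspace_add[OF cechC_subspace[OF J]] by blast
  qed
  show "cechC (padd I e f) t p \<subseteq> shift f ` cechC hf (t - e) p + cechC I t p"
  proof
    fix c assume c: "c \<in> cechC (padd I e f) t p"
    have "\<exists>w u. c \<sigma> = Fract f 1 * w + u \<and> (if card \<sigma> = p then w \<in> cechl hf (t - e) \<sigma> \<and> u \<in> cechl I t \<sigma> else w = 0 \<and> u = 0)" for \<sigma>
    proof (cases "card \<sigma> = p")
      case True
      then obtain a k where a: "c \<sigma> = Fract a (Xs \<sigma> ^ k)" "a \<in> padd I e f (int (k * card \<sigma>) + t)"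
        using c unfolding cechC_def cechl_def mem_Collect_eq by metis
      then obtain b g where bg: "a = b + f * g" "b \<in> I (int (k * card \<sigma>) + t)" "g \<in> hf (int (k * card \<sigma>) + t - e)"
        by (auto simp: padd_def)
      have "c \<sigma> = Fract f 1 * Fract g (Xs \<sigma> ^ k) + Fract b (Xs \<sigma> ^ k)"
        using Fract_cancel[of "Xs \<sigma> ^ k" a "Xs \<sigma> ^ k"] by (simp add: a(1) bg(1) algebra_simps)
      moreover have "Fract g (Xs \<sigma> ^ k) \<in> cechl hf (t - e) \<sigma>" using bg by (intro cechlI) (simp add: algebra_simps)
      moreover have "Fract b (Xs \<sigma> ^ k) \<in> cechl I t \<sigma>" using bg by (intro cechlI)
      ultimately show ?thesis using True by metis
    qed (use c in \<open>auto simp: cechC_def\<close>)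
    then obtain w u where wu: "\<And>\<sigma>. c \<sigma> = Fract f 1 * w \<sigma> + u \<sigma>"
      "\<And>\<sigma>. if card \<sigma> = p then w \<sigma> \<in> cechl hf (t - e) \<sigma> \<and> u \<sigma> \<in> cechl I t \<sigma> else w \<sigma> = 0 \<and> u \<sigma> = 0"
      by metis
    have "c = shift f w + u" using wu(1) by (simp add: fun_eq_iff shift_def)
    moreover have "w \<in> cechC hf (t - e) p" "u \<in> cechC I t p" using wu(2) unfolding cechC_def mem_Collect_eq by metis+
    ultimately show "c \<in> shift f ` cechC hf (t - e) p + cechC I t p" by blast
  qed
qed

text \<open>Localisation commutes with I : f. Concretely, the power of \<open>Xs \<sigma>\<close>
  that brings \<open>f * a\<close> into \<open>I\<close> is multiplied into numerator and
  denominator of the fraction.\<close>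

lemma cechC_colon:
  assumes I: "gideal I" and f: "f \<in> hf e" and w: "w \<in> cechC hf (t - e) p"
  shows "shift f w \<in> cechC I t p \<longleftrightarrow> w \<in> cechC (colon I e f) (t - e) p"
proof -
  have "Fract f 1 * x \<in> cechl I t \<sigma> \<longleftrightarrow> x \<in> cechl (colon I e f) (t - e) \<sigma>" if x: "x \<in> cechl hf (t - e) \<sigma>" for x \<sigma>
  proof
    assume "x \<in> cechl (colon I e f) (t - e) \<sigma>"
    then obtain a k where "x = Fract a (Xs \<sigma> ^ k)" "a \<in> colon I e f (int (k * card \<sigma>) + (t - e))"
      by (auto simp: cechl_def)
    then show "Fract f 1 * x \<in> cechl I t \<sigma>"
      using cechlI[of "f * a" I k \<sigma> t] by (simp add: colon_def algebra_simps)
  next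
    obtain a k where a: "x = Fract a (Xs \<sigma> ^ k)" "a \<in> hf (int (k * card \<sigma>) + (t - e))"
      using x by (auto simp: cechl_def)
    assume "Fract f 1 * x \<in> cechl I t \<sigma>"
    then obtain b l where b: "Fract (f * a) (Xs \<sigma> ^ k) = Fract b (Xs \<sigma> ^ l)" "b \<in> I (int (l * card \<sigma>) + t)"
      using a(1) by (auto simp: cechl_def)
    then have eq: "f * (a * Xs \<sigma> ^ l) = b * Xs \<sigma> ^ k" by (simp add: eq_fract mult.assoc)
    have "b * Xs \<sigma> ^ k \<in> I (e + (int ((k + l) * card \<sigma>) + (t - e)))"
      by (rule gideal_mult_right[OF I b(2) Xs_power_hf]) (simp add: algebra_simps)
    moreover have "a * Xs \<sigma> ^ l \<in> hf (int ((k + l) * card \<sigma>) + (t - e))"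
      by (rule gideal_mult_right[OF gideal_UNIV a(2) Xs_power_hf]) (simp add: algebra_simps)
    ultimately have "a * Xs \<sigma> ^ l \<in> colon I e f (int ((k + l) * card \<sigma>) + (t - e))"
      by (simp add: colon_def eq)
    then show "x \<in> cechl (colon I e f) (t - e) \<sigma>"
      using cechlI[of "a * Xs \<sigma> ^ l" "colon I e f" "k + l" \<sigma> "t - e"] Fract_cancel[of "Xs \<sigma> ^ l" a "Xs \<sigma> ^ k"]
      by (simp add: a(1) power_add)
  qed
  then have *: "card \<sigma> = p \<Longrightarrow> Fract f 1 * w \<sigma> \<in> cechl I t \<sigma> \<longleftrightarrow> w \<sigma> \<in> cechl (colon I e f) (t - e) \<sigma>" for \<sigma>
    using w unfolding cechC_def mem_Collect_eq by metis
  show ?thesis using w * by (simp add: cechC_def shift_def)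
qed

text \<open>Multiplication by \<open>f\<close> identifies the shifted complex of R/(I : f) with that
  of (I + (f))/I. In the exact sequence for \<open>I\<close>, I + (f) and R, the outer terms are
  therefore again cohomologies of graded quotient rings.\<close>

lemma cech_padd_cohom:
  fixes t :: int
  assumes I: "gideal I" and f: "f \<in> hf e"
  defines "V \<equiv> cechC (padd I e f) t" and "U \<equiv> cechC I t"
    and "W' \<equiv> cechC hf (t - e)" and "A' \<equiv> cechC (colon I e f) (t - e)"
  shows "fv.qfin (fv.cocyc cech_coboundary V U p) (fv.cobnd cech_coboundary V U p) \<longleftrightarrow>
      fv.qfin (fv.cocyc cech_coboundary W' A' p) (fv.cobnd cech_coboundary W' A' p)"
    and "fv.qfin (fv.cocyc cech_coboundary W' A' p) (fv.cobnd cech_coboundary W' A' p) \<Longrightarrow>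
      fv.cohom cech_coboundary V U p = fv.cohom cech_coboundary W' A' p"
proof -
  let ?d = cech_coboundary
  let ?Z = "fv.cocyc ?d V U p" and ?B = "fv.cobnd ?d V U p" and ?Z' = "fv.cocyc ?d W' A' p" and ?B' = "fv.cobnd ?d W' A' p"
  interpret d: Vector_Spaces.linear "\<lambda>z c. fscale z c" "\<lambda>z c. fscale z c" cech_coboundary
    by (rule linear_coboundary)
  interpret sh: Vector_Spaces.linear "\<lambda>z c. fscale z c" "\<lambda>z c. fscale z c" "shift f"
    by (rule linear_shift)
  have J: "gideal (padd I e f)" and A: "gideal (colon I e f)"
    using gideal_padd gideal_colon I f by blast+
  have sc: "fv.subcomplex cech_coboundary V" "fv.subcomplex cech_coboundary U"
    "fv.subcomplex cech_coboundary W'" "fv.subcomplex cech_coboundary A'"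
    unfolding V_def U_def W'_def A'_def using J I A gideal_UNIV by (intro cechC_subcomplex; blast)+
  have s: "fv.subspace (V q)" "fv.subspace (U q)" "fv.subspace (W' q)" "fv.subspace (A' q)"
    and dU: "c \<in> U q \<Longrightarrow> cech_coboundary c \<in> U (Suc q)"
    and dW: "c \<in> W' q \<Longrightarrow> cech_coboundary c \<in> W' (Suc q)" for c q
    using sc by (auto simp: fv.subcomplex_def)
  have V: "V q = shift f ` W' q + U q" for q unfolding V_def W'_def U_def by (rule cechC_padd[OF I f])
  have col: "w \<in> W' q \<Longrightarrow> shift f w \<in> U q \<longleftrightarrow> w \<in> A' q" for w q
    unfolding W'_def U_def A'_def by (rule cechC_colon[OF I f])
  have A'W': "A' q \<subseteq> W' q" for q
    unfolding A'_def W'_def by (rule cechC_mono) (use gideal_hf[OF A] in \<open>auto simp: le_fun_def\<close>)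
  have UV: "U q \<subseteq> V q" for q unfolding U_def V_def by (rule cechC_mono[OF le_padd])
  have U_cob: "U q \<subseteq> fv.cobnd ?d V U q" for q
    using fv.subspace_0[OF s(1)] d.zero by (cases q) (force simp: fv.cobnd_def)+
  have 1: "shift f ` ?Z' + ?B = ?Z"
  proof (rule antisym)
    have "shift f w \<in> ?Z" if w: "w \<in> ?Z'" for w
    proof -
      have "shift f w + 0 \<in> V p" unfolding V
        using w fv.subspace_0[OF s(2)] by (intro set_plus_intro) (auto simp: fv.cocyc_def)
      moreover have "shift f (?d w) \<in> U (Suc p)" using w col[of "?d w" "Suc p"] A'W' by (auto simp: fv.cocyc_def)
      ultimately show ?thesis by (simp add: fv.cocyc_def shift_coboundary)
    qed
    moreover have "?B \<subseteq> ?Z"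
      by (rule fv.cobnd_subset_cocyc[OF linear_coboundary sc(1,2) _ UV]) (simp add: coboundary_coboundary)
    ultimately show "shift f ` ?Z' + ?B \<subseteq> ?Z"
      using fv.subspace_add[OF fv.subspace_cocyc_cobnd(1)[OF linear_coboundary sc(1,2)]]
      by (auto elim!: set_plus_elim)
    show "?Z \<subseteq> shift f ` ?Z' + ?B"
    proof
      fix v assume v: "v \<in> ?Z"
      then obtain w u where wu: "v = shift f w + u" "w \<in> W' p" "u \<in> U p"
        unfolding fv.cocyc_def V by (auto elim!: set_plus_elim)
      have "shift f (?d w) = ?d v - ?d u" using wu(1) by (simp add: d.add shift_coboundary)
      then have "shift f (?d w) \<in> U (Suc p)"
        using v dU[OF wu(3)] fv.subspace_diff[OF s(2)] by (simp add: fv.cocyc_def)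
      then have "w \<in> ?Z'" using col dW[OF wu(2)] wu(2) by (simp add: fv.cocyc_def)
      then show "v \<in> shift f ` ?Z' + ?B"
        unfolding wu(1) using wu(3) U_cob by (intro set_plus_intro) auto
    qed
  qed
  have 2: "{z \<in> ?Z'. shift f z \<in> ?B} = ?B'"
  proof (rule antisym)
    have cb: "?B' \<subseteq> ?Z'"
      by (rule fv.cobnd_subset_cocyc[OF linear_coboundary sc(3,4) _ A'W']) (simp add: coboundary_coboundary)
    show "{z \<in> ?Z'. shift f z \<in> ?B} \<subseteq> ?B'"
    proof safe
      fix z assume z: "z \<in> ?Z'" "shift f z \<in> ?B"
      show "z \<in> ?B'"
      proof (cases p)
        case 0
        then show ?thesis using z col[of z 0] by (simp add: fv.cobnd_def fv.cocyc_def)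
      next
        case (Suc q)
        then obtain v u' where vu: "shift f z = ?d v + u'" "v \<in> V q" "u' \<in> U p" using z by (auto simp: fv.cobnd_def)
        then obtain w u where wu: "v = shift f w + u" "w \<in> W' q" "u \<in> U q" unfolding V by (auto elim!: set_plus_elim)
        have "shift f (z - ?d w) = ?d u + u'"
          using vu wu by (simp add: shift_diff d.add shift_coboundary)
        then have "shift f (z - ?d w) \<in> U p"
          using dU[OF wu(3)] vu(3) Suc fv.subspace_add[OF s(2)] by simp
        moreover have "z - ?d w \<in> W' p"
          using z dW[OF wu(2)] Suc fv.subspace_diff[OF s(3)] by (simp add: fv.cocyc_def)
        ultimately have "z - ?d w \<in> A' p" using col by blast
        moreover have "z = ?d w + (z - ?d w)" by simp
        ultimately show ?thesis using wu(2) Suc unfolding fv.cobnd_def by force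
      qed
    qed
    have "shift f z \<in> ?B" if z: "z \<in> ?B'" for z
    proof (cases p)
      case 0
      then show ?thesis using z col[of z 0] A'W'[of 0] by (auto simp: fv.cobnd_def)
    next
      case (Suc q)
      then obtain w a where wa: "z = ?d w + a" "w \<in> W' q" "a \<in> A' p" using z by (auto simp: fv.cobnd_def)
      have "shift f w + 0 \<in> V q" unfolding V
        using wa fv.subspace_0[OF s(2)] by (intro set_plus_intro) auto
      moreover have "shift f a \<in> U p" using col[of a p] A'W' wa(3) by blast
      ultimately show ?thesis using Suc by (auto simp: fv.cobnd_def wa(1) shift_add shift_coboundary[symmetric])
    qed
    then show "?B' \<subseteq> {z \<in> ?Z'. shift f z \<in> ?B}"
      using cb by blast
  qed
  note sZ = fv.subspace_cocyc_cobnd[OF linear_coboundary sc(3,4)] fv.subspace_cocyc_cobnd[OF linear_coboundary sc(1,2)]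
  note im = fv.qfin_image[OF linear_shift sZ(1)[of p] sZ(4)[of p], of f] fv.qd_image[OF linear_shift sZ(1)[of p] sZ(4)[of p], of f]
  show "fv.qfin (?Z) (?B) \<longleftrightarrow>
      fv.qfin (?Z') (?B')"
    using im(1) unfolding 1 2 .
  show "fv.qfin (?Z') (?B') \<Longrightarrow>
      fv.cohom ?d V U p = fv.cohom ?d W' A' p"
    using im(2) unfolding 1 2 fv.cohom_def .
qed

text \<open>The contracting homotopy of the Cech complex after inverting one variable.\<close>

definition cone :: "'n::{finite,linorder} \<Rightarrow> ('n set \<Rightarrow> 'n mpoly fract) \<Rightarrow> ('n set \<Rightarrow> 'n mpoly fract)" where
  "cone i c = (\<lambda>\<tau>. if i \<in> \<tau> then 0 else (-1) ^ pos i \<tau> * c (insert i \<tau>))"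

lemma cone_homotopy: "cech_coboundary (cone i c) + cone i (cech_coboundary c) = c"
proof
  fix \<sigma> :: "'a set"
  have sq: "((-1) ^ k * ((-1) ^ k * x) :: 'a mpoly fract) = x" for k x
    by (simp add: mult.assoc[symmetric] power_mult_distrib[symmetric])
  show "(cech_coboundary (cone i c) + cone i (cech_coboundary c)) \<sigma> = c \<sigma>"
  proof (cases "i \<in> \<sigma>")
    case True
    have "cech_coboundary (cone i c) \<sigma> = (\<Sum>j\<in>{i}. (-1) ^ pos j \<sigma> * cone i c (\<sigma> - {j}))"
      unfolding cech_coboundary_def by (rule sum.mono_neutral_right) (use True in \<open>auto simp: cone_def\<close>)
    also have "\<dots> = c \<sigma>"
      using True pos_remove(2)[of i i \<sigma>] by (simp add: cone_def sq insert_absorb)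
    finally show ?thesis using True by (simp add: cone_def)
  next
    case False
    define \<rho> where "\<rho> = insert i \<sigma>"
    have pi: "pos i \<rho> = pos i \<sigma>" unfolding \<rho>_def by (rule arg_cong[of _ _ card]) auto
    have "cone i (cech_coboundary c) \<sigma> = (-1) ^ pos i \<sigma> * (\<Sum>j\<in>\<rho>. (-1) ^ pos j \<rho> * c (\<rho> - {j}))"
      using False by (simp add: cone_def cech_coboundary_def \<rho>_def)
    also have "(\<Sum>j\<in>\<rho>. (-1) ^ pos j \<rho> * c (\<rho> - {j})) =
        (-1) ^ pos i \<sigma> * c \<sigma> + (\<Sum>j\<in>\<sigma>. (-1) ^ pos j \<rho> * c (\<rho> - {j}))"
      unfolding pi[symmetric] using False by (subst (1) \<rho>_def) (simp add: \<rho>_def)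
    finally have 1: "cone i (cech_coboundary c) \<sigma> =
        c \<sigma> + (\<Sum>j\<in>\<sigma>. (-1) ^ pos i \<sigma> * ((-1) ^ pos j \<rho> * c (\<rho> - {j})))"
      by (simp add: distrib_left sq sum_distrib_left)
    have "cech_coboundary (cone i c) \<sigma> = (\<Sum>j\<in>\<sigma>. - ((-1) ^ pos i \<sigma> * ((-1) ^ pos j \<rho> * c (\<rho> - {j}))))"
      unfolding cech_coboundary_def
    proof (intro sum.cong refl)
      fix j assume j: "j \<in> \<sigma>"
      have ne: "j \<noteq> i" and ins: "insert i (\<sigma> - {j}) = \<rho> - {j}" using j False by (auto simp: \<rho>_def)
      have "cone i c (\<sigma> - {j}) = (-1) ^ pos i (\<sigma> - {j}) * c (\<rho> - {j})"
        using False by (simp add: cone_def ins)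
      moreover have "((-1) ^ pos j \<sigma> * (-1) ^ pos i (\<sigma> - {j}) :: 'a mpoly fract) = - ((-1) ^ pos i \<sigma> * (-1) ^ pos j \<rho>)"
      proof (cases "j < i")
        case True
        then have "pos j \<rho> = pos j \<sigma>" using pos_remove(2)[of i j \<rho>] False by (simp add: \<rho>_def)
        then show ?thesis using pos_remove(1)[OF j True] by simp
      next
        case nl: False
        then have "pos j \<rho> = Suc (pos j \<sigma>)"
          using pos_remove(1)[of i \<rho> j] ne False by (simp add: \<rho>_def)
        then show ?thesis using pos_remove(2)[OF nl, of \<sigma>] by simp
      qed
      ultimately show "(-1) ^ pos j \<sigma> * cone i c (\<sigma> - {j}) = - ((-1) ^ pos i \<sigma> * ((-1) ^ pos j \<rho> * c (\<rho> - {j})))"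
        by (simp add: mult.assoc[symmetric])
    qed
    then show ?thesis using 1 by (simp add: sum_negf)
  qed
qed

text \<open>\<open>cone i\<close> alone leaves the complex, as its values may have powers of
  \<open>var i\<close> in the denominator. One power of \<open>var i\<close>, uniform over the
  finitely many \<open>\<tau>\<close>, clears them.\<close>

lemma shift_cone:
  assumes J: "gideal J" and c: "c \<in> cechC J t (Suc p)"
  shows "\<exists>N. \<forall>k\<ge>N. shift (var i ^ k) (cone i c) \<in> cechC J (int k + t) p"
proof -
  have "\<exists>N. \<forall>k\<ge>N. i \<notin> \<tau> \<longrightarrow> card \<tau> = p \<longrightarrow> Fract (var i ^ k) 1 * c (insert i \<tau>) \<in> cechl J (int k + t) \<tau>" for \<tau>
  proof (cases "i \<notin> \<tau> \<and> card \<tau> = p")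
    case True
    then have "card (insert i \<tau>) = Suc p" by simp
    then obtain a l where a: "c (insert i \<tau>) = Fract a (Xs (insert i \<tau>) ^ l)" "a \<in> J (int (l * Suc p) + t)"
      using c unfolding cechC_def cechl_def mem_Collect_eq by metis
    have "Fract (var i ^ k) 1 * c (insert i \<tau>) \<in> cechl J (int k + t) \<tau>" if k: "k \<ge> l" for k
    proof -
      have "Fract (var i ^ k) 1 * c (insert i \<tau>) = Fract (a * var i ^ (k - l)) (Xs \<tau> ^ l)"
        using True Fract_cancel[of "var i ^ l" "a * var i ^ (k - l)" "Xs \<tau> ^ l"] k
        by (simp add: a(1) Xs_insert power_mult_distrib mult.assoc power_add[symmetric])
          (simp add: mult.commute)
      moreover have "a * var i ^ (k - l) \<in> J (int (l * card \<tau>) + (int k + t))"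
        by (rule gideal_mult_right[OF J a(2) hf_power[OF hf_var]])
          (use True k in \<open>simp add: algebra_simps of_nat_diff\<close>)
      ultimately show ?thesis by (simp add: cechlI)
    qed
    then show ?thesis by blast
  qed auto
  then obtain N where N: "\<And>\<tau> k. k \<ge> N \<tau> \<Longrightarrow> i \<notin> \<tau> \<Longrightarrow> card \<tau> = p \<Longrightarrow>
      Fract (var i ^ k) 1 * c (insert i \<tau>) \<in> cechl J (int k + t) \<tau>" by metis
  have "shift (var i ^ k) (cone i c) \<in> cechC J (int k + t) p" if k: "k \<ge> Max (range N)" for k
    unfolding cechC_def mem_Collect_eq
  proof
    fix \<tau>
    have "k \<ge> N \<tau>" using k Max_ge[of "range N" "N \<tau>"] by simp
    then have "i \<notin> \<tau> \<Longrightarrow> card \<tau> = p \<Longrightarrow> (-1) ^ pos i \<tau> * (Fract (var i ^ k) 1 * c (insert i \<tau>)) \<in> cechl J (int k + t) \<tau>"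
      by (intro cechl_sign J N)
    moreover have "i \<notin> \<tau> \<Longrightarrow> card \<tau> \<noteq> p \<Longrightarrow> c (insert i \<tau>) = 0" using c by (simp add: cechC_def)
    ultimately show "if card \<tau> = p then shift (var i ^ k) (cone i c) \<tau> \<in> cechl J (int k + t) \<tau>
        else shift (var i ^ k) (cone i c) \<tau> = 0"
      by (auto simp: shift_def cone_def cechl_zero[OF J] mult.left_commute)
  qed
  then show ?thesis by blast
qed

lemma cone_cechC_0: "c \<in> cechC J t 0 \<Longrightarrow> cone i c = 0"
  by (auto simp: cone_def cechC_def fun_eq_iff)

lemma linear_cone_zero: "shift f 0 = 0" "cone i 0 = 0"
  by (auto simp: shift_def cone_def fun_eq_iff)

abbreviation "cechZ I t p \<equiv> fv.cocyc cech_coboundary (cechC hf t) (cechC I t) p"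
abbreviation "cechB I t p \<equiv> fv.cobnd cech_coboundary (cechC hf t) (cechC I t) p"
abbreviation "cechH I t p \<equiv> fv.cohom cech_coboundary (cechC hf t) (cechC I t) p"

text \<open>Inverting \<open>var i\<close> makes the complex contractible, so every cohomology class
  is killed by a power of \<open>var i\<close>.\<close>

lemma cocycle_killed:
  assumes I: "gideal I" and c: "c \<in> cechZ I t p"
  shows "\<exists>k. shift (var i ^ k) c \<in> cechB I (int k + t) p"
proof -
  have c': "c \<in> cechC hf t p" "cech_coboundary c \<in> cechC I t (Suc p)" using c by (auto simp: fv.cocyc_def)
  obtain N where N: "\<And>k. k \<ge> N \<Longrightarrow> shift (var i ^ k) (cone i (cech_coboundary c)) \<in> cechC I (int k + t) p"
    using shift_cone[OF I c'(2)] by blast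
  have eq: "shift (var i ^ k) c = cech_coboundary (shift (var i ^ k) (cone i c)) +
      shift (var i ^ k) (cone i (cech_coboundary c))" for k
    by (subst cone_homotopy[of i c, symmetric]) (simp add: shift_add shift_coboundary)
  show ?thesis
  proof (cases p)
    case 0
    then have "cone i c = 0" using c'(1) cone_cechC_0 by blast
    moreover have "cech_coboundary 0 = (0 :: 'a set \<Rightarrow> _)" by (simp add: cech_coboundary_def fun_eq_iff)
    ultimately show ?thesis
      using N[of N] 0 by (intro exI[of _ N]) (simp add: eq fv.cobnd_def linear_cone_zero)
  next
    case (Suc q)
    obtain N' where N': "\<And>k. k \<ge> N' \<Longrightarrow> shift (var i ^ k) (cone i c) \<in> cechC hf (int k + t) q"
      using shift_cone[OF gideal_UNIV c'(1)[unfolded Suc]] by blast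
    show ?thesis unfolding Suc fv.cobnd_def
      using N[of "max N N'"] N'[of "max N N'"] Suc
      by (intro exI[of _ "max N N'"]) (auto simp: eq)
  qed
qed

lemma cechC_beyond: "CARD('n) < p \<Longrightarrow> cechC J t p = ({0} :: ('n::{finite,linorder} set \<Rightarrow> _) set)"
proof -
  assume p: "CARD('n) < p"
  have "card \<sigma> \<noteq> p" for \<sigma> :: "'n set" using p card_mono[of UNIV \<sigma>] by auto
  then show ?thesis by (auto simp: cechC_def fun_eq_iff)
qed

section \<open>Polynomials and their backward differences\<close>

lemma poly_difference:
  fixes P :: "real poly" and e :: real
  shows "\<exists>D. (\<forall>x. poly D x = poly P x - poly P (x - e)) \<and>
    (\<forall>n. degree P \<le> Suc n \<longrightarrow> degree D \<le> n \<and> coeff D n = real (Suc n) * e * coeff P (Suc n)) \<and>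
    (degree P = 0 \<longrightarrow> D = 0)"
proof (induction P)
  case 0
  show ?case by (intro exI[of _ 0]) simp
next
  case (pCons a P)
  obtain D where D: "\<And>x. poly D x = poly P x - poly P (x - e)"
    "\<And>n. degree P \<le> Suc n \<Longrightarrow> degree D \<le> n \<and> coeff D n = real (Suc n) * e * coeff P (Suc n)"
    "degree P = 0 \<Longrightarrow> D = 0" using pCons.IH by metis
  \<comment> \<open>From x P(x) - (x - e) P(x - e) = x (P(x) - P(x - e)) + e P(x - e), where P(x -
    e) is P(x) - D(x).\<close>
  let ?D = "pCons 0 D + smult e (P - D)"
  have 1: "poly ?D x = poly (pCons a P) x - poly (pCons a P) (x - e)" for x
    by (simp add: D(1)) (simp add: algebra_simps)
  have 2: "degree ?D \<le> n \<and> coeff ?D n = real (Suc n) * e * coeff (pCons a P) (Suc n)"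
    if "degree (pCons a P) \<le> Suc n" for n
  proof -
    have dP: "degree P \<le> n" using that by (cases "P = 0") auto
    show ?thesis
    proof (cases n)
      case 0
      then show ?thesis using D(3) dP by simp
    next
      case (Suc m)
      note Dm = D(2)[of m]
      have d: "degree D \<le> m" "coeff D m = real n * e * coeff P n" "coeff D n = 0"
        using Dm dP Suc by (auto intro: coeff_eq_0)
      have "degree ?D \<le> n"
        using d(1) dP Suc by (intro degree_add_le degree_pCons_le[THEN order_trans]
            degree_smult_le[THEN order_trans] degree_diff_le) auto
      then show ?thesis using d Suc by (simp add: algebra_simps)
    qed
  qed
  have 3: "degree (pCons a P) = 0 \<longrightarrow> ?D = 0"
    using D(3) pCons.hyps by (auto split: if_splits)
  show ?case
    by (rule exI[of _ ?D], intro conjI allI impI 3) (simp_all only: 1 2[THEN conjunct1] 2[THEN conjunct2])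
qed

lemma ex_antidifference:
  fixes q :: "real poly"
  shows "\<exists>Q. \<forall>x. poly Q x - poly Q (x - 1) = poly q x"
proof -
  have "\<forall>k\<ge>n. coeff q k = 0 \<Longrightarrow> ?thesis" for n
  proof (induction n arbitrary: q)
    case 0
    then have "q = 0" by (simp add: poly_eq_iff)
    then show ?case by (intro exI[of _ 0]) simp
  next
    case (Suc n)
    define P where "P = monom (coeff q n / real (Suc n)) (Suc n)"
    obtain D where D: "\<And>x. poly D x = poly P x - poly P (x - 1)"
      "degree D \<le> n" "coeff D n = real (Suc n) * 1 * coeff P (Suc n)"
      using poly_difference[of P 1] degree_monom_le[of "coeff q n / real (Suc n)" "Suc n", folded P_def] by metis
    have "\<forall>k\<ge>n. coeff (q - D) k = 0"
    proof (intro allI impI)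
      fix k assume "k \<ge> n"
      then show "coeff (q - D) k = 0"
        using Suc.prems D(2,3) coeff_eq_0[of D k] by (cases "k = n") (auto simp: P_def)
    qed
    from Suc.IH[OF this] obtain Q where Q: "\<And>x. poly Q x - poly Q (x - 1) = poly (q - D) x" by blast
    have "poly (Q + P) x - poly (Q + P) (x - 1) = poly q x" for x
      using Q[of x] D(1)[of x] by simp
    then show ?case by blast
  qed
  from this[of "Suc (degree q)"] show ?thesis by (simp add: coeff_eq_0)
qed

text \<open>With the difference known at every integer, negative ones included, \<open>F\<close> is
  a polynomial everywhere and not only for large \<open>t\<close>; reading off the Euler
  characteristic in degree 0 depends on this.\<close>

lemma int_antidifference:
  fixes F :: "int \<Rightarrow> real"
  assumes "\<And>t. F t - F (t - 1) = poly q (of_int t)"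
  shows "\<exists>Q. \<forall>t. F t = poly Q (of_int t)"
proof -
  obtain Q where Q: "\<And>x. poly Q x - poly Q (x - 1) = poly q x" using ex_antidifference by blast
  define c where "c = F 0 - poly Q 0"
  have "F t = poly Q (of_int t) + c" for t
  proof (induction t rule: int_induct[where k = 0])
    case (step1 i)
    then show ?case using assms[of "i + 1"] Q[of "of_int (i + 1)"] by simp
  next
    case (step2 i)
    then show ?case using assms[of i] Q[of "of_int i"] by simp
  qed (simp add: c_def)
  then show ?thesis by (intro exI[of _ "Q + [:c:]"]) simp
qed

section \<open>Finiteness, vanishing and polynomiality of the cohomology\<close>

definition emb0 :: "'n::{finite,linorder} mpoly \<Rightarrow> ('n set \<Rightarrow> 'n mpoly fract)" where
  "emb0 a = (\<lambda>\<sigma>. if \<sigma> = {} then Fract a 1 else 0)"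

lemma cechl_empty: "cechl J t {} = (\<lambda>a. Fract a 1) ` J t"
  by (auto simp: cechl_def Xs_def image_iff)

lemma cechC_0: "cechC J t 0 = emb0 ` J t"
  by (auto simp: cechC_def cechl_empty emb0_def image_iff fun_eq_iff split: if_splits)

lemma
  fixes I :: "'n::{finite,linorder} cfam"
  assumes I: "gideal I"
  shows qfin_cechC_0: "fv.qfin (cechC hf t 0) (cechC I t 0)"
    and qd_cechC_0: "fv.qd (cechC hf t 0) (cechC I t 0) = H I t"
proof -
  obtain B where B: "mp.qbasis B (hf t) (I t)"
    using mp.ex_qbasis[OF subspace_gideal[OF I] qfin_hf] by blast
  have inj: "inj (emb0 :: 'n mpoly \<Rightarrow> _)" by (auto simp: inj_def emb0_def fun_eq_iff eq_fract)
  have emb_sum: "emb0 (\<Sum>b\<in>B. const (a b) * b) = (\<Sum>b\<in>B. fscale (a b) (emb0 b))" for a and B :: "'n mpoly set"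
  proof -
    have add: "emb0 (x + y) = emb0 x + emb0 y" for x y :: "'n mpoly" by (simp add: emb0_def fun_eq_iff)
    have "emb0 (const c * x) = fscale c (emb0 x)" for c and x :: "'n mpoly" by (simp add: emb0_def fun_eq_iff)
    moreover have "emb0 0 = (0 :: 'n set \<Rightarrow> _)" by (simp add: emb0_def fun_eq_iff fract_collapse)
    ultimately show ?thesis by (induction B rule: infinite_finite_induct) (auto simp: add)
  qed
  have emb_diff: "emb0 (x - y) = emb0 x - emb0 y" for x y :: "'n mpoly" by (simp add: emb0_def fun_eq_iff)
  have "fv.qbasis (emb0 ` B) (cechC hf t 0) (cechC I t 0)"
    unfolding fv.qbasis_def
  proof (intro conjI allI impI)
    show "finite (emb0 ` B)" "emb0 ` B \<subseteq> cechC hf t 0"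
      using B by (auto simp: mp.qbasis_def cechC_0)
    show "cechC hf t 0 \<subseteq> fv.span (emb0 ` B \<union> cechC I t 0)"
    proof
      fix c :: "'n set \<Rightarrow> 'n mpoly fract" assume "c \<in> cechC hf t 0"
      then obtain v where v: "c = emb0 v" "v \<in> hf t" by (auto simp: cechC_0)
      then obtain a where "v - (\<Sum>b\<in>B. const (a b) * b) \<in> I t"
        using B mp.mem_span_Un_subspace[OF subspace_gideal[OF I], of B v t] by (auto simp: mp.qbasis_def)
      then have "emb0 v - (\<Sum>b\<in>B. fscale (a b) (emb0 b)) \<in> cechC I t 0"
        unfolding emb_sum[symmetric] emb_diff[symmetric] cechC_0 by (rule imageI)
      then have "(\<Sum>b\<in>B. fscale (a b) (emb0 b)) + (emb0 v - (\<Sum>b\<in>B. fscale (a b) (emb0 b))) \<in> fv.span (emb0 ` B \<union> cechC I t 0)"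
        by (intro fv.span_add fv.span_sum fv.span_scale) (auto intro: fv.span_base)
      then show "c \<in> fv.span (emb0 ` B \<union> cechC I t 0)" using v by simp
    qed
    fix a assume "(\<Sum>b\<in>emb0 ` B. fscale (a b) b) \<in> cechC I t 0"
    then have "emb0 (\<Sum>b\<in>B. const (a (emb0 b)) * b) \<in> emb0 ` I t"
      by (simp add: emb_sum cechC_0 sum.reindex[OF inj_on_subset[OF inj subset_UNIV]])
    then have "(\<Sum>b\<in>B. const (a (emb0 b)) * b) \<in> I t" using inj by (simp add: inj_image_mem_iff)
    then show "\<forall>b\<in>emb0 ` B. a b = 0" using mp.qbasis_indep[OF B] by auto
  qed
  then show "fv.qfin (cechC hf t 0) (cechC I t 0)" "fv.qd (cechC hf t 0) (cechC I t 0) = H I t"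
    using fv.qbasis_imp_qfin fv.qd_eq[OF cechC_subspace[OF I]] mp.qd_eq[OF subspace_gideal[OF I] B]
      card_image[OF inj_on_subset[OF inj subset_UNIV]] by (auto simp: H_def)
qed

text \<open>Three facts that the induction on ideals carries together: finite dimension, vanishing
  in high degrees, and that the Hilbert function minus the Euler characteristic of local cohomology
  is a polynomial in every degree.\<close>

definition good_cohomology :: "'n::{finite,linorder} cfam \<Rightarrow> bool" where
  "good_cohomology I \<longleftrightarrow> (\<forall>t p. fv.qfin (cechZ I t p) (cechB I t p)) \<and>
    (\<exists>t0. \<forall>t\<ge>t0. \<forall>p. cechZ I t p \<subseteq> cechB I t p) \<and>
    (\<exists>q :: real poly. \<forall>t. real (H I t) - of_int (\<Sum>p\<le>CARD('n). (-1) ^ p * int (cechH I t p)) = poly q (of_int t))"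

text \<open>Every localisation of R/I at a nonempty \<open>\<sigma>\<close> is zero here, so only
  index 0 survives, with dimension \<open>H I t\<close>; the polynomial is 0.\<close>

lemma good_cohomology_irrelevant:
  fixes I :: "'n::{finite,linorder} cfam"
  assumes I: "gideal I" and v: "\<And>i. var i \<in> I 1"
  shows "good_cohomology I"
proof -
  have Xs: "a * Xs \<sigma> \<in> I (t + int (card \<sigma>))" if "a \<in> hf t" "\<sigma> \<noteq> {}" for a \<sigma> t
  proof -
    obtain i where i: "i \<in> \<sigma>" using \<open>\<sigma> \<noteq> {}\<close> by blast
    then have X: "Xs \<sigma> = Xs (\<sigma> - {i}) * var i" and c: "card \<sigma> = Suc (card (\<sigma> - {i}))"
      using Xs_insert[of i "\<sigma> - {i}"] card_Suc_Diff1[of \<sigma> i] by (simp_all add: insert_absorb mult.commute)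
    show ?thesis unfolding X mult.assoc[symmetric]
      by (rule gideal_mult'[OF I v hf_mult[OF that(1) Xs_hf]]) (simp add: c)
  qed
  have cl: "cechl I t \<sigma> = cechl hf t \<sigma>" if "\<sigma> \<noteq> {}" for t \<sigma>
  proof
    show "cechl I t \<sigma> \<subseteq> cechl hf t \<sigma>" using gideal_hf[OF I] by (auto simp: cechl_def)
    show "cechl hf t \<sigma> \<subseteq> cechl I t \<sigma>"
    proof
      fix x assume "x \<in> cechl hf t \<sigma>"
      then obtain a k where a: "x = Fract a (Xs \<sigma> ^ k)" "a \<in> hf (int (k * card \<sigma>) + t)" by (auto simp: cechl_def)
      have "a * Xs \<sigma> \<in> I (int (Suc k * card \<sigma>) + t)"
        using Xs[OF a(2) that] by (simp add: algebra_simps)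
      then have "Fract (a * Xs \<sigma>) (Xs \<sigma> ^ Suc k) \<in> cechl I t \<sigma>" by (rule cechlI)
      then show "x \<in> cechl I t \<sigma>" using Fract_cancel[of "Xs \<sigma>" a "Xs \<sigma> ^ k"] a(1) by (simp add: mult.commute)
    qed
  qed
  have C: "cechC I t (Suc p) = cechC hf t (Suc p)" for t p
  proof -
    have *: "card \<sigma> = Suc p \<Longrightarrow> cechl I t \<sigma> = cechl hf t \<sigma>" for \<sigma> :: "'n set"
      by (rule cl) auto
    show ?thesis unfolding cechC_def by (intro Collect_cong all_cong1) (simp add: *)
  qed
  have Z: "cechZ I t p = cechC hf t p" for t p
    using cechC_coboundary[OF gideal_UNIV] by (auto simp: fv.cocyc_def C)
  have B0: "cechB I t 0 = cechC I t 0" for t by (simp add: fv.cobnd_def)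
  have BS: "cechB I t (Suc p) = cechC hf t (Suc p)" for t p
  proof -
    have "cechB I t (Suc p) \<subseteq> cechZ I t (Suc p)"
      by (rule fv.cobnd_subset_cocyc[OF linear_coboundary cechC_subcomplex[OF gideal_UNIV] cechC_subcomplex[OF I]])
        (use gideal_hf[OF I] in \<open>auto simp: coboundary_coboundary intro!: cechC_mono le_funI\<close>)
    moreover have "cechC hf t (Suc p) \<subseteq> cechB I t (Suc p)"
    proof
      fix c :: "'n set \<Rightarrow> 'n mpoly fract" assume c: "c \<in> cechC hf t (Suc p)"
      have "0 \<in> cechC (hf :: 'n cfam) t p" using fv.subspace_0[OF cechC_subspace[OF gideal_UNIV]] .
      moreover have "cech_coboundary 0 = (0 :: 'n set \<Rightarrow> _)" by (simp add: cech_coboundary_def fun_eq_iff)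
      ultimately show "c \<in> cechB I t (Suc p)" using c unfolding fv.cobnd_def by (force simp: C)
    qed
    ultimately show ?thesis using Z by blast
  qed
  have fin: "fv.qfin (cechZ I t p) (cechB I t p)" for t p
    using qfin_cechC_0[OF I] by (cases p) (simp_all add: Z B0 BS)
  have h: "cechH I t p = (if p = 0 then H I t else 0)" for t p
    using qd_cechC_0[OF I] by (cases p) (simp_all add: fv.cohom_def Z B0 BS)
  have "H I t = 0" if "t \<ge> 1" for t
  proof -
    have "g * 1 \<in> I (0 + t)" if "g \<in> hf t" for g
      by (rule gideal_Suc[OF I _ \<open>t \<ge> 1\<close> that]) (use v in simp)
    then show ?thesis using gideal_hf[OF I] by (subst H_eq_0[OF I]) auto
  qed
  then have "cechZ I t p \<subseteq> cechB I t p" if "t \<ge> 1" for t p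
    using that gideal_hf[OF I] by (cases p) (auto simp: Z B0 BS cechC_0 H_eq_0[OF I])
  moreover have "real (H I t) - of_int (\<Sum>p\<le>CARD('n). (-1) ^ p * int (cechH I t p)) = poly 0 (of_int t)" for t
    by (simp add: h if_distrib sum.delta' cong: if_cong)
  ultimately show ?thesis unfolding good_cohomology_def using fin by blast
qed

lemma gideal_le_hf: "gideal I \<Longrightarrow> I \<le> hf"
  by (auto simp: le_fun_def gideal_hf)

lemma cech_qd_0:
  fixes I :: "'n::{finite,linorder} cfam"
  assumes I: "gideal I" and "fv.qfin (cechZ I t p) (cechB I t p)" "cechH I t p = 0"
  shows "cechZ I t p \<subseteq> cechB I t p"
proof -
  note sc = fv.subspace_cocyc_cobnd[OF linear_coboundary cechC_subcomplex[OF gideal_UNIV] cechC_subcomplex[OF I]]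
  have "cechB I t p \<subseteq> cechZ I t p"
    by (rule fv.cobnd_subset_cocyc[OF linear_coboundary cechC_subcomplex[OF gideal_UNIV] cechC_subcomplex[OF I]])
      (auto simp: coboundary_coboundary cechC_mono gideal_le_hf[OF I])
  then show ?thesis using fv.qd_eq_0[OF sc] assms(2,3) by (simp add: fv.cohom_def)
qed

lemma cech_qd_0':
  assumes I: "gideal I" and "cechZ I t p \<subseteq> cechB I t p"
  shows "cechH I t p = 0"
proof -
  have "cechB I t p \<subseteq> cechZ I t p"
    by (rule fv.cobnd_subset_cocyc[OF linear_coboundary cechC_subcomplex[OF gideal_UNIV] cechC_subcomplex[OF I]])
      (auto simp: coboundary_coboundary cechC_mono gideal_le_hf[OF I])
  then have "cechB I t p = cechZ I t p" using assms(2) by blast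
  then show ?thesis by (simp add: fv.cohom_def)
qed

lemma
  fixes I :: "'n::{finite,linorder} cfam"
  assumes I: "gideal I" and f: "f \<in> hf e"
    and J: "\<And>t p. fv.qfin (cechZ (padd I e f) t p) (cechB (padd I e f) t p)"
  shows cech_fin_total: "(\<And>p. fv.qfin (cechZ (colon I e f) (t - e) p) (cechB (colon I e f) (t - e) p)) \<Longrightarrow>
      fv.qfin (cechZ I t p) (cechB I t p)"
    and cech_fin_sub: "(\<And>p. fv.qfin (cechZ I t p) (cechB I t p)) \<Longrightarrow>
      fv.qfin (cechZ (colon I e f) (t - e) p) (cechB (colon I e f) (t - e) p)"
    and cech_le: "(\<And>p. fv.qfin (cechZ (colon I e f) (t - e) p) (cechB (colon I e f) (t - e) p)) \<Longrightarrow>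
      cechH I t p \<le> cechH (colon I e f) (t - e) p + cechH (padd I e f) t p"
    and cech_euler: "(\<And>p. fv.qfin (cechZ (colon I e f) (t - e) p) (cechB (colon I e f) (t - e) p)) \<Longrightarrow>
      (\<Sum>p\<le>CARD('n). (-1) ^ p * int (cechH I t p)) =
      (\<Sum>p\<le>CARD('n). (-1) ^ p * int (cechH (colon I e f) (t - e) p)) +
      (\<Sum>p\<le>CARD('n). (-1) ^ p * int (cechH (padd I e f) t p))"
proof -
  have pa: "gideal (padd I e f)" by (rule gideal_padd[OF I f])
  have dd: "\<forall>p. \<forall>c\<in>cechC hf t p. cech_coboundary (cech_coboundary c) = 0"
    by (simp add: coboundary_coboundary)
  note pc = cech_padd_cohom[OF I f, of t]
  note ex = linear_coboundary cechC_subcomplex[OF I, of t] cechC_subcomplex[OF pa, of t]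
    cechC_subcomplex[OF gideal_UNIV, of t] dd cechC_mono[OF le_padd] cechC_mono[OF gideal_le_hf[OF pa]] J[of t]
  show "fv.qfin (cechZ I t p) (cechB I t p)"
    if "\<And>p. fv.qfin (cechZ (colon I e f) (t - e) p) (cechB (colon I e f) (t - e) p)"
    by (rule fv.cohom_fin_total[OF ex]) (use that pc(1) in blast)
  show "fv.qfin (cechZ (colon I e f) (t - e) p) (cechB (colon I e f) (t - e) p)"
    if "\<And>p. fv.qfin (cechZ I t p) (cechB I t p)"
    unfolding pc(1)[symmetric] by (rule fv.cohom_fin_sub[OF ex that])
  assume fin: "\<And>p. fv.qfin (cechZ (colon I e f) (t - e) p) (cechB (colon I e f) (t - e) p)"
  have fin': "fv.qfin (fv.cocyc cech_coboundary (cechC (padd I e f) t) (cechC I t) p)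
    (fv.cobnd cech_coboundary (cechC (padd I e f) t) (cechC I t) p)" for p
    using pc(1) fin by blast
  show "cechH I t p \<le> cechH (colon I e f) (t - e) p + cechH (padd I e f) t p"
    using fv.cohom_le[OF ex fin', of p] pc(2)[OF fin, of p] by simp
  have "cechC hf t (Suc CARD('n)) = ({0} :: ('n set \<Rightarrow> 'n mpoly fract) set)"
    by (rule cechC_beyond) simp
  from fv.cohom_euler[OF ex fin' this]
  show "(\<Sum>p\<le>CARD('n). (-1) ^ p * int (cechH I t p)) =
      (\<Sum>p\<le>CARD('n). (-1) ^ p * int (cechH (colon I e f) (t - e) p)) +
      (\<Sum>p\<le>CARD('n). (-1) ^ p * int (cechH (padd I e f) t p))"
    by (simp add: pc(2)[OF fin])
qed

lemma good_cohomology_extension: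
  fixes I :: "'n::{finite,linorder} cfam"
  assumes I: "gideal I" and f: "f \<in> hf e"
    and A: "good_cohomology (colon I e f)" and J: "good_cohomology (padd I e f)"
  shows "good_cohomology I"
  unfolding good_cohomology_def
proof (intro conjI allI)
  have fA: "fv.qfin (cechZ (colon I e f) t p) (cechB (colon I e f) t p)" for t p
    using A by (simp add: good_cohomology_def)
  have fJ: "fv.qfin (cechZ (padd I e f) t p) (cechB (padd I e f) t p)" for t p
    using J by (simp add: good_cohomology_def)
  show fin: "fv.qfin (cechZ I t p) (cechB I t p)" for t p
    by (rule cech_fin_total[OF I f fJ fA])
  obtain ta where ta: "\<And>t p. t \<ge> ta \<Longrightarrow> cechZ (colon I e f) t p \<subseteq> cechB (colon I e f) t p"
    using A unfolding good_cohomology_def by blast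
  obtain tj where tj: "\<And>t p. t \<ge> tj \<Longrightarrow> cechZ (padd I e f) t p \<subseteq> cechB (padd I e f) t p"
    using J unfolding good_cohomology_def by blast
  have "cechZ I t p \<subseteq> cechB I t p" if "t \<ge> max tj (ta + e)" for t p
  proof (rule cech_qd_0[OF I fin])
    have "cechH (colon I e f) (t - e) p = 0" using that by (intro cech_qd_0'[OF gideal_colon[OF I f]] ta) auto
    moreover have "cechH (padd I e f) t p = 0" using that by (intro cech_qd_0'[OF gideal_padd[OF I f]] tj) auto
    ultimately show "cechH I t p = 0" using cech_le[OF I f fJ fA, of t p] by simp
  qed
  then show "\<exists>t0. \<forall>t\<ge>t0. \<forall>p. cechZ I t p \<subseteq> cechB I t p" by blast
  obtain qa :: "real poly" where qa: "\<And>t. real (H (colon I e f) t) -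
      of_int (\<Sum>p\<le>CARD('n). (-1) ^ p * int (cechH (colon I e f) t p)) = poly qa (of_int t)"
    using A unfolding good_cohomology_def by blast
  obtain qj :: "real poly" where qj: "\<And>t. real (H (padd I e f) t) -
      of_int (\<Sum>p\<le>CARD('n). (-1) ^ p * int (cechH (padd I e f) t p)) = poly qj (of_int t)"
    using J unfolding good_cohomology_def by blast
  have "real (H I t) - of_int (\<Sum>p\<le>CARD('n). (-1) ^ p * int (cechH I t p)) =
      poly (pcompose qa [:- of_int e, 1:] + qj) (of_int t)" for t
    using qa[of "t - e"] qj[of t] cech_euler[OF I f fJ fA, of t] H_exact[OF I f, of t]
    by (simp add: poly_pcompose)
  then show "\<exists>q :: real poly. \<forall>t. real (H I t) - of_int (\<Sum>p\<le>CARD('n). (-1) ^ p * int (cechH I t p)) = poly q (of_int t)"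
    by blast
qed

text \<open>The kernel of multiplication by \<open>x\<close> on cohomology is the image of the
  preceding cohomology of R/(I + (x)), which assumption \<open>J\<close> makes zero in degree
  \<open>t + 1\<close>.\<close>

lemma coboundary_injective_step:
  assumes I: "gideal I" and x: "x \<in> hf 1" and nzd: "colon I 1 x = I"
    and J: "\<And>p. cechZ (padd I 1 x) (t + 1) p \<subseteq> cechB (padd I 1 x) (t + 1) p"
    and c: "c \<in> cechZ I t p" "shift x c \<in> cechB I (t + 1) p"
  shows "c \<in> cechB I t p"
proof -
  interpret d: Vector_Spaces.linear "\<lambda>z c. fscale z c" "\<lambda>z c. fscale z c" cech_coboundary
    by (rule linear_coboundary)
  note sW = cechC_subspace[OF gideal_UNIV] and sU = cechC_subspace[OF I]
  have col: "w \<in> cechC hf t q \<Longrightarrow> shift x w \<in> cechC I (t + 1) q \<longleftrightarrow> w \<in> cechC I t q" for w q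
    using cechC_colon[OF I x, of w "t + 1" q] nzd by simp
  show ?thesis
  proof (cases p)
    case 0
    then show ?thesis using c col by (simp add: fv.cobnd_def fv.cocyc_def)
  next
    case (Suc q)
    then obtain b u where bu: "shift x c = cech_coboundary b + u" "b \<in> cechC hf (t + 1) q" "u \<in> cechC I (t + 1) p"
      using c(2) by (auto simp: fv.cobnd_def)
    have c': "c \<in> cechC hf t p" using c(1) by (simp add: fv.cocyc_def)
    have V: "cechC (padd I 1 x) (t + 1) r = shift x ` cechC hf t r + cechC I (t + 1) r" for r
      using cechC_padd[OF I x, of "t + 1" r] by simp
    have sV: "fv.subspace (cechC (padd I 1 x) (t + 1) r)" for r by (rule cechC_subspace[OF gideal_padd[OF I x]])
    have "shift x c + 0 \<in> cechC (padd I 1 x) (t + 1) p" unfolding V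
      using c' fv.subspace_0[OF sU] by (intro set_plus_intro) auto
    moreover have "u \<in> cechC (padd I 1 x) (t + 1) p" using bu(3) cechC_mono[OF le_padd] by blast
    ultimately have "shift x c - u \<in> cechC (padd I 1 x) (t + 1) p" using fv.subspace_diff[OF sV] by simp
    then have "b \<in> cechZ (padd I 1 x) (t + 1) q" using bu Suc by (simp add: fv.cocyc_def)
    then have "b \<in> cechB (padd I 1 x) (t + 1) q" using J by blast
    moreover have "\<exists>b' v. b = cech_coboundary b' + v \<and> cech_coboundary (cech_coboundary b') = 0 \<and>
        v \<in> cechC (padd I 1 x) (t + 1) q" if b: "b \<in> cechB (padd I 1 x) (t + 1) q"
    proof (cases q)
      case 0
      then show ?thesis using b d.zero by (intro exI[of _ 0] exI[of _ b]) (simp add: fv.cobnd_def)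
    next
      case (Suc r)
      then show ?thesis using b coboundary_coboundary by (auto simp: fv.cobnd_def)
    qed
    ultimately obtain b' v where bv: "b = cech_coboundary b' + v" "cech_coboundary (cech_coboundary b') = 0"
      "v \<in> cechC (padd I 1 x) (t + 1) q" by blast
    obtain w u' where wu: "v = shift x w + u'" "w \<in> cechC hf t q" "u' \<in> cechC I (t + 1) q"
      using bv(3) unfolding V by (auto elim!: set_plus_elim)
    have "shift x (c - cech_coboundary w) = cech_coboundary u' + u"
      using bu(1) bv(1,2) wu(1) by (simp add: shift_diff d.add shift_coboundary)
    then have "shift x (c - cech_coboundary w) \<in> cechC I (t + 1) p"
      using cechC_coboundary[OF I wu(3)] bu(3) Suc fv.subspace_add[OF sU] by simp
    moreover have "c - cech_coboundary w \<in> cechC hf t p"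
      using c' cechC_coboundary[OF gideal_UNIV wu(2)] Suc fv.subspace_diff[OF sW] by simp
    ultimately have "c - cech_coboundary w \<in> cechC I t p" using col by blast
    moreover have "c = cech_coboundary w + (c - cech_coboundary w)" by simp
    ultimately show ?thesis using wu(2) Suc unfolding fv.cobnd_def by force
  qed
qed

text \<open>For large \<open>t\<close> a cocycle is killed by some power of \<open>var i\<close>,
  while multiplication by \<open>var i\<close> is injective on cohomology; hence it is a coboundary.
  Finite dimension is then carried down degree by degree, and the backward difference of the desired
  polynomial formula is the formula for \<open>padd I 1 (var i)\<close>.\<close>

lemma good_cohomology_nonzerodivisor:
  fixes I :: "'n::{finite,linorder} cfam"
  assumes I: "gideal I" and nzd: "colon I 1 (var i) = I" and J: "good_cohomology (padd I 1 (var i))"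
  shows "good_cohomology I"
proof -
  let ?x = "var i :: 'n mpoly" and ?J = "padd I 1 (var i)"
  have fJ: "fv.qfin (cechZ ?J t p) (cechB ?J t p)" for t p
    using J by (simp add: good_cohomology_def)
  obtain t0 where t0: "\<And>t p. t \<ge> t0 \<Longrightarrow> cechZ ?J t p \<subseteq> cechB ?J t p"
    using J unfolding good_cohomology_def by blast
  have van: "cechZ I t p \<subseteq> cechB I t p" if "t \<ge> t0" for t p
  proof
    fix c assume c: "c \<in> cechZ I t p"
    have Zs: "shift (?x ^ k) c \<in> cechZ I (int k + t) p" for k
    proof -
      have "?x ^ k \<in> hf (int k)" using hf_power[OF hf_var, of i k] by simp
      then show ?thesis using c
        by (auto simp: fv.cocyc_def shift_coboundary intro!: cechC_shift[OF gideal_UNIV] cechC_shift[OF I])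
    qed
    obtain k where k: "shift (?x ^ k) c \<in> cechB I (int k + t) p" using cocycle_killed[OF I c] by blast
    have "shift (?x ^ (k - j)) c \<in> cechB I (int (k - j) + t) p" if "j \<le> k" for j
      using that
    proof (induction j)
      case (Suc j)
      then have j: "k - j = Suc (k - Suc j)" by simp
      show ?case
      proof (rule coboundary_injective_step[OF I hf_var nzd _ Zs])
        show "cechZ ?J (int (k - Suc j) + t + 1) p \<subseteq> cechB ?J (int (k - Suc j) + t + 1) p" for p
          using \<open>t \<ge> t0\<close> by (intro t0) simp
        show "shift ?x (shift (?x ^ (k - Suc j)) c) \<in> cechB I (int (k - Suc j) + t + 1) p"
          using Suc j by (simp add: shift_shift algebra_simps)
      qed
    qed (use k in simp)
    from this[of k] show "c \<in> cechB I t p" by simp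
  qed
  have fin0: "fv.qfin (cechZ I t p) (cechB I t p)" if "t \<ge> t0" for t p
    using van[OF that, of p] unfolding fv.qfin_def
    by (intro exI[of _ "{}"]) (auto intro: fv.span_base)
  have fin: "fv.qfin (cechZ I (t0 - int n) p) (cechB I (t0 - int n) p)" for n p
  proof (induction n arbitrary: p)
    case (Suc n)
    have "t0 - int (Suc n) = t0 - int n - 1" by simp
    then show ?case using cech_fin_sub[OF I hf_var fJ Suc.IH, of p] by (simp only: nzd)
  qed (use fin0[of t0] in simp)
  have fin': "fv.qfin (cechZ I t p) (cechB I t p)" for t p
    using fin0[of t p] fin[of "nat (t0 - t)" p] by (cases "t \<ge> t0") auto
  obtain qj :: "real poly" where qj: "\<And>t. real (H ?J t) -
      of_int (\<Sum>p\<le>CARD('n). (-1) ^ p * int (cechH ?J t p)) = poly qj (of_int t)"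
    using J unfolding good_cohomology_def by blast
  define F where "F t = real (H I t) - of_int (\<Sum>p\<le>CARD('n). (-1) ^ p * int (cechH I t p))" for t
  have "F t - F (t - 1) = poly qj (of_int t)" for t
    using qj[of t] cech_euler[OF I hf_var fJ, of t] H_exact[OF I hf_var, of t i] fin'
    by (simp add: F_def nzd)
  from int_antidifference[of F, OF this] show ?thesis
    unfolding good_cohomology_def F_def using fin' van by blast
qed

text \<open>Noetherian induction: for a variable outside \<open>I\<close> the ideal I + (var i) is
  larger, and I : var i either is larger too or equals \<open>I\<close>.\<close>

lemma good_cohomology:
  fixes I :: "'n::{finite,linorder} cfam"
  assumes "gideal I"
  shows "good_cohomology I"
  using wf_gideal_gt assms
proof (induction I rule: wf_induct_rule)
  case (less I)
  show ?case
  proof (cases "\<forall>i. var i \<in> I 1")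
    case True
    then show ?thesis using good_cohomology_irrelevant less.prems by blast
  next
    case False
    then obtain i where i: "var i \<notin> I 1" by blast
    have pa: "gideal (padd I 1 (var i))" and co: "gideal (colon I 1 (var i))"
      using gideal_padd gideal_colon less.prems hf_var by blast+
    have "padd I 1 (var i) \<noteq> I" using mem_padd[OF less.prems, of "var i" 1] i by auto
    then have "(padd I 1 (var i), I) \<in> gideal_gt"
      using le_padd[of I 1 "var i"] pa less.prems by (auto simp: gideal_gt_def less_le)
    then have J: "good_cohomology (padd I 1 (var i))" using less.IH pa by blast
    show ?thesis
    proof (cases "colon I 1 (var i) = I")
      case True
      then show ?thesis using good_cohomology_nonzerodivisor J less.prems by blast
    next
      case False
      then have "(colon I 1 (var i), I) \<in> gideal_gt"
        using le_colon[OF less.prems hf_var, of i] co less.prems by (auto simp: gideal_gt_def less_le)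
      then show ?thesis using good_cohomology_extension[OF less.prems hf_var _ J] less.IH co by blast
    qed
  qed
qed

section \<open>Hilbert polynomials and the comparison with the given definitions\<close>

definition HP :: "'n::{finite,linorder} cfam \<Rightarrow> real poly" where
  "HP I = (THE q. \<forall>\<^sub>F t in at_top. real (H I t) = poly q (of_int t))"

lemma poly_eventually_unique:
  fixes p q :: "real poly"
  assumes "\<forall>\<^sub>F t :: int in at_top. poly p (of_int t) = poly q (of_int t)"
  shows "p = q"
proof (rule ccontr)
  assume "p \<noteq> q"
  then have fin: "finite {x. poly (p - q) x = 0}" by (intro poly_roots_finite) simp
  obtain t0 where t0: "\<And>t. t \<ge> t0 \<Longrightarrow> poly p (of_int t) = poly q (of_int t)"
    using assms by (auto simp: eventually_at_top_linorder)
  have "(of_int :: int \<Rightarrow> real) ` {t0..} \<subseteq> {x. poly (p - q) x = 0}" using t0 by auto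
  then have "finite ((of_int :: int \<Rightarrow> real) ` {t0..})" using fin finite_subset by blast
  then have "finite {t0..}" by (rule finite_imageD) (simp add: inj_on_def)
  then show False using infinite_Ici by blast
qed

lemma HP_unique:
  assumes "\<forall>\<^sub>F t in at_top. real (H I t) = poly q (of_int t)"
  shows "HP I = q"
  unfolding HP_def
proof (rule the_equality)
  show "\<forall>\<^sub>F t in at_top. real (H I t) = poly q (of_int t)" by (rule assms)
  fix q' assume "\<forall>\<^sub>F t in at_top. real (H I t) = poly q' (of_int t)"
  with assms have "\<forall>\<^sub>F t in at_top. poly q' (of_int t) = poly q (of_int t)" by eventually_elim simp
  then show "q' = q" by (rule poly_eventually_unique)
qed

lemma HP_euler:
  fixes I :: "'n::{finite,linorder} cfam"
  assumes I: "gideal I"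
  shows "real (H I t) - of_int (\<Sum>p\<le>CARD('n). (-1) ^ p * int (cechH I t p)) = poly (HP I) (of_int t)"
    and "\<forall>\<^sub>F t in at_top. real (H I t) = poly (HP I) (of_int t)"
proof -
  obtain t0 where t0: "\<And>t p. t \<ge> t0 \<Longrightarrow> cechZ I t p \<subseteq> cechB I t p"
    using good_cohomology[OF I] unfolding good_cohomology_def by blast
  obtain q :: "real poly" where q: "\<And>t. real (H I t) -
      of_int (\<Sum>p\<le>CARD('n). (-1) ^ p * int (cechH I t p)) = poly q (of_int t)"
    using good_cohomology[OF I] unfolding good_cohomology_def by blast
  have "real (H I t) = poly q (of_int t)" if "t \<ge> t0" for t
    using q[of t] cech_qd_0'[OF I t0[OF that]] by simp
  then have "\<forall>\<^sub>F t in at_top. real (H I t) = poly q (of_int t)"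
    unfolding eventually_at_top_linorder by blast
  with HP_unique q show "real (H I t) - of_int (\<Sum>p\<le>CARD('n). (-1) ^ p * int (cechH I t p)) = poly (HP I) (of_int t)"
    "\<forall>\<^sub>F t in at_top. real (H I t) = poly (HP I) (of_int t)" by auto
qed

definition gr :: "('n::{finite,linorder}, 'k::field) mpol set \<Rightarrow> ('n, 'k) fam" where
  "gr I t = I \<inter> hf t"

lemma hilbert_function_eq_H:
  assumes "gideal (gr I)"
  shows "hilbert_function I t = H (gr I) (int t)"
proof -
  have "I \<inter> forms t = gr I (int t)" by (simp add: gr_def forms_eq_hf)
  then show ?thesis unfolding hilbert_function_def H_def forms_eq_hf
    by (simp add: quot_dim_eq_qd[OF mp.quotient_space_axioms subspace_gideal[OF assms] qfin_hf])
qed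

lemma hilbert_polynomial_eq_HP:
  assumes I: "gideal (gr I)"
  shows "hilbert_polynomial I = HP (gr I)"
proof -
  have ev: "\<forall>\<^sub>F t in sequentially. poly (HP (gr I)) (real t) = real (hilbert_function I t)"
  proof -
    obtain t0 where t0: "\<And>t. t \<ge> t0 \<Longrightarrow> real (H (gr I) t) = poly (HP (gr I)) (of_int t)"
      using HP_euler(2)[OF I] by (auto simp: eventually_at_top_linorder)
    have "poly (HP (gr I)) (real t) = real (hilbert_function I t)" if "t \<ge> nat t0" for t
      using t0[of "int t"] that by (simp add: hilbert_function_eq_H[OF I])
    then show ?thesis unfolding eventually_sequentially by blast
  qed
  show ?thesis unfolding hilbert_polynomial_def
  proof (rule the_equality)
    show "\<forall>\<^sub>F t in sequentially. poly (HP (gr I)) (real t) = real (hilbert_function I t)" by (rule ev)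
    fix p assume "\<forall>\<^sub>F t in sequentially. poly p (real t) = real (hilbert_function I t)"
    with ev have "\<forall>\<^sub>F t in sequentially. poly p (real t) = poly (HP (gr I)) (real t)" by eventually_elim simp
    then obtain N where N: "\<And>t. t \<ge> N \<Longrightarrow> poly p (real t) = poly (HP (gr I)) (real t)"
      by (auto simp: eventually_sequentially)
    have "poly p (of_int t) = poly (HP (gr I)) (of_int t)" if "t \<ge> int N" for t
      using N[of "nat t"] that by simp
    then show "p = HP (gr I)"
      by (intro poly_eventually_unique) (auto simp: eventually_at_top_linorder)
  qed
qed

lemma euler_characteristic_eq:
  fixes I :: "'n::{finite,linorder} mpoly set"
  assumes I: "gideal (gr I)"
  shows "of_int (euler_characteristic I) = poly (HP (gr I)) 0"
proof -
  let ?C = "cechC (gr I) 0" and ?Z = "cechZ (gr I) 0" and ?B = "cechB (gr I) 0" and ?W = "cechC hf 0"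
  have cl: "cech_local J \<sigma> = cechl (gr J) 0 \<sigma>" for J and \<sigma> :: "'n set"
    by (auto simp: cech_local_def cechl_def gr_def forms_eq_hf coord_eq_var Xs_def)
  have cc: "cech_cochains J p = cechC (gr J) 0 (Suc p)" for J :: "'n mpoly set" and p
    by (simp add: cech_cochains_def cechC_def cl)
  have U: "gr (UNIV :: 'n mpoly set) = hf" by (auto simp: gr_def)
  have Z: "cech_cocycles I p = cechZ (gr I) 0 (Suc p)" for p
    by (simp add: cech_cocycles_def fv.cocyc_def cc U)
  have B: "cech_coboundaries I (Suc p) = cechB (gr I) 0 (Suc (Suc p))" for p
    by (simp add: cech_coboundaries_def fv.cobnd_def cc U)
  have c0: "cech_coboundary 0 = (0 :: 'n set \<Rightarrow> _)" by (simp add: cech_coboundary_def fun_eq_iff)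
  have B0: "cech_coboundaries I 0 = cechC (gr I) 0 1"
    by (simp add: cech_coboundaries_def cc c0)
  note sc = fv.subspace_cocyc_cobnd[OF linear_coboundary cechC_subcomplex[OF gideal_UNIV] cechC_subcomplex[OF I], of 0]
  have fin: "fv.qfin (cechZ (gr I) t p) (cechB (gr I) t p)" for t p
    using good_cohomology[OF I] by (simp add: good_cohomology_def)
  have UW: "?C p \<subseteq> ?W p" for p by (rule cechC_mono[OF gideal_le_hf[OF I]])
  have cbcy: "?B p \<subseteq> ?Z p" for p
    by (rule fv.cobnd_subset_cocyc[OF linear_coboundary cechC_subcomplex[OF gideal_UNIV] cechC_subcomplex[OF I]])
      (auto simp: coboundary_coboundary UW)
  have hS: "cohomology_dim I (Suc p) = cechH (gr I) 0 (Suc (Suc p))" for p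
    unfolding cohomology_dim_def fv.cohom_def Z B
    by (rule quot_dim_eq_qd) (rule fv.quotient_space_axioms, rule sc(2), rule fin)
  have s1: "fv.subspace (?C 1)" and s0: "fv.subspace (?W 0)" by (intro cechC_subspace I gideal_UNIV)+
  have im: "cech_coboundary ` ?W 0 + ?C 1 = ?B 1"
    using fv.cobnd_Suc[of cech_coboundary "?W" "?C" 0] by simp
  have ker: "{v \<in> ?W 0. cech_coboundary v \<in> ?C 1} = ?Z 0"
    by (simp add: fv.cocyc_def)
  have f0: "fv.qfin (?W 0) (?Z 0)"
    by (rule fv.qfin_mono[OF qfin_cechC_0[OF I]]) (use cbcy[of 0] in \<open>simp add: fv.cobnd_def\<close>)
  have e1: "fv.qd (?B 1) (?C 1) = fv.qd (?W 0) (?Z 0)"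
    using fv.qd_image[OF linear_coboundary s0 s1] unfolding im ker using f0 by blast
  have f1: "fv.qfin (?B 1) (?C 1)"
    using fv.qfin_image[OF linear_coboundary s0 s1] unfolding im ker using f0 by blast
  have U1: "?C 1 \<subseteq> ?B 1"
    using fv.subspace_0[OF s0] c0 by (force simp: fv.cobnd_def)
  have f2: "fv.qfin (?Z 1) (?C 1)"
    by (rule fv.qfin_trans[OF sc(2) s1 U1 cbcy f1 fin])
  have h0: "cohomology_dim I 0 = fv.qd (?Z 1) (?C 1)"
    unfolding cohomology_dim_def Z B0 One_nat_def
    by (rule quot_dim_eq_qd) (rule fv.quotient_space_axioms, rule s1[unfolded One_nat_def], rule f2[unfolded One_nat_def])
  also have "\<dots> = cechH (gr I) 0 1 + fv.qd (?W 0) (?Z 0)"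
    unfolding fv.cohom_def e1[symmetric] by (rule fv.qd_trans'[OF sc(2) s1 U1 cbcy f2])
  \<comment> \<open>The sheaf complex lacks the augmentation. Its H^0 therefore exceeds the
    augmented cohomology in index 1 by the part of (R/I)_0 on which the coboundary is injective, of
    dimension \<open>H (gr I) 0 - cechH (gr I) 0 0\<close>.\<close>
  finally have h0': "int (cohomology_dim I 0) + int (cechH (gr I) 0 0) = int (cechH (gr I) 0 1) + int (H (gr I) 0)"
    using fv.qd_trans'[OF sc(1) cechC_subspace[OF I] _ _ qfin_cechC_0[OF I], of 0] cbcy[of 0]
      qd_cechC_0[OF I, of 0] by (simp add: fv.cohom_def fv.cobnd_def fv.cocyc_def)
  obtain N where N: "CARD('n) = Suc N" using not0_implies_Suc[of "CARD('n)"] by auto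
  have "euler_characteristic I = (\<Sum>p\<le>N. (-1) ^ p * int (cohomology_dim I p))"
    unfolding euler_characteristic_def N lessThan_Suc_atMost ..
  also have "\<dots> = int (cohomology_dim I 0) + (\<Sum>p<N. (-1) ^ Suc p * int (cohomology_dim I (Suc p)))"
    by (simp add: sum.atMost_shift)
  also have "\<dots> = int (H (gr I) 0) - (\<Sum>p\<le>CARD('n). (-1) ^ p * int (cechH (gr I) 0 p))"
    using h0' unfolding N by (simp add: hS sum.atMost_shift sum.lessThan_Suc_shift sum_negf del: sum.lessThan_Suc)
  finally show ?thesis using HP_euler(1)[OF I, of 0] by simp
qed

section \<open>Ideals and their graded pieces\<close>

definition hcomp :: "int \<Rightarrow> ('n::{finite,linorder}, 'k::field) mpol \<Rightarrow> ('n, 'k) mpol" where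
  "hcomp t f = (\<Sum>m\<in>{m\<in>keys f. int (mdeg m) = t}. single m (lookup f m))"

lemma lookup_hcomp: "lookup (hcomp t f) m = (if int (mdeg m) = t then lookup f m else 0)"
  by (auto simp: hcomp_def lookup_sum lookup_single when_def in_keys_iff)

lemma hcomp_hf [simp]: "hcomp t f \<in> hf t"
  by (auto simp: hf_def in_keys_iff lookup_hcomp split: if_splits)

lemma hcomp_add: "hcomp t (f + g) = hcomp t f + hcomp t g"
  by (rule poly_mapping_eqI) (simp add: lookup_hcomp lookup_add)

lemma hcomp_zero [simp]: "hcomp t 0 = 0"
  by (rule poly_mapping_eqI) (simp add: lookup_hcomp)

lemma hcomp_sum: "hcomp t (sum f A) = (\<Sum>x\<in>A. hcomp t (f x))"
  by (induction A rule: infinite_finite_induct) (auto simp: hcomp_add)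

lemma hcomp_of_hf: "f \<in> hf s \<Longrightarrow> hcomp t f = (if t = s then f else 0)"
  by (rule poly_mapping_eqI) (auto simp: lookup_hcomp hf_def in_keys_iff)

definition degs :: "('n::{finite,linorder}, 'k::field) mpol \<Rightarrow> int set" where
  "degs f = (\<lambda>m. int (mdeg m)) ` keys f"

lemma finite_degs [simp]: "finite (degs f)"
  by (simp add: degs_def)

lemma hcomp_degs: "t \<notin> degs f \<Longrightarrow> hcomp t f = 0"
  by (rule poly_mapping_eqI) (auto simp: lookup_hcomp degs_def in_keys_iff)

lemma sum_hcomp: "finite S \<Longrightarrow> degs f \<subseteq> S \<Longrightarrow> (\<Sum>s\<in>S. hcomp s f) = f"
  by (rule poly_mapping_eqI) (force simp: lookup_sum lookup_hcomp degs_def in_keys_iff)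

lemma hcomp_mult: "hcomp u (f * g) = (\<Sum>s\<in>degs f. hcomp s f * hcomp (u - s) g)"
proof -
  have "f * g = (\<Sum>s\<in>degs f. hcomp s f) * (\<Sum>t\<in>degs g. hcomp t g)" by (simp add: sum_hcomp)
  also have "\<dots> = (\<Sum>s\<in>degs f. \<Sum>t\<in>degs g. hcomp s f * hcomp t g)" by (rule sum_product)
  also have "hcomp u \<dots> = (\<Sum>s\<in>degs f. \<Sum>t\<in>degs g. if t = u - s then hcomp s f * hcomp t g else 0)"
  proof -
    have "hcomp u (hcomp s f * hcomp t g) = (if t = u - s then hcomp s f * hcomp t g else 0)" for s t
      using hcomp_of_hf[OF hf_mult[OF hcomp_hf hcomp_hf], of u s f t g] by auto
    then show ?thesis by (simp add: hcomp_sum)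
  qed
  also have "\<dots> = (\<Sum>s\<in>degs f. hcomp s f * hcomp (u - s) g)"
    by (intro sum.cong refl) (auto simp: sum.delta' hcomp_degs)
  finally show ?thesis .
qed

lemma cring_poly_ring: "cring (poly_ring :: 'n::{finite,linorder} mpoly ring)"
proof -
  have "\<exists>y. y + x = 0" for x :: "'n mpoly" by (rule exI[of _ "- x"]) simp
  then show ?thesis
    by (intro cringI abelian_groupI comm_monoidI) (auto simp: poly_ring_def algebra_simps)
qed

lemma ideal_poly_ringD:
  fixes I :: "'n::{finite,linorder} mpoly set"
  assumes "ideal I poly_ring"
  shows "0 \<in> I" "f \<in> I \<Longrightarrow> g \<in> I \<Longrightarrow> f + g \<in> I" "f \<in> I \<Longrightarrow> g * f \<in> I"
proof -
  interpret ideal I poly_ring by fact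
  show "0 \<in> I" using additive_subgroup.zero_closed[OF additive_subgroup_axioms] by (simp add: poly_ring_def)
  show "f \<in> I \<Longrightarrow> g \<in> I \<Longrightarrow> f + g \<in> I" using additive_subgroup.a_closed[OF additive_subgroup_axioms, of f g] by (simp add: poly_ring_def)
  show "f \<in> I \<Longrightarrow> g * f \<in> I" using I_l_closed[of f g] by (simp add: poly_ring_def)
qed

lemma ideal_poly_ringI:
  fixes I :: "'n::{finite,linorder} mpoly set"
  assumes "0 \<in> I" "\<And>f g. f \<in> I \<Longrightarrow> g \<in> I \<Longrightarrow> f + g \<in> I" "\<And>f g. f \<in> I \<Longrightarrow> g * f \<in> I"
  shows "ideal I poly_ring"
proof (rule idealI)
  interpret cring "poly_ring :: 'n mpoly ring" by (rule cring_poly_ring)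
  show "ring (poly_ring :: 'n mpoly ring)" by unfold_locales
  have inv: "\<ominus>\<^bsub>poly_ring\<^esub> x = - x" for x :: "'n mpoly"
    using minus_equality[of "- x" x] by (simp add: poly_ring_def)
  have "- x \<in> I" if "x \<in> I" for x using assms(3)[OF that, of "-1"] by simp
  then show "subgroup I (add_monoid poly_ring)"
    using assms inv by (intro add.subgroupI) (auto simp: poly_ring_def a_inv_def)
qed (use assms in \<open>auto simp: poly_ring_def mult.commute\<close>)

lemma gr_subset_genideal: "S \<subseteq> genideal poly_ring S"
  by (auto simp: genideal_def)

lemma genideal_ideal: "ideal (genideal poly_ring S) (poly_ring :: 'n::{finite,linorder} mpoly ring)"
proof -
  interpret cring "poly_ring :: 'n mpoly ring" by (rule cring_poly_ring)
  show ?thesis by (rule genideal_ideal) (simp add: poly_ring_def)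
qed

lemma genideal_least: "ideal J poly_ring \<Longrightarrow> S \<subseteq> J \<Longrightarrow> genideal poly_ring S \<subseteq> J"
  by (auto simp: genideal_def)

definition tot :: "('n::{finite,linorder}, 'k::field) fam \<Rightarrow> ('n, 'k) mpol set" where
  "tot I = {f. \<forall>t. hcomp t f \<in> I t}"

lemma gr_tot:
  assumes "gideal I"
  shows "gr (tot I) = I"
proof (rule ext, safe)
  fix t f
  show "f \<in> gr (tot I) t \<Longrightarrow> f \<in> I t" by (auto simp: gr_def tot_def hcomp_of_hf split: if_splits dest: spec[of _ t])
  assume f: "f \<in> I t"
  then show "f \<in> gr (tot I) t"
    using gideal_hf[OF assms f] gideal_zero[OF assms] by (auto simp: gr_def tot_def hcomp_of_hf)
qed

lemma tot_mono: "I \<le> J \<Longrightarrow> tot I \<subseteq> tot J"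
  by (auto simp: tot_def le_fun_def)

lemma ideal_tot:
  fixes I :: "'n::{finite,linorder} cfam"
  assumes I: "gideal I"
  shows "ideal (tot I) poly_ring"
proof (rule ideal_poly_ringI)
  fix f g :: "'n mpoly" assume f: "f \<in> tot I"
  show "g * f \<in> tot I" unfolding tot_def mem_Collect_eq hcomp_mult
  proof (intro allI gideal_sum I)
    fix t s show "hcomp s g * hcomp (t - s) f \<in> I t"
      using f by (intro gideal_mult'[OF I _ hcomp_hf]) (auto simp: tot_def)
  qed
qed (auto simp: tot_def hcomp_add gideal_zero[OF I] gideal_add[OF I])

lemma homogeneous_ideal_tot:
  fixes I :: "'n::{finite,linorder} cfam"
  assumes I: "gideal I"
  shows "homogeneous_ideal (tot I)"
  unfolding homogeneous_ideal_def
proof (intro conjI antisym ideal_tot I)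
  show "genideal poly_ring (tot I \<inter> (\<Union>t. forms t)) \<subseteq> tot I"
    by (rule genideal_least[OF ideal_tot[OF I]]) blast
  show "tot I \<subseteq> genideal poly_ring (tot I \<inter> (\<Union>t. forms t))" (is "_ \<subseteq> ?G")
  proof
    fix f assume f: "f \<in> tot I"
    have G: "hcomp s f \<in> ?G" if "s \<in> degs f" for s
    proof -
      have "hcomp s f \<in> gr (tot I) s" using f by (simp add: gr_tot[OF I]) (simp add: tot_def)
      moreover obtain k where "s = int k" using \<open>s \<in> degs f\<close> by (auto simp: degs_def)
      moreover have "hcomp s f \<in> forms k" using \<open>s = int k\<close> by (simp add: forms_eq_hf)
      ultimately have "hcomp s f \<in> tot I \<inter> (\<Union>t. forms t)" unfolding gr_def by blast
      then show ?thesis by (rule subsetD[OF gr_subset_genideal])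
    qed
    have "sum (\<lambda>s. hcomp s f) A \<in> ?G" if "finite A" "A \<subseteq> degs f" for A
      using that
    proof (induction A)
      case empty
      show ?case using ideal_poly_ringD(1)[OF genideal_ideal] by simp
    next
      case (insert s A)
      then show ?case using ideal_poly_ringD(2)[OF genideal_ideal G[of s]] by simp
    qed
    from this[of "degs f"] show "f \<in> ?G" by (simp add: sum_hcomp)
  qed
qed

lemma
  fixes I :: "'n::{finite,linorder} mpoly set"
  assumes "homogeneous_ideal I"
  shows gideal_gr: "gideal (gr I)" and tot_gr: "tot (gr I) = I"
proof -
  have I: "ideal I poly_ring" and gen: "I = genideal poly_ring (I \<inter> (\<Union>t. forms t))"
    using assms by (auto simp: homogeneous_ideal_def)
  note i = ideal_poly_ringD[OF I]
  show gi: "gideal (gr I)" by (rule gidealI) (auto simp: gr_def i hf_add hf_mult)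
  have "I \<subseteq> tot (gr I)"
  proof (subst gen, rule genideal_least[OF ideal_tot[OF gi]], safe)
    fix f t assume "f \<in> I" "f \<in> forms t"
    then show "f \<in> tot (gr I)" by (auto simp: tot_def hcomp_of_hf forms_eq_hf gr_def i)
  qed
  moreover have "tot (gr I) \<subseteq> I"
  proof
    fix f assume f: "f \<in> tot (gr I)"
    have "sum (\<lambda>s. hcomp s f) A \<in> I" if "finite A" for A
      using that by (induction A) (use f in \<open>auto simp: tot_def gr_def i\<close>)
    from this[of "degs f"] show "f \<in> I" by (simp add: sum_hcomp)
  qed
  ultimately show "tot (gr I) = I" by blast
qed

lemma sat_gr:
  assumes "closed_subscheme I"
  shows "gideal (gr I)" "sat (gr I) = gr I" "tot (gr I) = I"
proof -
  have I: "homogeneous_ideal I" "saturation I = I" using assms by (auto simp: closed_subscheme_def)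
  show gi: "gideal (gr I)" and "tot (gr I) = I" using gideal_gr tot_gr I(1) by blast+
  have "f \<in> gr I t" if "f \<in> sat (gr I) t" for f t
  proof -
    have "f \<in> saturation I" "f \<in> hf t" using that by (auto simp: sat_def saturation_def forms_eq_hf gr_def)
    then show ?thesis using I(2) by (simp add: gr_def)
  qed
  then show "sat (gr I) = gr I" using le_sat[OF gi] by (auto simp: fun_eq_iff le_fun_def)
qed

lemma saturation_tot:
  fixes I :: "'n::{finite,linorder} cfam"
  assumes I: "gideal I"
  shows "saturation (tot I) = tot (sat I)"
proof
  show "saturation (tot I) \<subseteq> tot (sat I)"
  proof
    fix f assume "f \<in> saturation (tot I)"
    then obtain k where k: "\<And>g. g \<in> hf (int k) \<Longrightarrow> g * f \<in> tot I" by (auto simp: saturation_def forms_eq_hf)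
    have "g * hcomp t f \<in> I (t + int k)" if g: "g \<in> hf (int k)" for g t
    proof -
      have "hcomp (t + int k) (g * f) \<in> I (t + int k)" using k[OF g] by (simp add: tot_def)
      also have "hcomp (t + int k) (g * f) = (\<Sum>s\<in>degs g. if s = int k then g * hcomp t f else 0)"
        unfolding hcomp_mult by (intro sum.cong refl) (auto simp: hcomp_of_hf[OF g])
      also have "\<dots> = g * hcomp t f"
        using hcomp_degs[of "int k" g] hcomp_of_hf[OF g, of "int k"] by (auto simp: sum.delta)
      finally show ?thesis .
    qed
    then show "f \<in> tot (sat I)" by (auto simp: tot_def sat_def)
  qed
  show "tot (sat I) \<subseteq> saturation (tot I)"
  proof
    fix f assume f: "f \<in> tot (sat I)"
    \<comment> \<open>One exponent \<open>K\<close> for all degrees is needed, since the components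
      of \<open>f\<close> lie in different degrees.\<close>
    obtain K where K: "sat I = sat_step I K" using sat_eq_sat_step[OF I] by blast
    have "g * f \<in> tot I" if g: "g \<in> hf (int K)" for g
      unfolding tot_def mem_Collect_eq hcomp_mult
    proof (intro allI gideal_sum I)
      fix t s
      have "hcomp (t - int K) f \<in> sat_step I K (t - int K)" using f K by (simp add: tot_def)
      then have "g * hcomp (t - int K) f \<in> I t" using g by (auto simp: sat_step_def)
      then show "hcomp s g * hcomp (t - s) f \<in> I t"
        using gideal_zero[OF I] by (auto simp: hcomp_of_hf[OF g])
    qed
    then show "f \<in> saturation (tot I)" by (auto simp: saturation_def forms_eq_hf)
  qed
qed

lemma closed_subscheme_tot:
  fixes I :: "'n::{finite,linorder} cfam"
  assumes "gideal I" "sat I = I"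
  shows "closed_subscheme (tot I)"
  using homogeneous_ideal_tot[OF assms(1)] saturation_tot[OF assms(1)] assms by (simp add: closed_subscheme_def)

lemma gprime_gr:
  fixes P :: "'n::{finite,linorder} mpoly set"
  assumes "integral_subscheme P"
  shows "gprime (gr P)" "\<exists>i. var i \<notin> gr P 1" "tot (gr P) = P"
proof -
  have P: "homogeneous_ideal P" "primeideal P poly_ring" "\<not> forms 1 \<subseteq> P"
    using assms by (auto simp: integral_subscheme_def)
  show tg: "tot (gr P) = P" by (rule tot_gr[OF P(1)])
  interpret primeideal P poly_ring by (rule P(2))
  have pr: "f * g \<in> P \<Longrightarrow> f \<in> P \<or> g \<in> P" for f g
    using I_prime[of f g] by (simp add: poly_ring_def)
  note i = ideal_poly_ringD[OF is_ideal]
  have "1 \<notin> P" using i(3)[of 1] P(3) by auto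
  then show gp: "gprime (gr P)"
    using gideal_gr[OF P(1)] pr by (auto simp: gprime_def gr_def)
  show "\<exists>i. var i \<notin> gr P 1"
  proof (rule ccontr)
    assume "\<not> ?thesis"
    then have "g * 1 \<in> gr P (0 + 1)" if "g \<in> hf 1" for g
      using gideal_Suc[OF gprime_gideal[OF gp], of 1 0 1 g] that by simp
    then show False using P(3) by (auto simp: gr_def forms_eq_hf)
  qed
qed

lemma integral_subscheme_tot:
  fixes P :: "'n::{finite,linorder} cfam"
  assumes P: "gprime P" and v: "var i \<notin> P 1"
  shows "integral_subscheme (tot P)"
  unfolding integral_subscheme_def
proof (intro conjI)
  have gi: "gideal P" by (rule gprime_gideal[OF P])
  show "homogeneous_ideal (tot P)" by (rule homogeneous_ideal_tot[OF gi])
  have "var i \<notin> tot P" using v hcomp_of_hf[OF hf_var, of 1 i]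
    unfolding tot_def mem_Collect_eq by metis
  then show "\<not> forms 1 \<subseteq> tot P" by (metis forms_eq_hf hf_var of_nat_1 subsetD)
  show "primeideal (tot P) poly_ring"
  proof (rule primeidealI[OF ideal_tot[OF gi] cring_poly_ring])
    show "carrier poly_ring \<noteq> tot P" using \<open>var i \<notin> tot P\<close> by (auto simp: poly_ring_def)
    fix f g :: "'n mpoly" assume "f \<otimes>\<^bsub>poly_ring\<^esub> g \<in> tot P"
    then have fg: "f * g \<in> tot P" by (simp add: poly_ring_def)
    show "f \<in> tot P \<or> g \<in> tot P"
    proof (rule ccontr)
      assume "\<not> ?thesis"
      then obtain a b where "hcomp a f \<notin> P a" "hcomp b g \<notin> P b" by (auto simp: tot_def)
      moreover define A where "A = {s. hcomp s f \<notin> P s}"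
      moreover define B where "B = {s. hcomp s g \<notin> P s}"
      moreover have "A \<subseteq> degs f" "B \<subseteq> degs g"
        unfolding A_def B_def using hcomp_degs gideal_zero[OF gi] by (metis (mono_tags) mem_Collect_eq subsetI)+
      ultimately have fin: "finite A" "finite B" "A \<noteq> {}" "B \<noteq> {}" using finite_subset finite_degs by blast+
      \<comment> \<open>\<open>s0\<close> and \<open>t0\<close> are the largest degrees of
        components outside \<open>P\<close>; in degree \<open>s0 + t0\<close> every other product of
        components has a factor in \<open>P\<close>.\<close>
      define s0 where "s0 = Max A"
      define t0 where "t0 = Max B"
      have st: "hcomp s0 f \<notin> P s0" "hcomp t0 g \<notin> P t0"
        using Max_in[OF fin(1,3)] Max_in[OF fin(2,4)] by (auto simp: s0_def t0_def A_def B_def)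
      have gtA: "hcomp s f \<in> P s" if "s > s0" for s using Max_ge[OF fin(1), of s] that by (auto simp: s0_def A_def)
      have gtB: "hcomp s g \<in> P s" if "s > t0" for s using Max_ge[OF fin(2), of s] that by (auto simp: t0_def B_def)
      have s0: "s0 \<in> degs f" by (rule ccontr) (use st(1) hcomp_degs[of s0 f] gideal_zero[OF gi, of s0] in simp)
      have "hcomp (s0 + t0) (f * g) = hcomp s0 f * hcomp t0 g +
          (\<Sum>s\<in>degs f - {s0}. hcomp s f * hcomp (s0 + t0 - s) g)"
        unfolding hcomp_mult by (subst sum.remove[OF finite_degs s0]) simp
      moreover have "(\<Sum>s\<in>degs f - {s0}. hcomp s f * hcomp (s0 + t0 - s) g) \<in> P (s0 + t0)"
      proof (rule gideal_sum[OF gi])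
        fix s assume "s \<in> degs f - {s0}"
        then consider "s > s0" | "s0 + t0 - s > t0" by force
        then show "hcomp s f * hcomp (s0 + t0 - s) g \<in> P (s0 + t0)"
        proof cases
          case 1
          show ?thesis by (rule gideal_mult_right[OF gi gtA[OF 1] hcomp_hf]) simp
        next
          case 2
          show ?thesis by (rule gideal_mult'[OF gi gtB[OF 2] hcomp_hf]) simp
        qed
      qed
      moreover have "hcomp (s0 + t0) (f * g) \<in> P (s0 + t0)" using fg by (simp add: tot_def)
      ultimately have "hcomp s0 f * hcomp t0 g \<in> P (s0 + t0)"
        using gideal_diff[OF gi, of "hcomp (s0 + t0) (f * g)" "s0 + t0"] by fastforce
      then show False using gprimeD[OF P hcomp_hf hcomp_hf] st by blast
    qed
  qed
qed

lemma gr_mono: "I \<subseteq> J \<Longrightarrow> gr I \<le> gr J"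
  by (auto simp: gr_def le_fun_def)

lemma gprime_saturated:
  assumes P: "gprime P" and v: "var i \<notin> P 1"
  shows "sat P = P"
proof (rule antisym)
  show "sat P \<le> P"
  proof (rule le_funI, rule subsetI)
    fix t f assume "f \<in> sat P t"
    then obtain k where "f \<in> hf t" "\<And>g. g \<in> hf (int k) \<Longrightarrow> g * f \<in> P (t + int k)" by (auto simp: sat_def)
    then have "var i ^ k * f \<in> P (int k + t)" using hf_power[OF hf_var, of i k] by (simp add: add.commute)
    then have "var i ^ k \<in> P (int k * 1) \<or> f \<in> P t"
      using gprimeD[OF P, of "var i ^ k" "int k" f t] hf_power[OF hf_var, of i k] \<open>f \<in> hf t\<close> by simp
    then show "f \<in> P t" using gprime_power[OF P hf_var] v by blast
  qed
qed (rule le_sat[OF gprime_gideal[OF P]])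

section \<open>Dimension and Hilbert polynomials\<close>

lemma eventually_nonneg_lead:
  fixes r :: "real poly"
  assumes "\<forall>\<^sub>F t :: int in at_top. 0 \<le> poly r (of_int t)" "r \<noteq> 0"
  shows "lead_coeff r > 0"
proof (rule ccontr)
  assume "\<not> lead_coeff r > 0"
  then have "lead_coeff (- r) > 0" using assms(2) by (simp add: less_le)
  then obtain n where n: "\<And>x. x \<ge> n \<Longrightarrow> poly (- r) x \<ge> lead_coeff (- r)"
    using poly_pinfty_gt_lc[of "- r"] by blast
  have "\<forall>\<^sub>F t :: int in at_top. t \<ge> \<lceil>n\<rceil>" by (rule eventually_ge_at_top)
  then have "\<forall>\<^sub>F t :: int in at_top. False"
    using assms(1)
  proof eventually_elim
    case (elim t)
    then have "poly (- r) (of_int t) \<ge> lead_coeff (- r)" by (intro n) linarith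
    then show ?case using elim \<open>lead_coeff (- r) > 0\<close> by simp
  qed
  then show False by simp
qed

lemma eventually_nonneg_coeff:
  fixes r :: "real poly"
  assumes "\<forall>\<^sub>F t :: int in at_top. 0 \<le> poly r (of_int t)" "degree r \<le> n"
  shows "coeff r n \<ge> 0"
  using eventually_nonneg_lead[OF assms(1)] assms(2) coeff_eq_0[of r n] by (cases "degree r = n"; cases "r = 0") auto

lemma eventually_le_poly:
  fixes p q :: "real poly"
  assumes "\<forall>\<^sub>F t :: int in at_top. 0 \<le> poly p (of_int t) \<and> poly p (of_int t) \<le> poly q (of_int t)"
  shows "degree p \<le> degree q" and "q = 0 \<Longrightarrow> p = 0" and "degree q \<le> n \<Longrightarrow> coeff p n \<le> coeff q n"
proof -
  have p: "\<forall>\<^sub>F t :: int in at_top. 0 \<le> poly p (of_int t)" using assms by eventually_elim simp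
  have qp: "\<forall>\<^sub>F t :: int in at_top. 0 \<le> poly (q - p) (of_int t)" using assms by eventually_elim simp
  show deg: "degree p \<le> degree q"
  proof (rule ccontr)
    assume "\<not> ?thesis"
    then have d: "degree q < degree p" by simp
    then have "p \<noteq> 0" by auto
    have "coeff (q - p) (degree p) \<ge> 0"
      by (rule eventually_nonneg_coeff[OF qp]) (use d in \<open>intro degree_diff_le; simp\<close>)
    then show False using eventually_nonneg_lead[OF p \<open>p \<noteq> 0\<close>] d coeff_eq_0[of q "degree p"] by simp
  qed
  show "p = 0" if "q = 0"
  proof (rule poly_eventually_unique)
    show "\<forall>\<^sub>F t :: int in at_top. poly p (of_int t) = poly 0 (of_int t)"
      using assms by eventually_elim (simp add: that)
  qed
  show "coeff p n \<le> coeff q n" if "degree q \<le> n"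
    using eventually_nonneg_coeff[OF qp, of n] that deg by (simp add: degree_diff_le)
qed

lemma HP_at:
  assumes "gideal I"
  obtains t0 where "\<And>t. t \<ge> t0 \<Longrightarrow> real (H I t) = poly (HP I) (of_int t)"
  using HP_euler(2)[OF assms] unfolding eventually_at_top_linorder by blast

lemma HP_mono:
  assumes I: "gideal I" and J: "gideal J" and "I \<le> J"
  shows "\<forall>\<^sub>F t :: int in at_top. 0 \<le> poly (HP J) (of_int t) \<and> poly (HP J) (of_int t) \<le> poly (HP I) (of_int t)"
  using HP_euler(2)[OF I] HP_euler(2)[OF J]
proof eventually_elim
  case (elim t)
  then show ?case using H_mono[OF assms, of t] by (metis of_nat_0_le_iff of_nat_le_iff)
qed

lemma poly_ident:
  fixes p q :: "real poly"
  assumes "p = q"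
  shows "poly p x = poly q x"
  using assms by simp

lemma HP_exact:
  assumes I: "gideal I" and f: "f \<in> hf e"
  shows "poly (HP I) x = poly (HP (colon I e f)) (x - of_int e) + poly (HP (padd I e f)) x"
proof -
  obtain t1 where t1: "\<And>t. t \<ge> t1 \<Longrightarrow> real (H I t) = poly (HP I) (of_int t)"
    using HP_at[OF I] by blast
  obtain t2 where t2: "\<And>t. t \<ge> t2 \<Longrightarrow> real (H (colon I e f) t) = poly (HP (colon I e f)) (of_int t)"
    using HP_at[OF gideal_colon[OF I f]] by blast
  obtain t3 where t3: "\<And>t. t \<ge> t3 \<Longrightarrow> real (H (padd I e f) t) = poly (HP (padd I e f)) (of_int t)"
    using HP_at[OF gideal_padd[OF I f]] by blast
  have "poly (HP I) (of_int t) = poly (pcompose (HP (colon I e f)) [:- of_int e, 1:] + HP (padd I e f)) (of_int t)"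
    if "t \<ge> max t1 (max (t2 + e) t3)" for t
    using t1[of t] t2[of "t - e"] t3[of t] that H_exact[OF I f, of t] by (simp add: poly_pcompose)
  then have "HP I = pcompose (HP (colon I e f)) [:- of_int e, 1:] + HP (padd I e f)"
    by (intro poly_eventually_unique) (unfold eventually_at_top_linorder, blast)
  then show ?thesis using poly_ident[of "HP I" _ x] by (simp add: poly_pcompose)
qed

lemma HP_eq_0_iff:
  assumes I: "gideal I"
  shows "HP I = 0 \<longleftrightarrow> (\<exists>t0. \<forall>t\<ge>t0. I t = hf t)"
proof
  assume "HP I = 0"
  then show "\<exists>t0. \<forall>t\<ge>t0. I t = hf t" using HP_at[OF I] H_eq_0[OF I] by (metis of_nat_eq_0_iff poly_0)
next
  assume "\<exists>t0. \<forall>t\<ge>t0. I t = hf t"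
  then obtain t0 where "\<And>t. t \<ge> t0 \<Longrightarrow> I t = hf t" by blast
  then show "HP I = 0"
    using H_eq_0[OF I] by (intro HP_unique) (auto simp: eventually_at_top_linorder)
qed

lemma HP_nonzero_var:
  assumes I: "gideal I" "HP I \<noteq> 0"
  shows "\<exists>i. var i \<notin> I 1"
proof (rule ccontr)
  assume "\<not> ?thesis"
  then have "g * 1 \<in> I (0 + t)" if "g \<in> hf t" "t \<ge> 1" for g t
    by (intro gideal_Suc[OF I(1) _ that(2,1)]) simp
  then have "\<forall>t\<ge>1. I t = hf t" using gideal_hf[OF I(1)] by auto
  then show False using HP_eq_0_iff[OF I(1)] I(2) by blast
qed

lemma HP_prime_nonzero:
  assumes P: "gprime P" "var i \<notin> P 1"
  shows "HP P \<noteq> 0"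
proof
  assume "HP P = 0"
  then obtain t0 where "\<And>t. t \<ge> t0 \<Longrightarrow> P t = hf t" using HP_eq_0_iff[OF gprime_gideal[OF P(1)]] by blast
  then have "P (int (nat t0)) = hf (int (nat t0))" by simp
  then have "var i ^ nat t0 \<in> P (int (nat t0) * 1)" using hf_power[OF hf_var, of i "nat t0"] by simp
  then show False using gprime_power[OF P(1) hf_var] P(2) by blast
qed

text \<open>A homogeneous ideal that is maximal among those with Hilbert polynomial of given degree is prime.\<close>

lemma ex_prime_same_degree:
  fixes I :: "'n::{finite,linorder} cfam"
  assumes I: "gideal I" "HP I \<noteq> 0"
  obtains P i where "gprime P" "I \<le> P" "var i \<notin> P 1" "degree (HP P) = degree (HP I)"
proof -
  define Q where "Q J \<longleftrightarrow> HP J \<noteq> 0 \<and> degree (HP J) \<ge> degree (HP I)" for J :: "'n cfam"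
  obtain P where P: "gideal P" "I \<le> P" "Q P" "\<And>K. gideal K \<Longrightarrow> P < K \<Longrightarrow> \<not> Q K"
    using gideal_maximal[OF I(1), of Q] I(2) unfolding Q_def by blast
  have "gprime P" unfolding gprime_def
  proof (intro conjI allI ballI impI P(1))
    show "1 \<notin> P 0"
    proof
      assume "1 \<in> P 0"
      then have "P = hf" by (rule gideal_eq_UNIV[OF P(1)])
      then show False using P(3) HP_eq_0_iff[OF P(1)] by (auto simp: Q_def)
    qed
    fix a b and f g :: "'n mpoly" assume fg: "f \<in> hf a" "g \<in> hf b" "f * g \<in> P (a + b)"
    show "f \<in> P a \<or> g \<in> P b"
    proof (rule ccontr)
      assume n: "\<not> ?thesis"
      have "g \<in> colon P a f b" using fg by (simp add: colon_def)
      then have "P < colon P a f" using n le_colon[OF P(1) fg(1)] by (auto simp: less_le)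
      then have 1: "\<not> Q (colon P a f)" by (rule P(4)[OF gideal_colon[OF P(1) fg(1)]])
      have "P < padd P a f" using n le_padd[of P a f] mem_padd[OF P(1), of f a] by (auto simp: less_le)
      then have 2: "\<not> Q (padd P a f)" by (rule P(4)[OF gideal_padd[OF P(1) fg(1)]])
      have eq: "HP P = pcompose (HP (colon P a f)) [:- of_int a, 1:] + HP (padd P a f)"
        by (rule poly_eq_poly_eq_iff[THEN iffD1]) (auto simp: poly_pcompose HP_exact[OF P(1) fg(1)])
      have "coeff (HP P) (degree (HP P)) = 0"
      proof -
        have "degree (HP P) \<ge> degree (HP I)" using P(3) by (simp add: Q_def)
        moreover have "coeff q (degree (HP P)) = 0" if "q = 0 \<or> degree q < degree (HP P)" for q :: "real poly"
          using that coeff_eq_0 by auto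
        ultimately have "coeff (pcompose (HP (colon P a f)) [:- of_int a, 1:]) (degree (HP P)) = 0"
          "coeff (HP (padd P a f)) (degree (HP P)) = 0"
          using 1 2 by (auto simp: Q_def degree_pcompose)
        then show ?thesis by (subst (1) eq) simp
      qed
      then show False using P(3) by (simp add: Q_def)
    qed
  qed
  moreover have "degree (HP P) = degree (HP I)"
    using eventually_le_poly(1)[OF HP_mono[OF I(1) P(1,2)]] P(3) by (simp add: Q_def)
  moreover obtain i where "var i \<notin> P 1" using HP_nonzero_var[OF P(1)] P(3) by (auto simp: Q_def)
  ultimately show ?thesis using that P(2) by blast
qed

text \<open>The local-to-global principle for what follows: if a property holds after multiplication
  by some form avoiding each given point, then the ideal of such multipliers lies in no relevant
  prime and so contains all forms of high degree.\<close>

lemma contains_high_degree: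
  fixes I :: "'n::{finite,linorder} cfam"
  assumes I: "gideal I" and "\<And>P i. gprime P \<Longrightarrow> I \<le> P \<Longrightarrow> var i \<notin> P 1 \<Longrightarrow> False"
  shows "\<exists>t0. \<forall>t\<ge>t0. I t = hf t"
  using ex_prime_same_degree[OF I] assms(2) HP_eq_0_iff[OF I] by metis

lemma gprime_colon:
  assumes P: "gprime P" and f: "f \<in> hf e" "f \<notin> P e"
  shows "colon P e f = P"
proof (rule antisym)
  show "colon P e f \<le> P"
    using gprimeD[OF P f(1)] f(2) by (auto simp: le_fun_def colon_def)
qed (rule le_colon[OF gprime_gideal[OF P] f(1)])

lemma HP_hypersurface:
  assumes P: "gideal P" "f \<in> hf e" "colon P e f = P"
  shows "poly (HP (padd P e f)) x = poly (HP P) x - poly (HP P) (x - of_int e)"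
  using HP_exact[OF P(1,2), of x] P(3) by simp

lemma HP_hypersurface_degree:
  assumes P: "gideal P" "f \<in> hf e" "colon P e f = P"
  shows "degree (HP P) \<le> Suc n \<Longrightarrow> degree (HP (padd P e f)) \<le> n"
    and "degree (HP P) \<le> Suc n \<Longrightarrow> coeff (HP (padd P e f)) n = real (Suc n) * of_int e * coeff (HP P) (Suc n)"
    and "degree (HP P) = 0 \<Longrightarrow> HP (padd P e f) = 0"
proof -
  obtain D where D: "\<And>x. poly D x = poly (HP P) x - poly (HP P) (x - of_int e)"
    "\<And>n. degree (HP P) \<le> Suc n \<Longrightarrow> degree D \<le> n \<and> coeff D n = real (Suc n) * of_int e * coeff (HP P) (Suc n)"
    "degree (HP P) = 0 \<Longrightarrow> D = 0"
    using poly_difference[of "HP P" "of_int e"] by metis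
  have "HP (padd P e f) = D"
    using HP_hypersurface[OF P] D(1) by (intro poly_eq_poly_eq_iff[THEN iffD1] ext) simp
  then show "degree (HP P) \<le> Suc n \<Longrightarrow> degree (HP (padd P e f)) \<le> n"
    "degree (HP P) \<le> Suc n \<Longrightarrow> coeff (HP (padd P e f)) n = real (Suc n) * of_int e * coeff (HP P) (Suc n)"
    "degree (HP P) = 0 \<Longrightarrow> HP (padd P e f) = 0" using D by simp_all
qed

text \<open>A form of \<open>Q\<close> outside \<open>P\<close> is a nonzerodivisor modulo
  \<open>P\<close>, so already adding it to \<open>P\<close> lowers the degree of the Hilbert
  polynomial.\<close>

lemma HP_prime_strict:
  assumes P: "gprime P" and Q: "gideal Q" "HP Q \<noteq> 0" "P < Q"
  shows "degree (HP Q) < degree (HP P)"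
proof -
  obtain e f where f: "f \<in> Q e" "f \<notin> P e" using Q(3) by (auto simp: less_le le_fun_def fun_eq_iff)
  have fe: "f \<in> hf e" by (rule gideal_hf[OF Q(1) f(1)])
  note gp = gprime_gideal[OF P]
  have "padd P e f \<le> Q" using Q(3) f(1) by (intro padd_least Q) simp_all
  note le = eventually_le_poly(1,2)[OF HP_mono[OF gideal_padd[OF gp fe] Q(1) this]]
  note d = HP_hypersurface_degree[OF gp fe gprime_colon[OF P fe f(2)]]
  show ?thesis
  proof (cases "degree (HP P)")
    case 0
    then show ?thesis using d(3) le(2) Q(2) by simp
  next
    case (Suc n)
    then show ?thesis using d(1)[of n] le(1) by simp
  qed
qed

lemma points_iff:
  "P \<in> points I \<longleftrightarrow> integral_subscheme P \<and> I \<subseteq> P"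
  by (simp add: points_def)

text \<open>Along a chain of primes the degree of the Hilbert polynomial falls strictly, which
  bounds the length. A chain of full length arises by cutting with a variable and taking a prime
  over the section whose Hilbert polynomial has the same degree.\<close>

theorem scheme_dim_eq_degree:
  fixes I :: "'n::{finite,linorder} mpoly set"
  assumes I: "gideal (gr I)" "tot (gr I) = I"
  shows "scheme_dim I = enat (degree (HP (gr I)))"
proof -
  have upper: "n \<le> degree (HP (gr I))"
    if p: "\<forall>i\<le>n. p i \<in> points I" "\<forall>i<n. p i \<subset> p (Suc i)" for n :: nat and p
  proof -
    have gp: "gprime (gr (p i))" "HP (gr (p i)) \<noteq> 0" "tot (gr (p i)) = p i" if "i \<le> n" for i
      using gprime_gr[of "p i"] HP_prime_nonzero p(1) that by (auto simp: points_iff)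
    have "degree (HP (gr (p i))) + i \<le> degree (HP (gr I))" if "i \<le> n" for i
      using that
    proof (induction i)
      case 0
      have "gr I \<le> gr (p 0)" using p(1) by (intro gr_mono) (auto simp: points_iff)
      then show ?case using eventually_le_poly(1)[OF HP_mono[OF I(1) gprime_gideal[OF gp(1)[of 0]]]] by simp
    next
      case (Suc i)
      have "gr (p i) \<noteq> gr (p (Suc i))" using gp(3)[of i] gp(3)[of "Suc i"] p(2) Suc.prems by (metis Suc_le_lessD less_imp_le psubsetE subset_refl)
      then have "gr (p i) < gr (p (Suc i))" using gr_mono[of "p i" "p (Suc i)"] p(2) Suc.prems by (auto simp: less_le)
      then have "degree (HP (gr (p (Suc i)))) < degree (HP (gr (p i)))"
        using Suc.prems by (intro HP_prime_strict gp gprime_gideal) auto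
      then show ?case using Suc by simp
    qed
    from this[of n] show ?thesis by simp
  qed
  have lower: "\<exists>p. (\<forall>i\<le>n. p i \<in> points (tot J)) \<and> (\<forall>i<n. p i \<subset> p (Suc i))"
    if "gideal J" "HP J \<noteq> 0" "degree (HP J) = n" for J :: "'n cfam" and n
    using that
  proof (induction n arbitrary: J)
    case 0
    obtain P i where P: "gprime P" "J \<le> P" "var i \<notin> P 1" using ex_prime_same_degree[OF 0(1,2)] by metis
    show ?case
      by (rule exI[of _ "\<lambda>_. tot P"]) (use integral_subscheme_tot[OF P(1,3)] tot_mono[OF P(2)] in \<open>auto simp: points_iff\<close>)
  next
    case (Suc n)
    obtain P i where P: "gprime P" "J \<le> P" "var i \<notin> P 1" "degree (HP P) = Suc n"
      using ex_prime_same_degree[OF Suc.prems(1,2)] Suc.prems(3) by metis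
    note gp = gprime_gideal[OF P(1)]
    let ?K = "padd P 1 (var i)"
    have gk: "gideal ?K" by (rule gideal_padd[OF gp hf_var])
    note d = HP_hypersurface_degree[OF gp hf_var gprime_colon[OF P(1) hf_var P(3)]]
    have "coeff (HP ?K) n \<noteq> 0" using d(2)[of n] P(4) by (metis leading_coeff_0_iff mult_eq_0_iff of_int_1 of_nat_eq_0_iff order_refl degree_0 nat.distinct(1) zero_neq_one)
    then have K: "HP ?K \<noteq> 0" "degree (HP ?K) = n" using d(1)[of n] P(4) le_degree[of "HP ?K" n] by auto
    obtain p where p: "\<forall>i\<le>n. p i \<in> points (tot ?K)" "\<forall>i<n. p i \<subset> p (Suc i)" using Suc.IH[OF gk K] by blast
    define p' where "p' i = (case i of 0 \<Rightarrow> tot P | Suc j \<Rightarrow> p j)" for i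
    have PK: "tot P \<subseteq> tot ?K" by (rule tot_mono[OF le_padd])
    have "var i \<in> gr (tot ?K) 1" "var i \<notin> gr (tot P) 1"
      using mem_padd[OF gp, of "var i" 1] P(3) by (simp_all add: gr_tot[OF gk] gr_tot[OF gp])
    then have "var i \<in> tot ?K" "var i \<notin> tot P" by (auto simp: gr_def)
    then have "tot P \<subset> p 0" using p(1) PK by (auto simp: points_iff)
    moreover have "tot J \<subseteq> tot P" by (rule tot_mono[OF P(2)])
    ultimately show ?case
      using p PK integral_subscheme_tot[OF P(1,3)]
      by (intro exI[of _ p']) (auto simp: p'_def points_iff split: nat.split; blast)
  qed
  show ?thesis
  proof (cases "HP (gr I) = 0")
    case False
    obtain p where "\<forall>i\<le>degree (HP (gr I)). p i \<in> points I" "\<forall>i<degree (HP (gr I)). p i \<subset> p (Suc i)"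
      using lower[OF I(1) False refl] I(2) by auto
    then have "enat (degree (HP (gr I))) \<le> scheme_dim I"
      unfolding scheme_dim_def by (intro Sup_upper) auto
    moreover have "scheme_dim I \<le> enat (degree (HP (gr I)))" unfolding scheme_dim_def
    proof (rule Sup_least)
      fix x assume "x \<in> {enat n |n. \<exists>p. (\<forall>i\<le>n. p i \<in> points I) \<and> (\<forall>i<n. p i \<subset> p (Suc i))}"
      then obtain n p where "x = enat n" "\<forall>i\<le>n. p i \<in> points I" "\<forall>i<n. p i \<subset> p (Suc i)" by blast
      then show "x \<le> enat (degree (HP (gr I)))" using upper by simp
    qed
    ultimately show ?thesis by (rule antisym[rotated])
  next
    \<comment> \<open>The empty scheme: the supremum over no chains is 0, and so is the degree of
      the zero polynomial.\<close>
    case True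
    have "P \<notin> points I" for P
    proof
      assume P: "P \<in> points I"
      then have "integral_subscheme P" "gr I \<le> gr P" by (auto simp: points_iff intro: gr_mono)
      then show False
        using gprime_gr[of P] HP_prime_nonzero[of "gr P"] True
          eventually_le_poly(2)[OF HP_mono[OF I(1) gprime_gideal[of "gr P"]]] by blast
    qed
    then have *: "{enat n |n. \<exists>p. (\<forall>i\<le>n. p i \<in> points I) \<and> (\<forall>i<n. p i \<subset> p (Suc i))} = {}"
      using le0 by blast
    show ?thesis using True unfolding scheme_dim_def * by (simp add: bot_enat_def zero_enat_def)
  qed
qed

section \<open>Residuals along a divisor\<close>

text \<open>\<open>D\<close> is, in high degrees, the image of multiplication by the section \<open>A / B\<close> of \<open>\<O>(k)\<close> on \<open>X\<close>.\<close>

definition twisted_divisor ::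
  "('n::{finite,linorder}, 'k::field) fam \<Rightarrow> ('n, 'k) fam \<Rightarrow> int \<Rightarrow> bool" where
  "twisted_divisor X D k \<longleftrightarrow> (\<exists>a b A B t1. A \<in> hf a \<and> B \<in> hf b \<and> A \<notin> X a \<and> B \<notin> X b \<and> k = a - b \<and>
    (\<forall>t\<ge>t1. (\<forall>g\<in>hf t. \<exists>y\<in>hf (t + k). B * y - A * g \<in> X (t + a)) \<and>
      (\<forall>y\<in>hf (t + k). y \<in> D (t + k) \<longleftrightarrow> (\<exists>g\<in>hf t. B * y - A * g \<in> X (t + a)))))"

lemma sat_colon_ideal:
  fixes C D :: "('n::{finite,linorder}, 'k::field) fam"
  assumes C: "gideal C" "sat C = C" and D: "gideal D"
  shows "sat (colon_ideal C D) = colon_ideal C D"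
proof (rule antisym)
  show "sat (colon_ideal C D) \<le> colon_ideal C D"
  proof (rule le_funI, rule subsetI)
    fix t f assume "f \<in> sat (colon_ideal C D) t"
    then obtain m where f: "f \<in> hf t" "\<And>g. g \<in> hf (int m) \<Longrightarrow> g * f \<in> colon_ideal C D (t + int m)"
      by (auto simp: sat_def)
    have "y * f \<in> C (e + t)" if y: "y \<in> D e" for e y
    proof (rule sat_memI[OF C, where k = m])
      show "y * f \<in> hf (e + t)" using gideal_hf[OF D y] f(1) by (rule hf_mult)
      fix g :: "('n, 'k) mpol" assume "g \<in> hf (int m)"
      then have "y * (g * f) \<in> C (e + (t + int m))" using f(2) y by (auto simp: colon_ideal_def)
      then show "g * (y * f) \<in> C (e + t + int m)" by (simp add: ac_simps)
    qed
    then show "f \<in> colon_ideal C D t" using f(1) by (simp add: colon_ideal_def)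
  qed
qed (rule le_sat[OF gideal_colon_ideal[OF C(1)]])

lemma le_colon_ideal: "gideal C \<Longrightarrow> gideal D \<Longrightarrow> C \<le> colon_ideal C D"
  by (auto simp: le_fun_def colon_ideal_def gideal_hf intro!: gideal_mult')

text \<open>In high degrees \<open>A / B\<close> identifies R/X, shifted by \<open>k\<close>, with
  D/X. Under it C : D corresponds to the intersection of \<open>C\<close> and \<open>D\<close>, so
  D/(C \<inter> D), the kernel of R/C -> R/(C + D), has the Hilbert function of R/(C : D) shifted by
  \<open>k\<close>.\<close>

lemma residual_H:
  fixes X C D :: "('n::{finite,linorder}, 'k::field) fam"
  assumes X: "gprime X" and C: "gideal C" "sat C = C" "X \<le> C" and D: "gideal D" "X \<le> D"
    and td: "twisted_divisor X D k"
  shows "\<exists>t1. \<forall>t\<ge>t1. H C (t + k) = H (isum C D) (t + k) + H (colon_ideal C D) t"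
proof -
  note gX = gprime_gideal[OF X]
  obtain a b A B t1 where AB: "A \<in> hf a" "B \<in> hf b" "A \<notin> X a" "B \<notin> X b" "k = a - b"
    and i: "\<And>t g. t \<ge> t1 \<Longrightarrow> g \<in> hf t \<Longrightarrow> \<exists>y\<in>hf (t + k). B * y - A * g \<in> X (t + a)"
    and ii: "\<And>t y. t \<ge> t1 \<Longrightarrow> y \<in> hf (t + k) \<Longrightarrow> y \<in> D (t + k) \<longleftrightarrow> (\<exists>g\<in>hf t. B * y - A * g \<in> X (t + a))"
    using td unfolding twisted_divisor_def by metis
  have cancel: "y \<in> X t" if "y \<in> hf t" "B * y \<in> X (t + b)" for y t
    using gprimeD[OF X AB(2) that(1)] that(2) AB(4) by (simp add: add.commute)
  \<comment> \<open>Both y/g and y'/g' represent \<open>A / B\<close> on \<open>X\<close>, so cross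
    multiplication gives equality modulo \<open>X\<close>; \<open>B\<close> is cancelled because
    \<open>X\<close> is prime.\<close>
  have cross: "y' * g - y * g' \<in> C (t + t' + k)"
    if y: "y \<in> hf (t + k)" "g \<in> hf t" "B * y - A * g \<in> X (t + a)"
      and y': "y' \<in> hf (t' + k)" "g' \<in> hf t'" "B * y' - A * g' \<in> X (t' + a)" for y g y' g' t t'
  proof -
    have "y' * g - y * g' \<in> X (t + t' + k)"
    proof (rule cancel)
      show "y' * g - y * g' \<in> hf (t + t' + k)"
        using hf_mult[OF y'(1) y(2)] hf_mult[OF y(1) y'(2)] by (intro hf_diff) (simp_all add: ac_simps)
      have "B * (y' * g - y * g') = g * (B * y' - A * g') - g' * (B * y - A * g)"
        by (simp add: algebra_simps)
      also have "\<dots> \<in> X (t + t' + k + b)"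
        by (intro gideal_diff gX gideal_mult'[OF gX y'(3) y(2)] gideal_mult'[OF gX y(3) y'(2)])
          (use AB(5) in auto)
      finally show "B * (y' * g - y * g') \<in> X (t + t' + k + b)" .
    qed
    then show ?thesis using C(3) by (auto simp: le_fun_def)
  qed
  define m where "m = nat t1"
  \<comment> \<open>\<open>g\<close> and \<open>y\<close> correspond under \<open>A / B\<close>. By
    \<open>cross\<close>, multiplying \<open>y\<close> by forms \<open>g'\<close> of large degree
    agrees modulo \<open>C\<close> with multiplying \<open>g\<close> by elements of
    \<open>D\<close>, and saturation of \<open>C\<close> removes these multipliers.\<close>
  have key: "g \<in> colon_ideal C D t \<longleftrightarrow> y \<in> C (t + k)"
    if y: "y \<in> hf (t + k)" "g \<in> hf t" "B * y - A * g \<in> X (t + a)" for y g t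
  proof
    assume gc: "g \<in> colon_ideal C D t"
    show "y \<in> C (t + k)"
    proof (rule sat_memI[OF C(1,2) y(1), where k = m])
      fix g' :: "('n, 'k) mpol" assume g': "g' \<in> hf (int m)"
      have m: "int m \<ge> t1" by (simp add: m_def)
      obtain y' where y': "y' \<in> hf (int m + k)" "B * y' - A * g' \<in> X (int m + a)" using i[OF m g'] by blast
      then have "y' \<in> D (int m + k)" using ii[OF m] g' by blast
      then have "y' * g \<in> C (int m + k + t)" using gc by (simp add: colon_ideal_def)
      then have "y' * g \<in> C (t + int m + k)" by (simp add: ac_simps)
      from gideal_diff[OF C(1) this cross[OF y y'(1) g' y'(2)]]
      show "g' * y \<in> C (t + k + int m)" by (simp add: ac_simps)
    qed
  next
    assume yC: "y \<in> C (t + k)"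
    have large: "y'' * g \<in> C (e + t)" if y'': "y'' \<in> D e" "e \<ge> t1 + k" for y'' e
    proof -
      have y''h: "y'' \<in> hf (e - k + k)" using gideal_hf[OF D(1) y''(1)] by simp
      then obtain g'' where g'': "g'' \<in> hf (e - k)" "B * y'' - A * g'' \<in> X (e - k + a)"
        using ii[of "e - k" y''] y'' by auto
      have "y'' * g - y * g'' \<in> C (e + t)" using cross[OF y y''h g''] by (simp add: ac_simps)
      moreover have "y * g'' \<in> C (e + t)" by (rule gideal_mult_right[OF C(1) yC g''(1)]) simp
      ultimately show ?thesis using gideal_add[OF C(1), of "y'' * g - y * g''" "e + t" "y * g''"] by simp
    qed
    have "y'' * g \<in> C (e + t)" if y'': "y'' \<in> D e" for y'' e
    proof (rule sat_memI[OF C(1,2), where k = "nat (t1 + k - e)"])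
      show "y'' * g \<in> hf (e + t)" using gideal_hf[OF D(1) y''] y(2) by (rule hf_mult)
      fix h :: "('n, 'k) mpol" assume h: "h \<in> hf (int (nat (t1 + k - e)))"
      have "h * y'' \<in> D (int (nat (t1 + k - e)) + e)" by (rule gideal_mult[OF D(1) y'' h])
      from large[OF this] show "h * (y'' * g) \<in> C (e + t + int (nat (t1 + k - e)))"
        by (simp add: ac_simps)
    qed
    then show "g \<in> colon_ideal C D t" using y(2) by (simp add: colon_ideal_def)
  qed
  have "H C (t + k) = H (isum C D) (t + k) + H (colon_ideal C D) t" if t: "t \<ge> t1" for t
  proof -
    define u where "u = t + k"
    have gI: "gideal (isum C D)" by (rule gideal_isum[OF C(1) D(1)])
    note sC = subspace_gideal[OF C(1)] and sD = subspace_gideal[OF D(1)] and sX = subspace_gideal[OF gX]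
    have "H C u = H (isum C D) u + mp.qd (isum C D u) (C u)"
      unfolding H_def using le_isum(1)[OF D(1), of C] gideal_hf[OF gI]
      by (intro mp.qd_trans' subspace_gideal gI C(1) qfin_hf) (auto simp: le_fun_def)
    also have "isum C D u = id ` D u + C u"
      by (auto simp: isum_def set_plus_def) (metis add.commute)+
    also have "mp.qd (id ` D u + C u) (C u) = mp.qd (D u) {v \<in> D u. id v \<in> C u}"
      by (rule mp.qd_image[OF mp.linear_id sD sC mp.qfin_subset[OF qfin_hf[of u]]]) (use gideal_hf[OF D(1)] in auto)
    also have "{v \<in> D u. id v \<in> C u} = D u \<inter> C u" by auto
    finally have 1: "H C u = H (isum C D) u + mp.qd (D u) (D u \<inter> C u)" .
    \<comment> \<open>Both sides are compared among the forms of degree \<open>t + a\<close>,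
      reached by multiplication with \<open>B\<close> from \<open>D\<close> and with
      \<open>A\<close> from all forms; \<open>W\<close> is the image of C \<inter> D there, enlarged
      by \<open>X\<close>.\<close>
    define W where "W = (*) B ` (D u \<inter> C u) + X (t + a)"
    have sDC: "mp.subspace (D u \<inter> C u)" by (rule mp.subspace_inter[OF sD sC])
    have 0: "0 \<in> D u \<inter> C u" "0 \<in> X (t + a)" using mp.subspace_0[OF sDC] gideal_zero[OF gX] by auto
    have sBDC: "mp.subspace ((*) B ` (D u \<inter> C u))"
    proof -
      interpret l: Vector_Spaces.linear "\<lambda>c p. const c * p" "\<lambda>c p. const c * p" "(*) B" by (rule linear_times)
      show ?thesis by (rule l.subspace_image[OF sDC])
    qed
    have sW: "mp.subspace W" unfolding W_def by (rule mp.subspace_set_plus[OF sBDC sX])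
    have XW: "x \<in> W" if "x \<in> X (t + a)" for x
      unfolding W_def using set_plus_intro[OF imageI[OF 0(1), of "(*) B"] that] by simp
    have BW: "B * y \<in> W" if "y \<in> D u" "y \<in> C u" for y
      unfolding W_def using set_plus_intro[OF imageI[OF IntI[OF that], of "(*) B"] 0(2)] by simp
    have e1: "{y \<in> D u. B * y \<in> W} = D u \<inter> C u"
    proof safe
      fix y assume y: "y \<in> D u" "B * y \<in> W"
      then obtain y0 x where yx: "B * y = B * y0 + x" "y0 \<in> D u" "y0 \<in> C u" "x \<in> X (t + a)"
        unfolding W_def by (auto elim!: set_plus_elim)
      have "B * (y - y0) \<in> X (u + b)" using yx AB(5) by (simp add: right_diff_distrib u_def)
      then have "y - y0 \<in> X u"
        using cancel[OF hf_diff[OF gideal_hf[OF D(1) y(1)] gideal_hf[OF D(1) yx(2)]]] by simp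
      then have "y - y0 \<in> C u" using C(3) by (auto simp: le_fun_def)
      from gideal_add[OF C(1) this yx(3)] show "y \<in> C u" by simp
    qed (use BW in auto)
    have e2: "{g \<in> hf t. A * g \<in> W} = colon_ideal C D t"
    proof safe
      fix g :: "('n, 'k) mpol" assume g: "g \<in> hf t" "A * g \<in> W"
      then obtain y0 x where yx: "A * g = B * y0 + x" "y0 \<in> D u" "y0 \<in> C u" "x \<in> X (t + a)"
        unfolding W_def by (auto elim!: set_plus_elim)
      have "B * y0 - A * g \<in> X (t + a)" using gideal_uminus[OF gX yx(4)] yx(1) by simp
      then show "g \<in> colon_ideal C D t"
        using key[of y0 t g] g(1) yx gideal_hf[OF D(1) yx(2)] by (simp add: u_def)
    next
      fix g assume g: "g \<in> colon_ideal C D t"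
      then show gh: "g \<in> hf t" by (simp add: colon_ideal_def)
      obtain y where y: "y \<in> hf (t + k)" "B * y - A * g \<in> X (t + a)" using i[OF t gh] by blast
      then have "y \<in> D u" "y \<in> C u" using ii[OF t y(1)] gh key[OF y(1) gh y(2)] g by (auto simp: u_def)
      then have "B * y - (B * y - A * g) \<in> W" using BW XW y(2) mp.subspace_diff[OF sW] by blast
      then show "A * g \<in> W" by simp
    qed
    have e3: "(*) B ` D u + W = (*) A ` hf t + W"
    proof (rule antisym)
      show "(*) B ` D u + W \<subseteq> (*) A ` hf t + W"
      proof
        fix z assume "z \<in> (*) B ` D u + W"
        then obtain y w where z: "z = B * y + w" "y \<in> D u" "w \<in> W" by (auto elim!: set_plus_elim)
        then obtain g where g: "g \<in> hf t" "B * y - A * g \<in> X (t + a)"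
          using ii[OF t, of y] gideal_hf[OF D(1) z(2)] by (auto simp: u_def)
        have "(B * y - A * g) + w \<in> W" using mp.subspace_add[OF sW XW[OF g(2)] z(3)] .
        then have "A * g + ((B * y - A * g) + w) \<in> (*) A ` hf t + W" using g(1) by (intro set_plus_intro) auto
        then show "z \<in> (*) A ` hf t + W" using z by simp
      qed
      show "(*) A ` hf t + W \<subseteq> (*) B ` D u + W"
      proof
        fix z assume "z \<in> (*) A ` hf t + W"
        then obtain g w where z: "z = A * g + w" "g \<in> hf t" "w \<in> W" by (auto elim!: set_plus_elim)
        obtain y where y: "y \<in> hf (t + k)" "B * y - A * g \<in> X (t + a)" using i[OF t z(2)] by blast
        then have yD: "y \<in> D u" using ii[OF t y(1)] z(2) by (auto simp: u_def)
        have "w - (B * y - A * g) \<in> W" using mp.subspace_diff[OF sW z(3) XW[OF y(2)]] .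
        then have "B * y + (w - (B * y - A * g)) \<in> (*) B ` D u + W" using yD by (intro set_plus_intro) auto
        then show "z \<in> (*) B ` D u + W" using z(1) by (simp add: add.commute)
      qed
    qed
    have f1: "mp.qfin (D u) {y \<in> D u. B * y \<in> W}"
      by (rule mp.qfin_subset[OF qfin_hf[of u]]) (use gideal_hf[OF D(1)] in auto)
    have "mp.qd ((*) B ` D u + W) W = mp.qd (D u) (D u \<inter> C u)"
      using mp.qd_image[OF linear_times sD sW f1] unfolding e1 .
    moreover have "mp.qd ((*) A ` hf t + W) W = H (colon_ideal C D) t"
      using mp.qd_image[OF linear_times subspace_hf sW qfin_hf, of A t] unfolding e2 H_def .
    ultimately show ?thesis using 1 e3 by (simp add: u_def)
  qed
  then show ?thesis by blast
qed

lemma residual_HP: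
  fixes X C D :: "'n::{finite,linorder} cfam"
  assumes X: "gprime X" and C: "gideal C" "sat C = C" "X \<le> C" and D: "gideal D" "X \<le> D"
    and td: "twisted_divisor X D k"
  shows "poly (HP C) x = poly (HP (isum C D)) x + poly (HP (colon_ideal C D)) (x - of_int k)"
proof -
  note gI = gideal_isum[OF C(1) D(1)] and gco = gideal_colon_ideal[OF C(1), of D]
  obtain t0 where t0: "\<And>t. t \<ge> t0 \<Longrightarrow> H C (t + k) = H (isum C D) (t + k) + H (colon_ideal C D) t"
    using residual_H[OF assms] by blast
  obtain t1 where t1: "\<And>t. t \<ge> t1 \<Longrightarrow> real (H C t) = poly (HP C) (of_int t)" using HP_at[OF C(1)] by blast
  obtain t2 where t2: "\<And>t. t \<ge> t2 \<Longrightarrow> real (H (isum C D) t) = poly (HP (isum C D)) (of_int t)" using HP_at[OF gI] by blast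
  obtain t3 where t3: "\<And>t. t \<ge> t3 \<Longrightarrow> real (H (colon_ideal C D) t) = poly (HP (colon_ideal C D)) (of_int t)" using HP_at[OF gco] by blast
  have "poly (HP C) (of_int t) = poly (HP (isum C D) + pcompose (HP (colon_ideal C D)) [:- of_int k, 1:]) (of_int t)"
    if "t \<ge> max (t0 + k) (max t1 (max t2 (t3 + k)))" for t
    using t0[of "t - k"] t1[of t] t2[of t] t3[of "t - k"] that by (simp add: poly_pcompose)
  then have "HP C = HP (isum C D) + pcompose (HP (colon_ideal C D)) [:- of_int k, 1:]"
    by (intro poly_eventually_unique) (unfold eventually_at_top_linorder, blast)
  then show ?thesis using poly_ident[of "HP C" _ x] by (simp add: poly_pcompose)
qed

text \<open>The case \<open>C = X\<close> of the residual formula: \<open>D\<close> contains a form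
  outside the prime \<open>X\<close>, so X : D = X.\<close>

lemma twisted_divisor_HP:
  fixes X D :: "'n::{finite,linorder} cfam"
  assumes X: "gprime X" "var i \<notin> X 1" and D: "gideal D" "X \<le> D" and td: "twisted_divisor X D k"
  shows "poly (HP D) x = poly (HP X) x - poly (HP X) (x - of_int k)"
proof -
  note gX = gprime_gideal[OF X(1)]
  obtain a b A B t1 where AB: "A \<in> hf a" "B \<in> hf b" "A \<notin> X a" "B \<notin> X b" "k = a - b"
    and i: "\<And>t g. t \<ge> t1 \<Longrightarrow> g \<in> hf t \<Longrightarrow> \<exists>y\<in>hf (t + k). B * y - A * g \<in> X (t + a)"
    and ii: "\<And>t y. t \<ge> t1 \<Longrightarrow> y \<in> hf (t + k) \<Longrightarrow> y \<in> D (t + k) \<longleftrightarrow> (\<exists>g\<in>hf t. B * y - A * g \<in> X (t + a))"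
    using td unfolding twisted_divisor_def by metis
  define m where "m = nat t1"
  have m: "int m \<ge> t1" by (simp add: m_def)
  have vm: "var i ^ m \<in> hf (int m)" using hf_power[OF hf_var, of i m] by simp
  obtain y where y: "y \<in> hf (int m + k)" "B * y - A * var i ^ m \<in> X (int m + a)" using i[OF m vm] by blast
  have yD: "y \<in> D (int m + k)" using ii[OF m y(1)] y(2) vm by blast
  have yX: "y \<notin> X (int m + k)"
  proof
    assume "y \<in> X (int m + k)"
    then have "B * y \<in> X (int m + a)" using AB(5) by (intro gideal_mult'[OF gX _ AB(2)]) auto
    from gideal_diff[OF gX this y(2)] have "A * var i ^ m \<in> X (a + int m)" by (simp add: add.commute)
    then have "var i ^ m \<in> X (int m * 1)" using gprimeD[OF X(1) AB(1) vm] AB(3) by simp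
    then show False using gprime_power[OF X(1) hf_var] X(2) by blast
  qed
  have "colon_ideal X D = X"
  proof (rule antisym)
    show "colon_ideal X D \<le> X"
    proof (rule le_funI, rule subsetI)
      fix t f assume "f \<in> colon_ideal X D t"
      then have "f \<in> hf t" "y * f \<in> X (int m + k + t)" using yD by (auto simp: colon_ideal_def)
      then show "f \<in> X t" using gprimeD[OF X(1) y(1)] yX by blast
    qed
  qed (rule le_colon_ideal[OF gX D(1)])
  moreover have "isum X D = D"
    using isum_least[OF D(1) D(2) order_refl] le_isum(2)[OF gX, of D] by (rule antisym)
  ultimately show ?thesis
    using residual_HP[OF X(1) gX gprime_saturated[OF X] order_refl D td, of x] by simp
qed

section \<open>Cartier divisors\<close>

lemma Fract_eq_iff: "(b :: 'a::idom) \<noteq> 0 \<Longrightarrow> d \<noteq> 0 \<Longrightarrow> Fract a b = Fract c d \<longleftrightarrow> a * d = c * b"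
  by (simp add: eq_fract)

lemma Fract_power: "Fract (a :: 'a::idom) b ^ k = Fract (a ^ k) (b ^ k)"
  by (induction k) (simp_all add: One_fract_def)

locale integral_scheme =
  fixes P :: "'n::{finite,linorder} mpoly set"
  assumes integral: "integral_subscheme P"
begin

lemma prime: "f * g \<in> P \<Longrightarrow> f \<in> P \<or> g \<in> P"
proof -
  interpret primeideal P poly_ring using integral by (simp add: integral_subscheme_def)
  show "f * g \<in> P \<Longrightarrow> f \<in> P \<or> g \<in> P" using I_prime[of f g] by (simp add: poly_ring_def)
qed

lemma ideal: "ideal P poly_ring"
  using integral by (simp add: integral_subscheme_def homogeneous_ideal_def)

lemma zero: "0 \<in> P" and add: "f \<in> P \<Longrightarrow> g \<in> P \<Longrightarrow> f + g \<in> P" and mult: "f \<in> P \<Longrightarrow> g * f \<in> P"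
  using ideal_poly_ringD[OF ideal] by blast+

lemma mult_right: "f \<in> P \<Longrightarrow> f * g \<in> P"
  using mult[of f g] by (simp add: mult.commute)

lemma diff: "f \<in> P \<Longrightarrow> g \<in> P \<Longrightarrow> f - g \<in> P"
  using add[of f "- 1 * g"] mult[of g "- 1"] by simp

lemma notin_nonzero: "f \<notin> P \<Longrightarrow> f \<noteq> 0"
  using zero by blast

lemma notin_mult: "f \<notin> P \<Longrightarrow> g \<notin> P \<Longrightarrow> f * g \<notin> P"
  using prime by blast

lemma one_notin: "1 \<notin> P"
proof
  assume "1 \<in> P"
  then have "P = UNIV" using mult[of 1] by auto
  then show False using integral by (auto simp: integral_subscheme_def)
qed

lemma notin_power: "f \<notin> P \<Longrightarrow> f ^ k \<notin> P"
  by (induction k) (auto simp: one_notin dest: prime)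

lemma ex_var: "\<exists>i. var i \<notin> P"
  using gprime_gr(2)[OF integral] by (auto simp: gr_def)

lemma gprime: "gprime (gr P)"
  by (rule gprime_gr(1)[OF integral])

end

lemma local_ring_iff: "x \<in> local_ring P \<longleftrightarrow> (\<exists>a b t. x = Fract a b \<and> a \<in> hf (int t) \<and> b \<in> hf (int t) \<and> b \<notin> P)"
  by (auto simp: local_ring_def forms_eq_hf)

lemma local_ideal_iff:
  "x \<in> local_ideal I P \<longleftrightarrow> (\<exists>a b t. x = Fract a b \<and> a \<in> I \<and> a \<in> hf (int t) \<and> b \<in> hf (int t) \<and> b \<notin> P)"
  by (auto simp: local_ideal_def forms_eq_hf)

context integral_scheme
begin

lemma local_ring_mult: "x \<in> local_ring P \<Longrightarrow> y \<in> local_ring P \<Longrightarrow> x * y \<in> local_ring P"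
proof -
  assume "x \<in> local_ring P" "y \<in> local_ring P"
  then obtain a b t c d u where "x = Fract a b" "a \<in> hf (int t)" "b \<in> hf (int t)" "b \<notin> P"
    "y = Fract c d" "c \<in> hf (int u)" "d \<in> hf (int u)" "d \<notin> P" unfolding local_ring_iff by blast
  then show ?thesis unfolding local_ring_iff
    using hf_mult[of a "int t" c "int u"] hf_mult[of b "int t" d "int u"] notin_mult[of b d]
    by (intro exI[of _ "a * c"] exI[of _ "b * d"] exI[of _ "t + u"]) auto
qed

lemma local_ideal_mult:
  assumes I: "ideal I poly_ring" and "x \<in> local_ring P" "y \<in> local_ideal I P"
  shows "x * y \<in> local_ideal I P"
proof -
  obtain a b t c d u where "x = Fract a b" "a \<in> hf (int t)" "b \<in> hf (int t)" "b \<notin> P"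
    "y = Fract c d" "c \<in> I" "c \<in> hf (int u)" "d \<in> hf (int u)" "d \<notin> P"
    using assms(2,3) unfolding local_ring_iff local_ideal_iff by blast
  then show ?thesis unfolding local_ideal_iff
    using hf_mult[of a "int t" c "int u"] hf_mult[of b "int t" d "int u"] notin_mult[of b d]
      ideal_poly_ringD(3)[OF I, of c a]
    by (intro exI[of _ "a * c"] exI[of _ "b * d"] exI[of _ "t + u"]) auto
qed

lemma local_ideal_add:
  assumes I: "ideal I poly_ring" and "x \<in> local_ideal I P" "y \<in> local_ideal I P"
  shows "x + y \<in> local_ideal I P"
proof -
  obtain a b t c d u where *: "x = Fract a b" "a \<in> I" "a \<in> hf (int t)" "b \<in> hf (int t)" "b \<notin> P"
    "y = Fract c d" "c \<in> I" "c \<in> hf (int u)" "d \<in> hf (int u)" "d \<notin> P"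
    using assms(2,3) unfolding local_ideal_iff by blast
  have "x + y = Fract (a * d + c * b) (b * d)" using * notin_nonzero[of b] notin_nonzero[of d] by simp
  moreover have "a * d + c * b \<in> I"
    using ideal_poly_ringD(3)[OF I, of a d] ideal_poly_ringD(3)[OF I, of c b] ideal_poly_ringD(2)[OF I] * by (simp add: mult.commute)
  moreover have "a * d + c * b \<in> hf (int (t + u))"
    using hf_mult[of a "int t" d "int u"] hf_mult[of c "int u" b "int t"] * by (auto intro!: hf_add simp: add.commute)
  moreover have "b * d \<in> hf (int (t + u))" using hf_mult[of b "int t" d "int u"] * by simp
  ultimately show ?thesis unfolding local_ideal_iff using notin_mult[of b d] * by blast
qed

lemma local_ideal_mono: "I \<subseteq> J \<Longrightarrow> local_ideal I P \<subseteq> local_ideal J P"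
  unfolding local_ideal_def by blast

lemma local_generator_mem:
  assumes "local_generator X D P f" "ideal X poly_ring"
  shows "f \<in> local_ring P" "f \<in> local_ideal D P"
proof -
  have "(1 :: 'n mpoly fract) = Fract 1 1" "(0 :: 'n mpoly fract) = Fract 0 1"
    by (simp_all add: One_fract_def Zero_fract_def)
  moreover have "(1 :: 'n mpoly) \<in> hf (int 0)" by simp
  ultimately have 1: "(1 :: 'n mpoly fract) \<in> local_ring P" and 0: "(0 :: 'n mpoly fract) \<in> local_ideal X P"
    unfolding local_ring_iff local_ideal_iff using one_notin hf_zero ideal_poly_ringD(1)[OF assms(2)] by blast+
  show "f \<in> local_ring P" using assms by (simp add: local_generator_def)
  have "f = 1 * f + 0" by simp
  then show "f \<in> local_ideal D P" using assms(1) 1 0 unfolding local_generator_def by blast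
qed

end

section \<open>From local conditions to membership in saturated ideals\<close>

lemma mem_of_local_multiples:
  fixes X :: "'n::{finite,linorder} mpoly set"
  assumes J: "gideal J" "sat J = J" "gr X \<le> J" and X: "tot (gr X) = X" and y: "y \<in> hf t"
    and loc: "\<And>P. P \<in> points X \<Longrightarrow> \<exists>e b. b \<in> hf e \<and> b \<notin> P \<and> b * y \<in> J (e + t)"
  shows "y \<in> J t"
proof -
  have gc: "gideal (colon J t y)" by (rule gideal_colon[OF J(1) y])
  \<comment> \<open>A relevant prime containing J : y would be a point of \<open>X\<close> because
    \<open>gr X \<le> J\<close>, and the multiplier \<open>b\<close> given at that point avoids
    it.\<close>
  have "\<exists>t0. \<forall>u\<ge>t0. colon J t y u = hf u"
  proof (rule contains_high_degree[OF gc])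
    fix P i assume P: "gprime P" "colon J t y \<le> P" "var i \<notin> P 1"
    have "gr X \<le> P" using J(3) le_colon[OF J(1) y] P(2) by (meson order_trans)
    then have "X \<subseteq> tot P" using tot_mono X by metis
    then have "tot P \<in> points X" using integral_subscheme_tot[OF P(1,3)] by (simp add: points_iff)
    then obtain e b where b: "b \<in> hf e" "b \<notin> tot P" "b * y \<in> J (e + t)" using loc by blast
    then have "b \<in> colon J t y e" by (simp add: colon_def ac_simps)
    then have "b \<in> gr (tot P) e" using P(2) gr_tot[OF gprime_gideal[OF P(1)]] by (auto simp: le_fun_def)
    then show False using b(2) by (simp add: gr_def)
  qed
  then obtain t0 where t0: "\<And>u. u \<ge> t0 \<Longrightarrow> colon J t y u = hf u" by blast
  show "y \<in> J t"
  proof (rule sat_memI[OF J(1,2) y, where k = "nat t0"])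
    fix g :: "'n mpoly" assume "g \<in> hf (int (nat t0))"
    then have "g \<in> colon J t y (int (nat t0))" using t0[of "int (nat t0)"] by simp
    then show "g * y \<in> J (t + int (nat t0))" by (simp add: colon_def mult.commute)
  qed
qed

lemma mem_of_local_ideal:
  fixes X :: "'n::{finite,linorder} mpoly set"
  assumes D: "closed_subscheme D" "X \<subseteq> D" and X: "integral_subscheme X" and y: "y \<in> hf (int t)"
    and loc: "\<And>P. P \<in> points X \<Longrightarrow> \<exists>b. b \<in> hf (int t) \<and> b \<notin> P \<and> Fract y b \<in> local_ideal D P"
  shows "y \<in> D"
proof -
  note sD = sat_gr[OF D(1)]
  have iD: "ideal D poly_ring" using D(1) by (simp add: closed_subscheme_def homogeneous_ideal_def)
  have "y \<in> gr D (int t)"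
  proof (rule mem_of_local_multiples[OF sD(1,2) gr_mono[OF D(2)] gprime_gr(3)[OF X] y])
    fix P assume P: "P \<in> points X"
    then interpret integral_scheme P by unfold_locales (simp add: points_iff)
    obtain b where b: "b \<in> hf (int t)" "b \<notin> P" "Fract y b \<in> local_ideal D P" using loc[OF P] by blast
    then obtain s c u where s: "Fract y b = Fract s c" "s \<in> D" "s \<in> hf (int u)" "c \<in> hf (int u)" "c \<notin> P"
      by (auto simp: local_ideal_iff)
    then have "c * y = b * s" using notin_nonzero b by (simp add: Fract_eq_iff mult.commute)
    then have "c * y \<in> D" using ideal_poly_ringD(3)[OF iD s(2)] by simp
    then have "c * y \<in> gr D (int u + int t)" using hf_mult[OF s(4) y] by (simp add: gr_def)
    then show "\<exists>e b. b \<in> hf e \<and> b \<notin> P \<and> b * y \<in> gr D (e + int t)" using s by blast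
  qed
  then show ?thesis by (simp add: gr_def)
qed

lemma genideal_insert:
  fixes X :: "'n::{finite,linorder} mpoly set"
  assumes X: "homogeneous_ideal X" and h: "h \<in> hf e" "e \<ge> 0"
  shows "genideal poly_ring (insert h X) = tot (padd (gr X) e h)"
proof
  note g = gideal_gr[OF X] and tg = tot_gr[OF X]
  note gp = gideal_padd[OF g h(1)]
  have hi: "h \<in> tot (padd (gr X) e h)"
    using mem_padd[OF g, of h e] gideal_zero[OF gp] by (auto simp: tot_def hcomp_of_hf[OF h(1)])
  show "genideal poly_ring (insert h X) \<subseteq> tot (padd (gr X) e h)"
    by (rule genideal_least[OF ideal_tot[OF gp]]) (use hi tot_mono[OF le_padd, of "gr X" e h] tg in auto)
  note G = ideal_poly_ringD[OF genideal_ideal[of "insert h X"]]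
  show "tot (padd (gr X) e h) \<subseteq> genideal poly_ring (insert h X)"
  proof
    fix f assume f: "f \<in> tot (padd (gr X) e h)"
    have hc: "hcomp s f \<in> genideal poly_ring (insert h X)" for s
    proof -
      have "hcomp s f \<in> padd (gr X) e h s" using f by (simp add: tot_def)
      then obtain a g where "hcomp s f = a + h * g" "a \<in> gr X s" unfolding padd_def by blast
      moreover have "a \<in> genideal poly_ring (insert h X)" "h \<in> genideal poly_ring (insert h X)"
        using gr_subset_genideal[of "insert h X"] calculation by (auto simp: gr_def)
      ultimately show ?thesis using G(2) G(3)[of h g] by (simp add: mult.commute)
    qed
    have "sum (\<lambda>s. hcomp s f) A \<in> genideal poly_ring (insert h X)" if "finite A" for A
      using that by (induction A) (auto simp: G hc)
    from this[of "degs f"] show "f \<in> genideal poly_ring (insert h X)" by (simp add: sum_hcomp)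
  qed
qed

lemma hyperplane_section_eq:
  fixes X :: "'n::{finite,linorder} mpoly set"
  assumes X: "homogeneous_ideal X" and h: "h \<in> hf 1"
  shows "hyperplane_section X h = tot (sat (padd (gr X) 1 h))"
  unfolding hyperplane_section_def genideal_insert[OF X h zero_le_one]
  by (rule saturation_tot[OF gideal_padd[OF gideal_gr[OF X] h]])

text \<open>Dividing by a variable invertible at \<open>P\<close> turns the form \<open>h\<close>
  into a function. Saturation does not change the local ideal, since multiplication by a power of
  that variable undoes it.\<close>

lemma local_generator_hyperplane:
  fixes X :: "'n::{finite,linorder} mpoly set"
  assumes X: "integral_subscheme X" and h: "h \<in> hf 1" and P: "P \<in> points X" and i: "var i \<notin> P"
  shows "local_generator X (hyperplane_section X h) P (Fract h (var i))"
proof -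
  interpret P: integral_scheme P using P by unfold_locales (simp add: points_iff)
  have hX: "homogeneous_ideal X" using X by (simp add: integral_subscheme_def)
  note gX = gideal_gr[OF hX]
  define K where "K = genideal poly_ring (insert h X)"
  have K: "K = tot (padd (gr X) 1 h)" unfolding K_def by (rule genideal_insert[OF hX h zero_le_one])
  have gp: "gideal (padd (gr X) 1 h)" by (rule gideal_padd[OF gX h])
  have iK: "ideal K poly_ring" unfolding K by (rule ideal_tot[OF gp])
  let ?H = "hyperplane_section X h"
  have KH: "K \<subseteq> ?H" unfolding K hyperplane_section_eq[OF hX h] by (rule tot_mono[OF le_sat[OF gp]])
  have XK: "X \<subseteq> K" "h \<in> K" unfolding K_def using gr_subset_genideal by blast+
  have 1: "Fract h (var i) \<in> local_ring P"
    unfolding local_ring_iff using h i by (intro exI[of _ h] exI[of _ "var i"] exI[of _ 1]) simp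
  have v0: "var i \<noteq> (0 :: 'n mpoly)" by simp
  have "local_ideal ?H P = {g * Fract h (var i) + e | g e. g \<in> local_ring P \<and> e \<in> local_ideal X P}"
  proof (rule antisym; rule subsetI)
    fix x assume "x \<in> local_ideal ?H P"
    then obtain a b t where a: "x = Fract a b" "a \<in> ?H" "a \<in> hf (int t)" "b \<in> hf (int t)" "b \<notin> P"
      by (auto simp: local_ideal_iff)
    then obtain m where m: "\<And>g. g \<in> hf (int m) \<Longrightarrow> g * a \<in> K"
      unfolding hyperplane_section_def K_def by (auto simp: saturation_def forms_eq_hf)
    let ?v = "var i ^ m :: 'n mpoly"
    have vm: "?v \<in> hf (int m)" using hf_power[OF hf_var, of i m] by simp
    then have "?v * a \<in> gr K (int m + int t)" using m hf_mult[OF vm a(3)] by (simp add: gr_def)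
    then obtain e r where er: "?v * a = e + h * r" "e \<in> gr X (int m + int t)" "r \<in> hf (int m + int t - 1)"
      unfolding K gr_tot[OF gp] by (auto simp: padd_def)
    have vb: "?v * b \<notin> P" using P.notin_mult P.notin_power i a(5) by blast
    note nz = P.notin_nonzero[OF vb]
    have "x = Fract (?v * a) (?v * b)" using a(1) by (simp add: mult_fract_cancel)
    also have "\<dots> = Fract (r * var i) (?v * b) * Fract h (var i) + Fract e (?v * b)"
    proof -
      have "Fract (r * var i) (?v * b) * Fract h (var i) = Fract (h * r) (?v * b)"
        using nz v0 by (simp add: eq_fract algebra_simps)
      then show ?thesis using nz er(1) by (simp add: eq_fract algebra_simps)
    qed
    also have "Fract (r * var i) (?v * b) \<in> local_ring P"
      unfolding local_ring_iff
      using hf_mult[OF er(3) hf_var, of i] hf_mult[OF vm a(4)] vb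
      by (intro exI[of _ "r * var i"] exI[of _ "?v * b"] exI[of _ "m + t"]) simp
    moreover have "Fract e (?v * b) \<in> local_ideal X P"
      unfolding local_ideal_iff using er(2) hf_mult[OF vm a(4)] vb
      by (intro exI[of _ e] exI[of _ "?v * b"] exI[of _ "m + t"]) (simp add: gr_def)
    ultimately show "x \<in> {g * Fract h (var i) + e | g e. g \<in> local_ring P \<and> e \<in> local_ideal X P}" by blast
  next
    fix x assume "x \<in> {g * Fract h (var i) + e | g e. g \<in> local_ring P \<and> e \<in> local_ideal X P}"
    then obtain g e where x: "x = g * Fract h (var i) + e" "g \<in> local_ring P" "e \<in> local_ideal X P" by blast
    have "Fract h (var i) \<in> local_ideal K P" unfolding local_ideal_iff
      using h i XK by (intro exI[of _ h] exI[of _ "var i"] exI[of _ 1]) simp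
    then have "x \<in> local_ideal K P" unfolding x(1)
      using x P.local_ideal_mono[OF XK(1)] by (intro P.local_ideal_add P.local_ideal_mult iK) auto
    then show "x \<in> local_ideal ?H P" using P.local_ideal_mono[OF KH] by blast
  qed
  then show ?thesis using 1 by (simp add: local_generator_def)
qed

text \<open>If \<open>h\<close> vanished on \<open>X\<close>, the section would be all of
  \<open>X\<close>; its ideal in the function field is zero and has no generator that is a
  nonzerodivisor.\<close>

lemma hyperplane_notin:
  fixes X :: "'n::{finite,linorder} mpoly set"
  assumes X: "integral_subscheme X" and h: "h \<in> hf 1"
    and H: "effective_cartier_divisor X (hyperplane_section X h)"
  shows "h \<notin> X"
proof
  assume hX': "h \<in> X"
  interpret integral_scheme X by unfold_locales (rule X)
  have hX: "homogeneous_ideal X" using X by (simp add: integral_subscheme_def)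
  obtain i where i: "var i \<notin> gr X 1" using gprime_gr(2)[OF X] by blast
  have "padd (gr X) 1 h = gr X"
    using padd_least[OF gideal_gr[OF hX] order_refl, of h 1] le_padd[of "gr X" 1 h] hX' h
    by (auto simp: gr_def intro: antisym)
  then have HX: "hyperplane_section X h = X"
    using hyperplane_section_eq[OF hX h] gprime_saturated[OF gprime i] tot_gr[OF hX] by simp
  have "X \<in> points X" using X by (simp add: points_iff)
  then obtain f where f: "local_generator X X X f" "\<And>g. g \<in> local_ring X \<Longrightarrow> g * f \<in> local_ideal X X \<Longrightarrow> g \<in> local_ideal X X"
    using H unfolding HX effective_cartier_divisor_def by blast
  have "1 \<in> local_ring X"
    unfolding local_ring_iff using one_notin by (intro exI[of _ 1] exI[of _ 0]) (simp add: One_fract_def)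
  then have "1 \<in> local_ideal X X" using f(2)[of 1] local_generator_mem(2)[OF f(1) ideal] by simp
  then obtain a b where "Fract 1 1 = Fract a b" "a \<in> X" "b \<notin> X" by (auto simp: local_ideal_iff One_fract_def)
  then show False using notin_nonzero[of b] by (simp add: eq_fract)
qed

section \<open>Linear equivalence to a multiple of a hyperplane section\<close>

lemma Fract_powi:
  fixes a b :: "'a::idom"
  assumes "a \<noteq> 0" "b \<noteq> 0"
  shows "Fract a b powi k = Fract (a ^ nat k * b ^ nat (- k)) (b ^ nat k * a ^ nat (- k))"
proof (cases "k \<ge> 0")
  case True
  then show ?thesis by (simp add: power_int_def Fract_power)
next
  case False
  then show ?thesis by (simp add: power_int_def Fract_power power_inverse[symmetric])
qed

lemma effective_cartier_divisorD:
  assumes "effective_cartier_divisor X D"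
  shows "closed_subscheme D" "X \<subseteq> D" "P \<in> points X \<Longrightarrow> \<exists>f. local_generator X D P f"
  using assms unfolding effective_cartier_divisor_def by blast+

lemma closed_subscheme_ideal: "closed_subscheme D \<Longrightarrow> ideal D poly_ring"
  by (simp add: closed_subscheme_def homogeneous_ideal_def)

text \<open>\<open>A / B\<close> is the rational function times the k-th power of \<open>h\<close>,
  with \<open>nat k\<close> and \<open>nat (- k)\<close> separating the signs of the exponent.
  Clearing denominators in the relation at \<open>P\<close> says that, on \<open>X\<close>,
  \<open>A / B\<close> and x^k f1/f2 differ by the unit u1/u2.\<close>

lemma local_linear_equivalence:
  fixes X :: "'n::{finite,linorder} mpoly set"
  assumes X: "integral_subscheme X" and h: "h \<in> hf 1" "h \<notin> X"
    and A1: "A1 \<in> hf t0" and B1: "B1 \<in> hf t0" "B1 \<notin> X"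
    and D: "effective_cartier_divisor X D" and P: "P \<in> points X"
    and rel: "\<And>f g. local_generator X D P f \<Longrightarrow> local_generator X (hyperplane_section X h) P g \<Longrightarrow>
      \<exists>u\<in>local_units P. f - u * Fract A1 B1 * g powi k \<in> local_ideal X X"
  defines "A \<equiv> A1 * h ^ nat k" and "B \<equiv> B1 * h ^ nat (- k)"
  shows "\<exists>f1 f2 u1 u2 x d1 d2. local_generator X D P (Fract f1 f2) \<and> f1 \<in> hf (int d1) \<and> f2 \<in> hf (int d1) \<and> f2 \<notin> P \<and>
    u1 \<in> hf (int d2) \<and> u2 \<in> hf (int d2) \<and> u1 \<notin> P \<and> u2 \<notin> P \<and> x \<in> hf 1 \<and> x \<notin> P \<and>
    f1 * u2 * x ^ nat k * B - f2 * u1 * x ^ nat (- k) * A \<in> X"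
proof -
  interpret X: integral_scheme X by unfold_locales (rule X)
  interpret P: integral_scheme P using P by unfold_locales (simp add: points_iff)
  have XP: "X \<subseteq> P" using P by (simp add: points_iff)
  obtain f where f: "local_generator X D P f" using effective_cartier_divisorD(3)[OF D P] by blast
  obtain i where i: "var i \<notin> P" using P.ex_var by blast
  define x where "x = (var i :: 'n mpoly)"
  have x: "x \<in> hf 1" "x \<notin> P" using i by (simp_all add: x_def)
  obtain u where u: "u \<in> local_units P" "f - u * Fract A1 B1 * Fract h x powi k \<in> local_ideal X X"
    using rel[OF f local_generator_hyperplane[OF X h(1) P i]] unfolding x_def by blast
  obtain f1 f2 d1 where f12: "f = Fract f1 f2" "f1 \<in> hf (int d1)" "f2 \<in> hf (int d1)" "f2 \<notin> P"
    using P.local_generator_mem(1)[OF f X.ideal] by (auto simp: local_ring_iff)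
  obtain u1 u2 d2 where u12: "u = Fract u1 u2" "u1 \<in> hf (int d2)" "u2 \<in> hf (int d2)" "u1 \<notin> P" "u2 \<notin> P"
    using u(1) by (auto simp: local_units_def forms_eq_hf)
  define N where "N = f1 * u2 * x ^ nat k * B - f2 * u1 * x ^ nat (- k) * A"
  define M where "M = f2 * (u2 * (x ^ nat k * B))"
  have nx: "x \<notin> X" "f2 \<notin> X" "u2 \<notin> X" using XP x f12 u12 by auto
  have M: "M \<notin> X" unfolding M_def B_def
    using nx B1(2) h(2) by (intro X.notin_mult X.notin_power)
  note nz = X.notin_nonzero[OF nx(1)] X.notin_nonzero[OF nx(2)] X.notin_nonzero[OF nx(3)]
    X.notin_nonzero[OF h(2)] X.notin_nonzero[OF B1(2)]
  have "f - u * Fract A1 B1 * Fract h x powi k = Fract N M"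
    unfolding f12(1) u12(1) Fract_powi[OF nz(4,1)] N_def M_def A_def B_def
    using nz by (simp add: eq_fract algebra_simps)
  then obtain a b where ab: "Fract N M = Fract a b" "a \<in> X" "b \<notin> X"
    using u(2) by (auto simp: local_ideal_iff)
  then have "N * b = a * M" using X.notin_nonzero[OF M] X.notin_nonzero[OF ab(3)] by (simp add: eq_fract)
  then have "N * b \<in> X" using X.mult_right[OF ab(2)] by simp
  then have "N \<in> X" using X.prime ab(3) by blast
  then show ?thesis using f f12 u12 x unfolding N_def by blast
qed

text \<open>The forms that the rational section \<open>A / B\<close> multiplies into forms of degree
  \<open>e + k\<close> on \<open>X\<close>. With \<open>A\<close> and \<open>B\<close> exchanged and
  \<open>k\<close> negated, these are instead the forms equal on \<open>X\<close> to
  \<open>A / B\<close> times a form.\<close>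

definition numerators :: "'n::{finite,linorder} mpoly set \<Rightarrow> int \<Rightarrow> 'n mpoly \<Rightarrow> 'n mpoly \<Rightarrow> 'n cfam" where
  "numerators X k B A e = {q \<in> hf e. \<exists>p\<in>hf (e + k). B * p - A * q \<in> X}"

context integral_scheme
begin

lemma diff_commute: "f - g \<in> P \<longleftrightarrow> g - f \<in> P"
  using mult[of "f - g" "-1"] mult[of "g - f" "-1"] by auto

lemma gideal_numerators: "gideal (numerators P k B A)"
proof (rule gidealI)
  fix t show "0 \<in> numerators P k B A t" unfolding numerators_def using zero by (auto intro!: bexI[of _ 0])
next
  fix t and f g :: "'n mpoly" assume "f \<in> numerators P k B A t" "g \<in> numerators P k B A t"
  then obtain p p' where p: "p \<in> hf (t + k)" "B * p - A * f \<in> P" "p' \<in> hf (t + k)" "B * p' - A * g \<in> P"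
    "f \<in> hf t" "g \<in> hf t" by (auto simp: numerators_def)
  have "B * (p + p') - A * (f + g) = (B * p - A * f) + (B * p' - A * g)" by (simp add: algebra_simps)
  then have "B * (p + p') - A * (f + g) \<in> P" using add[OF p(2,4)] by simp
  then show "f + g \<in> numerators P k B A t" using hf_add[OF p(1,3)] hf_add[OF p(5,6)] by (auto simp: numerators_def)
next
  fix t e and f g :: "'n mpoly" assume "f \<in> numerators P k B A t" "g \<in> hf e"
  then obtain p where p: "p \<in> hf (t + k)" "B * p - A * f \<in> P" "f \<in> hf t" "g \<in> hf e" by (auto simp: numerators_def)
  have "B * (g * p) - A * (g * f) = g * (B * p - A * f)" by (simp add: algebra_simps)
  then have "B * (g * p) - A * (g * f) \<in> P" using mult[OF p(2), of g] by simp
  moreover have "g * p \<in> hf (e + t + k)" using hf_mult[OF p(4,1)] by (simp add: add.assoc)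
  ultimately show "g * f \<in> numerators P k B A (e + t)" using hf_mult[OF p(4,3)] by (auto simp: numerators_def)
qed (simp add: numerators_def)

lemma le_numerators: "gr P \<le> numerators P k B A"
proof (rule le_funI, rule subsetI)
  fix t f assume "f \<in> gr P t"
  then have "f \<in> hf t" "B * 0 - A * f \<in> P" using mult[of f "- A"] by (simp_all add: gr_def)
  then show "f \<in> numerators P k B A t" unfolding numerators_def using hf_zero by blast
qed

end

theorem cartier_twisted_divisor:
  fixes X :: "'n::{finite,linorder} mpoly set"
  assumes X: "integral_subscheme X" and D: "effective_cartier_divisor X D" and h: "h \<in> hf 1"
    and le: "linearly_equivalent_to_multiple X D k (hyperplane_section X h)"
  shows "twisted_divisor (gr X) (gr D) k"
proof -
  interpret X: integral_scheme X by unfold_locales (rule X)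
  have H: "effective_cartier_divisor X (hyperplane_section X h)"
    using le by (simp add: linearly_equivalent_to_multiple_def)
  have hX: "h \<notin> X" by (rule hyperplane_notin[OF X h H])
  obtain \<phi> where \<phi>: "\<phi> \<in> local_ring X" "\<phi> \<notin> local_ideal X X"
    and rel: "\<And>P f g. P \<in> points X \<Longrightarrow> local_generator X D P f \<Longrightarrow> local_generator X (hyperplane_section X h) P g \<Longrightarrow>
      \<exists>u\<in>local_units P. f - u * \<phi> * g powi k \<in> local_ideal X X"
    using le unfolding linearly_equivalent_to_multiple_def by blast
  obtain A1 B1 t0 where AB1: "\<phi> = Fract A1 B1" "A1 \<in> hf (int t0)" "B1 \<in> hf (int t0)" "B1 \<notin> X"
    using \<phi>(1) by (auto simp: local_ring_iff)
  have A1: "A1 \<notin> X" using \<phi>(2) AB1 by (auto simp: local_ideal_iff)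
  define A where "A = A1 * h ^ nat k"
  define B where "B = B1 * h ^ nat (- k)"
  define a where "a = int t0 + int (nat k)"
  define b where "b = int t0 + int (nat (- k))"
  have AB: "A \<in> hf a" "B \<in> hf b"
    unfolding A_def B_def a_def b_def
    using hf_mult[OF AB1(2) hf_power[OF h, of "nat k"]] hf_mult[OF AB1(3) hf_power[OF h, of "nat (- k)"]] by simp_all
  have AX: "A \<notin> X" "B \<notin> X" unfolding A_def B_def
    using A1 AB1(4) hX by (simp_all add: X.notin_mult X.notin_power)
  have k: "k = a - b" by (simp add: a_def b_def)
  note gX = gprime_gideal[OF X.gprime] and tX = gprime_gr(3)[OF X]
  note sD = sat_gr[OF effective_cartier_divisorD(1)[OF D]]
  have XD: "X \<subseteq> D" by (rule effective_cartier_divisorD(2)[OF D])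
  have iD: "ideal D poly_ring" by (rule closed_subscheme_ideal[OF effective_cartier_divisorD(1)[OF D]])
  have cancelB: "y \<in> X" if "B * y \<in> X" for y using X.prime that AX by blast
  have loc: "\<exists>f1 f2 u1 u2 x d1 d2. local_generator X D P (Fract f1 f2) \<and> f1 \<in> hf (int d1) \<and> f2 \<in> hf (int d1) \<and> f2 \<notin> P \<and>
    u1 \<in> hf (int d2) \<and> u2 \<in> hf (int d2) \<and> u1 \<notin> P \<and> u2 \<notin> P \<and> x \<in> hf 1 \<and> x \<notin> P \<and>
    f1 * u2 * x ^ nat k * B - f2 * u1 * x ^ nat (- k) * A \<in> X" if P: "P \<in> points X" for P
    unfolding A_def B_def
    by (rule local_linear_equivalence[OF X h hX AB1(2,3,4) D P]) (use rel[OF P] AB1(1) in blast)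
  have points: "tot P' \<in> points X" "gr (tot P') = P'" if "gprime P'" "gr X \<le> P'" "var i \<notin> P' 1" for P' i
  proof -
    have "X \<subseteq> tot P'" using tot_mono[OF that(2)] tX by simp
    then show "tot P' \<in> points X" using integral_subscheme_tot[OF that(1,3)] by (simp add: points_iff)
    show "gr (tot P') = P'" by (rule gr_tot[OF gprime_gideal[OF that(1)]])
  qed
  \<comment> \<open>The local denominators lie in \<open>Q\<close> and avoid the prime in question,
    so no relevant prime contains \<open>Q\<close>; in high degrees \<open>A / B\<close> thus
    multiplies every form into a form on \<open>X\<close>.\<close>
  define Q where "Q e = {q \<in> hf e. \<exists>p\<in>hf (e + k). B * p - A * q \<in> X}" for e
  have gQ: "gideal Q" and XQ: "gr X \<le> Q"
  proof -
    have "Q = numerators X k B A" unfolding Q_def numerators_def fun_eq_iff by simp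
    then show "gideal Q" "gr X \<le> Q" using X.gideal_numerators X.le_numerators by simp_all
  qed
  have "\<exists>t1. \<forall>t\<ge>t1. Q t = hf t"
  proof (rule contains_high_degree[OF gQ])
    fix P' i assume P': "gprime P'" "Q \<le> P'" "var i \<notin> P' 1"
    note pt = points[OF P'(1) order_trans[OF XQ P'(2)] P'(3)]
    interpret P: integral_scheme "tot P'" using pt(1) by unfold_locales (simp add: points_iff)
    obtain f1 f2 u1 u2 x d1 d2 where f: "f1 \<in> hf (int d1)" "f2 \<in> hf (int d1)" "f2 \<notin> tot P'"
      "u1 \<in> hf (int d2)" "u2 \<in> hf (int d2)" "u1 \<notin> tot P'" "x \<in> hf 1" "x \<notin> tot P'"
      "f1 * u2 * x ^ nat k * B - f2 * u1 * x ^ nat (- k) * A \<in> X" using loc[OF pt(1)] by blast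
    let ?q = "f2 * u1 * x ^ nat (- k)" and ?p = "f1 * u2 * x ^ nat k"
    let ?e = "int d1 + int d2 + int (nat (- k))"
    have xt: "x ^ j \<in> hf (int j)" for j using hf_power[OF f(7), of j] by simp
    have q: "?q \<in> hf ?e" by (rule hf_mult[OF hf_mult[OF f(2,4)] xt])
    have "?p \<in> hf (int d1 + int d2 + int (nat k))" by (rule hf_mult[OF hf_mult[OF f(1,5)] xt])
    moreover have "int d1 + int d2 + int (nat k) = ?e + k" by simp
    ultimately have "?p \<in> hf (?e + k)" by (simp only:)
    moreover have "B * ?p - A * ?q \<in> X" using f(9) by (simp add: ac_simps)
    ultimately have "?q \<in> Q ?e" using q unfolding Q_def by blast
    then have "?q \<in> P' ?e" by (rule subsetD[OF le_funD[OF P'(2)]])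
    then have "?q \<in> gr (tot P') ?e" by (simp only: pt(2))
    moreover have "?q \<notin> tot P'" using f by (intro P.notin_mult P.notin_power)
    ultimately show False by (simp add: gr_def)
  qed
  then obtain t1 where t1: "\<And>t. t \<ge> t1 \<Longrightarrow> Q t = hf t" by blast
  \<comment> \<open>\<open>D'\<close> consists of the forms equal on \<open>X\<close> to
    \<open>A / B\<close> times a form. It agrees with \<open>gr D\<close> at every point, hence up
    to saturation, hence in high degrees.\<close>
  define D' where "D' \<tau> = {y \<in> hf \<tau>. \<exists>g\<in>hf (\<tau> - k). B * y - A * g \<in> X}" for \<tau>
  have "D' = numerators X (- k) A B"
    unfolding D'_def numerators_def fun_eq_iff using X.diff_commute by auto
  then have gD': "gideal D'" and XD': "gr X \<le> D'" using X.gideal_numerators X.le_numerators by simp_all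
  have D'D: "y \<in> gr D \<tau>" if y: "y \<in> D' \<tau>" for y \<tau>
  proof (cases "\<tau> \<ge> 0")
    case False
    then have "y = 0" using gideal_hf[OF gD' y] hf_neg[of \<tau>] by (metis not_le singletonD)
    then show ?thesis using gideal_zero[OF sD(1)] by simp
  next
    case True
    obtain t where t: "\<tau> = int t" using True nonneg_int_cases by blast
    obtain g where g: "y \<in> hf (int t)" "g \<in> hf (int t - k)" "B * y - A * g \<in> X" using y by (auto simp: D'_def t)
    have "y \<in> D"
    proof (rule mem_of_local_ideal[OF effective_cartier_divisorD(1,2)[OF D] X g(1)])
      fix P assume P: "P \<in> points X"
      then interpret P: integral_scheme P by unfold_locales (simp add: points_iff)
      obtain f1 f2 u1 u2 x d1 d2 where f: "local_generator X D P (Fract f1 f2)" "f1 \<in> hf (int d1)" "f2 \<in> hf (int d1)" "f2 \<notin> P"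
        "u1 \<in> hf (int d2)" "u2 \<in> hf (int d2)" "u1 \<notin> P" "x \<in> hf 1" "x \<notin> P"
        "f1 * u2 * x ^ nat k * B - f2 * u1 * x ^ nat (- k) * A \<in> X" using loc[OF P] by blast
      let ?q = "f2 * u1 * x ^ nat (- k)" and ?p = "f1 * u2 * x ^ nat k"
      define x0 where "x0 = y * ?q - ?p * g"
      have "B * x0 = ?q * (B * y - A * g) - g * (?p * B - ?q * A)" by (simp add: x0_def algebra_simps)
      also have "\<dots> \<in> X" by (intro X.diff X.mult g(3) f(10))
      finally have x0: "x0 \<in> X" by (rule cancelB)
      define w where "w = u1 * x ^ nat (- k) * x ^ t"
      have w: "w \<notin> P" "f2 * w \<notin> P" unfolding w_def using f by (simp_all add: P.notin_mult P.notin_power)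
      have xt: "x ^ j \<in> hf (int j)" for j using hf_power[OF f(8), of j] by simp
      have wh: "w \<in> hf (int (d2 + nat (- k) + t))"
        unfolding w_def of_nat_add by (rule hf_mult[OF hf_mult[OF f(5) xt] xt])
      have eq: "Fract y (x ^ t) = Fract (u2 * x ^ nat k * g) w * Fract f1 f2 + Fract x0 (f2 * w)"
        using P.notin_nonzero[OF w(1)] P.notin_nonzero[OF f(4)] P.notin_nonzero[OF f(9)] P.notin_nonzero[OF f(7)]
        by (simp add: eq_fract w_def x0_def) (simp add: algebra_simps)
      have "u2 * x ^ nat k * g \<in> hf (int d2 + int (nat k) + (int t - k))"
        by (rule hf_mult[OF hf_mult[OF f(6) xt] g(2)])
      moreover have "int d2 + int (nat k) + (int t - k) = int (d2 + nat (- k) + t)" by simp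
      ultimately have "u2 * x ^ nat k * g \<in> hf (int (d2 + nat (- k) + t))" by (simp only:)
      then have "Fract (u2 * x ^ nat k * g) w \<in> local_ring P"
        unfolding local_ring_iff using wh w(1) by blast
      moreover have "Fract x0 (f2 * w) \<in> local_ideal X P"
      proof -
        have fw: "f2 * w \<in> hf (int (d1 + (d2 + nat (- k) + t)))" unfolding of_nat_add[of d1] by (rule hf_mult[OF f(3) wh])
        have "y * ?q \<in> hf (int t + (int d1 + int d2 + int (nat (- k))))"
          by (rule hf_mult[OF g(1) hf_mult[OF hf_mult[OF f(3,5)] xt]])
        moreover have "?p * g \<in> hf ((int d1 + int d2 + int (nat k)) + (int t - k))"
          by (rule hf_mult[OF hf_mult[OF hf_mult[OF f(2,6)] xt] g(2)])
        moreover have "int t + (int d1 + int d2 + int (nat (- k))) = int (d1 + (d2 + nat (- k) + t))"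
          "(int d1 + int d2 + int (nat k)) + (int t - k) = int (d1 + (d2 + nat (- k) + t))" by simp_all
        ultimately have "x0 \<in> hf (int (d1 + (d2 + nat (- k) + t)))" unfolding x0_def by (metis hf_diff)
        then show ?thesis unfolding local_ideal_iff using x0 fw w(2) by blast
      qed
      ultimately have "Fract y (x ^ t) \<in> local_ideal D P"
        using f(1) unfolding local_generator_def eq by blast
      then show "\<exists>b. b \<in> hf (int t) \<and> b \<notin> P \<and> Fract y b \<in> local_ideal D P"
        using xt[of t] P.notin_power[OF f(9)] by blast
    qed
    then show ?thesis using g(1) by (simp add: gr_def t)
  qed
  have DD': "y \<in> sat D' \<tau>" if y: "y \<in> gr D \<tau>" for y \<tau>
  proof (cases "\<tau> \<ge> 0")
    case False
    then have "y = 0" using gideal_hf[OF sD(1) y] hf_neg[of \<tau>] by (metis not_le singletonD)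
    then show ?thesis using gideal_zero[OF gideal_sat[OF gD']] by simp
  next
    case True
    obtain t where t: "\<tau> = int t" using True nonneg_int_cases by blast
    have yh: "y \<in> hf (int t)" and yD: "y \<in> D" using y by (auto simp: gr_def t)
    show ?thesis unfolding t
    proof (rule mem_of_local_multiples[OF gideal_sat[OF gD'] sat_sat[OF gD'] _ tX yh])
      show "gr X \<le> sat D'" by (rule order_trans[OF XD' le_sat[OF gD']])
      fix P assume P: "P \<in> points X"
      then interpret P: integral_scheme P by unfold_locales (simp add: points_iff)
      obtain f1 f2 u1 u2 x d1 d2 where f: "local_generator X D P (Fract f1 f2)" "f1 \<in> hf (int d1)" "f2 \<in> hf (int d1)" "f2 \<notin> P"
        "u1 \<in> hf (int d2)" "u2 \<in> hf (int d2)" "u2 \<notin> P" "x \<in> hf 1" "x \<notin> P"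
        "f1 * u2 * x ^ nat k * B - f2 * u1 * x ^ nat (- k) * A \<in> X" using loc[OF P] by blast
      let ?q = "f2 * u1 * x ^ nat (- k)" and ?p = "f1 * u2 * x ^ nat k"
      have xt: "x ^ j \<in> hf (int j)" for j using hf_power[OF f(8), of j] by simp
      have "Fract y (x ^ t) \<in> local_ideal D P"
        unfolding local_ideal_iff using yD yh xt[of t] P.notin_power[OF f(9), of t] by blast
      then obtain g e where ge: "Fract y (x ^ t) = g * Fract f1 f2 + e" "g \<in> local_ring P" "e \<in> local_ideal X P"
        using f(1) unfolding local_generator_def by blast
      obtain g1 g2 r where g: "g = Fract g1 g2" "g1 \<in> hf (int r)" "g2 \<in> hf (int r)" "g2 \<notin> P"
        using ge(2) by (auto simp: local_ring_iff)
      obtain e1 e2 r' where e: "e = Fract e1 e2" "e1 \<in> X" "e1 \<in> hf (int r')" "e2 \<in> hf (int r')" "e2 \<notin> P"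
        using ge(3) by (auto simp: local_ideal_iff)
      define b where "b = g2 * f2 * e2 * u2 * x ^ nat k"
      define z where "z = x ^ t * e2 * g1 * ?q"
      have "y * (g2 * f2 * e2) = x ^ t * (g1 * f1 * e2 + e1 * g2 * f2)"
        using ge(1) P.notin_nonzero[OF f(9)] P.notin_nonzero[OF f(4)] P.notin_nonzero[OF g(4)] P.notin_nonzero[OF e(5)]
        unfolding g(1) e(1) by (simp add: eq_fract algebra_simps)
      then have "B * (b * y) = B * (u2 * x ^ nat k) * (x ^ t * (g1 * f1 * e2 + e1 * g2 * f2))"
        unfolding b_def by (simp add: ac_simps)
      then have "B * (b * y) - A * z = x ^ t * e2 * g1 * (?p * B - ?q * A) + (B * (u2 * x ^ nat k) * x ^ t * g2 * f2) * e1"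
        unfolding z_def by (simp add: algebra_simps)
      also have "\<dots> \<in> X" by (intro X.add X.mult e(2) f(10))
      finally have rel: "B * (b * y) - A * z \<in> X" .
      let ?e = "int r + int d1 + int r' + int d2 + int (nat k)"
      have bh: "b \<in> hf ?e" unfolding b_def
        by (intro hf_mult g(3) f(3) e(4) f(6) xt)
      have "z \<in> hf (int t + int r' + int r + (int d1 + int d2 + int (nat (- k))))" unfolding z_def
        by (intro hf_mult g(2) f(3,5) e(4) xt)
      moreover have "int t + int r' + int r + (int d1 + int d2 + int (nat (- k))) = ?e + int t - k" by simp
      ultimately have "z \<in> hf (?e + int t - k)" by (simp only:)
      then have "b * y \<in> D' (?e + int t)" unfolding D'_def using rel hf_mult[OF bh yh] by blast
      moreover have "b \<notin> P" unfolding b_def using f g e by (intro P.notin_mult P.notin_power)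
      ultimately show "\<exists>e b. b \<in> hf e \<and> b \<notin> P \<and> b * y \<in> sat D' (e + int t)"
        using bh le_sat[OF gD'] by (auto simp: le_fun_def)
    qed
  qed
  obtain t2 where t2: "\<And>t. t \<ge> t2 \<Longrightarrow> sat D' t = D' t" using sat_eventually[OF gD'] by blast
  have eq: "gr D t = D' t" if "t \<ge> t2" for t using D'D DD' t2[OF that] by blast
  have grX: "y \<in> gr X t \<longleftrightarrow> y \<in> X" if "y \<in> hf t" for y t using that by (simp add: gr_def)
  have deg: "B * y - A * g \<in> hf (t + a)" if "y \<in> hf (t + k)" "g \<in> hf t" for y g t
    using hf_mult[OF AB(2) that(1)] hf_mult[OF AB(1) that(2)] by (intro hf_diff) (simp_all add: k ac_simps)
  show ?thesis unfolding twisted_divisor_def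
  proof (intro exI conjI allI impI ballI)
    show "A \<in> hf a" "B \<in> hf b" "k = a - b" by (fact AB k)+
    show "A \<notin> gr X a" "B \<notin> gr X b" using AX by (simp_all add: gr_def)
    fix t assume t: "t \<ge> max t1 (t2 - k)"
    show "\<exists>y\<in>hf (t + k). B * y - A * g \<in> gr X (t + a)" if "g \<in> hf t" for g
    proof -
      have "g \<in> Q t" using t1[of t] t that by simp
      then show ?thesis using deg that unfolding Q_def by (auto simp: gr_def)
    qed
    fix y :: "'n mpoly" assume y: "y \<in> hf (t + k)"
    have "y \<in> gr D (t + k) \<longleftrightarrow> y \<in> D' (t + k)" using eq[of "t + k"] t by simp
    also have "\<dots> \<longleftrightarrow> (\<exists>g\<in>hf t. B * y - A * g \<in> gr X (t + a))"
      using y deg[OF y] by (auto simp: D'_def gr_def)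
    finally show "y \<in> gr D (t + k) \<longleftrightarrow> (\<exists>g\<in>hf t. B * y - A * g \<in> gr X (t + a))" .
  qed
qed

section \<open>Sums of divisors\<close>

lemma local_generator_prod_list:
  fixes X :: "'n::{finite,linorder} mpoly set"
  assumes X: "integral_subscheme X" and P: "P \<in> points X" and x: "x \<in> hf 1" "x \<notin> P"
    and D: "\<And>i. i \<in> set es \<Longrightarrow> local_generator X (D i) P (f i)"
    and y: "list_all2 (\<lambda>y i. y \<in> gr (D i) (int (\<tau> y))) ys es"
  shows "\<exists>g e t. prod_list ys \<in> hf (int t) \<and> g \<in> local_ring P \<and> e \<in> local_ideal X P \<and>
    Fract (prod_list ys) (x ^ t) = g * prod_list (map f es) + e"
  using y D
proof (induction ys es rule: list_all2_induct)
  case Nil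
  interpret X: integral_scheme X by unfold_locales (rule X)
  interpret P: integral_scheme P using P by unfold_locales (simp add: points_iff)
  have "(1 :: 'n mpoly fract) = Fract 1 1" "(0 :: 'n mpoly fract) = Fract 0 1"
    by (simp_all add: One_fract_def Zero_fract_def)
  moreover have "(1 :: 'n mpoly) \<in> hf (int 0)" by simp
  ultimately have 1: "(1 :: 'n mpoly fract) \<in> local_ring P" and 0: "(0 :: 'n mpoly fract) \<in> local_ideal X P"
    unfolding local_ring_iff local_ideal_iff using P.one_notin hf_zero X.zero by blast+
  then show ?case by (intro exI[of _ 1] exI[of _ 0] exI[of _ 0]) (simp add: One_fract_def)
next
  case (Cons y ys i es)
  interpret X: integral_scheme X by unfold_locales (rule X)
  interpret P: integral_scheme P using P by unfold_locales (simp add: points_iff)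
  have xt: "x ^ j \<in> hf (int j)" for j using hf_power[OF x(1), of j] by simp
  obtain g e t where IH: "prod_list ys \<in> hf (int t)" "g \<in> local_ring P" "e \<in> local_ideal X P"
    "Fract (prod_list ys) (x ^ t) = g * prod_list (map f es) + e" using Cons.IH Cons.prems by auto
  have yD: "y \<in> D i" "y \<in> hf (int (\<tau> y))" using Cons.hyps by (auto simp: gr_def)
  note gen = Cons.prems[of i, simplified]
  have "Fract y (x ^ \<tau> y) \<in> local_ideal (D i) P"
    unfolding local_ideal_iff using yD xt P.notin_power[OF x(2)] by blast
  then obtain g' e' where g': "g' \<in> local_ring P" "e' \<in> local_ideal X P" "Fract y (x ^ \<tau> y) = g' * f i + e'"
    using gen unfolding local_generator_def by blast
  have lr: "f i \<in> local_ring P" using P.local_generator_mem(1)[OF gen X.ideal] .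
  have lrp: "prod_list (map f es') \<in> local_ring P" if "set es' \<subseteq> set es" for es'
    using that
  proof (induction es')
    case Nil
    then show ?case unfolding local_ring_iff using P.one_notin by (intro exI[of _ 1] exI[of _ 0]) (simp add: One_fract_def)
  next
    case (Cons j es')
    have "f j \<in> local_ring P"
      using P.local_generator_mem(1)[OF _ X.ideal] \<open>\<And>i'. i' \<in> set (i # es) \<Longrightarrow> _\<close> Cons.prems by auto
    then show ?case using Cons by (simp add: P.local_ring_mult)
  qed
  have "Fract (y * prod_list ys) (x ^ (\<tau> y + t)) = Fract y (x ^ \<tau> y) * Fract (prod_list ys) (x ^ t)"
    by (simp add: power_add)
  also have "\<dots> = (g' * g) * (f i * prod_list (map f es)) + ((g' * f i) * e + ((g * prod_list (map f es)) * e' + e' * e))"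
    unfolding g'(3) IH(4) by (simp add: algebra_simps)
  finally have eq: "Fract (prod_list (y # ys)) (x ^ (\<tau> y + t)) = (g' * g) * prod_list (map f (i # es)) +
    ((g' * f i) * e + ((g * prod_list (map f es)) * e' + e' * e))" by simp
  have e'r: "e' \<in> local_ring P" using g'(2) unfolding local_ideal_iff local_ring_iff by blast
  have "(g' * f i) * e + ((g * prod_list (map f es)) * e' + e' * e) \<in> local_ideal X P"
    using IH(2,3) g'(1,2) lr lrp[OF order_refl] e'r
    by (intro P.local_ideal_add P.local_ideal_mult P.local_ring_mult X.ideal)
  moreover have "g' * g \<in> local_ring P" using IH(2) g'(1) by (rule P.local_ring_mult[rotated])
  moreover have "prod_list (y # ys) \<in> hf (int (\<tau> y + t))" using hf_mult[OF yD(2) IH(1)] by simp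
  ultimately show ?case using eq by blast
qed

text \<open>At a point, each factor is modulo \<open>X\<close> a multiple of the local generator of
  its divisor, and the product of these generators is the local generator of \<open>S\<close>. The
  list \<open>es\<close> repeats each component according to its multiplicity.\<close>

lemma divisor_sum_prod_mem:
  fixes X :: "'n::{finite,linorder} mpoly set"
  assumes X: "integral_subscheme X" and S: "is_divisor_sum X l m D S"
    and D: "\<And>i. i \<in> {1..l} \<Longrightarrow> effective_cartier_divisor X (D i)"
    and es: "mset es = (\<Sum>i\<in>{1..l}. replicate_mset (m i) i)"
    and y: "list_all2 (\<lambda>y i. y \<in> gr (D i) (int (\<tau> y))) ys es"
  shows "prod_list ys \<in> S"
proof -
  interpret X: integral_scheme X by unfold_locales (rule X)
  have S': "effective_cartier_divisor X S" using S by (simp add: is_divisor_sum_def)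
  have set_es: "set es \<subseteq> {1..l}"
  proof
    fix i assume "i \<in> set es"
    then have "i \<in># (\<Sum>i\<in>{1..l}. replicate_mset (m i) i)" using es by (metis set_mset_mset)
    then show "i \<in> {1..l}" by (auto simp: set_mset_sum split: if_splits)
  qed
  have prod: "prod_list (map f es) = (\<Prod>i\<in>{1..l}. f i ^ m i)" for f :: "nat \<Rightarrow> 'n mpoly fract"
  proof -
    have "prod_list (map f es) = prod_mset (image_mset f (mset es))" by (simp flip: prod_mset_prod_list)
    also have "\<dots> = (\<Prod>i\<in>{1..l}. f i ^ m i)"
    proof -
      have "prod_mset (image_mset f (\<Sum>i\<in>A. replicate_mset (m i) i)) = (\<Prod>i\<in>A. f i ^ m i)" if "finite A" for A
        using that by (induction A) simp_all
      then show ?thesis unfolding es by simp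
    qed
    finally show ?thesis .
  qed
  have "\<exists>t. prod_list ys \<in> hf (int t)"
    using y
  proof (induction ys es rule: list_all2_induct)
    case Nil
    show ?case by (intro exI[of _ 0]) simp
  next
    case (Cons y ys i es)
    then obtain t where "prod_list ys \<in> hf (int t)" by blast
    then have "y * prod_list ys \<in> hf (int (\<tau> y + t))"
      using Cons.hyps hf_mult[of y "int (\<tau> y)" "prod_list ys" "int t"] by (simp add: gr_def)
    then show ?case by (intro exI[of _ "\<tau> y + t"]) simp
  qed
  then obtain t where t: "prod_list ys \<in> hf (int t)" by blast
  show ?thesis
  proof (cases "prod_list ys = 0")
    case True
    then show ?thesis
      using ideal_poly_ringD(1)[OF closed_subscheme_ideal[OF effective_cartier_divisorD(1)[OF S']]] by simp
  next
    case nz: False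
    show ?thesis
    proof (rule mem_of_local_ideal[OF effective_cartier_divisorD(1,2)[OF S'] X t])
      fix P assume P: "P \<in> points X"
      then interpret P: integral_scheme P by unfold_locales (simp add: points_iff)
      obtain i where i: "var i \<notin> P" using P.ex_var by blast
      have "\<forall>i\<in>{1..l}. \<exists>f. local_generator X (D i) P f" using effective_cartier_divisorD(3)[OF D P] by blast
      then obtain f where f: "\<And>i. i \<in> {1..l} \<Longrightarrow> local_generator X (D i) P (f i)" by metis
      have gS: "local_generator X S P (\<Prod>i\<in>{1..l}. f i ^ m i)"
        using S P f unfolding is_divisor_sum_def by blast
      obtain g e t' where g: "prod_list ys \<in> hf (int t')" "g \<in> local_ring P" "e \<in> local_ideal X P"
        "Fract (prod_list ys) (var i ^ t') = g * prod_list (map f es) + e"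
        using local_generator_prod_list[OF X P hf_var i _ y, of f] f set_es by blast
      \<comment> \<open>A nonzero form has only one degree, so the degree found at this point is the
        fixed \<open>t\<close>.\<close>
      have "t' = t" using g(1) t nz hcomp_of_hf[OF t, of "int t'"] hcomp_of_hf[OF g(1), of "int t'"]
        by (auto split: if_splits)
      then have "Fract (prod_list ys) (var i ^ t) \<in> local_ideal S P"
        using g gS unfolding local_generator_def prod by blast
      then show "\<exists>b. b \<in> hf (int t) \<and> b \<notin> P \<and> Fract (prod_list ys) b \<in> local_ideal S P"
        using hf_power[OF hf_var, of i t] P.notin_power[OF i] by (intro exI[of _ "var i ^ t"]) simp
    qed
  qed
qed

lemma divisor_sum_subset:
  fixes X :: "'n::{finite,linorder} mpoly set"
  assumes X: "integral_subscheme X" and S: "is_divisor_sum X l m D S"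
    and D: "\<And>i. i \<in> {1..l} \<Longrightarrow> effective_cartier_divisor X (D i)"
    and j: "j \<in> {1..l}" "m j > 0"
  shows "S \<subseteq> D j"
proof -
  interpret X: integral_scheme X by unfold_locales (rule X)
  have S': "effective_cartier_divisor X S" using S by (simp add: is_divisor_sum_def)
  note cS = sat_gr[OF effective_cartier_divisorD(1)[OF S']]
  note cD = sat_gr[OF effective_cartier_divisorD(1)[OF D[OF j(1)]]]
  have iD: "ideal (D j) poly_ring" by (rule closed_subscheme_ideal[OF effective_cartier_divisorD(1)[OF D[OF j(1)]]])
  have main: "y \<in> D j" if y: "y \<in> S" "y \<in> hf (int t)" for y t
  proof (rule mem_of_local_ideal[OF effective_cartier_divisorD(1,2)[OF D[OF j(1)]] X y(2)])
    fix P assume P: "P \<in> points X"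
    then interpret P: integral_scheme P by unfold_locales (simp add: points_iff)
    obtain i where i: "var i \<notin> P" using P.ex_var by blast
    have "\<forall>i\<in>{1..l}. \<exists>f. local_generator X (D i) P f" using effective_cartier_divisorD(3)[OF D P] by blast
    then obtain f where f: "\<And>i. i \<in> {1..l} \<Longrightarrow> local_generator X (D i) P (f i)" by metis
    have gS: "local_generator X S P (\<Prod>i\<in>{1..l}. f i ^ m i)"
      using S P f unfolding is_divisor_sum_def by blast
    have vt: "var i ^ t \<in> hf (int t)" "var i ^ t \<notin> P" using hf_power[OF hf_var, of i t] P.notin_power[OF i] by simp_all
    have "Fract y (var i ^ t) \<in> local_ideal S P" unfolding local_ideal_iff using y vt by blast
    then obtain g e where g: "Fract y (var i ^ t) = g * (\<Prod>i\<in>{1..l}. f i ^ m i) + e"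
      "g \<in> local_ring P" "e \<in> local_ideal X P" using gS unfolding local_generator_def by blast
    have one: "1 \<in> local_ring P"
      unfolding local_ring_iff using P.one_notin by (intro exI[of _ 1] exI[of _ 0]) (simp add: One_fract_def)
    have pw: "x ^ k \<in> local_ring P" if "x \<in> local_ring P" for x k
      using that by (induction k) (auto simp: one P.local_ring_mult)
    have "(\<Prod>i\<in>A. f i ^ m i) \<in> local_ring P" if "finite A" "A \<subseteq> {1..l}" for A
      using that
    proof (induction A)
      case (insert k A)
      then show ?case
        using P.local_generator_mem(1)[OF f[of k] X.ideal] by (simp add: P.local_ring_mult pw)
    qed (simp add: one)
    then have pr: "(\<Prod>i\<in>{1..l} - {j}. f i ^ m i) \<in> local_ring P" by blast
    obtain m' where m': "m j = Suc m'" using j(2) gr0_implies_Suc by blast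
    have eq1: "g * (\<Prod>i\<in>{1..l}. f i ^ m i) = (g * (\<Prod>i\<in>{1..l} - {j}. f i ^ m i) * f j ^ m') * f j"
      using j(1) by (subst prod.remove[of "{1..l}" j]) (simp_all add: m' ac_simps)
    have mem1: "(g * (\<Prod>i\<in>{1..l} - {j}. f i ^ m i) * f j ^ m') * f j \<in> local_ideal (D j) P"
      using g(2) pr pw P.local_generator_mem[OF f[OF j(1)] X.ideal]
      by (intro P.local_ideal_mult iD P.local_ring_mult) auto
    have mem2: "e \<in> local_ideal (D j) P"
      using g(3) P.local_ideal_mono[OF effective_cartier_divisorD(2)[OF D[OF j(1)]]] by blast
    have "Fract y (var i ^ t) \<in> local_ideal (D j) P"
      unfolding g(1) eq1 by (rule P.local_ideal_add[OF iD mem1 mem2])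
    then show "\<exists>b. b \<in> hf (int t) \<and> b \<notin> P \<and> Fract y b \<in> local_ideal (D j) P" using vt by blast
  qed
  have "gr S \<le> gr (D j)"
  proof (rule le_funI, rule subsetI)
    fix t y assume y: "y \<in> gr S t"
    show "y \<in> gr (D j) t"
    proof (cases "t \<ge> 0")
      case True
      then show ?thesis using y main[of y "nat t"] by (simp add: gr_def)
    next
      case False
      then have "y = 0" using gideal_hf[OF cS(1) y] hf_neg[of t] by (metis not_le singletonD)
      then show ?thesis using gideal_zero[OF cD(1)] by simp
    qed
  qed
  from tot_mono[OF this] show ?thesis unfolding cS(3) cD(3) .
qed

section \<open>Base change to \<open>\<complex>(u)\<close>\<close>

type_synonym ufield = "complex poly fract"

definition \<iota> :: "'n::{finite,linorder} mpoly \<Rightarrow> ('n, ufield) mpol" where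
  "\<iota> f = Poly_Mapping.map (\<lambda>c. Fract [:c:] 1) f"

lemma lookup_\<iota>: "lookup (\<iota> f) m = Fract [:lookup f m:] 1"
  by (simp add: \<iota>_def map.rep_eq when_def fract_collapse)

lemma \<iota>_add: "\<iota> (f + g) = \<iota> f + \<iota> g"
  by (rule poly_mapping_eqI) (simp add: lookup_\<iota> lookup_add)

lemma \<iota>_zero [simp]: "\<iota> 0 = 0"
  by (rule poly_mapping_eqI) (simp add: lookup_\<iota> fract_collapse)

lemma \<iota>_single: "\<iota> (single m c) = single m (Fract [:c:] 1)"
  by (rule poly_mapping_eqI) (simp add: lookup_\<iota> lookup_single when_def fract_collapse)

lemma \<iota>_one [simp]: "\<iota> 1 = 1"
  using \<iota>_single[of 0 1] by (simp add: One_fract_def[symmetric] one_pCons[symmetric])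

lemma \<iota>_sum: "\<iota> (sum f A) = (\<Sum>x\<in>A. \<iota> (f x))"
  by (induction A rule: infinite_finite_induct) (auto simp: \<iota>_add)

lemma \<iota>_mult: "\<iota> (f * g) = \<iota> f * \<iota> g"
proof -
  have 1: "\<iota> (single m c * single k d) =
      \<iota> (single m c) * \<iota> (single k d)" for m k :: "'a \<Rightarrow>\<^sub>0 nat" and c d
    by (simp add: mult_single \<iota>_single mult.commute)
  have "f * g = (\<Sum>m\<in>keys f. \<Sum>k\<in>keys g.
      single m (lookup f m) * single k (lookup g k))"
    by (subst (1) sum_monomials[of f], subst (1) sum_monomials[of g]) (rule sum_product)
  then have "\<iota> (f * g) = (\<Sum>m\<in>keys f. \<Sum>k\<in>keys g.
      \<iota> (single m (lookup f m)) * \<iota> (single k (lookup g k)))"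
    by (simp add: \<iota>_sum 1)
  also have "\<dots> = \<iota> f * \<iota> g"
    by (subst (3) sum_monomials[of f], subst (3) sum_monomials[of g]) (simp add: \<iota>_sum sum_product)
  finally show ?thesis .
qed

lemma \<iota>_power: "\<iota> (f ^ k) = \<iota> f ^ k"
  by (induction k) (auto simp: \<iota>_mult)

lemma \<iota>_hf: "f \<in> hf t \<Longrightarrow> \<iota> f \<in> hf t"
  by (auto simp: hf_def in_keys_iff lookup_\<iota> fract_collapse)

lemma \<iota>_uminus: "\<iota> (- f) = - \<iota> f"
  using \<iota>_add[of f "- f"] by (simp add: eq_neg_iff_add_eq_0 add.commute)

lemma \<iota>_diff: "\<iota> (f - g) = \<iota> f - \<iota> g"
  using \<iota>_add[of f "- g"] by (simp add: \<iota>_uminus)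

definition U :: "('n::{finite,linorder}, ufield) mpol" where "U = const (Fract [:0, 1:] 1)"

lemma U_hf [simp]: "U \<in> hf 0" by (simp add: U_def)

text \<open>Substitutes the indeterminate u of \<open>ufield\<close> for the polynomial variable;
  the values are the polynomials over C(u) whose coefficients have no denominators.\<close>

definition E :: "'n::{finite,linorder} mpoly poly \<Rightarrow> ('n, ufield) mpol" where
  "E p = poly (map_poly \<iota> p) U"

lemma E_0 [simp]: "E 0 = 0" by (simp add: E_def)

lemma E_pCons: "E (pCons a p) = \<iota> a + U * E p"
  by (simp add: E_def map_poly_pCons)

lemma E_const: "E [:a:] = \<iota> a"
  by (simp add: E_pCons)

lemma E_add: "E (p + q) = E p + E q"
  by (induction p q rule: poly_induct2) (simp_all add: E_pCons \<iota>_add algebra_simps)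

lemma E_smult: "E (smult a p) = \<iota> a * E p"
  by (induction p) (simp_all add: E_pCons \<iota>_mult algebra_simps)

lemma E_mult: "E (p * q) = E p * E q"
  by (induction p) (simp_all add: E_pCons E_add E_smult algebra_simps)

lemma E_sum: "E (sum f A) = (\<Sum>x\<in>A. E (f x))"
  by (induction A rule: infinite_finite_induct) (auto simp: E_add)

definition slice :: "('n::{finite,linorder} \<Rightarrow>\<^sub>0 nat) \<Rightarrow> 'n mpoly poly \<Rightarrow> complex poly" where
  "slice m p = map_poly (\<lambda>f. lookup f m) p"

lemma lookup_const_mult:
  fixes x :: "('n::{finite,linorder}, 'k::field) mpol"
  shows "lookup (const c * x) m = c * lookup x m"
  using lookup_single_mult[of 0 c x m] by simp

lemma lookup_E: "lookup (E p) m = Fract (slice m p) 1"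
proof (induction p)
  case (pCons a p)
  have "slice m (pCons a p) = pCons (lookup a m) (slice m p)"
    by (simp add: slice_def map_poly_pCons)
  moreover have "pCons c q = [:c:] + [:0, 1:] * q" for c and q :: "complex poly" by simp
  ultimately have "slice m (pCons a p) = [:lookup a m:] + [:0, 1:] * slice m p" by metis
  then show ?case using pCons.IH by (simp add: E_pCons lookup_add lookup_\<iota> U_def lookup_const_mult)
qed (simp add: slice_def fract_collapse)

lemma E_eq_0_iff: "E p = 0 \<longleftrightarrow> p = 0"
proof
  assume "E p = 0"
  then have "slice m p = 0" for m using lookup_E[of p m] by (simp add: Zero_fract_def eq_fract)
  then have "lookup (coeff p j) m = 0" for m j
    by (metis slice_def coeff_map_poly lookup_zero coeff_0)
  then show "p = 0" by (intro poly_eqI poly_mapping_eqI) simp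
qed simp

lemma E_inj: "E p = E q \<Longrightarrow> p = q"
  using E_eq_0_iff[of "p - q"] E_add[of "p - q" q] by simp

definition \<kappa> :: "complex poly \<Rightarrow> 'n::{finite,linorder} mpoly poly" where
  "\<kappa> c = map_poly const c"

lemma coeff_\<kappa>: "coeff (\<kappa> c) j = const (coeff c j)"
  by (simp add: \<kappa>_def coeff_map_poly)

lemma E_\<kappa>: "E (\<kappa> c) = const (Fract c 1)"
proof (rule poly_mapping_eqI)
  fix m :: "'a \<Rightarrow>\<^sub>0 nat"
  have "slice m (\<kappa> c) = (if m = 0 then c else 0)"
    by (rule poly_eqI) (simp add: slice_def coeff_map_poly coeff_\<kappa> lookup_single when_def)
  then show "lookup (E (\<kappa> c)) m = lookup (const (Fract c 1)) m"
    by (simp add: lookup_E lookup_single when_def fract_collapse)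
qed

definition coefs_in :: "'n::{finite,linorder} mpoly set \<Rightarrow> 'n mpoly poly \<Rightarrow> bool" where
  "coefs_in J p \<longleftrightarrow> (\<forall>j. coeff p j \<in> J)"

lemma coefs_in_add: "gideal J \<Longrightarrow> coefs_in (J t) p \<Longrightarrow> coefs_in (J t) q \<Longrightarrow> coefs_in (J t) (p + q)"
  by (simp add: coefs_in_def gideal_add)

lemma coefs_in_mult:
  assumes "gideal J" "coefs_in (J t) p" "coefs_in (hf e) q" "u = e + t"
  shows "coefs_in (J u) (q * p)"
  using assms by (auto simp: coefs_in_def coeff_mult intro!: gideal_sum gideal_mult)

lemma coefs_in_\<kappa>: "coefs_in (hf 0) (\<kappa> c)"
  by (simp add: coefs_in_def coeff_\<kappa>)

lemma coefs_in_mult_\<kappa>: "gideal J \<Longrightarrow> coefs_in (J t) p \<Longrightarrow> coefs_in (J t) (\<kappa> c * p)"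
  by (rule coefs_in_mult[OF _ _ coefs_in_\<kappa>]) auto

lemma coefs_in_pCons: "coefs_in J (pCons a p) \<longleftrightarrow> a \<in> J \<and> coefs_in J p"
  by (metis coefs_in_def coeff_pCons_0 coeff_pCons_Suc not0_implies_Suc)

lemma coefs_in_E_hf: "coefs_in (hf t) p \<Longrightarrow> E p \<in> hf t"
proof (induction p)
  case (pCons a p)
  then show ?case using hf_mult[OF U_hf, of "E p" t] by (auto simp: E_pCons coefs_in_pCons intro!: hf_add \<iota>_hf)
qed simp

text \<open>Take the highest coefficient of \<open>p\<close> outside \<open>J t\<close> and the
  leading coefficient of \<open>c\<close>: in the matching coefficient of the product all other
  terms lie in \<open>J t\<close>. This makes membership in \<open>bc\<close> independent of the
  denominator chosen.\<close>

lemma coefs_in_cancel_\<kappa>: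
  assumes J: "gideal J" and c: "c \<noteq> 0" and p: "coefs_in (hf t) p" "coefs_in (J t) (\<kappa> c * p)"
  shows "coefs_in (J t) p"
proof (rule ccontr)
  assume "\<not> ?thesis"
  then have ex: "\<exists>j. coeff p j \<notin> J t" by (auto simp: coefs_in_def)
  have bd: "j \<le> degree p" if "coeff p j \<notin> J t" for j
    using that gideal_zero[OF J] le_degree by metis
  define N where "N = (GREATEST j. coeff p j \<notin> J t)"
  have N: "coeff p N \<notin> J t" unfolding N_def
    using GreatestI_ex_nat[of "\<lambda>j. coeff p j \<notin> J t" "degree p"] ex bd by blast
  have gt: "coeff p j \<in> J t" if "j > N" for j
    using Greatest_le_nat[of "\<lambda>j. coeff p j \<notin> J t" j "degree p"] bd that unfolding N_def by (metis not_le)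
  let ?M = "degree c"
  have "coeff (\<kappa> c * p) (?M + N) = (\<Sum>i\<le>?M + N. const (coeff c i) * coeff p (?M + N - i))"
    by (simp add: coeff_mult coeff_\<kappa>)
  also have "\<dots> = const (lead_coeff c) * coeff p N + (\<Sum>i\<in>{..?M + N} - {?M}. const (coeff c i) * coeff p (?M + N - i))"
    by (subst sum.remove[of _ ?M]) auto
  finally have eq: "const (lead_coeff c) * coeff p N = coeff (\<kappa> c * p) (?M + N) -
    (\<Sum>i\<in>{..?M + N} - {?M}. const (coeff c i) * coeff p (?M + N - i))" by simp
  have "const (coeff c i) * coeff p (?M + N - i) \<in> J t" if "i \<in> {..?M + N} - {?M}" for i
  proof (cases "i < ?M")
    case True
    then show ?thesis by (intro gideal_smult J gt) auto
  next
    case False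
    then have "coeff c i = 0" using that by (intro coeff_eq_0) auto
    then show ?thesis using gideal_zero[OF J] by simp
  qed
  then have "const (lead_coeff c) * coeff p N \<in> J t"
    unfolding eq using p(2) by (intro gideal_diff J gideal_sum) (auto simp: coefs_in_def)
  then have "const (inverse (lead_coeff c)) * (const (lead_coeff c) * coeff p N) \<in> J t" by (rule gideal_smult[OF J])
  then show False using N c by (simp add: mult.assoc[symmetric] mult_single)
qed

lemma ex_clear_denominator:
  fixes f :: "('n::{finite,linorder}, ufield) mpol"
  assumes "f \<in> hf t"
  shows "\<exists>c p. c \<noteq> 0 \<and> const (Fract c 1) * f = E p \<and> coefs_in (hf t) p"
proof -
  have mono: "\<exists>c p. c \<noteq> 0 \<and> const (Fract c 1) * single m x = E p \<and> coefs_in (hf t) p"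
    if "int (mdeg m) = t" for m :: "'n \<Rightarrow>\<^sub>0 nat" and x
  proof -
    obtain a b where x: "x = Fract a b" "b \<noteq> 0" by (cases x rule: Fract_cases) auto
    define p where "p = map_poly (single m) a"
    have cf: "coeff p j = single m (coeff a j)" for j by (simp add: p_def coeff_map_poly)
    have "slice k p = (if k = m then a else 0)" for k
      by (rule poly_eqI) (auto simp: slice_def coeff_map_poly cf lookup_single when_def)
    then have "E p = single m (Fract a 1)"
      by (intro poly_mapping_eqI) (simp add: lookup_E lookup_single when_def fract_collapse)
    moreover have "const (Fract b 1) * single m x = single m (Fract a 1)"
    proof -
      have "Fract b 1 * x = Fract a 1" using x by (simp add: eq_fract)
      then show ?thesis by (simp add: mult_single)
    qed
    moreover have "coefs_in (hf t) p" using that by (simp add: coefs_in_def cf hf_single)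
    ultimately show ?thesis using x(2) by metis
  qed
  have "\<exists>c p. c \<noteq> 0 \<and> const (Fract c 1) * (\<Sum>m\<in>A. single m (lookup f m)) = E p \<and> coefs_in (hf t) p"
    if "finite A" "\<forall>m\<in>A. int (mdeg m) = t" for A
    using that
  proof (induction A)
    case empty
    show ?case by (intro exI[of _ 1] exI[of _ 0]) (simp add: coefs_in_def)
  next
    case (insert m A)
    then obtain c p where cp: "c \<noteq> 0" "coefs_in (hf t) p"
      "const (Fract c 1) * (\<Sum>m\<in>A. single m (lookup f m)) = E p" by auto
    obtain d q where dq: "d \<noteq> 0" "const (Fract d 1) * single m (lookup f m) = E q" "coefs_in (hf t) q"
      using mono[of m "lookup f m"] insert.prems by auto
    have cd: "const (Fract (c * d) 1) = const (Fract c 1) * (const (Fract d 1) :: ('n, ufield) mpol)"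
      by (simp add: mult_single)
    have "const (Fract (c * d) 1) * (\<Sum>m\<in>insert m A. single m (lookup f m)) =
      const (Fract c 1) * (const (Fract d 1) * single m (lookup f m)) +
      const (Fract d 1) * (const (Fract c 1) * (\<Sum>m\<in>A. single m (lookup f m)))"
      unfolding cd using insert.hyps by (simp add: algebra_simps)
    also have "\<dots> = E (\<kappa> c * q + \<kappa> d * p)" unfolding cp(3) dq(2) by (simp add: E_add E_mult E_\<kappa>)
    finally have "const (Fract (c * d) 1) * (\<Sum>m\<in>insert m A. single m (lookup f m)) = E (\<kappa> c * q + \<kappa> d * p)" .
    moreover have "coefs_in (hf t) (\<kappa> c * q + \<kappa> d * p)"
      using cp(2) dq(3) by (intro coefs_in_add coefs_in_mult_\<kappa> gideal_UNIV)
    ultimately show ?case using cp(1) dq(1) by (intro exI[of _ "c * d"] exI) auto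
  qed
  from this[of "keys f"] show ?thesis
    using assms sum_monomials[of f] by (auto simp: hf_def)
qed

text \<open>The extension of \<open>I\<close> to C(u), described by denominator-free multiples so
  that membership can be read off coefficientwise in u.\<close>

definition bc :: "'n::{finite,linorder} cfam \<Rightarrow> int \<Rightarrow> ('n, ufield) mpol set" where
  "bc I t = {f \<in> hf t. \<exists>c p. c \<noteq> 0 \<and> const (Fract c 1) * f = E p \<and> coefs_in (I t) p}"

lemma const_cancel: "(c :: complex poly) \<noteq> 0 \<Longrightarrow> const (Fract 1 c) * (const (Fract c 1) * f) = f"
proof -
  assume "c \<noteq> 0"
  then have "Fract c c = 1" by (simp add: One_fract_def eq_fract)
  then show ?thesis by (simp add: mult.assoc[symmetric] mult_single)
qed

lemma bc_coefs:
  assumes I: "gideal I" and f: "f \<in> bc I t" and c: "c \<noteq> 0" and p: "const (Fract c 1) * f = E p" "coefs_in (hf t) p"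
  shows "coefs_in (I t) p"
proof -
  obtain d q where dq: "d \<noteq> 0" "const (Fract d 1) * f = E q" "coefs_in (I t) q" using f by (auto simp: bc_def)
  have "E (\<kappa> d * p) = E (\<kappa> c * q)"
    by (simp add: E_mult E_\<kappa> p(1)[symmetric] dq(2)[symmetric] ac_simps)
  then have "\<kappa> d * p = \<kappa> c * q" by (rule E_inj)
  then have "coefs_in (I t) (\<kappa> d * p)" using coefs_in_mult_\<kappa>[OF I dq(3)] by simp
  then show ?thesis using coefs_in_cancel_\<kappa>[OF I dq(1) p(2)] by blast
qed

lemma gideal_bc:
  assumes I: "gideal I"
  shows "gideal (bc I)"
proof (rule gidealI)
  fix t show "0 \<in> bc I t" unfolding bc_def mem_Collect_eq using gideal_zero[OF I]
    by (intro conjI exI[of _ 1] exI[of _ 0]) (auto simp: coefs_in_def)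
next
  fix t f g assume "f \<in> bc I t" "g \<in> bc I t"
  then obtain c p d q where *: "f \<in> hf t" "c \<noteq> 0" "const (Fract c 1) * f = E p" "coefs_in (I t) p"
    "g \<in> hf t" "d \<noteq> 0" "const (Fract d 1) * g = E q" "coefs_in (I t) q" by (auto simp: bc_def)
  have cd: "const (Fract (c * d) 1) = const (Fract c 1) * (const (Fract d 1) :: ('a, ufield) mpol)" by (simp add: mult_single)
  have "const (Fract (c * d) 1) * (f + g) = const (Fract d 1) * (const (Fract c 1) * f) + const (Fract c 1) * (const (Fract d 1) * g)"
    unfolding cd by (simp add: algebra_simps)
  also have "\<dots> = E (\<kappa> d * p + \<kappa> c * q)" by (simp add: * E_add E_mult E_\<kappa>)
  finally show "f + g \<in> bc I t" unfolding bc_def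
    using * hf_add coefs_in_add[OF I coefs_in_mult_\<kappa>[OF I] coefs_in_mult_\<kappa>[OF I]]
    by (auto intro!: exI[of _ "c * d"] exI[of _ "\<kappa> d * p + \<kappa> c * q"])
next
  fix t e and f g :: "('a, ufield) mpol" assume "f \<in> bc I t" and g: "g \<in> hf e"
  then obtain c p where *: "f \<in> hf t" "c \<noteq> 0" "const (Fract c 1) * f = E p" "coefs_in (I t) p" by (auto simp: bc_def)
  obtain d q where **: "d \<noteq> 0" "const (Fract d 1) * g = E q" "coefs_in (hf e) q" using ex_clear_denominator[OF g] by blast
  have cd: "const (Fract (c * d) 1) = const (Fract c 1) * (const (Fract d 1) :: ('a, ufield) mpol)" by (simp add: mult_single)
  have "const (Fract (c * d) 1) * (g * f) = (const (Fract d 1) * g) * (const (Fract c 1) * f)"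
    unfolding cd by (simp add: algebra_simps)
  also have "\<dots> = E (q * p)" by (simp add: * ** E_mult)
  finally show "g * f \<in> bc I (e + t)" unfolding bc_def
    using * ** hf_mult[OF g *(1)] coefs_in_mult[OF I *(4) **(3) refl]
    by (auto intro!: exI[of _ "c * d"] exI[of _ "q * p"])
qed (simp add: bc_def)

lemma bc_mono: "I t \<subseteq> J t \<Longrightarrow> bc I t \<subseteq> bc J t"
  unfolding bc_def coefs_in_def by blast

lemma bc_mem_scale:
  assumes I: "gideal I" and c: "c \<noteq> 0" and f: "f \<in> hf t" "const (Fract c 1) * f \<in> bc I t"
  shows "f \<in> bc I t"
  using gideal_smult[OF gideal_bc[OF I] f(2), of "Fract 1 c"] unfolding const_cancel[OF c] .

lemma E_mem_bc: "gideal I \<Longrightarrow> coefs_in (I t) p \<Longrightarrow> E p \<in> bc I t"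
  unfolding bc_def
  using coefs_in_E_hf[of t p] gideal_hf[of I]
  by (auto intro!: exI[of _ 1] exI[of _ p] simp: coefs_in_def One_fract_def[symmetric])

lemma E_mem_bc_iff:
  assumes "gideal I" "coefs_in (hf t) p"
  shows "E p \<in> bc I t \<longleftrightarrow> coefs_in (I t) p"
  using bc_coefs[OF assms(1), of "E p" t 1 p] assms E_mem_bc by (auto simp: One_fract_def[symmetric])

lemma \<iota>_mem_bc_iff: "gideal I \<Longrightarrow> f \<in> hf t \<Longrightarrow> \<iota> f \<in> bc I t \<longleftrightarrow> f \<in> I t"
  using E_mem_bc_iff[of I t "[:f:]"] gideal_zero[of I t] by (simp add: E_const coefs_in_pCons) (simp add: coefs_in_def)

text \<open>A basis of R_t/I_t remains one after extension of scalars: a relation over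
  \<open>ufield\<close> is cleared of denominators and then holds for each coefficient in u.\<close>

lemma H_bc:
  fixes I :: "'n::{finite,linorder} cfam"
  assumes I: "gideal I"
  shows "H (bc I) t = H I t"
proof -
  note gb = gideal_bc[OF I]
  obtain B where B: "mp.qbasis B (hf t) (I t)"
    using mp.ex_qbasis[OF subspace_gideal[OF I] qfin_hf] by blast
  have fB: "finite B" "B \<subseteq> hf t" using B by (auto simp: mp.qbasis_def)
  have inj: "inj (\<iota> :: 'n mpoly \<Rightarrow> _)" using E_inj by (metis E_const injI pCons_eq_iff)
  have "mp.qbasis (\<iota> ` B) (hf t) (bc I t)" unfolding mp.qbasis_def
  proof (intro conjI allI impI)
    show "finite (\<iota> ` B)" "\<iota> ` B \<subseteq> hf t" using fB \<iota>_hf by auto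
    show "hf t \<subseteq> mp.span (\<iota> ` B \<union> bc I t)"
    proof
      fix f :: "('n, ufield) mpol" assume f: "f \<in> hf t"
      have "single m 1 \<in> mp.span (\<iota> ` B \<union> bc I t)" if m: "m \<in> keys f" for m
      proof -
        have mt: "single m 1 \<in> hf t" using f m by (intro hf_single) (simp add: hf_def)
        then have "single m 1 \<in> mp.span (B \<union> I t)" using B unfolding mp.qbasis_def by blast
        then obtain a where a: "single m 1 - (\<Sum>b\<in>B. const (a b) * b) \<in> I t"
          using mp.mem_span_Un_subspace[OF subspace_gideal[OF I] fB(1)] by blast
        let ?i = "single m 1 - (\<Sum>b\<in>B. const (a b) * b)"
        have "\<iota> ?i \<in> bc I t" using \<iota>_mem_bc_iff[OF I gideal_hf[OF I a]] a by simp
        moreover have "\<iota> (const (a b) * b) = const (Fract [:a b:] 1) * \<iota> b" for b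
          by (simp add: \<iota>_mult \<iota>_single)
        ultimately have "(\<Sum>b\<in>B. const (Fract [:a b:] 1) * \<iota> b) + \<iota> ?i \<in> mp.span (\<iota> ` B \<union> bc I t)"
          by (intro mp.span_add mp.span_sum mp.span_scale) (auto intro: mp.span_base)
        moreover have "(\<Sum>b\<in>B. const (Fract [:a b:] 1) * \<iota> b) + \<iota> ?i = \<iota> (single m 1)"
          by (simp add: \<iota>_diff \<iota>_sum \<iota>_mult \<iota>_single)
        ultimately show ?thesis by (simp add: \<iota>_single One_fract_def one_pCons)
      qed
      then have "(\<Sum>m\<in>keys f. const (lookup f m) * single m 1) \<in> mp.span (\<iota> ` B \<union> bc I t)"
        by (intro mp.span_sum mp.span_scale)
      then show "f \<in> mp.span (\<iota> ` B \<union> bc I t)" using sum_monomials[of f] by (simp add: mult_single)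
    qed
    fix a assume "(\<Sum>b\<in>\<iota> ` B. const (a b) * b) \<in> bc I t"
    then have s: "(\<Sum>b\<in>B. const (a (\<iota> b)) * \<iota> b) \<in> bc I t" by (simp add: sum.reindex[OF inj_on_subset[OF inj subset_UNIV]])
    have "\<exists>d n. d \<noteq> 0 \<and> (\<forall>b\<in>A. const (Fract d 1) * const (a (\<iota> b)) = (const (Fract (n b) 1) :: ('n, ufield) mpol))"
      if "finite A" for A
      using that
    proof (induction A)
      case (insert b A)
      then obtain d n where dn: "d \<noteq> 0" "\<forall>b\<in>A. const (Fract d 1) * const (a (\<iota> b)) = (const (Fract (n b) 1) :: ('n, ufield) mpol)"
        by blast
      obtain p q where pq: "a (\<iota> b) = Fract p q" "q \<noteq> 0" by (cases "a (\<iota> b)" rule: Fract_cases) auto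
      have "const (Fract (d * q) 1) * const (a (\<iota> b')) = (const (Fract ((if b' = b then d * p else n b' * q)) 1) :: ('n, ufield) mpol)"
        if "b' \<in> insert b A" for b'
      proof (cases "b' = b")
        case True
        have "Fract (d * q) 1 * Fract p q = Fract (d * p) 1" using pq(2) by (simp add: eq_fract)
        then show ?thesis using pq True by (simp add: mult_single del: mult_fract)
      next
        case False
        then have "const (Fract d 1) * const (a (\<iota> b')) = (const (Fract (n b') 1) :: ('n, ufield) mpol)" using dn(2) that by blast
        then have "const (Fract q 1) * (const (Fract d 1) * const (a (\<iota> b'))) = const (Fract q 1) * (const (Fract (n b') 1) :: ('n, ufield) mpol)" by simp
        then show ?thesis using False by (simp add: mult.assoc[symmetric] mult_single mult.commute)
      qed
      then show ?case using dn(1) pq(2)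
        by (intro exI[of _ "d * q"] exI[of _ "\<lambda>b'. if b' = b then d * p else n b' * q"]) auto
    qed (auto intro: exI[of _ 1])
    from this[OF fB(1)] obtain d n where dn: "d \<noteq> 0"
      "\<And>b. b \<in> B \<Longrightarrow> const (Fract d 1) * const (a (\<iota> b)) = (const (Fract (n b) 1) :: ('n, ufield) mpol)" by blast
    define p where "p = (\<Sum>b\<in>B. \<kappa> (n b) * [:b:])"
    have "const (Fract d 1) * (\<Sum>b\<in>B. const (a (\<iota> b)) * \<iota> b) = E p"
      unfolding p_def E_sum sum_distrib_left
      by (intro sum.cong refl) (simp only: E_mult E_\<kappa> E_const mult.assoc[symmetric] dn(2))
    moreover have "coefs_in (hf t) p" unfolding p_def coefs_in_def
      using fB(2) by (auto intro!: hf_sum hf_smult simp: coeff_sum coeff_\<kappa> mult.commute[of _ "const _"])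
    ultimately have "coefs_in (I t) p" using bc_coefs[OF I s dn(1)] by blast
    then have cj: "(\<Sum>b\<in>B. const (coeff (n b) j) * b) \<in> I t" for j
      by (simp add: coefs_in_def p_def coeff_sum coeff_\<kappa> mult.commute)
    have n0: "n b = 0" if "b \<in> B" for b
      using mp.qbasis_indep[OF B cj that] by (intro poly_eqI) simp
    have "a (\<iota> b) = 0" if "b \<in> B" for b
    proof -
      have "const (Fract d 1) * const (a (\<iota> b)) = (0 :: ('n, ufield) mpol)"
        using dn(2)[OF that] n0[OF that] by (simp add: fract_collapse)
      then have "const (a (\<iota> b)) = (0 :: ('n, ufield) mpol)" using const_cancel[OF dn(1), of "const (a (\<iota> b))"] by (metis mult_zero_right)
      then show ?thesis by (metis lookup_single_eq lookup_zero)
    qed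
    then show "\<forall>b\<in>\<iota> ` B. a b = 0" by blast
  qed
  from mp.qd_eq[OF subspace_gideal[OF gb] this] mp.qd_eq[OF subspace_gideal[OF I] B]
  show ?thesis by (simp add: H_def card_image[OF inj_on_subset[OF inj subset_UNIV]])
qed

section \<open>Generic members of pencils\<close>

definition nzd :: "('n::{finite,linorder}, 'k::field) fam \<Rightarrow> int \<Rightarrow> ('n, 'k) mpol \<Rightarrow> bool" where
  "nzd I e f \<longleftrightarrow> (\<forall>t. \<forall>g\<in>hf t. f * g \<in> I (e + t) \<longrightarrow> g \<in> I t)"

lemma nzdD: "nzd I e f \<Longrightarrow> g \<in> hf t \<Longrightarrow> f * g \<in> I (e + t) \<Longrightarrow> g \<in> I t"
  by (auto simp: nzd_def)

lemma colon_nzd: "gideal I \<Longrightarrow> f \<in> hf e \<Longrightarrow> nzd I e f \<Longrightarrow> colon I e f = I"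
  by (intro antisym le_colon) (auto simp: le_fun_def colon_def nzd_def)

lemma nzd_colon: "colon I e f = I \<Longrightarrow> nzd I e f"
  by (auto simp: nzd_def colon_def fun_eq_iff set_eq_iff)

lemma nzd_prime: "gprime P \<Longrightarrow> f \<in> hf e \<Longrightarrow> f \<notin> P e \<Longrightarrow> nzd P e f"
  by (rule nzd_colon[OF gprime_colon])

lemma nzd_power:
  assumes "nzd I e f" "f \<in> hf e" "g \<in> hf t" "f ^ k * g \<in> I (int k * e + t)"
  shows "g \<in> I t"
  using assms(3,4)
proof (induction k arbitrary: g t)
  case (Suc k)
  have "f * (f ^ k * g) \<in> I (e + (int k * e + t))" using Suc.prems(2) by (simp add: algebra_simps)
  then have "f ^ k * g \<in> I (int k * e + t)"
    by (rule nzdD[OF assms(1) hf_mult[OF hf_power[OF assms(2)] Suc.prems(1)]])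
  then show ?case by (rule Suc.IH[OF Suc.prems(1)])
qed simp

text \<open>Large degrees suffice, since membership of \<open>g\<close> in a saturated ideal can be
  tested on its multiples of high degree.\<close>

lemma nzd_sat:
  fixes I :: "('n::{finite,linorder}, 'k::field) fam"
  assumes I: "gideal I" and f: "f \<in> hf e" and loc: "\<And>t g. t \<ge> t0 \<Longrightarrow> g \<in> hf t \<Longrightarrow> f * g \<in> I (e + t) \<Longrightarrow> g \<in> sat I t"
  shows "nzd (sat I) e f"
  unfolding nzd_def
proof (intro allI ballI impI)
  fix t g assume g: "g \<in> hf t" "f * g \<in> sat I (e + t)"
  then obtain m where m: "\<And>h. h \<in> hf (int m) \<Longrightarrow> h * (f * g) \<in> I (e + t + int m)" by (auto simp: sat_def)
  let ?k = "max m (nat (t0 - t))"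
  have fg: "f * g \<in> hf (e + t)" using f g(1) by (rule hf_mult)
  show "g \<in> sat I t"
  proof (rule sat_memI[OF gideal_sat[OF I] sat_sat[OF I] g(1), where k = ?k])
    fix h :: "('n, 'k) mpol" assume h: "h \<in> hf (int ?k)"
    have "h * (f * g) \<in> I (e + t + int ?k)"
      using gideal_sup_hf[OF I fg, of m ?k] m h by auto
    then have "f * (h * g) \<in> I (e + (t + int ?k))" by (simp add: ac_simps)
    moreover have "h * g \<in> hf (t + int ?k)" using hf_mult[OF h g(1)] by (simp add: add.commute)
    moreover have "t + int ?k \<ge> t0" by simp
    ultimately show "h * g \<in> sat I (t + int ?k)" using loc by blast
  qed
qed

text \<open>The member \<open>l1 + u l2\<close> of a pencil of linear forms, over \<open>\<complex>(u)\<close>.\<close>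

definition pencil :: "'n::{finite,linorder} mpoly \<Rightarrow> 'n mpoly \<Rightarrow> 'n mpoly poly" where
  "pencil l1 l2 = [:l1, l2:]"

lemma coeff_pencil_mult: "coeff (pencil l1 l2 * p) (Suc j) = l1 * coeff p (Suc j) + l2 * coeff p j"
  "coeff (pencil l1 l2 * p) 0 = l1 * coeff p 0"
  by (simp_all add: pencil_def)

lemma coefs_in_pencil: "l1 \<in> hf 1 \<Longrightarrow> l2 \<in> hf 1 \<Longrightarrow> coefs_in (hf 1) (pencil l1 l2)"
  by (simp add: pencil_def coefs_in_pCons) (simp add: coefs_in_def)

text \<open>The product has coefficients \<open>l1 * coeff p (Suc j) + l2 * coeff p j\<close>.
  Starting above the degree of \<open>p\<close>, each coefficient in \<open>I\<close> yields the
  next lower one, because \<open>l2\<close> is a nonzerodivisor.\<close>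

lemma nzd_bc_pencil:
  fixes I :: "'n::{finite,linorder} cfam"
  assumes I: "gideal I" and l: "l1 \<in> hf 1" "l2 \<in> hf 1" and l2: "nzd I 1 l2"
  shows "nzd (bc I) 1 (E (pencil l1 l2))"
  unfolding nzd_def
proof (intro allI ballI impI)
  fix t and f :: "('n, ufield) mpol" assume f: "f \<in> hf t" "E (pencil l1 l2) * f \<in> bc I (1 + t)"
  obtain c p where cp: "c \<noteq> 0" "const (Fract c 1) * f = E p" "coefs_in (hf t) p"
    using ex_clear_denominator[OF f(1)] by blast
  have "const (Fract c 1) * (E (pencil l1 l2) * f) = E (pencil l1 l2 * p)"
    by (simp add: E_mult cp(2)[symmetric] ac_simps)
  moreover have "const (Fract c 1) * (E (pencil l1 l2) * f) \<in> bc I (1 + t)"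
    by (rule gideal_smult[OF gideal_bc[OF I] f(2)])
  ultimately have "coefs_in (I (1 + t)) (pencil l1 l2 * p)"
    using E_mem_bc_iff[OF I coefs_in_mult[OF gideal_UNIV cp(3) coefs_in_pencil[OF l] refl]] by simp
  then have rel: "l1 * coeff p (Suc j) + l2 * coeff p j \<in> I (1 + t)" for j
    by (metis coefs_in_def coeff_pencil_mult(1))
  have ph: "coeff p j \<in> hf t" for j using cp(3) by (simp add: coefs_in_def)
  have step: "coeff p j \<in> I t" if "coeff p (Suc j) \<in> I t" for j
  proof -
    have "l1 * coeff p (Suc j) \<in> I (1 + t)" by (rule gideal_mult[OF I that l(1)])
    from gideal_diff[OF I rel[of j] this] have "l2 * coeff p j \<in> I (1 + t)" by simp
    then show ?thesis by (rule nzdD[OF l2 ph])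
  qed
  have "coeff p (Suc (degree p) - k) \<in> I t" for k
  proof (induction k)
    case 0
    then show ?case using gideal_zero[OF I] by (simp add: coeff_eq_0)
  next
    case (Suc k)
    then show ?case using step[of "degree p - k"] by (cases "k \<le> degree p") (auto simp: Suc_diff_le)
  qed
  from this[of "Suc (degree p) - j" for j] have "coeff p j \<in> I t" if "j \<le> degree p" for j
    using that by (metis Suc_diff_le diff_diff_cancel le_SucI)
  then have "coefs_in (I t) p" using gideal_zero[OF I] coeff_eq_0[of p] unfolding coefs_in_def by (metis not_le)
  then have "const (Fract c 1) * f \<in> bc I t" using E_mem_bc[OF I] cp(2) by simp
  then show "f \<in> bc I t" by (rule bc_mem_scale[OF I cp(1) f(1)])
qed

lemma nzd_bc_\<iota>:
  fixes I :: "'n::{finite,linorder} cfam"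
  assumes I: "gideal I" and l: "l \<in> hf e" "nzd I e l"
  shows "nzd (bc I) e (\<iota> l)"
  unfolding nzd_def
proof (intro allI ballI impI)
  fix t and f :: "('n, ufield) mpol" assume f: "f \<in> hf t" "\<iota> l * f \<in> bc I (e + t)"
  obtain c p where cp: "c \<noteq> 0" "const (Fract c 1) * f = E p" "coefs_in (hf t) p"
    using ex_clear_denominator[OF f(1)] by blast
  have "const (Fract c 1) * (\<iota> l * f) = E (smult l p)"
    by (simp add: E_smult cp(2)[symmetric] ac_simps)
  moreover have "const (Fract c 1) * (\<iota> l * f) \<in> bc I (e + t)"
    by (rule gideal_smult[OF gideal_bc[OF I] f(2)])
  moreover have "coefs_in (hf (e + t)) (smult l p)" using cp(3) l(1) by (simp add: coefs_in_def hf_mult)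
  ultimately have "coefs_in (I (e + t)) (smult l p)" using E_mem_bc_iff[OF I] by simp
  then have "coefs_in (I t) p" using nzdD[OF l(2)] cp(3) by (simp add: coefs_in_def)
  then have "const (Fract c 1) * f \<in> bc I t" using E_mem_bc[OF I] cp(2) by simp
  then show "f \<in> bc I t" by (rule bc_mem_scale[OF I cp(1) f(1)])
qed

lemma bc_padd:
  fixes I :: "'n::{finite,linorder} cfam"
  assumes I: "gideal I" and l: "l \<in> hf e"
  shows "bc (padd I e l) t \<subseteq> padd (bc I) e (\<iota> l) t"
proof
  fix f assume f: "f \<in> bc (padd I e l) t"
  then obtain c p where cp: "f \<in> hf t" "c \<noteq> 0" "const (Fract c 1) * f = E p" "coefs_in (padd I e l t) p"
    by (auto simp: bc_def)
  note gb = gideal_padd[OF gideal_bc[OF I] \<iota>_hf[OF l]]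
  have E: "coefs_in (padd I e l t) p \<Longrightarrow> E p \<in> padd (bc I) e (\<iota> l) t" for p
  proof (induction p)
    case 0
    then show ?case using gideal_zero[OF gb] by simp
  next
    case (pCons a p)
    then have IH: "E p \<in> padd (bc I) e (\<iota> l) t" and a: "a \<in> padd I e l t" by (auto simp: coefs_in_pCons)
    obtain b g where bg: "a = b + l * g" "b \<in> I t" "g \<in> hf (t - e)" using a by (auto simp: padd_def)
    have "\<iota> a = \<iota> b + \<iota> l * \<iota> g" by (simp add: bg(1) \<iota>_add \<iota>_mult)
    moreover have "\<iota> b \<in> bc I t" using \<iota>_mem_bc_iff[OF I gideal_hf[OF I bg(2)]] bg(2) by simp
    ultimately have "\<iota> a \<in> padd (bc I) e (\<iota> l) t" using \<iota>_hf[OF bg(3)] by (auto simp: padd_def)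
    moreover have "U * E p \<in> padd (bc I) e (\<iota> l) t" by (rule gideal_mult'[OF gb IH U_hf]) simp
    ultimately show ?case unfolding E_pCons by (rule gideal_add[OF gb])
  qed
  have "const (Fract 1 c) * (const (Fract c 1) * f) \<in> padd (bc I) e (\<iota> l) t"
    unfolding cp(3) by (rule gideal_smult[OF gb E[OF cp(4)]])
  then show "f \<in> padd (bc I) e (\<iota> l) t" unfolding const_cancel[OF cp(2)] .
qed

text \<open>As a polynomial in u the divisor l1 + u l2 has leading coefficient \<open>l2\<close>, so
  powers of \<open>l2\<close> are multiplied in; the remainder \<open>e\<close> is free of
  u.\<close>

lemma pseudo_division:
  fixes p :: "'n::{finite,linorder} mpoly poly"
  assumes l: "l1 \<in> hf 1" "l2 \<in> hf 1" and p: "coefs_in (hf t) p"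
  shows "\<exists>k q e. [:l2:] ^ k * p = q * pencil l1 l2 + [:e:] \<and> e \<in> hf (int k + t) \<and> coefs_in (hf (int k + t - 1)) q"
  using p
proof (induction p)
  case 0
  show ?case by (intro exI[of _ 0]) (simp add: coefs_in_def)
next
  case (pCons a p)
  then have a: "a \<in> hf t" and p: "coefs_in (hf t) p" by (simp_all add: coefs_in_pCons)
  obtain k q e where IH: "[:l2:] ^ k * p = q * pencil l1 l2 + [:e:]" "e \<in> hf (int k + t)" "coefs_in (hf (int k + t - 1)) q"
    using pCons.IH p by blast
  have "pCons a p = [:a:] + [:0, 1:] * p" by simp
  then have "[:l2:] ^ Suc k * pCons a p = [:l2:] ^ Suc k * [:a:] + [:0, l2:] * ([:l2:] ^ k * p)"
    by (simp only: power_Suc distrib_left) (simp add: algebra_simps)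
  also have "\<dots> = ([:0, l2:] * q + [:e:]) * pencil l1 l2 + [:l2 ^ Suc k * a - l1 * e:]"
    unfolding IH(1) by (simp add: pencil_def poly_const_pow algebra_simps)
  finally have "[:l2:] ^ Suc k * pCons a p = ([:0, l2:] * q + [:e:]) * pencil l1 l2 + [:l2 ^ Suc k * a - l1 * e:]" .
  moreover have "l2 ^ Suc k * a - l1 * e \<in> hf (int (Suc k) + t)"
    using hf_mult[OF hf_power[OF l(2), of "Suc k"] a] hf_mult[OF l(1) IH(2)] by (intro hf_diff) (simp_all add: add.assoc)
  moreover have "coefs_in (hf (int (Suc k) + t - 1)) ([:0, l2:] * q + [:e:])"
  proof (rule coefs_in_add[OF gideal_UNIV])
    have "coefs_in (hf 1) [:0, l2:]" using l(2) by (simp add: coefs_in_pCons) (simp add: coefs_in_def)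
    then show "coefs_in (hf (int (Suc k) + t - 1)) ([:0, l2:] * q)"
      by (rule coefs_in_mult[OF gideal_UNIV IH(3)]) simp
    show "coefs_in (hf (int (Suc k) + t - 1)) [:e:]" using IH(2) by (simp add: coefs_in_pCons) (simp add: coefs_in_def)
  qed
  ultimately show ?case by blast
qed

text \<open>
  A general pencil of hyperplane sections of an integral scheme has an integral generic member.  This
  elementary replacement of Bertini's theorem suffices here, because the genus bound can be proved over \<open>\<complex>(u)\<close>.
\<close>

locale hyperplane_pencil =
  fixes D :: "'n::{finite,linorder} cfam" and l1 l2 :: "'n mpoly" and i0 :: 'n
  assumes D: "gprime D" "var i0 \<notin> D 1" and l: "l1 \<in> hf 1" "l2 \<in> hf 1" "l2 \<notin> D 1"
    and l1: "nzd (sat (padd D 1 l2)) 1 l1" and ne: "1 \<notin> sat (padd D 1 l2) 0"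
begin

abbreviation "L \<equiv> E (pencil l1 l2)"
abbreviation "\<Sigma>0 \<equiv> padd (bc D) 1 L"
definition "\<Sigma> = sat \<Sigma>0"

lemma gD: "gideal D" by (rule gprime_gideal[OF D(1)])
lemma L_hf: "L \<in> hf 1" by (rule coefs_in_E_hf[OF coefs_in_pencil[OF l(1,2)]])
lemma nzd_l2: "nzd D 1 l2" by (rule nzd_prime[OF D(1) l(2,3)])
lemma g\<Sigma>0: "gideal \<Sigma>0" by (rule gideal_padd[OF gideal_bc[OF gD] L_hf])
lemma g\<Sigma>: "gideal \<Sigma>" unfolding \<Sigma>_def by (rule gideal_sat[OF g\<Sigma>0])

text \<open>From l2 f = a + L q follows l1 q = 0 modulo (D, l2), where \<open>l1\<close> is a
  nonzerodivisor in high degrees. So q is a multiple of \<open>l2\<close> modulo \<open>D\<close>,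
  and cancelling \<open>l2\<close> puts f into (D, L).\<close>

lemma nzd_\<Sigma>_l2: "nzd \<Sigma> 1 (\<iota> l2)"
proof -
  define J where "J = padd D 1 l2"
  have gJ: "gideal J" unfolding J_def by (rule gideal_padd[OF gD l(2)])
  obtain t0 where t0: "\<And>t. t \<ge> t0 \<Longrightarrow> sat J t = J t" using sat_eventually[OF gJ] by blast
  show ?thesis unfolding \<Sigma>_def
  proof (rule nzd_sat[OF g\<Sigma>0 \<iota>_hf[OF l(2)], where ?t0.0 = "t0 + 1"])
    fix t f assume t: "t \<ge> t0 + 1" and f: "f \<in> hf t" "\<iota> l2 * f \<in> \<Sigma>0 (1 + t)"
    obtain a q where aq: "\<iota> l2 * f = a + L * q" "a \<in> bc D (1 + t)" "q \<in> hf t"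
      using f(2) by (auto simp: padd_def)
    have Lq: "L = \<iota> l1 + U * \<iota> l2" by (simp add: pencil_def E_pCons)
    have l2J: "\<iota> l2 \<in> bc J 1"
      using \<iota>_mem_bc_iff[OF gJ l(2)] mem_padd[OF gD, of l2 1] by (simp add: J_def)
    have "\<iota> l1 * q = \<iota> l2 * (f - U * q) - a" using aq(1) by (simp add: Lq algebra_simps)
    moreover have "f - U * q \<in> hf t" using hf_mult[OF U_hf aq(3)] f(1) by (intro hf_diff) simp_all
    then have "\<iota> l2 * (f - U * q) \<in> bc J (1 + t)" by (intro gideal_mult_right[OF gideal_bc[OF gJ] l2J]) auto
    moreover have "a \<in> bc J (1 + t)"
      using aq(2) bc_mono[of D "1 + t" J] le_padd[of D 1 l2] by (auto simp: J_def le_fun_def)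
    ultimately have "\<iota> l1 * q \<in> bc J (1 + t)" by (simp add: gideal_diff[OF gideal_bc[OF gJ]])
    then have "\<iota> l1 * q \<in> bc (sat J) (1 + t)"
      using bc_mono[of J "1 + t" "sat J"] le_sat[OF gJ] by (auto simp: le_fun_def)
    then have "q \<in> bc (sat J) t"
      by (rule nzdD[OF nzd_bc_\<iota>[OF gideal_sat[OF gJ] l(1) l1[folded J_def]] aq(3)])
    then have "q \<in> bc J t" using t0[of t] t bc_mono[of "sat J" t J] by auto
    then have "q \<in> padd (bc D) 1 (\<iota> l2) t" using bc_padd[OF gD l(2)] by (auto simp: J_def)
    then obtain a' q' where q: "q = a' + \<iota> l2 * q'" "a' \<in> bc D t" "q' \<in> hf (t - 1)" by (auto simp: padd_def)
    have "\<iota> l2 * (f - L * q') = a + L * a'" using aq(1) q(1) by (simp add: algebra_simps)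
    moreover have "a + L * a' \<in> bc D (1 + t)"
      by (intro gideal_add gideal_bc gD aq(2) gideal_mult q(2) L_hf)
    moreover have "L * q' \<in> hf t" using hf_mult[OF L_hf q(3)] by simp
    then have "f - L * q' \<in> hf t" by (intro hf_diff f(1))
    ultimately have "f - L * q' \<in> bc D t" using nzdD[OF nzd_bc_\<iota>[OF gD l(2) nzd_l2]] by metis
    then have "(f - L * q') + L * q' \<in> \<Sigma>0 t" using q(3) unfolding padd_def by blast
    then show "f \<in> sat \<Sigma>0 t" using le_sat[OF g\<Sigma>0] by (auto simp: le_fun_def)
  qed
qed

lemma ml: "(- l1) ^ j \<in> hf (int j)" and ml2: "l2 ^ j \<in> hf (int j)"
  using hf_power[OF hf_uminus[OF l(1)], of j] hf_power[OF l(2), of j] by simp_all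

text \<open>The sum is \<open>l2 ^ M\<close> times the value of \<open>c\<close> at u = -l1/l2.
  After powers of \<open>l2\<close> are divided out, modulo \<open>l2\<close> only a nonzero
  multiple of a power of \<open>l1\<close> remains, and this does not vanish on the nonempty section
  by \<open>l2\<close>.\<close>

lemma binary_form_notin:
  fixes c :: "complex poly"
  assumes c: "c \<noteq> 0" and M: "degree c \<le> M"
  shows "(\<Sum>j\<le>M. const (coeff c j) * ((- l1) ^ j * l2 ^ (M - j))) \<notin> D (int M)"
proof
  let ?d = "degree c"
  assume asm: "(\<Sum>j\<le>M. const (coeff c j) * ((- l1) ^ j * l2 ^ (M - j))) \<in> D (int M)"
  define s where "s = (\<Sum>j\<le>?d. const (coeff c j) * ((- l1) ^ j * l2 ^ (?d - j)))"
  have sh: "s \<in> hf (int ?d)" unfolding s_def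
  proof (intro hf_sum hf_smult)
    fix j assume "j \<in> {..?d}"
    then show "(- l1) ^ j * l2 ^ (?d - j) \<in> hf (int ?d)" using hf_mult[OF ml[of j] ml2[of "?d - j"]] by simp
  qed
  have "(\<Sum>j\<le>M. const (coeff c j) * ((- l1) ^ j * l2 ^ (M - j))) =
      (\<Sum>j\<le>?d. const (coeff c j) * ((- l1) ^ j * l2 ^ (M - j)))"
    by (rule sum.mono_neutral_right) (use M in \<open>auto simp: coeff_eq_0\<close>)
  also have "\<dots> = l2 ^ (M - ?d) * s" unfolding s_def sum_distrib_left
  proof (intro sum.cong refl)
    fix j assume "j \<in> {..?d}"
    then have "M - j = (M - ?d) + (?d - j)" using M by simp
    then show "const (coeff c j) * ((- l1) ^ j * l2 ^ (M - j)) = l2 ^ (M - ?d) * (const (coeff c j) * ((- l1) ^ j * l2 ^ (?d - j)))"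
      by (simp add: power_add ac_simps)
  qed
  finally have "l2 ^ (M - ?d) * s \<in> D (int (M - ?d) * 1 + int ?d)" using asm M by simp
  then have sD: "s \<in> D (int ?d)" by (rule nzd_power[OF nzd_l2 l(2) sh])
  note gJ = gideal_padd[OF gD l(2)]
  have sd: "s - (\<Sum>j<?d. const (coeff c j) * ((- l1) ^ j * l2 ^ (?d - j))) = const (lead_coeff c) * (- l1) ^ ?d"
    unfolding s_def by (subst lessThan_Suc_atMost[symmetric]) simp
  have b: "(\<Sum>j<?d. const (coeff c j) * ((- l1) ^ j * l2 ^ (?d - j))) \<in> padd D 1 l2 (int ?d)"
  proof (intro gideal_sum gJ gideal_smult)
    fix j assume j: "j \<in> {..<?d}"
    then have "?d - j = Suc (?d - Suc j)" by auto
    then have eq: "(- l1) ^ j * l2 ^ (?d - j) = ((- l1) ^ j * l2 ^ (?d - Suc j)) * l2" by (simp add: ac_simps)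
    show "(- l1) ^ j * l2 ^ (?d - j) \<in> padd D 1 l2 (int ?d)" unfolding eq
      by (rule gideal_mult'[OF gJ mem_padd[OF gD] hf_mult[OF ml ml2]]) (use j in auto)
  qed
  have "s \<in> padd D 1 l2 (int ?d)" using sD le_padd[of D 1 l2] by (auto simp: le_fun_def)
  from gideal_diff[OF gJ this b] have "const (lead_coeff c) * (- l1) ^ ?d \<in> padd D 1 l2 (int ?d)"
    unfolding sd .
  from gideal_smult[OF gJ this, of "inverse (lead_coeff c)"] have "(- l1) ^ ?d \<in> padd D 1 l2 (int ?d)"
    using c by (simp add: mult.assoc[symmetric] mult_single)
  from gideal_smult[OF gJ this, of "(-1) ^ ?d"] have "const ((-1) ^ ?d) * (- l1) ^ ?d \<in> padd D 1 l2 (int ?d)" .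
  moreover have "const ((-1) ^ k) * (- l1) ^ k = l1 ^ k" for k
  proof (induction k)
    case (Suc k)
    have "const ((-1) ^ Suc k) * (- l1) ^ Suc k = const ((-1) ^ k) * (- l1) ^ k * l1"
      by (simp add: single_uminus)
    then show ?case using Suc by simp
  qed simp
  ultimately have "l1 ^ ?d * 1 \<in> sat (padd D 1 l2) (int ?d * 1 + 0)"
    using le_sat[OF gJ] by (auto simp: le_fun_def)
  then have "1 \<in> sat (padd D 1 l2) 0" by (rule nzd_power[OF l1 l(1) hf_one])
  then show False using ne by simp
qed

text \<open>Clearing denominators gives c e = R + (l1 + u l2) Q with the coefficients of
  \<open>R\<close> in \<open>D\<close>. Substituting u = -l1/l2, homogenised to avoid division,
  removes the last term and leaves a binary form times \<open>e\<close> in the prime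
  \<open>D\<close>.\<close>

lemma \<iota>_mem_\<Sigma>0:
  assumes e: "e \<in> hf t" "\<iota> e \<in> \<Sigma>0 t"
  shows "e \<in> D t"
proof -
  obtain a q where aq: "\<iota> e = a + L * q" "a \<in> bc D t" "q \<in> hf (t - 1)" using e(2) by (auto simp: padd_def)
  have ah: "a \<in> hf t" using aq(2) by (simp add: bc_def)
  obtain c1 pa where c1: "c1 \<noteq> 0" "const (Fract c1 1) * a = E pa" "coefs_in (hf t) pa" using ex_clear_denominator[OF ah] by blast
  have pa: "coefs_in (D t) pa" by (rule bc_coefs[OF gD aq(2) c1])
  obtain c2 pq where c2: "c2 \<noteq> 0" "const (Fract c2 1) * q = E pq" "coefs_in (hf (t - 1)) pq" using ex_clear_denominator[OF aq(3)] by blast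
  define c where "c = c1 * c2"
  have cc: "const (Fract c 1) = const (Fract c1 1) * (const (Fract c2 1) :: ('n, ufield) mpol)"
    by (simp add: c_def mult_single)
  have "E (\<kappa> c * [:e:]) = const (Fract c 1) * \<iota> e" by (simp only: E_mult E_\<kappa> E_const)
  also have "\<dots> = const (Fract c2 1) * (const (Fract c1 1) * a) + L * (const (Fract c1 1) * (const (Fract c2 1) * q))"
    unfolding aq(1) cc by (simp add: algebra_simps)
  also have "\<dots> = E (\<kappa> c2 * pa + pencil l1 l2 * (\<kappa> c1 * pq))"
    unfolding c1(2) c2(2) by (simp add: E_add E_mult E_\<kappa>)
  finally have "\<kappa> c * [:e:] = \<kappa> c2 * pa + pencil l1 l2 * (\<kappa> c1 * pq)" by (rule E_inj)
  moreover define Q where "Q = \<kappa> c1 * pq"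
  moreover define R where "R = \<kappa> c2 * pa"
  ultimately have eq: "\<kappa> c * [:e:] = R + pencil l1 l2 * Q" by simp
  have R: "coeff R j \<in> D t" for j
    using coefs_in_mult_\<kappa>[OF gD pa, of c2] by (simp add: R_def coefs_in_def)
  have cj: "const (coeff c j) * e = coeff R j + l1 * coeff Q j + (if j = 0 then 0 else l2 * coeff Q (j - 1))" for j
    using arg_cong[OF eq, of "\<lambda>p. coeff p j"] by (cases j) (simp_all add: coeff_\<kappa> coeff_pencil_mult mult.commute[of "const _" e] add.assoc)
  \<comment> \<open>\<open>M\<close> is at least the degree of \<open>c\<close> and exceeds that of
    \<open>Q\<close>; the telescoping sum therefore ends with \<open>coeff Q M = 0\<close>.\<close>
  define M where "M = max (degree c) (Suc (degree Q))"
  have c0: "c \<noteq> 0" using c1(1) c2(1) by (simp add: c_def)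
  let ?m = "\<lambda>j. (- l1) ^ j * l2 ^ (M - j)"
  have mh: "?m j \<in> hf (int M)" if "j \<le> M" for j using hf_mult[OF ml[of j] ml2[of "M - j"]] that by simp
  have tele: "(\<Sum>j\<le>N. (l1 * coeff Q j + (if j = 0 then 0 else l2 * coeff Q (j - 1))) * ?m j) = l1 * coeff Q N * ?m N"
    if "N \<le> M" for N
    using that
  proof (induction N)
    case (Suc N)
    have "M - N = Suc (M - Suc N)" using Suc.prems by simp
    then have "l1 * coeff Q N * ?m N + l2 * coeff Q N * ?m (Suc N) = 0" by (simp add: algebra_simps)
    then show ?case using Suc by (simp add: algebra_simps)
  qed simp
  have "(\<Sum>j\<le>M. const (coeff c j) * ?m j) * e = (\<Sum>j\<le>M. (const (coeff c j) * e) * ?m j)"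
    by (simp add: sum_distrib_left ac_simps)
  also have "\<dots> = (\<Sum>j\<le>M. coeff R j * ?m j) + (\<Sum>j\<le>M. (l1 * coeff Q j + (if j = 0 then 0 else l2 * coeff Q (j - 1))) * ?m j)"
    by (simp only: cj sum.distrib[symmetric]) (simp add: algebra_simps)
  also have "(\<Sum>j\<le>M. (l1 * coeff Q j + (if j = 0 then 0 else l2 * coeff Q (j - 1))) * ?m j) = 0"
    using tele[of M] coeff_eq_0[of Q M] by (simp add: M_def)
  finally have "(\<Sum>j\<le>M. const (coeff c j) * ?m j) * e \<in> D (int M + t)"
    using gideal_mult_right[OF gD R mh] by (auto intro!: gideal_sum[OF gD] simp: add.commute)
  moreover have "(\<Sum>j\<le>M. const (coeff c j) * ?m j) \<in> hf (int M)" using mh by (intro hf_sum hf_smult) auto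
  moreover have "(\<Sum>j\<le>M. const (coeff c j) * ?m j) \<notin> D (int M)"
    by (rule binary_form_notin[OF c0]) (simp add: M_def)
  ultimately show "e \<in> D t" using gprimeD[OF D(1) _ e(1)] by blast
qed

lemma \<iota>_mem_\<Sigma>:
  assumes e: "e \<in> hf t" "\<iota> e \<in> \<Sigma> t"
  shows "e \<in> D t"
proof -
  obtain k where k: "\<And>g. g \<in> hf (int k) \<Longrightarrow> g * \<iota> e \<in> \<Sigma>0 (t + int k)" using e(2) by (auto simp: \<Sigma>_def sat_def)
  have v: "var i0 ^ k \<in> hf (int k)" using hf_power[OF hf_var, of i0 k] by simp
  have "\<iota> (var i0 ^ k * e) \<in> \<Sigma>0 (int k + t)" using k[OF \<iota>_hf[OF v]] by (simp add: \<iota>_mult add.commute)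
  then have "var i0 ^ k * e \<in> D (int k * 1 + t)" using \<iota>_mem_\<Sigma>0[OF hf_mult[OF v e(1)]] by simp
  then show ?thesis by (rule nzd_power[OF nzd_prime[OF D(1) hf_var D(2)] hf_var e(1)])
qed

text \<open>Modulo \<open>L\<close> the indeterminate u becomes -l1/l2, so up to denominators and
  powers of \<open>l2\<close> every form is congruent to some \<open>\<iota> e\<close> with complex
  coefficients. Since \<open>\<Sigma>\<close> meets these forms in \<open>D\<close> and
  \<open>l2\<close> can be cancelled, primality reduces to that of \<open>D\<close>.\<close>

lemma gprime_\<Sigma>: "gprime \<Sigma>"
  unfolding gprime_def
proof (intro conjI allI ballI impI g\<Sigma>)
  show "1 \<notin> \<Sigma> 0" using \<iota>_mem_\<Sigma>[OF hf_one] D(1) by (auto simp: gprime_def)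
  fix a b and f g :: "('n, ufield) mpol" assume f: "f \<in> hf a" and g: "g \<in> hf b" and fg: "f * g \<in> \<Sigma> (a + b)"
  have L\<Sigma>: "L \<in> \<Sigma> 1" using mem_padd[OF gideal_bc[OF gD], of L 1] le_sat[OF g\<Sigma>0] by (auto simp: \<Sigma>_def le_fun_def)
  have red: "\<exists>c k e. c \<noteq> 0 \<and> e \<in> hf (int k + t) \<and>
      const (Fract c 1) * (\<iota> l2 ^ k * f) - \<iota> e \<in> \<Sigma> (int k + t)" if ft: "f \<in> hf t" for f t
  proof -
    obtain c p where cp: "c \<noteq> 0" "const (Fract c 1) * f = E p" "coefs_in (hf t) p" using ex_clear_denominator[OF ft] by blast
    obtain k q e where q: "[:l2:] ^ k * p = q * pencil l1 l2 + [:e:]" "e \<in> hf (int k + t)" "coefs_in (hf (int k + t - 1)) q"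
      using pseudo_division[OF l(1,2) cp(3)] by blast
    have "const (Fract c 1) * (\<iota> l2 ^ k * f) = E ([:l2:] ^ k * p)"
      by (simp add: E_mult cp(2)[symmetric] poly_const_pow E_smult \<iota>_power ac_simps)
    also have "\<dots> = E q * L + \<iota> e" unfolding q(1) by (simp add: E_add E_mult E_const)
    finally have "const (Fract c 1) * (\<iota> l2 ^ k * f) - \<iota> e = E q * L" by simp
    moreover have "E q * L \<in> \<Sigma> (int k + t)"
      by (rule gideal_mult'[OF g\<Sigma> L\<Sigma> coefs_in_E_hf[OF q(3)]]) simp
    ultimately show ?thesis using cp(1) q(2) by metis
  qed
  have lift: "f \<in> \<Sigma> t" if ft: "f \<in> hf t" and c: "c \<noteq> 0" and e: "e \<in> D (int k + t)"
    and r: "const (Fract c 1) * (\<iota> l2 ^ k * f) - \<iota> e \<in> \<Sigma> (int k + t)" for f t c k e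
  proof -
    have "\<iota> e \<in> bc D (int k + t)" using \<iota>_mem_bc_iff[OF gD gideal_hf[OF gD e]] e by simp
    then have "\<iota> e \<in> \<Sigma> (int k + t)"
      using le_padd[of "bc D" 1 L] le_sat[OF g\<Sigma>0] by (auto simp: \<Sigma>_def le_fun_def)
    from gideal_add[OF g\<Sigma> r this] have "const (Fract c 1) * (\<iota> l2 ^ k * f) \<in> \<Sigma> (int k + t)" by simp
    from gideal_smult[OF g\<Sigma> this, of "Fract 1 c"] have "\<iota> l2 ^ k * f \<in> \<Sigma> (int k * 1 + t)"
      unfolding const_cancel[OF c] by simp
    then show ?thesis by (rule nzd_power[OF nzd_\<Sigma>_l2 \<iota>_hf[OF l(2)] ft])
  qed
  obtain c1 k1 e1 where 1: "c1 \<noteq> 0" "e1 \<in> hf (int k1 + a)" "const (Fract c1 1) * (\<iota> l2 ^ k1 * f) - \<iota> e1 \<in> \<Sigma> (int k1 + a)"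
    using red[OF f] by blast
  obtain c2 k2 e2 where 2: "c2 \<noteq> 0" "e2 \<in> hf (int k2 + b)" "const (Fract c2 1) * (\<iota> l2 ^ k2 * g) - \<iota> e2 \<in> \<Sigma> (int k2 + b)"
    using red[OF g] by blast
  define F where "F = const (Fract c1 1) * (\<iota> l2 ^ k1 * f)"
  define G' where "G' = const (Fract c2 1) * (\<iota> l2 ^ k2 * g)"
  have lk: "\<iota> l2 ^ k \<in> hf (int k)" for k using hf_power[OF \<iota>_hf[OF l(2)], of k] by simp
  have Fh: "F \<in> hf (int k1 + a)" unfolding F_def by (intro hf_smult hf_mult lk f)
  let ?t = "int k1 + a + (int k2 + b)"
  have "\<iota> e1 * \<iota> e2 = F * G' - (F * (G' - \<iota> e2) + (F - \<iota> e1) * \<iota> e2)" by (simp add: algebra_simps)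
  moreover have "F * G' \<in> \<Sigma> ?t"
  proof -
    have "F * G' = (const (Fract c1 1) * \<iota> l2 ^ k1 * (const (Fract c2 1) * \<iota> l2 ^ k2)) * (f * g)"
      by (simp add: F_def G'_def ac_simps)
    also have "\<dots> \<in> \<Sigma> ?t"
      by (rule gideal_mult'[OF g\<Sigma> fg hf_mult[OF hf_smult[OF lk] hf_smult[OF lk]]]) simp
    finally show ?thesis .
  qed
  moreover have "F * (G' - \<iota> e2) \<in> \<Sigma> ?t" by (rule gideal_mult[OF g\<Sigma> 2(3)[folded G'_def] Fh])
  moreover have "(F - \<iota> e1) * \<iota> e2 \<in> \<Sigma> ?t" by (rule gideal_mult_right[OF g\<Sigma> 1(3)[folded F_def] \<iota>_hf[OF 2(2)] refl])
  ultimately have "\<iota> (e1 * e2) \<in> \<Sigma> ?t" unfolding \<iota>_mult by (simp add: gideal_add[OF g\<Sigma>] gideal_diff[OF g\<Sigma>])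
  then have "e1 * e2 \<in> D ?t" by (rule \<iota>_mem_\<Sigma>[OF hf_mult[OF 1(2) 2(2)]])
  then have "e1 \<in> D (int k1 + a) \<or> e2 \<in> D (int k2 + b)" by (rule gprimeD[OF D(1) 1(2) 2(2)])
  then show "f \<in> \<Sigma> a \<or> g \<in> \<Sigma> b" using lift[OF f 1(1) _ 1(3)] lift[OF g 2(1) _ 2(3)] by blast
qed

lemma H_\<Sigma>: "\<exists>t0. \<forall>t\<ge>t0. H \<Sigma> t + H D (t - 1) = H D t"
proof -
  obtain t0 where t0: "\<And>t. t \<ge> t0 \<Longrightarrow> \<Sigma> t = \<Sigma>0 t" using sat_eventually[OF g\<Sigma>0] unfolding \<Sigma>_def by blast
  have "H \<Sigma> t + H D (t - 1) = H D t" if "t \<ge> t0" for t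
    using H_exact[OF gideal_bc[OF gD] L_hf, of t] colon_nzd[OF gideal_bc[OF gD] L_hf nzd_bc_pencil[OF gD l(1,2) nzd_l2]]
      H_bc[OF gD] t0[OF that] by (simp add: H_def)
  then show ?thesis by blast
qed

end

section \<open>Castelnuovo's argument\<close>

lemma nzd_H: "gideal I \<Longrightarrow> f \<in> hf e \<Longrightarrow> nzd I e f \<Longrightarrow> H I t = H I (t - e) + H (padd I e f) t"
  using H_exact[of I f e t] colon_nzd[of I f e] by simp

lemma ex_nzd:
  fixes I :: "('n::{finite,linorder}, 'k::field) fam"
  assumes "infinite (UNIV :: 'k set)" "gideal I" "sat I = I"
  obtains l where "l \<in> hf 1" "nzd I 1 l"
  using ex_linear_nonzerodivisor[OF assms] unfolding nzd_def by blast

lemma gideal_full_above: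
  fixes J :: "('n::{finite,linorder}, 'k::field) fam"
  assumes J: "gideal J" and t: "J t = hf t" "t \<ge> 0" and u: "t \<le> u"
  shows "J u = hf u"
  using u
proof (induction u rule: int_ge_induct)
  case (step u)
  have "g \<in> J (u + 1)" if g: "g \<in> hf (u + 1)" for g
  proof -
    obtain h where h: "\<And>i. h i \<in> hf u" "g = (\<Sum>i\<in>UNIV. var i * h i)" using hf_Suc[OF g] t(2) step.hyps by auto
    have "var i * h i \<in> J (u + 1)" for i using h(1)[of i] step.IH by (intro gideal_mult'[OF J _ hf_var]) auto
    then show ?thesis unfolding h(2) by (intro gideal_sum[OF J])
  qed
  then show ?case using gideal_hf[OF J] by blast
qed (rule t)

text \<open>The terms fall by at least 1 until they are at most 0, so their sum is at most D + (D -
  1) + ... + 1.\<close>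

lemma sum_strictly_decreasing:
  fixes a :: "nat \<Rightarrow> int"
  assumes "a 0 \<le> D" "0 \<le> D" "\<And>n. a (Suc n) \<le> max 0 (a n - 1)"
  shows "2 * (\<Sum>n<T. a n) \<le> D * (D + 1)"
  using assms
proof (induction T arbitrary: a D)
  case (Suc T)
  have "2 * (\<Sum>n<T. a (Suc n)) \<le> max 0 (a 0 - 1) * (max 0 (a 0 - 1) + 1)"
    by (rule Suc.IH) (use Suc.prems in auto)
  moreover have "2 * a 0 + max 0 (a 0 - 1) * (max 0 (a 0 - 1) + 1) \<le> D * (D + 1)"
  proof (cases "a 0 \<ge> 1")
    case True
    then have "2 * a 0 + max 0 (a 0 - 1) * (max 0 (a 0 - 1) + 1) = a 0 * (a 0 + 1)" by (simp add: algebra_simps)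
    also have "\<dots> \<le> D * (D + 1)" using True Suc.prems(1) by (intro mult_mono) auto
    finally show ?thesis .
  next
    case False
    then have "max 0 (a 0 - 1) = 0" by simp
    moreover have "0 \<le> D * (D + 1)" using Suc.prems(2) by simp
    ultimately show ?thesis using False by simp
  qed
  moreover have "2 * (\<Sum>n<Suc T. a n) = 2 * a 0 + 2 * (\<Sum>n<T. a (Suc n))" by (subst sum.lessThan_Suc_shift) simp
  ultimately show ?case by linarith
qed simp

section \<open>Hilbert functions of finite schemes\<close>

locale finite_scheme =
  fixes Z :: "('n::{finite,linorder}, 'k::field) fam" and \<delta> :: nat and t0 :: int
  assumes inf: "infinite (UNIV :: 'k set)" and gZ: "gideal Z" and satZ: "sat Z = Z"
    and HZ: "\<And>t. t \<ge> t0 \<Longrightarrow> H Z t = \<delta>"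
begin

lemma H_le_Suc: "H Z t \<le> H Z (t + 1)"
proof -
  obtain z where z: "z \<in> hf 1" "nzd Z 1 z" by (rule ex_nzd[OF inf gZ satZ])
  show ?thesis using nzd_H[OF gZ z, of "t + 1"] by simp
qed

lemma H_mono_degree: "t \<le> u \<Longrightarrow> H Z t \<le> H Z u"
proof (induction u rule: int_ge_induct)
  case (step u)
  then show ?case using H_le_Suc[of u] by linarith
qed simp

lemma H_le: "H Z t \<le> \<delta>"
  using H_mono_degree[of t "max t t0"] HZ[of "max t t0"] by simp

text \<open>When the Hilbert function repeats a value, the quotient by a linear nonzerodivisor
  \<open>z\<close> vanishes in that degree, hence in all later ones, and the function is constant
  from there. The bound \<open>t \<ge> -1\<close> includes the first step, from degree -1 with value
  0.\<close>

lemma H_stable: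
  assumes t: "t \<ge> -1" and eq: "H Z (t + 1) = H Z t"
  shows "H Z t = \<delta>"
proof -
  obtain z where z: "z \<in> hf 1" "nzd Z 1 z" by (rule ex_nzd[OF inf gZ satZ])
  note gp = gideal_padd[OF gZ z(1)]
  have "H (padd Z 1 z) (t + 1) = 0" using nzd_H[OF gZ z, of "t + 1"] eq by simp
  then have full: "padd Z 1 z (t + 1) = hf (t + 1)" using H_eq_0[OF gp] by simp
  have "H Z u = H Z t" if "t \<le> u" for u
    using that
  proof (induction u rule: int_ge_induct)
    case (step u)
    have "padd Z 1 z (u + 1) = hf (u + 1)" by (rule gideal_full_above[OF gp full]) (use t step in auto)
    then have "H (padd Z 1 z) (u + 1) = 0" using H_eq_0[OF gp] by simp
    then show ?case using nzd_H[OF gZ z, of "u + 1"] step.IH by simp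
  qed simp
  from this[of "max t t0"] show ?thesis using HZ[of "max t t0"] by simp
qed

lemma H_strict: "t \<ge> -1 \<Longrightarrow> int (H Z (t + 1)) = int \<delta> \<or> int (H Z (t + 1)) \<ge> int (H Z t) + 1"
  using H_stable[of t] H_le_Suc[of t] by linarith

lemma H_ge: "t \<ge> -1 \<Longrightarrow> min (int \<delta>) (t + 1) \<le> int (H Z t)"
proof (induction t rule: int_ge_induct)
  case (step t)
  then show ?case using H_strict[of t] by linarith
qed simp

text \<open>From degree \<delta> on, the quotient by Z + (z) vanishes. Hence \<open>f\<close> is a
  combination of variables with coefficients in \<open>Z t\<close>, plus \<open>z * w\<close>, and
  \<open>w\<close> lies in \<open>Z t\<close> because \<open>z\<close> cancels. The generators of
  \<open>Z\<close> thus have degree at most \<delta>.\<close>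

lemma generated:
  assumes t: "int \<delta> \<le> t" and f: "f \<in> Z (t + 1)"
  shows "\<exists>g. (\<forall>i. g i \<in> Z t) \<and> f = (\<Sum>i\<in>UNIV. var i * g i)"
proof -
  obtain z where z: "z \<in> hf 1" "nzd Z 1 z" by (rule ex_nzd[OF inf gZ satZ])
  note gp = gideal_padd[OF gZ z(1)]
  have "H Z t = \<delta>" "H Z (t - 1) = \<delta>" using H_ge[of t] H_ge[of "t - 1"] H_le[of t] H_le[of "t - 1"] t by linarith+
  then have "H (padd Z 1 z) t = 0" using nzd_H[OF gZ z, of t] by simp
  then have full: "padd Z 1 z t = hf t" using H_eq_0[OF gp] by simp
  obtain h where h: "\<And>i. h i \<in> hf t" "f = (\<Sum>i\<in>UNIV. var i * h i)"
    using hf_Suc[OF gideal_hf[OF gZ f]] t by auto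
  have "\<exists>a b. h i = a + z * b \<and> a \<in> Z t \<and> b \<in> hf (t - 1)" for i
    using h(1)[of i] unfolding full[symmetric] padd_def by blast
  then obtain a b where ab: "\<And>i. h i = a i + z * b i" "\<And>i. a i \<in> Z t" "\<And>i. b i \<in> hf (t - 1)" by metis
  define w where "w = (\<Sum>i\<in>UNIV. var i * b i)"
  have "z * w = f - (\<Sum>i\<in>UNIV. var i * a i)"
    unfolding h(2) w_def ab(1) by (simp add: sum_distrib_left algebra_simps sum.distrib)
  also have "\<dots> \<in> Z (t + 1)"
    by (intro gideal_diff[OF gZ f] gideal_sum[OF gZ] gideal_mult'[OF gZ ab(2) hf_var]) simp
  finally have zw: "z * w \<in> Z (1 + t)" by (simp add: add.commute)
  have "w \<in> hf t" unfolding w_def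
  proof (rule hf_sum)
    fix i show "var i * b i \<in> hf t" using hf_mult[OF hf_var ab(3), of i i] by simp
  qed
  then have w: "w \<in> Z t" using nzdD[OF z(2) _ zw] by blast
  obtain \<zeta> where \<zeta>: "\<And>i. \<zeta> i \<in> hf 0" "z = (\<Sum>i\<in>UNIV. var i * \<zeta> i)" using hf_Suc[of z 0] z(1) by auto
  have "f = (\<Sum>i\<in>UNIV. var i * a i) + z * w" by (simp add: \<open>z * w = _\<close>)
  also have "z * w = (\<Sum>i\<in>UNIV. var i * (\<zeta> i * w))" by (simp add: \<zeta>(2) sum_distrib_right mult.assoc)
  finally have "f = (\<Sum>i\<in>UNIV. var i * (a i + \<zeta> i * w))" by (simp add: distrib_left sum.distrib)
  moreover have "a i + \<zeta> i * w \<in> Z t" for i using gideal_mult[OF gZ w \<zeta>(1)[of i]] ab(2)[of i] gideal_add[OF gZ] by simp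
  ultimately show ?thesis by (intro exI[of _ "\<lambda>i. a i + \<zeta> i * w"]) blast
qed

end

section \<open>The Hilbert function of an integral curve\<close>

locale integral_curve =
  fixes P :: "('n::{finite,linorder}, 'k::field) fam" and i0 :: 'n and s c t0 :: int
  assumes inf: "infinite (UNIV :: 'k set)" and prime: "gprime P" and relevant: "var i0 \<notin> P 1"
    and s: "s \<ge> 1" and HP: "\<And>t. t \<ge> t0 \<Longrightarrow> int (H P t) = s * t + c"
begin

lemma gP: "gideal P" by (rule gprime_gideal[OF prime])

lemma H_hypersurface:
  assumes f: "f \<in> hf e" "f \<notin> P e"
  shows "H P t = H P (t - e) + H (padd P e f) t"
  by (rule nzd_H[OF gP f(1) nzd_prime[OF prime f]])

lemma H_hypersurface_eventually:
  assumes f: "f \<in> hf e" "f \<notin> P e" and t: "t \<ge> t0 + e" "t \<ge> t0"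
  shows "int (H (padd P e f) t) = s * e"
  using H_hypersurface[OF f, of t] HP[of t] HP[of "t - e"] t by (simp add: algebra_simps)

lemma bezout:
  assumes Q: "gideal Q" "P \<le> Q" "\<And>t. t \<ge> t1 \<Longrightarrow> int (H Q t) = \<delta>" and f: "f \<in> Q i" "f \<notin> P i"
  shows "\<delta> \<le> s * i"
proof -
  have fi: "f \<in> hf i" by (rule gideal_hf[OF Q(1) f(1)])
  have "padd P i f \<le> Q" by (rule padd_least[OF Q(1,2) f(1)])
  then have "H Q t \<le> H (padd P i f) t" for t by (rule H_mono[OF gideal_padd[OF gP fi] Q(1)])
  moreover define t where "t = max t1 (max t0 (t0 + i))"
  then have "t \<ge> t1" "t \<ge> t0 + i" "t \<ge> t0" by auto
  ultimately show ?thesis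
    using H_hypersurface_eventually[OF fi f(2), of t] Q(3)[of t] by (metis of_nat_le_iff)
qed

lemma H_agree:
  assumes Q: "gideal Q" "P \<le> Q" "\<And>t. t \<ge> t1 \<Longrightarrow> int (H Q t) = \<delta>" and i: "s * i < \<delta>"
  shows "H Q i = H P i"
proof -
  have "P i \<subseteq> Q i" using Q(2) by (simp add: le_fun_def)
  moreover have "Q i \<subseteq> P i"
  proof
    fix f assume "f \<in> Q i"
    then show "f \<in> P i" using bezout[OF Q, where f = f and i = i] i by fastforce
  qed
  ultimately show ?thesis using H_eq_iff[OF gP Q(1), of i] by blast
qed

lemma var_power_notin: "var i0 ^ k \<notin> P (int k)"
  using gprime_power[OF prime hf_var, of i0 k] relevant by auto

lemma finite_section:
  assumes k: "k \<ge> 1"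
  obtains t1 where "finite_scheme (sat (padd P (int k) (var i0 ^ k))) (nat (s * int k)) t1" "t1 \<ge> t0 + int k"
    "\<And>t. t \<ge> t1 \<Longrightarrow> sat (padd P (int k) (var i0 ^ k)) t = padd P (int k) (var i0 ^ k) t"
proof -
  have f: "var i0 ^ k \<in> hf (int k)" using hf_power[OF hf_var, of i0 k] by simp
  note gp = gideal_padd[OF gP f]
  obtain u where u: "\<And>t. t \<ge> u \<Longrightarrow> sat (padd P (int k) (var i0 ^ k)) t = padd P (int k) (var i0 ^ k) t"
    using sat_eventually[OF gp] by blast
  have "finite_scheme (sat (padd P (int k) (var i0 ^ k))) (nat (s * int k)) (max u (t0 + int k))"
  proof (unfold_locales)
    fix t assume t: "max u (t0 + int k) \<le> t"
    have "int (H (padd P (int k) (var i0 ^ k)) t) = s * int k"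
      by (rule H_hypersurface_eventually[OF f var_power_notin]) (use t in auto)
    then show "H (sat (padd P (int k) (var i0 ^ k))) t = nat (s * int k)"
      using u[of t] t by (simp add: H_def)
  qed (rule inf gideal_sat[OF gp] sat_sat[OF gp])+
  with u show ?thesis by (intro that[of "max u (t0 + int k)"]) auto
qed

text \<open>The section by \<open>var i0 ^ (i + 1)\<close> has length \<open>s * (i + 1)\<close>; a
  form of degree \<open>i\<close> vanishing on it vanishes on the curve, since \<open>s * i\<close>
  is smaller.\<close>

lemma H_upper:
  assumes i: "i \<ge> -1"
  shows "int (H P i) \<le> s * (i + 1)"
proof (cases "i = -1")
  case True
  then show ?thesis using H_neg[OF gP] by simp
next
  case False
  define k where "k = nat (i + 1)"
  have k: "k \<ge> 1" "int k = i + 1" using False i by (auto simp: k_def)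
  have f: "var i0 ^ k \<in> hf (int k)" using hf_power[OF hf_var, of i0 k] by simp
  let ?J = "padd P (int k) (var i0 ^ k)"
  obtain t1 where fs: "finite_scheme (sat ?J) (nat (s * int k)) t1" by (rule finite_section[OF k(1)])
  interpret Z: finite_scheme "sat ?J" "nat (s * int k)" t1 by (rule fs)
  have "P \<le> sat ?J" using le_padd le_sat[OF gideal_padd[OF gP f]] by (rule order_trans)
  then have "H (sat ?J) i = H P i"
  proof (rule H_agree[OF Z.gZ])
    show "int (H (sat ?J) t) = s * int k" if "t \<ge> t1" for t using Z.HZ[OF that] s by simp
    show "s * i < s * int k" using k(2) s by simp
  qed
  moreover have "int (nat (s * int k)) = s * (i + 1)" using k(2) s by simp
  ultimately show ?thesis using Z.H_le[of i] by (metis of_nat_le_iff)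
qed

text \<open>The hyperplane section has at least \<open>min s (j + 1)\<close> conditions in degree
  \<open>j\<close>, and these are summed over \<open>j \<le> i\<close>. The two clauses distinguish
  whether the minimum has reached \<open>s\<close>.\<close>

lemma H_lower_aux:
  assumes i: "i \<ge> -1"
  shows "(i + 1 \<le> s \<longrightarrow> (i + 1) * (i + 2) \<le> 2 * int (H P i)) \<and>
    (s \<le> i + 1 \<longrightarrow> 2 * s * (i + 1) - s * (s - 1) \<le> 2 * int (H P i))"
  using i
proof (induction i rule: int_ge_induct)
  case base
  then show ?case using s by simp
next
  case (step i)
  let ?J = "padd P (int 1) (var i0 ^ 1)"
  obtain t1 where fs: "finite_scheme (sat ?J) (nat (s * int 1)) t1" by (rule finite_section[of 1]) simp
  interpret Z: finite_scheme "sat ?J" "nat (s * int 1)" t1 by (rule fs)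
  have f: "var i0 ^ 1 \<in> hf (int 1)" by (simp add: hf_var)
  have "H (sat ?J) (i + 1) \<le> H ?J (i + 1)"
    by (rule H_mono[OF gideal_padd[OF gP f] Z.gZ le_sat[OF gideal_padd[OF gP f]]])
  moreover have "min s (i + 2) \<le> int (H (sat ?J) (i + 1))" using Z.H_ge[of "i + 1"] step.hyps s by (simp add: algebra_simps)
  moreover have "H P (i + 1) = H P i + H ?J (i + 1)"
    using H_hypersurface[OF f var_power_notin, of "i + 1"] by simp
  ultimately have st: "int (H P i) + min s (i + 2) \<le> int (H P (i + 1))" by linarith
  show ?case
  proof (intro conjI impI)
    assume "i + 1 + 1 \<le> s"
    then show "(i + 1 + 1) * (i + 1 + 2) \<le> 2 * int (H P (i + 1))" using step.IH st by (simp add: algebra_simps)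
  next
    assume a: "s \<le> i + 1 + 1"
    show "2 * s * (i + 1 + 1) - s * (s - 1) \<le> 2 * int (H P (i + 1))"
    proof (cases "s \<le> i + 1")
      case True
      then show ?thesis using step.IH st by (simp add: algebra_simps)
    next
      case False
      then have "s = i + 2" using a by simp
      then show ?thesis using step.IH st by (simp add: algebra_simps)
    qed
  qed
qed

lemma H_lower:
  assumes i: "i \<ge> -1"
  shows "2 * s * (i + 1) - s * (s - 1) \<le> 2 * int (H P i)"
proof (cases "s \<le> i + 1")
  case False
  have "0 \<le> (s - i - 1) * (s - i - 2)" using False by simp
  then have "2 * s * (i + 1) - s * (s - 1) \<le> (i + 1) * (i + 2)" by (simp add: algebra_simps)
  then show ?thesis using H_lower_aux[OF i] False by linarith
qed (use H_lower_aux[OF i] in blast)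

lemma c_le: "c \<le> s"
  using H_upper[of "max 0 t0"] HP[of "max 0 t0"] by (simp add: algebra_simps)

lemma c_ge: "2 * s - s * (s - 1) \<le> 2 * c"
  using H_lower[of "max 0 t0"] HP[of "max 0 t0"] by (simp add: algebra_simps)

text \<open>The excess of the Hilbert polynomial over the Hilbert function. It may be negative; the
  estimates below bound it from above.\<close>

definition "\<epsilon> i = s * i + c - int (H P i)"

lemma \<epsilon>_le: "i \<ge> -1 \<Longrightarrow> 2 * \<epsilon> i \<le> 2 * (c - s) + s * (s - 1)"
  using H_lower[of i] by (simp add: \<epsilon>_def algebra_simps)

text \<open>If the hyperplane section is saturated in degree \<open>i \<ge> s\<close>, generation in
  degrees at most \<open>s\<close> keeps it saturated, so \<epsilon> is constant from
  \<open>i - 1\<close> on and, being 0 eventually, is 0. Otherwise the Hilbert function of the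
  section exceeds \<open>s\<close>, and \<epsilon> falls by at least 1.\<close>

lemma \<epsilon>_step:
  assumes i: "i \<ge> s"
  shows "\<epsilon> i \<le> max 0 (\<epsilon> (i - 1) - 1)"
proof -
  let ?J = "padd P (int 1) (var i0 ^ 1)"
  obtain t1 where fs: "finite_scheme (sat ?J) (nat (s * int 1)) t1" and t1: "t1 \<ge> t0 + int 1"
    "\<And>t. t \<ge> t1 \<Longrightarrow> sat ?J t = ?J t" using finite_section[of 1] by auto
  interpret Z: finite_scheme "sat ?J" "nat (s * int 1)" t1 by (rule fs)
  have f: "var i0 ^ 1 \<in> hf (int 1)" by (simp add: hf_var)
  note gJ = gideal_padd[OF gP f]
  have le: "H (sat ?J) t \<le> H ?J t" for t by (rule H_mono[OF gJ Z.gZ le_sat[OF gJ]])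
  have HZ: "int (H (sat ?J) t) = s" if "t \<ge> s" for t using Z.H_ge[of t] Z.H_le[of t] that s by simp
  have ex: "\<epsilon> t = \<epsilon> (t - 1) + s - int (H ?J t)" for t
    using H_hypersurface[OF f var_power_notin, of t] by (simp add: \<epsilon>_def algebra_simps)
  show ?thesis
  proof (cases "int (H ?J i) = s")
    case True
    have sub: "?J i \<subseteq> sat ?J i" using le_sat[OF gJ] by (simp add: le_fun_def)
    have eqi: "?J i = sat ?J i" using H_eq_iff[OF gJ Z.gZ sub] True HZ[OF i] by simp
    have eq: "?J t = sat ?J t" if "i \<le> t" for t
      using that
    proof (induction t rule: int_ge_induct)
      case (step t)
      have "f \<in> ?J (t + 1)" if "f \<in> sat ?J (t + 1)" for f
      proof -
        have "int (nat (s * int 1)) \<le> t" using i step.hyps s by simp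
        from Z.generated[OF this, of f] that obtain g where g: "\<And>j. g j \<in> sat ?J t" "f = (\<Sum>j\<in>UNIV. var j * g j)" by metis
        then have "g j \<in> ?J t" for j using step.IH by simp
        then show ?thesis unfolding g(2) by (intro gideal_sum[OF gJ] gideal_mult'[OF gJ _ hf_var]) auto
      qed
      then show ?case using le_sat[OF gJ] by (auto simp: le_fun_def)
    qed (rule eqi)
    have const: "\<epsilon> t = \<epsilon> (i - 1)" if "i \<le> t" for t
      using that
    proof (induction t rule: int_ge_induct)
      case base
      then show ?case using ex[of i] True by simp
    next
      case (step t)
      have "int (H ?J (t + 1)) = s" using HZ[of "t + 1"] eq[of "t + 1"] step.hyps i by (simp add: H_def)
      then show ?case using ex[of "t + 1"] step.IH by simp
    qed
    have "\<epsilon> (max i t0) = 0" using HP[of "max i t0"] by (simp add: \<epsilon>_def)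
    then show ?thesis using const[of "max i t0"] const[of i] by simp
  next
    case False
    then have "int (H ?J i) \<ge> s + 1" using le[of i] HZ[OF i] by linarith
    then show ?thesis using ex[of i] by linarith
  qed
qed

text \<open>\<open>D1 = s (s - 1) / 2\<close> bounds every \<epsilon>, by the lower bound for
  \<open>H P\<close> and \<open>c \<le> s\<close>. The first \<open>s\<close> degrees contribute at
  most \<open>s * D1\<close>; from there on the values fall by at least 1 until they are
  nonpositive.\<close>

lemma sum_\<epsilon>_le:
  assumes D1: "2 * D1 = s * (s - 1)"
  shows "2 * (\<Sum>i<M. \<epsilon> (int i)) \<le> 2 * (s * D1) + D1 * (D1 + 1)"
proof -
  have D0: "0 \<le> D1" using D1 s by (smt (verit) mult_nonneg_nonneg)
  have e: "\<epsilon> i \<le> D1" if "i \<ge> -1" for i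
  proof -
    have "2 * \<epsilon> i \<le> 2 * D1" using \<epsilon>_le[OF that, folded D1] c_le by simp
    then show ?thesis by simp
  qed
  define S where "S = nat s"
  have S: "int S = s" using s by (simp add: S_def)
  have low: "(\<Sum>i<N. \<epsilon> (int i)) \<le> s * D1" if "N \<le> S" for N
  proof -
    have "(\<Sum>i<N. \<epsilon> (int i)) \<le> (\<Sum>i<N. D1)" by (intro sum_mono e) simp
    also have "\<dots> = int N * D1" by simp
    also have "\<dots> \<le> s * D1" using that S D0 by (intro mult_right_mono) auto
    finally show ?thesis .
  qed
  show ?thesis
  proof (cases "M \<le> S")
    case True
    moreover have "0 \<le> D1 * (D1 + 1)" using D0 by simp
    ultimately show ?thesis using low[of M] by linarith
  next
    case False
    have "(\<Sum>i<M. \<epsilon> (int i)) = (\<Sum>i<S. \<epsilon> (int i)) + (\<Sum>i=S..<M. \<epsilon> (int i))"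
      using False by (intro sum.lessThan_Suc_shift[THEN trans] | subst sum.ub_add_nat | simp add: lessThan_atLeast0 sum.atLeastLessThan_concat)+
    moreover have "(\<Sum>i=S..<M. \<epsilon> (int i)) = (\<Sum>n<M - S. \<epsilon> (s + int n))"
      using False S by (intro sum.reindex_bij_witness[of _ "\<lambda>n. n + S" "\<lambda>i. i - S"]) (auto simp: of_nat_diff)
    moreover have "2 * (\<Sum>n<M - S. \<epsilon> (s + int n)) \<le> D1 * (D1 + 1)"
    proof (rule sum_strictly_decreasing)
      show "\<epsilon> (s + int 0) \<le> D1" using e s by simp
      show "\<epsilon> (s + int (Suc n)) \<le> max 0 (\<epsilon> (s + int n) - 1)" for n
        using \<epsilon>_step[of "s + int (Suc n)"] by (simp add: algebra_simps)
    qed (rule D0)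
    ultimately show ?thesis using low[of S] by linarith
  qed
qed

end

section \<open>Deficiency of finite sections and the genus bound on surfaces\<close>

locale points_on_curve = integral_curve P i0 s c t0 + Q: finite_scheme Q \<delta> t1
  for P :: "('n::{finite,linorder}, 'k::field) fam" and i0 s c t0 Q \<delta> t1 +
  assumes PQ: "P \<le> Q" and \<delta>: "\<delta> \<ge> 1"
begin

text \<open>\<open>M\<close> is \<delta>/s rounded up. Below degree \<open>M\<close> Bezout makes
  the Hilbert functions of \<open>Q\<close> and of the curve agree; from \<open>M\<close> on the
  deficiency, at most \<open>D1\<close> at the start, falls by at least 1 until it is 0.\<close>

lemma deficiency_int:
  assumes M: "M \<ge> 1" "s * (int M - 1) < int \<delta>" "int \<delta> \<le> s * int M" and D1: "2 * D1 = s * (s - 1)"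
  shows "2 * (\<Sum>i<M + T. int \<delta> - int (H Q (int i))) \<le>
    2 * int M * (int \<delta> - c) - s * int M * (int M - 1) + 2 * s * D1 + 2 * D1 * (D1 + 1)"
proof -
  have D0: "0 \<le> D1" using D1 s by (smt (verit) mult_nonneg_nonneg)
  have agree: "H Q i = H P i" if "s * i < int \<delta>" for i
    by (rule H_agree[OF Q.gZ PQ _ that, of t1]) (simp add: Q.HZ)
  have "(\<Sum>i<M. int \<delta> - int (H Q (int i))) = (\<Sum>i<M. (int \<delta> - c - s * int i) + \<epsilon> (int i))"
  proof (intro sum.cong refl)
    fix i assume "i \<in> {..<M}"
    then have "s * int i \<le> s * (int M - 1)" using s by (intro mult_left_mono) auto
    then show "int \<delta> - int (H Q (int i)) = (int \<delta> - c - s * int i) + \<epsilon> (int i)"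
      using agree[of "int i"] M(2) by (simp add: \<epsilon>_def)
  qed
  also have "2 * \<dots> = 2 * (\<Sum>i<M. int \<delta> - c - s * int i) + 2 * (\<Sum>i<M. \<epsilon> (int i))" by (simp add: sum.distrib)
  also have "2 * (\<Sum>i<N. int \<delta> - c - s * int i) = 2 * int N * (int \<delta> - c) - s * int N * (int N - 1)" for N
    by (induction N) (simp_all add: algebra_simps)
  finally have A: "2 * (\<Sum>i<M. int \<delta> - int (H Q (int i))) \<le>
      2 * int M * (int \<delta> - c) - s * int M * (int M - 1) + 2 * s * D1 + D1 * (D1 + 1)"
    using sum_\<epsilon>_le[OF D1, of M] by simp
  have B: "2 * (\<Sum>n<T. int \<delta> - int (H Q (int (M + n)))) \<le> D1 * (D1 + 1)"
  proof (rule sum_strictly_decreasing)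
    have "H Q (int M - 1) = H P (int M - 1)" by (rule agree[OF M(2)])
    then have "int \<delta> - int (H Q (int M - 1)) \<le> s + \<epsilon> (int M - 1) - c" using M(3) by (simp add: \<epsilon>_def algebra_simps)
    then have "int \<delta> - int (H Q (int M - 1)) \<le> D1" using \<epsilon>_le[of "int M - 1", folded D1] M(1) by (simp add: algebra_simps)
    then show "int \<delta> - int (H Q (int (M + 0))) \<le> D1" using Q.H_le_Suc[of "int M - 1"] by simp
    show "int \<delta> - int (H Q (int (M + Suc n))) \<le> max 0 (int \<delta> - int (H Q (int (M + n))) - 1)" for n
      using Q.H_strict[of "int (M + n)"] by (simp add: algebra_simps) linarith
  qed (rule D0)
  have "(\<Sum>i<M + T. int \<delta> - int (H Q (int i))) =
      (\<Sum>i<M. int \<delta> - int (H Q (int i))) + (\<Sum>n<T. int \<delta> - int (H Q (int (M + n))))"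
    by (induction T) auto
  then show ?thesis using A B by linarith
qed

lemma deficiency_le:
  "(\<Sum>i<T. real \<delta> - real (H Q (int i))) \<le> (real \<delta>)\<^sup>2 / (2 * s) + real \<delta> * (1 / 2 - c / s) + 2 * real_of_int s ^ 4"
proof -
  have "even (s * (s - 1))" by simp
  then obtain D1 where D1: "2 * D1 = s * (s - 1)" by (metis dvdE)
  define r where "r = real_of_int s"
  define M where "M = nat ((int \<delta> + s - 1) div s)"
  define k where "k = (int \<delta> + s - 1) div s"
  have kk: "s * k \<le> int \<delta> + s - 1" "int \<delta> + s - 1 < s * k + s"
    using s by (simp_all add: k_def minus_mod_eq_mult_div[symmetric] algebra_simps)
  have "s * k > 0" using kk \<delta> by linarith
  then have k1: "k \<ge> 1" using s by (smt (verit) mult_nonneg_nonpos)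
  then have Mk: "int M = k" by (simp add: M_def k_def)
  have M: "M \<ge> 1" "s * (int M - 1) < int \<delta>" "int \<delta> \<le> s * int M"
    using kk k1 Mk by (simp_all add: algebra_simps)
  have "2 * (\<Sum>i<T. int \<delta> - int (H Q (int i))) \<le> 2 * (\<Sum>i<M + T. int \<delta> - int (H Q (int i)))"
    using Q.H_le by (intro mult_left_mono sum_mono2) auto
  also note deficiency_int[OF M D1]
  finally have "real_of_int (2 * (\<Sum>i<T. int \<delta> - int (H Q (int i)))) \<le>
    real_of_int (2 * int M * (int \<delta> - c) - s * int M * (int M - 1) + 2 * s * D1 + 2 * D1 * (D1 + 1))"
    by (rule of_int_le_iff[THEN iffD2])
  then have 1: "2 * (\<Sum>i<T. real \<delta> - real (H Q (int i))) \<le>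
    2 * real M * (real \<delta> - c) - r * real M * (real M - 1) + 2 * r * D1 + 2 * real_of_int D1 * (real_of_int D1 + 1)"
    by (simp add: r_def)
  have r1: "r \<ge> 1" using s by (simp add: r_def)
  have D: "2 * real_of_int D1 = r * (r - 1)"
    using arg_cong[OF D1, of real_of_int] by (simp add: r_def)
  \<comment> \<open>\<theta> lies in [0, 1] and is the rounding error of \<open>M\<close>; its
    contribution to the quadratic expression in \<open>M\<close> is at most
    \<open>r ^ 2\<close>.\<close>
  define \<theta> where "\<theta> = real M - real \<delta> / r"
  have M': "real M = real \<delta> / r + \<theta>" by (simp add: \<theta>_def)
  have \<theta>0: "0 \<le> \<theta>"
  proof -
    have "real_of_int (int \<delta>) \<le> real_of_int (s * int M)" using M(3) by (simp only: of_int_le_iff)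
    then show ?thesis using r1 by (simp add: \<theta>_def r_def field_simps)
  qed
  have \<theta>1: "\<theta> \<le> 1"
  proof -
    have "real_of_int (s * (int M - 1)) < real_of_int (int \<delta>)" using M(2) by (simp only: of_int_less_iff)
    then show ?thesis using r1 by (simp add: \<theta>_def r_def field_simps)
  qed
  have c: "2 * r - r * (r - 1) \<le> 2 * real_of_int c"
    using c_ge of_int_le_iff[of "2 * s - s * (s - 1)" "2 * c", where ?'a = real] by (simp add: r_def)
  have "\<theta> * (r - 2 * c) \<le> r ^ 2"
  proof -
    have "r - 2 * c \<le> r ^ 2" using c r1 by (simp add: power2_eq_square algebra_simps)
    then have "\<theta> * (r - 2 * c) \<le> \<theta> * r ^ 2" using \<theta>0 by (rule mult_left_mono)
    also have "\<dots> \<le> r ^ 2" using \<theta>1 \<theta>0 by (simp add: mult_left_le_one_le)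
    finally show ?thesis .
  qed
  moreover have "2 * real M * (real \<delta> - c) - r * real M * (real M - 1) =
      (real \<delta>)\<^sup>2 / r + 2 * (real \<delta> * (1 / 2 - c / r)) - r * \<theta>\<^sup>2 + \<theta> * (r - 2 * c)"
    unfolding M' using r1 by (simp add: field_simps power2_eq_square)
  moreover have "0 \<le> r * \<theta>\<^sup>2" using r1 by simp
  moreover have "2 * r * D1 + 2 * real_of_int D1 * (real_of_int D1 + 1) + r ^ 2 \<le> 4 * r ^ 4"
  proof -
    have D1r: "real_of_int D1 = r * (r - 1) / 2" using D by simp
    have "2 * r * D1 + 2 * real_of_int D1 * (real_of_int D1 + 1) + r ^ 2 = r ^ 2 * (r - 1) + r * (r - 1) * (r * (r - 1) / 2 + 1) + r ^ 2"
      unfolding D1r by (simp add: power2_eq_square field_simps)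
    also have "\<dots> = r ^ 4 / 2 + 3 * r ^ 2 / 2 - r" by (simp add: power2_eq_square power4_eq_xxxx field_simps)
    also have "\<dots> \<le> 4 * r ^ 4"
      using power_increasing[of 2 4 r] zero_le_power[of r 4] r1 by linarith
    finally show ?thesis .
  qed
  ultimately have "2 * (\<Sum>i<T. real \<delta> - real (H Q (int i))) \<le>
      (real \<delta>)\<^sup>2 / r + 2 * (real \<delta> * (1 / 2 - c / r)) + 4 * r ^ 4" using 1 by linarith
  then show ?thesis by (simp add: r_def)
qed

end

lemma infinite_UNIV_ufield: "infinite (UNIV :: ufield set)"
proof -
  have "inj (\<lambda>c :: complex. Fract [:c:] 1)" by (rule injI) (simp add: eq_fract)
  then show ?thesis using infinite_UNIV_char_0[where ?'a = complex] finite_imageD[of "\<lambda>c :: complex. Fract [:c:] 1" UNIV]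
    finite_subset[of "range (\<lambda>c :: complex. Fract [:c:] 1)" UNIV] by blast
qed

text \<open>\<open>HD\<close> gives the Hilbert polynomial s x + c of a hyperplane section, so 1 - c
  is the sectional genus.\<close>

locale integral_surface =
  fixes D :: "'n::{finite,linorder} cfam" and i0 :: 'n and s c :: int
  assumes D: "gprime D" "var i0 \<notin> D 1" and s: "s \<ge> 1"
    and HD: "\<And>x. poly (HP D) x - poly (HP D) (x - 1) = of_int s * x + of_int c"
begin

lemma gD: "gideal D" by (rule gprime_gideal[OF D(1)])

lemma H_difference: "\<exists>u. \<forall>t\<ge>u. int (H D t) - int (H D (t - 1)) = s * t + c"
proof -
  obtain u where u: "\<And>t. t \<ge> u \<Longrightarrow> real (H D t) = poly (HP D) (of_int t)" using HP_at[OF gD] by blast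
  have "int (H D t) - int (H D (t - 1)) = s * t + c" if "t \<ge> u + 1" for t
  proof -
    have "real_of_int (int (H D t) - int (H D (t - 1))) = of_int (s * t + c)"
      using HD[of "of_int t"] u[of t] u[of "t - 1"] that by simp
    then show ?thesis by (simp only: of_int_eq_iff)
  qed
  then show ?thesis by blast
qed

text \<open>\<open>l2\<close> is chosen as a nonzerodivisor on the given scheme \<open>B\<close>, so
  that the generic pencil member is one as well; \<open>l1\<close> is then chosen modulo the section
  by \<open>l2\<close>.\<close>

lemma ex_hyperplane_pencil:
  assumes B: "gideal B" "sat B = B" "D \<le> B" "1 \<notin> B 0"
  obtains l1 l2 where "hyperplane_pencil D l1 l2 i0" "nzd B 1 l2"
proof -
  obtain u where u: "\<And>t. t \<ge> u \<Longrightarrow> int (H D t) - int (H D (t - 1)) = s * t + c" using H_difference by blast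
  obtain l2 where l2: "l2 \<in> hf 1" "nzd B 1 l2" by (rule ex_nzd[OF infinite_UNIV_char_0 B(1,2)])
  have l2D: "l2 \<notin> D 1"
  proof
    assume "l2 \<in> D 1"
    then have "l2 * 1 \<in> B (1 + 0)" using B(3) by (auto simp: le_fun_def)
    then show False using nzdD[OF l2(2) hf_one] B(4) by blast
  qed
  define J where "J = padd D 1 l2"
  have gJ: "gideal J" unfolding J_def by (rule gideal_padd[OF gD l2(1)])
  have ne: "1 \<notin> sat J 0"
  proof
    assume "1 \<in> sat J 0"
    then have "sat J = hf" by (rule gideal_eq_UNIV[OF gideal_sat[OF gJ]])
    moreover obtain w where w: "\<And>t. t \<ge> w \<Longrightarrow> sat J t = J t" using sat_eventually[OF gJ] by blast
    ultimately have J0: "H J t = 0" if "t \<ge> w" for t using H_eq_0[OF gJ, of t] w[OF that] by simp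
    \<comment> \<open>In degrees above |c| the value s t + c is positive because
      \<open>s \<ge> 1\<close>, so the section by \<open>l2\<close> cannot be empty.\<close>
    define t where "t = max (max w u) (\<bar>c\<bar> + 1)"
    have "t \<ge> w" "t \<ge> u" "t \<ge> \<bar>c\<bar> + 1" by (auto simp: t_def)
    then have "s * t + c = 0"
      using nzd_H[OF gD l2(1) nzd_prime[OF D(1) l2(1) l2D], of t] J0[of t] u[of t] by (simp add: J_def)
    moreover have "t \<le> s * t" using s \<open>t \<ge> \<bar>c\<bar> + 1\<close> by (smt (verit) mult_le_cancel_right1)
    ultimately show False using \<open>t \<ge> \<bar>c\<bar> + 1\<close> by linarith
  qed
  obtain l1 where "l1 \<in> hf 1" "nzd (sat J) 1 l1" by (rule ex_nzd[OF infinite_UNIV_char_0 gideal_sat[OF gJ] sat_sat[OF gJ]])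
  then have "hyperplane_pencil D l1 l2 i0"
    using D l2(1) l2D ne by unfold_locales (simp_all add: J_def)
  then show ?thesis using l2(2) that by blast
qed

lemma integral_curve_pencil:
  assumes "hyperplane_pencil D l1 l2 i0"
  shows "\<exists>t0. integral_curve (hyperplane_pencil.\<Sigma> D l1 l2) i0 s c t0"
proof -
  interpret hyperplane_pencil D l1 l2 i0 by (rule assms)
  obtain u where u: "\<And>t. t \<ge> u \<Longrightarrow> int (H D t) - int (H D (t - 1)) = s * t + c" using H_difference by blast
  obtain t0 where t0: "\<And>t. t \<ge> t0 \<Longrightarrow> H \<Sigma> t + H D (t - 1) = H D t" using H_\<Sigma> by blast
  have "integral_curve \<Sigma> i0 s c (max t0 u)"
  proof unfold_locales
    show "var i0 \<notin> \<Sigma> 1"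
    proof
      assume "var i0 \<in> \<Sigma> 1"
      then have "\<iota> (var i0) \<in> \<Sigma> 1" by (simp add: var_def \<iota>_single One_fract_def one_pCons)
      then show False using \<iota>_mem_\<Sigma>[OF hf_var] D(2) by blast
    qed
    show "int (H \<Sigma> t) = s * t + c" if "max t0 u \<le> t" for t
      using t0[of t] u[of t] that by simp
  qed (use infinite_UNIV_ufield gprime_\<Sigma> s in auto)
  then show ?thesis by blast
qed

lemma c_bounds: "c \<le> s" "2 * s - s * (s - 1) \<le> 2 * c"
proof -
  have "1 \<notin> D 0" using D(1) by (simp add: gprime_def)
  then obtain l1 l2 where p: "hyperplane_pencil D l1 l2 i0"
    using ex_hyperplane_pencil[OF gD gprime_saturated[OF D]] by blast
  then obtain t0 where "integral_curve (hyperplane_pencil.\<Sigma> D l1 l2) i0 s c t0" using integral_curve_pencil by blast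
  then show "c \<le> s" "2 * s - s * (s - 1) \<le> 2 * c" by (rule integral_curve.c_le integral_curve.c_ge)+
qed

text \<open>Castelnuovo's count: \<open>H B\<close> is the running sum of the Hilbert function of
  the generic hyperplane section. Hence \<delta> - \<chi> is at most the sum of the deficiencies of
  the saturated section, a finite scheme of length \<delta> on the integral curve
  \<open>\<Sigma>\<close> over C(u).\<close>

lemma genus_bound:
  assumes B: "gideal B" "sat B = B" "D \<le> B" and HB: "\<And>x. poly (HP B) x = real \<delta> * x + \<chi>" and \<delta>: "\<delta> \<ge> 1"
  shows "- \<chi> \<le> (real \<delta>)\<^sup>2 / (2 * s) + real \<delta> * (- c / s - 1 / 2) + 2 * real_of_int s ^ 4"
proof -
  obtain v where v: "\<And>t. t \<ge> v \<Longrightarrow> real (H B t) = poly (HP B) (of_int t)" using HP_at[OF B(1)] by blast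
  have B1: "1 \<notin> B 0"
  proof
    assume "1 \<in> B 0"
    then have "B = hf" by (rule gideal_eq_UNIV[OF B(1)])
    then have "HP B = 0" using HP_eq_0_iff[OF B(1)] by blast
    then show False using HB[of 0] HB[of 1] \<delta> by simp
  qed
  obtain l1 l2 where p: "hyperplane_pencil D l1 l2 i0" and l2: "nzd B 1 l2" by (rule ex_hyperplane_pencil[OF B B1])
  interpret hyperplane_pencil D l1 l2 i0 by (rule p)
  obtain t0 where ic: "integral_curve \<Sigma> i0 s c t0" using integral_curve_pencil[OF p] by blast
  note gb = gideal_bc[OF B(1)]
  note L = nzd_bc_pencil[OF B(1) l(1,2) l2]
  define \<Gamma>0 where "\<Gamma>0 = padd (bc B) 1 L"
  have g\<Gamma>0: "gideal \<Gamma>0" unfolding \<Gamma>0_def by (rule gideal_padd[OF gb L_hf])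
  have H\<Gamma>0: "H B t = H B (t - 1) + H \<Gamma>0 t" for t using nzd_H[OF gb L_hf L, of t] H_bc[OF B(1)] by (simp add: \<Gamma>0_def)
  have "bc D \<le> bc B" using B(3) by (intro le_funI bc_mono) (simp add: le_fun_def)
  then have "bc D \<le> \<Gamma>0" using le_padd[of "bc B" 1 L] unfolding \<Gamma>0_def by (rule order_trans)
  then have "\<Sigma>0 \<le> \<Gamma>0" by (rule padd_least[OF g\<Gamma>0]) (simp add: \<Gamma>0_def mem_padd[OF gb])
  then have \<Sigma>\<Gamma>: "\<Sigma> \<le> sat \<Gamma>0" unfolding \<Sigma>_def by (rule sat_mono)
  obtain w where w: "\<And>t. t \<ge> w \<Longrightarrow> sat \<Gamma>0 t = \<Gamma>0 t" using sat_eventually[OF g\<Gamma>0] by blast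
  interpret integral_curve \<Sigma> i0 s c t0 by (rule ic)
  interpret points_on_curve \<Sigma> i0 s c t0 "sat \<Gamma>0" \<delta> "max w (v + 1)"
  proof unfold_locales
    show "H (sat \<Gamma>0) t = \<delta>" if "max w (v + 1) \<le> t" for t
    proof -
      have "real (H \<Gamma>0 t) = real (H B t) - real (H B (t - 1))" using H\<Gamma>0[of t] by simp
      also have "\<dots> = real \<delta>" using v[of t] v[of "t - 1"] that by (simp add: HB algebra_simps)
      finally show ?thesis using w[of t] that by (simp add: H_def)
    qed
  qed (use infinite_UNIV_ufield \<delta> \<Sigma>\<Gamma> gideal_sat[OF g\<Gamma>0] sat_sat[OF g\<Gamma>0] in auto)
  define T where "T = nat v + 1"
  have tele: "(\<Sum>i<N. real (H \<Gamma>0 (int i))) = real (H B (int N - 1))" for N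
  proof (induction N)
    case 0
    then show ?case using H_neg[OF B(1)] by simp
  next
    case (Suc N)
    then show ?case using H\<Gamma>0[of "int N"] by simp
  qed
  have "real \<delta> * real T - real (H B (int T - 1)) = (\<Sum>i<T. real \<delta> - real (H \<Gamma>0 (int i)))"
    unfolding tele[symmetric] by (simp add: sum_subtractf)
  also have "\<dots> \<le> (\<Sum>i<T. real \<delta> - real (H (sat \<Gamma>0) (int i)))"
    using H_mono[OF g\<Gamma>0 gideal_sat[OF g\<Gamma>0] le_sat[OF g\<Gamma>0]] by (intro sum_mono) simp
  also note deficiency_le
  also have "real (H B (int T - 1)) = real \<delta> * (real T - 1) + \<chi>" using v[of "int T - 1"] by (simp add: T_def HB)
  finally show ?thesis by (simp add: algebra_simps)
qed

end

section \<open>Sectional genus\<close>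

definition monomial_value :: "('n::{finite,linorder} \<Rightarrow> complex) \<Rightarrow> ('n \<Rightarrow>\<^sub>0 nat) \<Rightarrow> complex" where
  "monomial_value a m = (\<Prod>i\<in>UNIV. a i ^ lookup m i)"

lemma monomial_value_add: "monomial_value a (m + m') = monomial_value a m * monomial_value a m'"
  by (simp add: monomial_value_def lookup_add power_add prod.distrib)

lemma monomial_value_single: "monomial_value a (single i 1) = a i"
proof -
  have "monomial_value a (single i 1) = (\<Prod>j\<in>UNIV. if j = i then a i else 1)"
    unfolding monomial_value_def by (intro prod.cong refl) (simp add: lookup_single when_def)
  then show ?thesis by simp
qed

lemma eval_superset:
  "finite K \<Longrightarrow> keys p \<subseteq> K \<Longrightarrow> eval_mpoly p a = (\<Sum>m\<in>K. lookup p m * monomial_value a m)"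
  unfolding eval_mpoly_def monomial_value_def[symmetric]
  by (rule sum.mono_neutral_left) (auto simp: in_keys_iff)

lemma eval_single: "eval_mpoly (single m c) a = c * monomial_value a m"
  by (subst eval_superset[of "{m}"]) (auto simp: keys_single lookup_single)

lemma eval_0 [simp]: "eval_mpoly 0 a = 0"
  by (simp add: eval_mpoly_def)

lemma eval_add: "eval_mpoly (p + q) a = eval_mpoly p a + eval_mpoly q a"
proof -
  let ?K = "keys p \<union> keys q"
  have "eval_mpoly r a = (\<Sum>m\<in>?K. lookup r m * monomial_value a m)" if "r \<in> {p, q, p + q}" for r
    using that Poly_Mapping.keys_add[of p q] by (intro eval_superset) auto
  then show ?thesis by (simp add: lookup_add distrib_right sum.distrib)
qed

lemma eval_sum: "eval_mpoly (sum f A) a = (\<Sum>x\<in>A. eval_mpoly (f x) a)"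
  by (induction A rule: infinite_finite_induct) (simp_all add: eval_add)

lemma eval_mult: "eval_mpoly (p * q) a = eval_mpoly p a * eval_mpoly q a"
proof -
  let ?l = lookup
  have "p * q = (\<Sum>m\<in>keys p. \<Sum>n\<in>keys q. single (m + n) (?l p m * ?l q n))"
    by (subst sum_monomials[of p], subst sum_monomials[of q]) (simp add: sum_product mult_single)
  then have "eval_mpoly (p * q) a = (\<Sum>m\<in>keys p. \<Sum>n\<in>keys q.
      (?l p m * monomial_value a m) * (?l q n * monomial_value a n))"
    by (simp only: eval_sum eval_single monomial_value_add ac_simps)
  also have "\<dots> = eval_mpoly p a * eval_mpoly q a"
    by (simp add: eval_superset[of "keys p" p] eval_superset[of "keys q" q] sum_product)
  finally show ?thesis .
qed

text \<open>Induction on the set \<open>A\<close> of variables: the exponent of \<open>j\<close> is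
  fixed as in some \<open>m0\<close>, the corresponding coefficient is made nonzero by induction,
  and the value of the variable \<open>j\<close> avoids finitely many roots.\<close>

lemma nonvanishing_exponents:
  fixes K :: "('i \<Rightarrow> nat) set" and c :: "('i \<Rightarrow> nat) \<Rightarrow> complex"
  assumes "finite A" "finite K" "K \<noteq> {}" "\<And>m. m \<in> K \<Longrightarrow> c m \<noteq> 0"
    "\<And>m m'. m \<in> K \<Longrightarrow> m' \<in> K \<Longrightarrow> (\<And>i. i \<in> A \<Longrightarrow> m i = m' i) \<Longrightarrow> m = m'"
  shows "\<exists>a. (\<forall>i\<in>A. a i \<noteq> 0) \<and> (\<Sum>m\<in>K. c m * (\<Prod>i\<in>A. a i ^ m i)) \<noteq> 0"
  using assms
proof (induction A arbitrary: K rule: finite_induct)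
  case empty
  then obtain m where "m \<in> K" by blast
  with empty have "K = {m}" by blast
  then show ?case using empty by simp
next
  case (insert j A)
  obtain m0 where m0: "m0 \<in> K" using insert.prems by blast
  let ?K = "{m \<in> K. m j = m0 j}"
  have "\<exists>a. (\<forall>i\<in>A. a i \<noteq> 0) \<and> (\<Sum>m\<in>?K. c m * (\<Prod>i\<in>A. a i ^ m i)) \<noteq> 0"
  proof (rule insert.IH)
    show "finite ?K" "?K \<noteq> {}" using insert.prems m0 by auto
    show "c m \<noteq> 0" if "m \<in> ?K" for m using insert.prems that by auto
    show "m = m'" if m: "m \<in> ?K" "m' \<in> ?K" "\<And>i. i \<in> A \<Longrightarrow> m i = m' i" for m m'
    proof (rule insert.prems(4))
      show "m \<in> K" "m' \<in> K" using m by auto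
      show "m i = m' i" if "i \<in> insert j A" for i using m that by auto
    qed
  qed
  then obtain a where a: "\<forall>i\<in>A. a i \<noteq> 0" "(\<Sum>m\<in>?K. c m * (\<Prod>i\<in>A. a i ^ m i)) \<noteq> 0" by blast
  define q where "q = (\<Sum>m\<in>K. monom (c m * (\<Prod>i\<in>A. a i ^ m i)) (m j))"
  have "coeff q (m0 j) = (\<Sum>m\<in>?K. c m * (\<Prod>i\<in>A. a i ^ m i))"
    unfolding q_def coeff_sum coeff_monom using insert.prems(1) by (simp add: sum.inter_filter)
  then have "q \<noteq> 0" using a(2) by auto
  then have "finite (insert 0 {z. poly q z = 0})" using poly_roots_finite by blast
  then obtain z where z: "z \<noteq> 0" "poly q z \<noteq> 0" using ex_new_if_finite[OF infinite_UNIV_char_0] by blast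
  have pr: "(\<Prod>i\<in>insert j A. (a(j := z)) i ^ m i) = z ^ m j * (\<Prod>i\<in>A. a i ^ m i)" for m
  proof -
    have "(\<Prod>i\<in>A. (a(j := z)) i ^ m i) = (\<Prod>i\<in>A. a i ^ m i)" using insert.hyps(2) by (intro prod.cong) auto
    then show ?thesis using insert.hyps by simp
  qed
  have "(\<Sum>m\<in>K. c m * (\<Prod>i\<in>insert j A. (a(j := z)) i ^ m i)) = poly q z"
    unfolding pr q_def poly_sum poly_monom by (intro sum.cong refl) simp
  then show ?case using z a(1) by (intro exI[of _ "a(j := z)"]) auto
qed

lemma ex_nonvanishing:
  fixes F :: "'n::{finite,linorder} mpoly"
  assumes F: "F \<noteq> 0"
  obtains a where "a \<noteq> 0" "eval_mpoly F a \<noteq> 0"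
proof -
  let ?K = "lookup ` keys F"
  have "\<exists>a. (\<forall>i\<in>UNIV. a i \<noteq> 0) \<and>
    (\<Sum>m\<in>?K. lookup F (Abs_poly_mapping m) * (\<Prod>i\<in>UNIV. a i ^ m i)) \<noteq> 0"
  proof (rule nonvanishing_exponents)
    show "?K \<noteq> {}" using F by simp
    show "lookup F (Abs_poly_mapping m) \<noteq> 0" if "m \<in> ?K" for m
      using that by (auto simp: in_keys_iff)
    show "m = m'" if "\<And>i. i \<in> UNIV \<Longrightarrow> m i = m' i" for m m' :: "'n \<Rightarrow> nat"
      using that by (simp add: fun_eq_iff)
  qed simp_all
  then obtain a where a: "\<And>i. a i \<noteq> 0"
    "(\<Sum>m\<in>?K. lookup F (Abs_poly_mapping m) * (\<Prod>i\<in>UNIV. a i ^ m i)) \<noteq> 0" by blast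
  have "(\<Sum>m\<in>?K. lookup F (Abs_poly_mapping m) * (\<Prod>i\<in>UNIV. a i ^ m i)) = eval_mpoly F a"
    unfolding eval_mpoly_def
    by (subst sum.reindex) (auto intro: inj_onI poly_mapping_eqI)
  moreover have "a \<noteq> 0" using a(1) by (auto simp: fun_eq_iff)
  ultimately show ?thesis using a(2) that by simp
qed

lemma const_sum: "const (sum f A) = (\<Sum>x\<in>A. const (f x))"
  by (induction A rule: infinite_finite_induct) (simp_all add: single_add)

lemma linear_form_eq: "linear_form a = (\<Sum>i\<in>UNIV. const (a i) * var i)"
  by (simp add: linear_form_def var_def mult_single)

lemma linear_form_hf: "linear_form a \<in> hf 1"
  unfolding linear_form_eq by (intro hf_sum hf_smult hf_var)

lemma eval_linear_form: "eval_mpoly (linear_form b) a = (\<Sum>i\<in>UNIV. b i * a i)"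
  unfolding linear_form_def eval_sum eval_single monomial_value_single ..

lemma general_hyperplane_ex:
  assumes "general_hyperplane Q"
  obtains h where "h \<in> hf 1" "Q h"
proof -
  obtain t and F :: "'a mpoly" where F: "F \<in> forms t" "F \<noteq> 0" "\<And>a. a \<noteq> 0 \<and> eval_mpoly F a \<noteq> 0 \<Longrightarrow> Q (linear_form a)"
    using assms unfolding general_hyperplane_def by blast
  obtain a where "a \<noteq> 0" "eval_mpoly F a \<noteq> 0" by (rule ex_nonvanishing[OF F(2)])
  then show ?thesis using that F(3) linear_form_hf by blast
qed

lemma general_hyperplane_conj:
  assumes "general_hyperplane Q" "general_hyperplane R"
  shows "general_hyperplane (\<lambda>h. Q h \<and> R h)"
proof -
  obtain t and F :: "'a mpoly" where F: "F \<in> forms t" "F \<noteq> 0" "\<And>a. a \<noteq> 0 \<and> eval_mpoly F a \<noteq> 0 \<Longrightarrow> Q (linear_form a)"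
    using assms(1) unfolding general_hyperplane_def by blast
  obtain u and F' :: "'a mpoly" where F': "F' \<in> forms u" "F' \<noteq> 0" "\<And>a. a \<noteq> 0 \<and> eval_mpoly F' a \<noteq> 0 \<Longrightarrow> R (linear_form a)"
    using assms(2) unfolding general_hyperplane_def by blast
  have "F * F' \<in> forms (t + u)" using hf_mult[of F "int t" F' "int u"] F(1) F'(1) by (simp add: forms_eq_hf)
  moreover have "F * F' \<noteq> 0" using F(2) F'(2) by simp
  moreover have "Q (linear_form a) \<and> R (linear_form a)" if "a \<noteq> 0 \<and> eval_mpoly (F * F') a \<noteq> 0" for a
    using that F(3)[of a] F'(3)[of a] by (simp add: eval_mult)
  ultimately show ?thesis unfolding general_hyperplane_def by blast
qed

lemma general_hyperplane_mono:
  "general_hyperplane Q \<Longrightarrow> (\<And>h. h \<in> hf 1 \<Longrightarrow> Q h \<Longrightarrow> R h) \<Longrightarrow> general_hyperplane R"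
  unfolding general_hyperplane_def using linear_form_hf by blast

text \<open>\<open>I 1\<close> is a proper subspace of the linear forms, so a nonzero functional
  vanishes on it. That functional, a coordinate with respect to a basis modulo \<open>I 1\<close>,
  serves as \<open>F\<close> once written in the coefficients of a linear form.\<close>

lemma general_hyperplane_notin:
  fixes I :: "'n::{finite,linorder} cfam"
  assumes I: "gideal I" and v: "var i0 \<notin> I 1"
  shows "general_hyperplane (\<lambda>h. h \<notin> I 1)"
proof -
  obtain B where B: "mp.qbasis B (hf 1) (I 1)" using mp.ex_qbasis[OF subspace_gideal[OF I] qfin_hf] by blast
  have fB: "finite B" using B by (simp add: mp.qbasis_def)
  have "\<exists>c. var j - (\<Sum>b\<in>B. const (c b) * b) \<in> I 1" for j
  proof -
    have "var j \<in> mp.span (B \<union> I 1)" using B hf_var[of j] by (auto simp: mp.qbasis_def)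
    then show ?thesis by (rule mp.mem_span_Un_subspace[OF subspace_gideal[OF I] fB, THEN iffD1])
  qed
  then have "\<forall>j. \<exists>c. var j - (\<Sum>b\<in>B. const (c b) * b) \<in> I 1" by (rule allI)
  from choice[OF this] obtain A where A': "\<forall>j. var j - (\<Sum>b\<in>B. const (A j b) * b) \<in> I 1" ..
  note A = A'[rule_format]
  have "\<exists>b\<in>B. A i0 b \<noteq> 0"
  proof (rule ccontr)
    assume "\<not> ?thesis"
    then have "(\<Sum>b\<in>B. const (A i0 b) * b) = 0" by (intro sum.neutral) simp
    then show False using A[of i0] v by simp
  qed
  then obtain b0 where b0: "b0 \<in> B" "A i0 b0 \<noteq> 0" by blast
  define F where "F = linear_form (\<lambda>j. A j b0)"
  have "eval_mpoly F (\<lambda>j. if j = i0 then 1 else 0) = (\<Sum>j\<in>UNIV. if j = i0 then A j b0 else 0)"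
    unfolding F_def eval_linear_form by (intro sum.cong) auto
  then have "F \<noteq> 0" using b0(2) by auto
  moreover have "F \<in> forms 1" using linear_form_hf[of "\<lambda>j. A j b0"] by (simp add: F_def forms_eq_hf)
  moreover have "linear_form a \<notin> I 1" if a: "eval_mpoly F a \<noteq> 0" for a
  proof
    assume l: "linear_form a \<in> I 1"
    have "(\<Sum>j\<in>UNIV. const (a j) * (var j - (\<Sum>b\<in>B. const (A j b) * b))) \<in> I 1"
      by (intro gideal_sum[OF I] gideal_smult[OF I] A)
    from gideal_diff[OF I l this]
    have "(\<Sum>j\<in>UNIV. const (a j) * (\<Sum>b\<in>B. const (A j b) * b)) \<in> I 1"
      by (simp add: linear_form_eq right_diff_distrib sum_subtractf)
    also have "(\<Sum>j\<in>UNIV. const (a j) * (\<Sum>b\<in>B. const (A j b) * b)) = (\<Sum>b\<in>B. const (\<Sum>j\<in>UNIV. a j * A j b) * b)"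
      unfolding const_sum sum_distrib_left sum_distrib_right
      by (subst sum.swap) (simp add: mult.assoc[symmetric] mult_single)
    finally have "(\<Sum>j\<in>UNIV. a j * A j b0) = 0" by (rule mp.qbasis_indep[OF B _ b0(1)])
    then show False using a by (simp add: F_def eval_linear_form mult.commute)
  qed
  ultimately show ?thesis unfolding general_hyperplane_def by blast
qed

lemma HP_sat:
  fixes I :: "'n::{finite,linorder} cfam"
  assumes I: "gideal I"
  shows "HP (sat I) = HP I"
proof -
  obtain t0 where t0: "\<And>t. t \<ge> t0 \<Longrightarrow> sat I t = I t" using sat_eventually[OF I] by blast
  have "H (sat I) t = H I t" if "t \<ge> t0" for t using t0[OF that] by (simp add: H_def)
  then have "\<forall>\<^sub>F t in at_top. real (H (sat I) t) = poly (HP I) (of_int t)"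
    by (intro eventually_mono[OF eventually_conj[OF HP_euler(2)[OF I] eventually_ge_at_top[of t0]]]) simp
  then show ?thesis by (rule HP_unique)
qed

text \<open>Every hyperplane not containing \<open>D\<close> gives the same genus, as the Hilbert
  polynomial of the section is the difference of that of \<open>D\<close>. Two general conditions
  hold simultaneously for some hyperplane, so the value is unique.\<close>

lemma sectional_genus_eq:
  fixes D :: "'n::{finite,linorder} mpoly set"
  assumes D: "integral_subscheme D" and c: "poly (HP (gr D)) 0 - poly (HP (gr D)) (-1) = of_int c"
  shows "sectional_genus D = 1 - c"
proof -
  obtain i0 where i0: "var i0 \<notin> gr D 1" using gprime_gr(2)[OF D] by blast
  note gp = gprime_gr(1)[OF D] and gD = gprime_gideal[OF gprime_gr(1)[OF D]]
  have hD: "homogeneous_ideal D" using D by (simp add: integral_subscheme_def)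
  have g: "arithmetic_genus (hyperplane_section D h) = 1 - c" if h: "h \<in> hf 1" "h \<notin> gr D 1" for h
  proof -
    note gJ = gideal_padd[OF gD h(1)]
    have eq: "gr (hyperplane_section D h) = sat (padd (gr D) 1 h)"
      by (simp add: hyperplane_section_eq[OF hD h(1)] gr_tot[OF gideal_sat[OF gJ]])
    have "poly (HP (padd (gr D) 1 h)) 0 = of_int c"
      using HP_hypersurface[OF gD h(1) gprime_colon[OF gp h], of 0] c by simp
    then have "of_int (euler_characteristic (hyperplane_section D h)) = (of_int c :: real)"
      using euler_characteristic_eq[of "hyperplane_section D h"] gideal_sat[OF gJ] HP_sat[OF gJ] by (simp add: eq)
    then show ?thesis by (simp add: arithmetic_genus_def)
  qed
  have gen: "general_hyperplane (\<lambda>h. arithmetic_genus (hyperplane_section D h) = 1 - c)"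
    by (rule general_hyperplane_mono[OF general_hyperplane_notin[OF gD i0]]) (use g in blast)
  show ?thesis unfolding sectional_genus_def
  proof (rule the_equality, rule gen)
    fix g' assume "general_hyperplane (\<lambda>h. arithmetic_genus (hyperplane_section D h) = g')"
    from general_hyperplane_ex[OF general_hyperplane_conj[OF gen this]] show "g' = 1 - c" by metis
  qed
qed

section \<open>Residual curves\<close>

lemma poly_cubic:
  fixes p :: "real poly"
  assumes "degree p \<le> 3"
  shows "poly p x = coeff p 0 + coeff p 1 * x + coeff p 2 * x\<^sup>2 + coeff p 3 * x ^ 3"
proof -
  have "poly p x = (\<Sum>i\<le>degree p. coeff p i * x ^ i)" by (rule poly_altdef)
  also have "\<dots> = (\<Sum>i\<le>3. coeff p i * x ^ i)"
    by (rule sum.mono_neutral_left) (use assms in \<open>auto simp: coeff_eq_0\<close>)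
  finally show ?thesis by (simp add: eval_nat_numeral)
qed

text \<open>First and second differences of the Hilbert function at large degrees are integers,
  which makes \<open>s\<close> and \<open>c\<close> integers.\<close>

lemma first_difference:
  fixes I :: "'n::{finite,linorder} cfam"
  assumes I: "gideal I" "degree (HP I) \<le> 2"
  obtains s c :: int where "\<And>x. poly (HP I) x - poly (HP I) (x - 1) = of_int s * x + of_int c"
    "of_int s = 2 * coeff (HP I) 2"
proof -
  obtain t0 where t0: "\<And>t. t \<ge> t0 \<Longrightarrow> real (H I t) = poly (HP I) (of_int t)" using HP_at[OF I(1)] by blast
  define h where "h t = int (H I t)" for t
  have h: "poly (HP I) (of_int t) = of_int (h t)" if "t \<ge> t0" for t using t0[OF that] by (simp add: h_def)
  have "coeff (HP I) 3 = 0" using I(2) by (simp add: coeff_eq_0)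
  then have p: "poly (HP I) x = coeff (HP I) 0 + coeff (HP I) 1 * x + coeff (HP I) 2 * x\<^sup>2" for x
    using poly_cubic[of "HP I" x] I(2) by simp
  define s where "s = h (t0 + 2) - 2 * h (t0 + 1) + h t0"
  define c where "c = h (t0 + 1) - h t0 - s * (t0 + 1)"
  have s: "of_int s = 2 * coeff (HP I) 2"
    using h[of t0] h[of "t0 + 1"] h[of "t0 + 2"] by (simp add: s_def p power2_eq_square algebra_simps)
  moreover have "poly (HP I) x - poly (HP I) (x - 1) = of_int s * x + of_int c" for x
    using h[of t0] h[of "t0 + 1"] s by (simp add: c_def p power2_eq_square algebra_simps)
  ultimately show ?thesis using that by blast
qed

lemma third_difference:
  fixes I :: "'n::{finite,linorder} cfam"
  assumes I: "gideal I" "degree (HP I) \<le> 3"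
  obtains n :: int where "of_int n = 6 * coeff (HP I) 3"
proof -
  obtain t0 where t0: "\<And>t. t \<ge> t0 \<Longrightarrow> real (H I t) = poly (HP I) (of_int t)" using HP_at[OF I(1)] by blast
  define h where "h t = int (H I t)" for t
  have h: "of_int (h t) = poly (HP I) (of_int t)" if "t \<ge> t0" for t using t0[OF that] by (simp add: h_def)
  have "of_int (h (t0 + 3) - 3 * h (t0 + 2) + 3 * h (t0 + 1) - h t0) = 6 * coeff (HP I) 3"
    by (simp add: h poly_cubic[OF I(2)] power2_eq_square power3_eq_cube algebra_simps)
  then show ?thesis by (rule that)
qed

text \<open>The degree of a scheme of dimension 1. It is applied where the Hilbert polynomial has
  degree at most 1, and is then 0 for finite and for empty schemes.\<close>

abbreviation slope :: "'n::{finite,linorder} cfam \<Rightarrow> real" where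
  "slope I \<equiv> coeff (HP I) 1"

lemma HP_linear:
  fixes I :: "'n::{finite,linorder} cfam"
  assumes "degree (HP I) \<le> 1"
  shows "poly (HP I) x = slope I * x + poly (HP I) 0"
proof -
  have "coeff (HP I) 2 = 0" "coeff (HP I) 3 = 0" using assms by (simp_all add: coeff_eq_0)
  then show ?thesis using poly_cubic[of "HP I" x] poly_cubic[of "HP I" 0] assms by simp
qed

lemma slope_nat:
  fixes I :: "'n::{finite,linorder} cfam"
  assumes I: "gideal I" "degree (HP I) \<le> 1"
  obtains L :: nat where "slope I = real L"
proof -
  obtain t0 where t0: "\<And>t. t \<ge> t0 \<Longrightarrow> real (H I t) = poly (HP I) (of_int t)" using HP_at[OF I(1)] by blast
  have "slope I = of_int (int (H I (t0 + 1)) - int (H I t0))"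
    using t0[of t0] t0[of "t0 + 1"] HP_linear[OF I(2), of "of_int t0"] HP_linear[OF I(2), of "of_int (t0 + 1)"]
    by (simp add: algebra_simps)
  moreover have "slope I \<ge> 0"
    by (rule eventually_nonneg_coeff[OF _ I(2)]) (use HP_mono[OF I(1) I(1) order_refl] in \<open>auto elim: eventually_mono\<close>)
  ultimately have "slope I = real (nat (int (H I (t0 + 1)) - int (H I t0)))" by simp
  then show ?thesis by (rule that)
qed

lemma slope_mono:
  fixes I J :: "'n::{finite,linorder} cfam"
  assumes I: "gideal I" "degree (HP I) \<le> 1" and J: "gideal J" "I \<le> J"
  shows "degree (HP J) \<le> 1" "slope J \<le> slope I"
proof -
  note le = eventually_le_poly[OF HP_mono[OF I(1) J]]
  show "degree (HP J) \<le> 1" using le(1) I(2) by linarith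
  show "slope J \<le> slope I" by (rule le(3)[OF I(2)])
qed

lemma HP_const_nonneg:
  fixes I :: "'n::{finite,linorder} cfam"
  assumes I: "gideal I" "degree (HP I) \<le> 1" "slope I = 0"
  shows "poly (HP I) 0 \<ge> 0"
proof -
  obtain t0 where t0: "\<And>t. t \<ge> t0 \<Longrightarrow> real (H I t) = poly (HP I) (of_int t)" using HP_at[OF I(1)] by blast
  show ?thesis using t0[of t0] HP_linear[OF I(2), of "of_int t0"] I(3) by simp
qed

lemma isum_mono_left: "gideal J \<Longrightarrow> gideal I' \<Longrightarrow> I \<le> I' \<Longrightarrow> isum I J \<le> isum I' J"
  by (intro isum_least gideal_isum order_trans[OF _ le_isum(1)] le_isum(2))

lemma le_colon_ideal': "gideal I \<Longrightarrow> gideal J \<Longrightarrow> I \<le> colon_ideal I J"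
  by (auto simp: le_fun_def colon_ideal_def gideal_hf intro: gideal_mult)

locale divisor_family =
  fixes X :: "'n::{finite,linorder} cfam" and E :: "nat \<Rightarrow> 'n cfam"
    and k s c :: "nat \<Rightarrow> int" and A :: "nat set"
  assumes X: "gprime X"
    and E: "\<And>i. i \<in> A \<Longrightarrow> \<exists>v. integral_surface (E i) v (s i) (c i)"
      "\<And>i. i \<in> A \<Longrightarrow> X \<le> E i" "\<And>i. i \<in> A \<Longrightarrow> twisted_divisor X (E i) (k i)"
    and k: "\<And>i. i \<in> A \<Longrightarrow> 1 \<le> k i" "\<And>i. i \<in> A \<Longrightarrow> k i \<le> s i"
begin

lemma gE: "i \<in> A \<Longrightarrow> gideal (E i)"
  using E(1)[of i] integral_surface.gD by blast

lemma s_pos: "i \<in> A \<Longrightarrow> 1 \<le> s i"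
  using k[of i] by simp

text \<open>With sectional genus \<pi> = 1 - c this is (2 \<pi> - 2 - s)/(2 s), the coefficient of
  the linear term in the genus bound.\<close>

definition "a i = - of_int (c i) / of_int (s i) - (1 / 2 :: real)"

lemma a_bounds:
  assumes i: "i \<in> A"
  shows "- 3 / 2 \<le> a i" "a i \<le> s i / 2"
proof -
  obtain v where v: "integral_surface (E i) v (s i) (c i)" using E(1)[OF i] by blast
  have s1: "real_of_int (s i) \<ge> 1" using s_pos[OF i] by simp
  have "real_of_int (c i) \<le> s i" using integral_surface.c_bounds(1)[OF v] by simp
  then show "- 3 / 2 \<le> a i" using s1 by (simp add: a_def field_simps)
  have "real_of_int (2 * s i - s i * (s i - 1)) \<le> real_of_int (2 * c i)"
    using integral_surface.c_bounds(2)[OF v] by (simp only: of_int_le_iff)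
  then show "a i \<le> s i / 2" using s1 by (simp add: a_def field_simps)
qed

lemma genus_bound:
  assumes i: "i \<in> A" and B: "gideal B" "sat B = B" "E i \<le> B" "degree (HP B) \<le> 1"
  shows "- poly (HP B) 0 \<le> (slope B)\<^sup>2 / (2 * s i) + slope B * a i + 2 * real_of_int (s i) ^ 4"
proof -
  obtain L where L: "slope B = real L" by (rule slope_nat[OF B(1,4)])
  obtain v where v: "integral_surface (E i) v (s i) (c i)" using E(1)[OF i] by blast
  show ?thesis
  proof (cases "L = 0")
    case True
    have "- poly (HP B) 0 \<le> 0" using HP_const_nonneg[OF B(1,4)] L True by simp
    also have "0 \<le> (slope B)\<^sup>2 / (2 * s i) + slope B * a i + 2 * real_of_int (s i) ^ 4" using L True by simp
    finally show ?thesis .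
  next
    case False
    then have "1 \<le> L" by simp
    from integral_surface.genus_bound[OF v B(1-3) _ this, OF HP_linear[OF B(4), unfolded L]]
    show ?thesis unfolding L a_def of_int_minus .
  qed
qed

context
  fixes C :: "'n cfam" and i :: nat
  assumes C: "gideal C" "sat C = C" "X \<le> C" "degree (HP C) \<le> 1" and i: "i \<in> A"
begin

lemma section_facts:
  shows "gideal (sat (isum C (E i)))" "sat (sat (isum C (E i))) = sat (isum C (E i))" "C \<le> sat (isum C (E i))"
    "E i \<le> sat (isum C (E i))" "degree (HP (sat (isum C (E i)))) \<le> 1" "HP (sat (isum C (E i))) = HP (isum C (E i))"
proof -
  note g = gideal_isum[OF C(1) gE[OF i]]
  show 1: "gideal (sat (isum C (E i)))" "sat (sat (isum C (E i))) = sat (isum C (E i))"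
    by (rule gideal_sat[OF g] sat_sat[OF g])+
  show 2: "C \<le> sat (isum C (E i))" using le_isum(1)[OF gE[OF i]] le_sat[OF g] by (rule order_trans)
  show "E i \<le> sat (isum C (E i))" using le_isum(2)[OF C(1)] le_sat[OF g] by (rule order_trans)
  show "degree (HP (sat (isum C (E i)))) \<le> 1" by (rule slope_mono(1)[OF C(1,4) 1(1) 2])
  show "HP (sat (isum C (E i))) = HP (isum C (E i))" by (rule HP_sat[OF g])
qed

lemma residual_facts:
  shows "gideal (colon_ideal C (E i))" "sat (colon_ideal C (E i)) = colon_ideal C (E i)" "C \<le> colon_ideal C (E i)"
    "X \<le> colon_ideal C (E i)" "degree (HP (colon_ideal C (E i))) \<le> 1"
proof -
  show 1: "gideal (colon_ideal C (E i))" "sat (colon_ideal C (E i)) = colon_ideal C (E i)"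
    by (rule gideal_colon_ideal[OF C(1)] sat_colon_ideal[OF C(1,2) gE[OF i]])+
  show 2: "C \<le> colon_ideal C (E i)" by (rule le_colon_ideal'[OF C(1) gE[OF i]])
  show "X \<le> colon_ideal C (E i)" using C(3) 2 by (rule order_trans)
  show "degree (HP (colon_ideal C (E i))) \<le> 1" by (rule slope_mono(1)[OF C(1,4) 1(1) 2])
qed

lemma residual_split:
  shows "slope C = slope (isum C (E i)) + slope (colon_ideal C (E i))"
    "poly (HP C) 0 = poly (HP (isum C (E i))) 0 + poly (HP (colon_ideal C (E i))) 0 - k i * slope (colon_ideal C (E i))"
proof -
  have eq: "poly (HP C) x = poly (HP (isum C (E i))) x + poly (HP (colon_ideal C (E i))) (x - k i)" for x
    by (rule residual_HP[OF X C(1-3) gE[OF i] E(2,3)[OF i]])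
  have d: "degree (HP (isum C (E i))) \<le> 1" using section_facts(5,6) by simp
  show "poly (HP C) 0 = poly (HP (isum C (E i))) 0 + poly (HP (colon_ideal C (E i))) 0 - k i * slope (colon_ideal C (E i))"
    using eq[of 0] HP_linear[OF residual_facts(5), of "- k i"] by simp
  show "slope C = slope (isum C (E i)) + slope (colon_ideal C (E i))"
    using eq[of 0] eq[of 1] HP_linear[OF residual_facts(5), of "- k i"] HP_linear[OF residual_facts(5), of "1 - k i"]
      HP_linear[OF d, of 1] HP_linear[OF C(4), of 1] by (simp add: algebra_simps)
qed

end

lemma slope_nonneg: "gideal I \<Longrightarrow> degree (HP I) \<le> 1 \<Longrightarrow> 0 \<le> slope I"
  using slope_nat[of I] by (metis of_nat_0_le_iff)

text \<open>The constants in the following bound are irrelevant; what matters is the coefficient \<open>\<mu> / 2\<close>.\<close>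

lemma crude_genus_bound:
  fixes \<mu> :: real
  assumes "set es \<subseteq> A" "gideal C" "sat C = C" "X \<le> C" "degree (HP C) \<le> 1"
    and "foldl (\<lambda>C i. colon_ideal C (E i)) C es = hf"
    and "\<And>i. i \<in> set es \<Longrightarrow> slope (isum C (E i)) \<le> \<mu> * s i" and "0 \<le> \<mu>"
  shows "- poly (HP C) 0 \<le> \<mu> / 2 * slope C + slope C * (\<Sum>i\<leftarrow>es. 2 * real_of_int (s i)) + (\<Sum>i\<leftarrow>es. 2 * real_of_int (s i) ^ 4)"
  using assms
proof (induction es arbitrary: C)
  case Nil
  then have "HP C = 0" using HP_eq_0_iff[of C] by auto
  then show ?case by simp
next
  case (Cons i es)
  have i: "i \<in> A" and es: "set es \<subseteq> A" using Cons.prems(1) by auto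
  note C = Cons.prems(2-5)
  define B where "B = sat (isum C (E i))"
  define R where "R = colon_ideal C (E i)"
  note B = section_facts[OF C i, folded B_def]
  note R = residual_facts[OF C i, folded R_def]
  note split = residual_split[OF C i, folded R_def B(6), folded B_def]
  have s1: "real_of_int (s i) \<ge> 1" using s_pos[OF i] by simp
  have LB: "0 \<le> slope B" by (rule slope_nonneg[OF B(1,5)])
  have LR: "0 \<le> slope R" by (rule slope_nonneg[OF R(1,5)])
  \<comment> \<open>One factor of \<open>slope B\<close> squared is replaced by \<mu> s, which
    cancels the s in the denominator and leaves the uniform coefficient \<mu>/2.\<close>
  have "slope B \<le> \<mu> * s i" using Cons.prems(7)[of i] B(6) by simp
  then have "slope B * slope B \<le> slope B * (\<mu> * s i)" using LB by (rule mult_left_mono)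
  then have "(slope B)\<^sup>2 / (2 * s i) \<le> \<mu> / 2 * slope B" using s1 by (simp add: power2_eq_square field_simps)
  moreover have "slope B * a i \<le> slope B * (s i / 2)" by (rule mult_left_mono[OF a_bounds(2)[OF i] LB])
  ultimately have 1: "- poly (HP B) 0 \<le> \<mu> / 2 * slope B + slope B * (s i / 2) + 2 * real_of_int (s i) ^ 4"
    using genus_bound[OF i B(1,2,4,5)] by linarith
  have 2: "- poly (HP R) 0 \<le> \<mu> / 2 * slope R + slope R * (\<Sum>i\<leftarrow>es. 2 * real_of_int (s i)) + (\<Sum>i\<leftarrow>es. 2 * real_of_int (s i) ^ 4)"
  proof (rule Cons.IH[OF es R(1,2,4,5) _ _ Cons.prems(8)])
    show "foldl (\<lambda>C i. colon_ideal C (E i)) R es = hf" using Cons.prems(6) by (simp add: R_def)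
    fix j assume j: "j \<in> set es"
    then have jA: "j \<in> A" using es by auto
    have "slope (isum R (E j)) \<le> slope (isum C (E j))"
    proof (rule slope_mono(2))
      show "gideal (isum C (E j))" "gideal (isum R (E j))" using gideal_isum C(1) R(1) gE[OF jA] by blast+
      show "degree (HP (isum C (E j))) \<le> 1" using section_facts(5,6)[OF C jA] by simp
      show "isum C (E j) \<le> isum R (E j)" by (rule isum_mono_left[OF gE[OF jA] R(1,3)])
    qed
    also have "\<dots> \<le> \<mu> * s j" using Cons.prems(7)[of j] j by simp
    finally show "slope (isum R (E j)) \<le> \<mu> * s j" .
  qed
  \<comment> \<open>The twist by \<open>k\<close> contributes \<open>k * slope R\<close>;
    \<open>k \<le> s\<close> puts it among the linear error terms.\<close>
  have "real_of_int (k i) * slope R \<le> s i * slope R" using k(2)[OF i] LR by (intro mult_right_mono) auto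
  then have "- poly (HP C) 0 \<le> \<mu> / 2 * (slope B + slope R) + slope B * (s i / 2) + s i * slope R
      + slope R * (\<Sum>i\<leftarrow>es. 2 * real_of_int (s i)) + (2 * real_of_int (s i) ^ 4 + (\<Sum>i\<leftarrow>es. 2 * real_of_int (s i) ^ 4))"
    using 1 2 split(2) by (simp add: algebra_simps)
  moreover have "slope B * (s i / 2) \<le> slope B * (2 * s i)" using LB s1 by (intro mult_left_mono) auto
  moreover have "s i * slope R \<le> slope R * (2 * s i)" using LR s1 by (simp add: mult.commute)
  moreover have "0 \<le> slope B * (\<Sum>i\<leftarrow>es. 2 * real_of_int (s i))"
  proof (rule mult_nonneg_nonneg[OF LB sum_list_nonneg])
    fix x assume "x \<in> set (map (\<lambda>i. 2 * real_of_int (s i)) es)"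
    then obtain j where "j \<in> set es" "x = 2 * real_of_int (s j)" by auto
    then show "0 \<le> x" using s_pos[of j] es by auto
  qed
  ultimately show ?case unfolding split(1) by (simp add: algebra_simps)
qed

end

section \<open>Numerical estimates for large degree\<close>

lemma sum_list_power4:
  fixes xs :: "real list"
  assumes "\<And>x. x \<in> set xs \<Longrightarrow> 0 \<le> x"
  shows "(\<Sum>x\<leftarrow>xs. x ^ 4) \<le> (\<Sum>x\<leftarrow>xs. x) ^ 4"
  using assms
proof (induction xs)
  case (Cons x xs)
  let ?S = "\<Sum>x\<leftarrow>xs. x"
  have "0 \<le> x" "0 \<le> ?S" using Cons.prems by (auto intro!: sum_list_nonneg)
  then have "0 \<le> 4 * x ^ 3 * ?S + 6 * x ^ 2 * ?S ^ 2 + 4 * x * ?S ^ 3" by simp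
  also have "\<dots> = (x + ?S) ^ 4 - x ^ 4 - ?S ^ 4"
    by (simp add: power4_eq_xxxx power3_eq_cube power2_eq_square algebra_simps)
  finally have "x ^ 4 + ?S ^ 4 \<le> (x + ?S) ^ 4" by simp
  then show ?case using Cons by simp
qed simp

lemma power_estimates:
  fixes \<sigma> d :: real
  assumes "1 \<le> \<sigma>" "30 * \<sigma> ^ 7 < d"
  shows "30 < d" "30 * \<sigma> < d" "30 * \<sigma> ^ 4 < d" "30 * \<sigma> ^ 5 < d"
proof -
  have "\<sigma> ^ k \<le> \<sigma> ^ 7" if "k \<le> 7" for k using that assms(1) by (rule power_increasing)
  from this[of 0] this[of 1] this[of 4] this[of 5] assms(2)
  show "30 < d" "30 * \<sigma> < d" "30 * \<sigma> ^ 4 < d" "30 * \<sigma> ^ 5 < d" by simp_all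
qed

text \<open>With \<mu> = d/(s + 1) the quadratic terms differ by d^2/(2 s (s + 1)), which is at
  least d^2/(4 \<sigma>^2) and outweighs the remaining terms, the slack d/(4 s) included.\<close>

lemma no_large_section_contradiction:
  fixes s \<sigma> d \<alpha> \<chi> :: real
  assumes s: "1 \<le> s" "s \<le> \<sigma>" and d: "30 * \<sigma> ^ 7 < d" and \<alpha>: "- 3 / 2 \<le> \<alpha>"
    and up: "- \<chi> \<le> d / (s + 1) / 2 * d + d * (2 * \<sigma>) + 2 * \<sigma> ^ 4"
    and lo: "d\<^sup>2 / (2 * s) + d * \<alpha> - d / (4 * s) < 1 - \<chi>"
  shows False
proof -
  have \<sigma>: "1 \<le> \<sigma>" using s by simp
  note pe = power_estimates[OF \<sigma> d]
  have d0: "0 < d" using pe by simp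
  have ss: "s * (s + 1) \<le> \<sigma> * (2 * \<sigma>)" using s by (intro mult_mono) auto
  have "d * d / (4 * \<sigma>\<^sup>2) \<le> d * d / (2 * s * (s + 1))"
  proof (rule divide_left_mono)
    show "2 * s * (s + 1) \<le> 4 * \<sigma>\<^sup>2" using ss by (simp add: power2_eq_square)
    show "0 < 4 * \<sigma>\<^sup>2 * (2 * s * (s + 1))" using s \<sigma> by (intro mult_pos_pos) auto
  qed simp
  also have "\<dots> = d\<^sup>2 / (2 * s) - d / (s + 1) / 2 * d" using s by (simp add: field_simps power2_eq_square)
  finally have 1: "d * d / (4 * \<sigma>\<^sup>2) \<le> d\<^sup>2 / (2 * s) - d / (s + 1) / 2 * d" .
  have "7 * \<sigma> * (4 * \<sigma>\<^sup>2) \<le> 30 * \<sigma> ^ 5"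
  proof -
    have "\<sigma> ^ 3 \<le> \<sigma> ^ 5" using \<sigma> by (intro power_increasing) auto
    moreover have "7 * \<sigma> * (4 * \<sigma>\<^sup>2) = 28 * \<sigma> ^ 3" by (simp add: power2_eq_square power3_eq_cube)
    ultimately show ?thesis using \<sigma> zero_le_power[of \<sigma> 5] by linarith
  qed
  then have "7 * \<sigma> * (4 * \<sigma>\<^sup>2) \<le> d" using pe(4) by simp
  then have "7 * \<sigma> \<le> d / (4 * \<sigma>\<^sup>2)" using \<sigma> by (simp add: pos_le_divide_eq)
  then have "d * (7 * \<sigma>) \<le> d * (d / (4 * \<sigma>\<^sup>2))" using d0 by (intro mult_left_mono) auto
  then have 2: "7 * (d * \<sigma>) \<le> d\<^sup>2 / (2 * s) - d / (s + 1) / 2 * d" using 1 by (simp add: ac_simps)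
  have 3: "d \<le> d * \<sigma>" using \<sigma> d0 by simp
  have 4: "- 3 / 2 * d \<le> d * \<alpha>" using mult_left_mono[OF \<alpha>, of d] d0 by simp
  have 5: "d / (4 * s) \<le> d" using s d0 by (simp add: divide_le_eq)
  have "d * (2 * \<sigma>) = 2 * (d * \<sigma>)" by simp
  then show False using 2 3 4 5 up lo pe d0 by linarith
qed

text \<open>\<open>e\<close> is the degree of the residual. Splitting d into d - e and e loses e (d
  - e)/s \<ge> e d/(2 s) in the quadratic terms. Since \<open>e \<ge> 1\<close>, half of this covers
  the slack d/(4 s), and the other half exceeds the errors, which are constant or linear in
  e.\<close>

lemma large_section_contradiction:
  fixes s \<sigma> \<sigma>' d e k \<alpha> \<chi>B \<chi>R :: real
  assumes s: "1 \<le> s" and \<sigma>': "0 \<le> \<sigma>'" and d: "30 * (s + \<sigma>') ^ 7 < d" and \<alpha>: "- 3 / 2 \<le> \<alpha>" and k: "k \<le> s"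
    and e: "1 \<le> e" "e \<le> d / 2"
    and B: "- \<chi>B \<le> (d - e)\<^sup>2 / (2 * s) + (d - e) * \<alpha> + 2 * s ^ 4"
    and R: "- \<chi>R \<le> e / s / 2 * e + e * (2 * \<sigma>') + 2 * \<sigma>' ^ 4"
    and lo: "d\<^sup>2 / (2 * s) + d * \<alpha> - d / (4 * s) < 1 - (\<chi>B + \<chi>R - k * e)"
  shows False
proof -
  define \<sigma> where "\<sigma> = s + \<sigma>'"
  have \<sigma>: "1 \<le> \<sigma>" "s \<le> \<sigma>" using s \<sigma>' by (simp_all add: \<sigma>_def)
  note pe = power_estimates[OF \<sigma>(1) d[folded \<sigma>_def]]
  have "0 \<le> 4 * s ^ 3 * \<sigma>' + 6 * s ^ 2 * \<sigma>' ^ 2 + 4 * s * \<sigma>' ^ 3" using s \<sigma>' by simp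
  also have "\<dots> = \<sigma> ^ 4 - s ^ 4 - \<sigma>' ^ 4"
    by (simp add: \<sigma>_def power4_eq_xxxx power3_eq_cube power2_eq_square algebra_simps)
  finally have 1: "2 * s ^ 4 + 2 * \<sigma>' ^ 4 \<le> 2 * \<sigma> ^ 4" by simp
  have "k * e \<le> s * e" using k e by (intro mult_right_mono) auto
  moreover have "0 \<le> e * s" using e s by simp
  ultimately have 2: "k * e + e * (2 * \<sigma>') \<le> 2 * (e * \<sigma>)" by (simp add: \<sigma>_def algebra_simps)
  have 3: "- (e * \<alpha>) \<le> 3 / 2 * e" using mult_left_mono[OF \<alpha>, of e] e by simp
  have eq: "d\<^sup>2 / (2 * s) - (d - e)\<^sup>2 / (2 * s) - e / s / 2 * e = e * (d - e) / s"
    using s by (simp add: field_simps power2_eq_square)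
  have "e * (d / 2) / s \<le> e * (d - e) / s" using e s by (intro divide_right_mono mult_left_mono) auto
  moreover have "e * (d / 2) / s = 2 * (e * (d / (4 * s)))" by simp
  moreover have "1 * (d / (4 * s)) \<le> e * (d / (4 * s))" using e s by (intro mult_right_mono) auto
  ultimately have 4: "e * (d / (4 * s)) + d / (4 * s) \<le> e * (d - e) / s" by linarith
  have "(d - e) * \<alpha> = d * \<alpha> - e * \<alpha>" by (simp add: algebra_simps)
  then have 5: "e * (d / (4 * s)) < 1 + 3 / 2 * e + 2 * (e * \<sigma>) + 2 * \<sigma> ^ 4"
    using B R lo 1 2 3 4 eq by linarith
  have "1 * (2 * \<sigma> ^ 4) \<le> e * (2 * \<sigma> ^ 4)" using e \<sigma> by (intro mult_right_mono) auto
  then have "e * (d / (4 * s)) < e * (5 / 2 + 2 * \<sigma> + 2 * \<sigma> ^ 4)" using 5 e by (simp add: algebra_simps)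
  then have "d / (4 * s) < 5 / 2 + 2 * \<sigma> + 2 * \<sigma> ^ 4" using e(1) by (simp only: mult_less_cancel_left_pos)
  also have "\<dots> \<le> 13 / 2 * \<sigma> ^ 4" using power_increasing[of 0 4 \<sigma>] power_increasing[of 1 4 \<sigma>] \<sigma> by simp
  finally have "d < 13 / 2 * \<sigma> ^ 4 * (4 * s)" using s by (simp add: divide_less_eq ac_simps)
  also have "\<dots> \<le> 13 / 2 * \<sigma> ^ 4 * (4 * \<sigma>)" using \<sigma> by (intro mult_left_mono) auto
  also have "\<dots> = 26 * \<sigma> ^ 5" by (simp add: eval_nat_numeral)
  finally show False using pe(4) \<sigma> zero_le_power[of \<sigma> 5] by linarith
qed

context divisor_family
begin

text \<open>
  If every section of \<open>C\<close> by a component of minimal degree has degree less than \<open>d / 2\<close>, the crude bound is already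
  too small.  Otherwise one section absorbs most of \<open>C\<close>, and the residual curve costs too much genus unless its
  degree vanishes.
\<close>

lemma ex_component_residual_degree_0:
  assumes C: "gideal C" "sat C = C" "X \<le> C" "degree (HP C) \<le> 1"
    and M: "set_mset M \<subseteq> A" "\<And>es. mset es = M \<Longrightarrow> foldl (\<lambda>C i. colon_ideal C (E i)) C es = hf"
    and i0: "i0 \<in># M" and min: "\<And>i. i \<in> A \<Longrightarrow> s i0 \<le> s i" and a: "\<And>i. i \<in> A \<Longrightarrow> s i = s i0 \<Longrightarrow> a i = a i0"
    and d: "30 * (\<Sum>i\<in>#M. real_of_int (s i)) ^ 7 < slope C"
    and lo: "(slope C)\<^sup>2 / (2 * s i0) + slope C * a i0 - slope C / (4 * s i0) < 1 - poly (HP C) 0"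
  shows "\<exists>i\<in>A. s i = s i0 \<and> slope (colon_ideal C (E i)) = 0"
proof (rule ccontr)
  assume neg: "\<not> ?thesis"
  have i0A: "i0 \<in> A" using i0 M(1) by blast
  have s1: "1 \<le> real_of_int (s i)" if "i \<in> A" for i using s_pos[OF that] by simp
  have p4: "(\<Sum>i\<leftarrow>es. 2 * real_of_int (s i) ^ 4) \<le> 2 * (\<Sum>i\<leftarrow>es. real_of_int (s i)) ^ 4" if "set es \<subseteq> A" for es
  proof -
    have "(\<Sum>x\<leftarrow>map (\<lambda>i. real_of_int (s i)) es. x ^ 4) \<le> (\<Sum>x\<leftarrow>map (\<lambda>i. real_of_int (s i)) es. x) ^ 4"
    proof (rule sum_list_power4)
      fix x assume "x \<in> set (map (\<lambda>i. real_of_int (s i)) es)"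
      then obtain i where "i \<in> set es" "x = real_of_int (s i)" by auto
      then show "0 \<le> x" using s1[of i] that by auto
    qed
    then show ?thesis by (simp add: sum_list_const_mult o_def)
  qed
  have tot: "(\<Sum>i\<leftarrow>es. real_of_int (s i)) = (\<Sum>i\<in>#mset es. real_of_int (s i))" for es
    by (simp add: sum_mset_sum_list[symmetric])
  define \<sigma> where "\<sigma> = (\<Sum>i\<in>#M. real_of_int (s i))"
  obtain N where N: "M = add_mset i0 N" using i0 by (metis multi_member_split)
  have nn: "0 \<le> (\<Sum>i\<in>#M'. real_of_int (s i))" if "set_mset M' \<subseteq> A" for M'
    using that s1 by (induction M') fastforce+
  have "set_mset N \<subseteq> A" using M(1) N by auto
  then have "real_of_int (s i0) \<le> \<sigma>" using nn[of N] by (simp add: \<sigma>_def N)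
  note \<sigma> = s1[OF i0A] this
  note d' = d[folded \<sigma>_def]
  have d0: "0 < slope C" using power_estimates(1)[OF _ d'] \<sigma> by simp
  show False
  proof (cases "\<exists>i\<in>set_mset M. s i = s i0 \<and> slope C / 2 \<le> slope (isum C (E i))")
    case False
    obtain es where es: "mset es = M" by (metis ex_mset)
    then have esA: "set es \<subseteq> A" using M(1) by auto
    \<comment> \<open>For a minimal component the section has degree below d/2, which is at most
      \<mu> s as s \<ge> 1. For any other component s i \<ge> s i0 + 1, so \<mu> s i is at least the
      whole degree.\<close>
    let ?\<mu> = "slope C / (s i0 + 1)"
    have "slope (isum C (E i)) \<le> ?\<mu> * s i" if i: "i \<in> set es" for i
    proof -
      have iA: "i \<in> A" using i esA by auto
      show ?thesis
      proof (cases "s i = s i0")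
        case True
        then have "slope (isum C (E i)) \<le> slope C / 2" using False i es by force
        also have "\<dots> \<le> ?\<mu> * s i" unfolding True using s1[OF i0A] d0 by (simp add: field_simps)
        finally show ?thesis .
      next
        case ne: False
        have "slope (isum C (E i)) \<le> slope C"
          by (rule slope_mono(2)[OF C(1,4) gideal_isum[OF C(1) gE[OF iA]] le_isum(1)[OF gE[OF iA]]])
        also have "\<dots> = ?\<mu> * (s i0 + 1)" using s1[OF i0A] by simp
        also have "\<dots> \<le> ?\<mu> * s i"
          using min[OF iA] ne d0 s1[OF i0A] by (intro mult_left_mono) auto
        finally show ?thesis .
      qed
    qed
    note sl = this
    have "0 \<le> ?\<mu>" using d0 s1[OF i0A] by simp
    have "- poly (HP C) 0 \<le> ?\<mu> / 2 * slope C + slope C * (\<Sum>i\<leftarrow>es. 2 * real_of_int (s i)) + (\<Sum>i\<leftarrow>es. 2 * real_of_int (s i) ^ 4)"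
      by (rule crude_genus_bound[OF esA C M(2)[OF es] sl \<open>0 \<le> ?\<mu>\<close>])
    also have "(\<Sum>i\<leftarrow>es. 2 * real_of_int (s i)) = 2 * \<sigma>" by (simp add: sum_list_const_mult tot es \<sigma>_def)
    also have "(\<Sum>i\<leftarrow>es. 2 * real_of_int (s i) ^ 4) \<le> 2 * \<sigma> ^ 4" using p4[OF esA] by (simp add: tot es \<sigma>_def)
    finally have "- poly (HP C) 0 \<le> ?\<mu> / 2 * slope C + slope C * (2 * \<sigma>) + 2 * \<sigma> ^ 4" by simp
    from no_large_section_contradiction[OF \<sigma> d' a_bounds(1)[OF i0A] this[unfolded of_int_add of_int_1] lo[unfolded of_int_mult of_int_numeral]]
    show False .
  next
    case True
    then obtain i where i: "i \<in># M" "s i = s i0" "slope C / 2 \<le> slope (isum C (E i))" by blast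
    have iA: "i \<in> A" using i(1) M(1) by blast
    obtain N where N: "M = add_mset i N" using i(1) by (metis multi_member_split)
    have NA: "set_mset N \<subseteq> A" using M(1) N by auto
    obtain es where es: "mset es = N" by (metis ex_mset)
    have esA: "set es \<subseteq> A" using es NA by auto
    define B where "B = sat (isum C (E i))"
    define R where "R = colon_ideal C (E i)"
    note B = section_facts[OF C iA, folded B_def]
    note R = residual_facts[OF C iA, folded R_def]
    note split = residual_split[OF C iA, folded R_def B(6), folded B_def]
    obtain e :: nat where e: "slope R = real e" by (rule slope_nat[OF R(1,5)])
    have e1: "1 \<le> real e" using neg iA i(2) e by (cases e) (auto simp: R_def)
    have e2: "real e \<le> slope C / 2" using i(3) split(1) e B(6) by (simp add: field_simps)
    have LB: "slope B = slope C - real e" using split(1) e by simp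
    \<comment> \<open>For the residual, \<mu> = e/s i0 is admissible: its sections have degree at
      most e, and every component has degree at least s i0.\<close>
    have "- poly (HP R) 0 \<le> real e / s i0 / 2 * slope R + slope R * (\<Sum>i\<leftarrow>es. 2 * real_of_int (s i)) + (\<Sum>i\<leftarrow>es. 2 * real_of_int (s i) ^ 4)"
    proof (rule crude_genus_bound[OF esA R(1,2,4,5)])
      \<comment> \<open>The order of the residuals is free, so the chosen component is taken
        first.\<close>
      show "foldl (\<lambda>C i. colon_ideal C (E i)) R es = hf"
        using M(2)[of "i # es"] by (simp add: N es R_def)
      fix j assume j: "j \<in> set es"
      then have jA: "j \<in> A" using esA by auto
      have "slope (isum R (E j)) \<le> slope R"
        by (rule slope_mono(2)[OF R(1,5) gideal_isum[OF R(1) gE[OF jA]] le_isum(1)[OF gE[OF jA]]])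
      also have "\<dots> = real e / s i0 * s i0" using s1[OF i0A] e by simp
      also have "\<dots> \<le> real e / s i0 * s j" using min[OF jA] s1[OF i0A] by (intro mult_left_mono) auto
      finally show "slope (isum R (E j)) \<le> real e / s i0 * s j" .
    qed (use s1[OF i0A] in simp)
    also have "(\<Sum>i\<leftarrow>es. 2 * real_of_int (s i)) = 2 * (\<Sum>i\<in>#N. real_of_int (s i))" by (simp add: sum_list_const_mult tot es)
    also have "(\<Sum>i\<leftarrow>es. 2 * real_of_int (s i) ^ 4) \<le> 2 * (\<Sum>i\<in>#N. real_of_int (s i)) ^ 4" using p4[OF esA] by (simp add: tot es)
    finally have \<chi>R: "- poly (HP R) 0 \<le> real e / s i0 / 2 * real e + real e * (2 * (\<Sum>i\<in>#N. real_of_int (s i))) + 2 * (\<Sum>i\<in>#N. real_of_int (s i)) ^ 4"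
      unfolding e by simp
    have \<chi>B: "- poly (HP B) 0 \<le> (slope C - real e)\<^sup>2 / (2 * s i0) + (slope C - real e) * a i0 + 2 * real_of_int (s i0) ^ 4"
      using genus_bound[OF iA B(1,2,4,5)] unfolding LB i(2) a[OF iA i(2)] by simp
    show False
    proof (rule large_section_contradiction[OF s1[OF i0A] nn[OF NA] _ a_bounds(1)[OF i0A] _ e1 e2 \<chi>B[unfolded of_int_mult of_int_numeral] \<chi>R])
      show "30 * (real_of_int (s i0) + (\<Sum>i\<in>#N. real_of_int (s i))) ^ 7 < slope C" using d by (simp add: N i(2))
      show "real_of_int (k i) \<le> s i0" using k(2)[OF iA] i(2) by simp
      show "(slope C)\<^sup>2 / (2 * real_of_int (s i0)) + slope C * a i0 - slope C / (4 * real_of_int (s i0)) <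
          1 - (poly (HP B) 0 + poly (HP R) 0 - real_of_int (k i) * real e)"
        using lo split(2) unfolding e by simp
    qed
  qed
qed

end

section \<open>Curves of maximal genus\<close>

lemma scheme_dim_eq:
  assumes "gideal (gr I)" "tot (gr I) = I"
  shows "scheme_dim I = numeral n \<longleftrightarrow> degree (HP (gr I)) = numeral n"
    and "scheme_dim I = 1 \<longleftrightarrow> degree (HP (gr I)) = 1"
  unfolding scheme_dim_eq_degree[OF assms] by (simp_all add: numeral_eq_enat one_enat_def)

lemma curves_iff:
  "C \<in> curves S d \<longleftrightarrow> closed_subscheme C \<and> S \<subseteq> C \<and> degree (HP (gr C)) = 1 \<and> slope (gr C) = of_int d"
proof (cases "closed_subscheme C")
  case True
  note g = sat_gr[OF True]
  show ?thesis
    unfolding curves_def mem_Collect_eq scheme_dim_eq(2)[OF g(1,3)] scheme_degree_def hilbert_polynomial_eq_HP[OF g(1)]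
    by (auto simp: True)
qed (simp add: curves_def)

lemma arithmetic_genus_eq:
  assumes "gideal (gr C)"
  shows "real_of_int (arithmetic_genus C) = 1 - poly (HP (gr C)) 0"
  using euler_characteristic_eq[OF assms] by (simp add: arithmetic_genus_def)

text \<open>With n the degree of \<open>X\<close>, the equation s = k n and n \<ge> 1 give both 1
  \<le> k and k \<le> s. The last two equations show that s determines k and then c, so components
  of equal degree have equal sectional genus.\<close>

lemma cartier_divisor_invariants:
  fixes X D :: "'n::{finite,linorder} mpoly set"
  assumes X: "integral_subscheme X" "scheme_dim X = 3" and D: "effective_cartier_divisor X D" "integral_subscheme D" "scheme_dim D = 2"
    and gen: "general_hyperplane (\<lambda>h. linearly_equivalent_to_multiple X D k (hyperplane_section X h))"
  shows "\<exists>s c :: int. scheme_degree D = of_int s \<and> 1 \<le> k \<and> k \<le> s \<and> twisted_divisor (gr X) (gr D) k \<and>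
    (\<forall>x. poly (HP (gr D)) x - poly (HP (gr D)) (x - 1) = of_int s * x + of_int c) \<and>
    of_int s = of_int k * (6 * coeff (HP (gr X)) 3) \<and>
    of_int c = poly (HP (gr X)) 0 - poly (HP (gr X)) (- of_int k) - poly (HP (gr X)) (-1) + poly (HP (gr X)) (-1 - of_int k)"
proof -
  obtain h where "h \<in> hf 1" "linearly_equivalent_to_multiple X D k (hyperplane_section X h)"
    by (rule general_hyperplane_ex[OF gen])
  then have td: "twisted_divisor (gr X) (gr D) k" by (rule cartier_twisted_divisor[OF X(1) D(1)])
  note gpX = gprime_gr[OF X(1)] and gpD = gprime_gr[OF D(2)]
  note gX = gprime_gideal[OF gpX(1)] and gD = gprime_gideal[OF gpD(1)]
  obtain v where v: "var v \<notin> gr X 1" using gpX(2) by blast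
  have XD: "gr X \<le> gr D" by (rule gr_mono[OF effective_cartier_divisorD(2)[OF D(1)]])
  have dX: "degree (HP (gr X)) = 3" using X(2) scheme_dim_eq(1)[OF gX gpX(3), of "num.Bit1 num.One"] by simp
  have dD: "degree (HP (gr D)) = 2" using D(3) scheme_dim_eq(1)[OF gD gpD(3), of "num.Bit0 num.One"] by simp
  note eq = twisted_divisor_HP[OF gpX(1) v gD XD td]
  obtain n where n: "of_int n = 6 * coeff (HP (gr X)) 3" using third_difference[OF gX] dX by auto
  obtain s c where sc: "\<And>x. poly (HP (gr D)) x - poly (HP (gr D)) (x - 1) = of_int s * x + of_int c"
    "of_int s = 2 * coeff (HP (gr D)) 2" using first_difference[OF gD] dD by auto
  have pos: "0 < lead_coeff (HP (gr I))" if "gideal (gr I)" "degree (HP (gr I)) \<noteq> 0" for I :: "'n mpoly set"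
    by (rule eventually_nonneg_lead[OF eventually_mono[OF HP_mono[OF that(1) that(1) order_refl]]]) (use that(2) in auto)
  have n1: "n \<ge> 1"
  proof -
    have "0 < real_of_int n" using pos[OF gX] dX n by simp
    then show ?thesis by simp
  qed
  have s1: "s \<ge> 1"
  proof -
    have "0 < real_of_int s" using pos[OF gD] dD sc(2) by simp
    then show ?thesis by simp
  qed
  have pX: "poly (HP (gr X)) x = coeff (HP (gr X)) 0 + coeff (HP (gr X)) 1 * x + coeff (HP (gr X)) 2 * x\<^sup>2 + coeff (HP (gr X)) 3 * x ^ 3" for x
    by (rule poly_cubic) (simp add: dX)
  have "of_int s = (poly (HP (gr D)) 1 - poly (HP (gr D)) 0) - (poly (HP (gr D)) 0 - poly (HP (gr D)) (-1))"
    using sc(1)[of 1] sc(1)[of 0] by simp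
  also have "\<dots> = of_int k * (6 * coeff (HP (gr X)) 3)"
    unfolding eq pX by (simp add: power2_eq_square power3_eq_cube algebra_simps)
  finally have sk: "of_int s = of_int k * (6 * coeff (HP (gr X)) 3)" .
  then have "real_of_int s = real_of_int (k * n)" by (simp add: n)
  then have skn: "s = k * n" by (simp only: of_int_eq_iff)
  then have "k \<ge> 1" using s1 n1 by (smt (verit) mult_nonpos_nonneg)
  moreover have "k \<le> s" using skn n1 \<open>k \<ge> 1\<close> by simp
  moreover have "scheme_degree D = of_int s"
    unfolding scheme_degree_def hilbert_polynomial_eq_HP[OF gD] using sc(2) dD by (simp add: fact_numeral)
  moreover have "of_int c = poly (HP (gr X)) 0 - poly (HP (gr X)) (- of_int k) - poly (HP (gr X)) (-1) + poly (HP (gr X)) (-1 - of_int k)"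
    using sc(1)[of 0] unfolding eq by simp
  ultimately show ?thesis using td sc(1) sk by blast
qed

text \<open>Membership in the iterated quotient is reduced to products with one factor from each
  ideal; every pair in \<open>zs\<close> is such a factor with its degree.\<close>

lemma mem_foldl_colon_ideal:
  fixes J :: "nat \<Rightarrow> 'n::{finite,linorder} cfam" and C :: "'n cfam"
  assumes "\<And>zs. list_all2 (\<lambda>z i. fst z \<in> J i (snd z)) zs es \<Longrightarrow> prod_list (map fst zs) * g \<in> C (sum_list (map snd zs) + t)"
    and "g \<in> hf t" and "\<And>i e. i \<in> set es \<Longrightarrow> J i e \<subseteq> hf e"
  shows "g \<in> foldl (\<lambda>C i. colon_ideal C (J i)) C es t"
  using assms
proof (induction es arbitrary: C)
  case Nil
  then show ?case using Nil.prems(1)[of "[]"] by simp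
next
  case (Cons i es)
  have "g \<in> foldl (\<lambda>C i. colon_ideal C (J i)) (colon_ideal C (J i)) es t"
  proof (rule Cons.IH)
    fix zs :: "('n mpoly \<times> int) list" assume zs: "list_all2 (\<lambda>z i. fst z \<in> J i (snd z)) zs es"
    have "prod_list (map fst zs) \<in> hf (sum_list (map snd zs))"
      using zs Cons.prems(3)
    proof (induction zs es rule: list_all2_induct)
      case (Cons z zs j es)
      then have "fst z \<in> hf (snd z)" "prod_list (map fst zs) \<in> hf (sum_list (map snd zs))" by auto
      then show ?case using hf_mult by simp
    qed (simp add: hf_one)
    then have "prod_list (map fst zs) * g \<in> hf (sum_list (map snd zs) + t)" by (rule hf_mult[OF _ Cons.prems(2)])
    moreover have "y * (prod_list (map fst zs) * g) \<in> C (e + (sum_list (map snd zs) + t))" if "y \<in> J i e" for e y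
      using Cons.prems(1)[of "(y, e) # zs"] zs that by (simp add: ac_simps)
    ultimately show "prod_list (map fst zs) * g \<in> colon_ideal C (J i) (sum_list (map snd zs) + t)"
      by (simp add: colon_ideal_def)
  qed (use Cons.prems in auto)
  then show ?case by simp
qed

text \<open>Products with one factor for each component, counted with multiplicity, lie in the ideal
  of \<open>S\<close> and so in that of \<open>C\<close>. Hence 1 lies in the iterated quotient, in
  whatever order the residuals are taken.\<close>

lemma divisor_sum_foldl_colon:
  fixes X C :: "'n::{finite,linorder} mpoly set"
  assumes X: "integral_subscheme X" and S: "is_divisor_sum X l m D S"
    and D: "\<And>i. i \<in> {1..l} \<Longrightarrow> effective_cartier_divisor X (D i)"
    and C: "closed_subscheme C" "S \<subseteq> C"
    and es: "mset es = (\<Sum>i\<in>{1..l}. replicate_mset (m i) i)"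
  shows "foldl (\<lambda>C i. colon_ideal C (gr (D i))) (gr C) es = hf"
proof -
  note gC = sat_gr(1)[OF C(1)]
  \<comment> \<open>\<open>divisor_sum_prod_mem\<close> takes the degree as a function of the form.
    For a nonzero form the degree is unique; a product equal to 0 is treated separately.\<close>
  define \<tau> where "\<tau> y = (SOME t. y \<in> hf (int t))" for y :: "'n mpoly"
  have \<tau>: "int (\<tau> y) = e" if y: "y \<in> hf e" "y \<noteq> 0" for y e
  proof -
    have "e \<ge> 0" using y hf_neg[of e] by (metis not_le singletonD)
    then have "y \<in> hf (int (nat e))" using y(1) by simp
    then have "y \<in> hf (int (\<tau> y))" unfolding \<tau>_def by (rule someI)
    moreover obtain q where "q \<in> keys y" using y(2) by (metis keys_eq_empty ex_in_conv)
    ultimately show ?thesis using y(1) unfolding hf_def mem_Collect_eq by metis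
  qed
  have "1 \<in> foldl (\<lambda>C i. colon_ideal C (gr (D i))) (gr C) es 0"
  proof (rule mem_foldl_colon_ideal)
    fix zs :: "('n mpoly \<times> int) list" assume zs: "list_all2 (\<lambda>z i. fst z \<in> gr (D i) (snd z)) zs es"
    have h: "prod_list (map fst zs) \<in> hf (sum_list (map snd zs))"
      using zs
    proof (induction zs es rule: list_all2_induct)
      case (Cons z zs j es)
      then show ?case by (simp add: gr_def hf_mult)
    qed (simp add: hf_one)
    have "prod_list (map fst zs) \<in> C"
    proof (cases "prod_list (map fst zs) = 0")
      case True
      then show ?thesis using ideal_poly_ringD(1)[OF closed_subscheme_ideal[OF C(1)]] by simp
    next
      case False
      have "list_all2 (\<lambda>y i. y \<in> gr (D i) (int (\<tau> y))) (map fst zs) es"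
        using zs False
      proof (induction zs es rule: list_all2_induct)
        case (Cons z zs j es)
        then have "fst z \<noteq> 0" "fst z \<in> hf (snd z)" by (auto simp: gr_def)
        from \<tau>[OF this(2,1)] show ?case using Cons by simp
      qed simp
      then show ?thesis using divisor_sum_prod_mem[OF X S D es] C(2) by blast
    qed
    then show "prod_list (map fst zs) * 1 \<in> gr C (sum_list (map snd zs) + 0)" using h by (simp add: gr_def)
  qed (auto simp: hf_one gr_def)
  moreover have "gideal (foldl (\<lambda>C i. colon_ideal C (gr (D i))) J es)" if "gideal J" for J
    using that by (induction es arbitrary: J) (simp_all add: gideal_colon_ideal)
  ultimately show ?thesis using gideal_eq_UNIV gC by blast
qed

lemma max_genus_eq:
  assumes "C \<in> \<C>" "\<And>C'. C' \<in> \<C> \<Longrightarrow> arithmetic_genus C' \<le> arithmetic_genus C"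
  shows "has_max_genus \<C>" "max_genus \<C> = arithmetic_genus C"
  unfolding has_max_genus_def max_genus_def using assms by (auto intro!: Greatest_equality)

text \<open>Genera may be unbounded below, so the maximum is taken over those not below a given
  one.\<close>

lemma ex_max_genus:
  assumes "\<C> \<noteq> {}" "\<And>C. C \<in> \<C> \<Longrightarrow> real_of_int (arithmetic_genus C) \<le> N"
  obtains C where "C \<in> \<C>" "\<And>C'. C' \<in> \<C> \<Longrightarrow> arithmetic_genus C' \<le> arithmetic_genus C"
proof -
  obtain C0 where C0: "C0 \<in> \<C>" using assms(1) by blast
  let ?A = "{g \<in> arithmetic_genus ` \<C>. arithmetic_genus C0 \<le> g}"
  have "?A \<subseteq> {arithmetic_genus C0..\<lfloor>N\<rfloor>}" using assms(2) by (auto simp: le_floor_iff)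
  then have fin: "finite ?A" by (rule finite_subset) simp
  have ne: "?A \<noteq> {}" using C0 by auto
  obtain C where C: "C \<in> \<C>" "arithmetic_genus C = Max ?A" using Max_in[OF fin ne] by auto
  have "arithmetic_genus C' \<le> arithmetic_genus C" if "C' \<in> \<C>" for C'
  proof (cases "arithmetic_genus C0 \<le> arithmetic_genus C'")
    case True
    then show ?thesis unfolding C(2) using that by (intro Max_ge[OF fin]) auto
  next
    case False
    moreover have "arithmetic_genus C0 \<le> Max ?A" using C0 by (intro Max_ge[OF fin]) auto
    ultimately show ?thesis unfolding C(2) by simp
  qed
  then show ?thesis using C(1) that by blast
qed

theorem corollary2p11:
  fixes X S :: "('n::{finite,linorder}) mpoly set"
    and D :: "nat \<Rightarrow> 'n mpoly set"
    and m :: "nat \<Rightarrow> nat"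
    and l :: nat
    and d :: int
    and s degS :: real
    and \<pi>\<^sub>1 :: int
  assumes "integral_subscheme X" and "scheme_dim X = 3"
    and "l \<ge> 1"
    and "\<And>i. i \<in> {1..l} \<Longrightarrow> effective_cartier_divisor X (D i)"
    and "\<And>i. i \<in> {1..l} \<Longrightarrow> integral_subscheme (D i) \<and> scheme_dim (D i) = 2"
    and "inj_on D {1..l}"
    and "\<And>i. i \<in> {1..l} \<Longrightarrow>
      \<exists>k. general_hyperplane
        (\<lambda>h. linearly_equivalent_to_multiple X (D i) k (hyperplane_section X h))"
    and "\<And>i j. 1 \<le> i \<Longrightarrow> i \<le> j \<Longrightarrow> j \<le> l \<Longrightarrow> scheme_degree (D i) \<le> scheme_degree (D j)"
    and "\<And>i. i \<in> {1..l} \<Longrightarrow> m i > 0"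
    and "is_divisor_sum X l m D S"
    and "s = scheme_degree (D 1)"
    and "\<pi>\<^sub>1 = sectional_genus (D 1)"
    and "degS = (\<Sum>i\<in>{1..l}. real (m i) * scheme_degree (D i))"
    and "real_of_int d > 30 * degS ^ 7"
    and "\<exists>C\<in>curves S d. real_of_int (arithmetic_genus C) >
      (real_of_int d)\<^sup>2 / (2 * s) + real_of_int d / (2 * s) * (2 * real_of_int \<pi>\<^sub>1 - 2 - s - 1 / 2)"
  shows "has_max_genus (curves S d) \<and> has_max_genus (curves_star l D d) \<and>
    G S d = G_star l D d \<and>
    (\<forall>C\<in>curves S d. arithmetic_genus C = G S d \<longrightarrow> C \<in> curves_star l D d)"
proof -
  define P where "P i k s c \<longleftrightarrow> scheme_degree (D i) = of_int s \<and> 1 \<le> k \<and> k \<le> s \<and> twisted_divisor (gr X) (gr (D i)) k \<and>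
    (\<forall>x. poly (HP (gr (D i))) x - poly (HP (gr (D i))) (x - 1) = of_int s * x + of_int c) \<and>
    of_int s = of_int k * (6 * coeff (HP (gr X)) 3) \<and>
    of_int c = poly (HP (gr X)) 0 - poly (HP (gr X)) (- of_int k) - poly (HP (gr X)) (-1) + poly (HP (gr X)) (-1 - of_int k)"
    for i and k s c :: int
  have "\<exists>k s c. P i k s c" if i: "i \<in> {1..l}" for i
  proof -
    obtain k where "general_hyperplane (\<lambda>h. linearly_equivalent_to_multiple X (D i) k (hyperplane_section X h))"
      using assms(7)[OF i] by blast
    from cartier_divisor_invariants[OF assms(1,2) assms(4)[OF i] _ _ this] assms(5)[OF i] show ?thesis
      unfolding P_def by blast
  qed
  then obtain k s' c where "\<And>i. i \<in> {1..l} \<Longrightarrow> P i (k i) (s' i) (c i)" by metis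
  note inv = this[unfolded P_def]
  have deg: "scheme_degree (D i) = of_int (s' i)" if "i \<in> {1..l}" for i using inv[OF that] by blast
  have l1: "1 \<in> {1..l}" using assms(3) by simp
  interpret divisor_family "gr X" "\<lambda>i. gr (D i)" k s' c "{1..l}"
  proof unfold_locales
    fix i assume i: "i \<in> {1..l}"
    have "\<exists>v. var v \<notin> gr (D i) 1" using gprime_gr(2) assms(5)[OF i] by blast
    then show "\<exists>v. integral_surface (gr (D i)) v (s' i) (c i)"
      using gprime_gr(1)[of "D i"] assms(5)[OF i] inv[OF i] unfolding integral_surface_def by fastforce
    show "gr X \<le> gr (D i)" by (rule gr_mono[OF effective_cartier_divisorD(2)[OF assms(4)[OF i]]])
  qed (use inv gprime_gr(1)[OF assms(1)] in auto)
  have s1: "s = of_int (s' 1)" using assms(11) inv[OF l1] by simp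
  have s'1: "1 \<le> real_of_int (s' 1)" using s_pos[OF l1] by simp
  have min: "s' 1 \<le> s' i" if "i \<in> {1..l}" for i
    using assms(8)[of 1 i] inv[OF l1] inv[OF that] that by simp
  have a_eq: "a i = a 1" if i: "i \<in> {1..l}" and eq: "s' i = s' 1" for i
  proof -
    have "real_of_int (k i) * (6 * coeff (HP (gr X)) 3) = real_of_int (k 1) * (6 * coeff (HP (gr X)) 3)"
      "real_of_int (k 1) * (6 * coeff (HP (gr X)) 3) \<noteq> 0"
      using inv[OF i] inv[OF l1] eq s'1 by auto
    then have "k i = k 1" by simp
    then have "real_of_int (c i) = real_of_int (c 1)" using inv[OF i] inv[OF l1] by presburger
    then show ?thesis by (simp add: a_def eq)
  qed
  define M where "M = (\<Sum>i\<in>{1..l}. replicate_mset (m i) i)"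
  have M: "set_mset M \<subseteq> {1..l}" "1 \<in># M" using l1 assms(9)[OF l1] by (auto simp: M_def set_mset_sum)
  have "(\<Sum>i\<in>#(\<Sum>i\<in>A. replicate_mset (m i) i). real_of_int (s' i)) = (\<Sum>i\<in>A. real (m i) * real_of_int (s' i))" for A
    by (induction A rule: infinite_finite_induct) simp_all
  then have degS: "(\<Sum>i\<in>#M. real_of_int (s' i)) = degS"
    unfolding M_def assms(13) using inv by (auto intro!: sum.cong)
  define bound where "bound = (real_of_int d)\<^sup>2 / (2 * s) + real_of_int d / (2 * s) * (2 * real_of_int \<pi>\<^sub>1 - 2 - s - 1 / 2)"
  have pi: "\<pi>\<^sub>1 = 1 - c 1"
    unfolding assms(12) using inv[OF l1] assms(5)[OF l1] by (intro sectional_genus_eq) (auto dest!: spec[of _ 0])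
  \<comment> \<open>The assumed bound consists of the quadratic and linear terms of the genus bound
    for \<open>D 1\<close>, diminished by the slack d/(4 s).\<close>
  then have bound_eq: "bound = (real_of_int d)\<^sup>2 / (2 * s' 1) + real_of_int d * a 1 - real_of_int d / (4 * s' 1)"
    unfolding bound_def s1 a_def pi using s'1 by (simp add: field_simps)
  have d0: "0 < d"
  proof -
    have "0 \<le> degS" unfolding assms(13) using inv by (intro sum_nonneg) fastforce
    then have "0 \<le> 30 * degS ^ 7" by simp
    then have "0 < real_of_int d" using assms(14) by linarith
    then show ?thesis by simp
  qed
  have SD: "S \<subseteq> D j" if "j \<in> {1..l}" for j
    by (rule divisor_sum_subset[OF assms(1,10,4) that assms(9)[OF that]])
  have star_sub: "curves_star l D d \<subseteq> curves S d"
    using SD unfolding curves_star_def curves_def by blast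
  have starI: "C \<in> curves_star l D d" if "i \<in> {1..l}" "s' i = s' 1" "C \<in> curves (D i) d" for i C
  proof -
    have "scheme_degree (D i) \<le> scheme_degree (D j)" if j: "j \<in> {1..l}" for j
      using min[OF j] \<open>s' i = s' 1\<close> unfolding deg[OF j] deg[OF \<open>i \<in> {1..l}\<close>] by simp
    then show ?thesis using that unfolding curves_star_def by blast
  qed
  \<comment> \<open>The section of \<open>C\<close> by the minimal component found has the same
    degree \<open>d\<close>, and its genus exceeds that of \<open>C\<close> by the length of the
    residual.\<close>
  have improve: "\<exists>B\<in>curves_star l D d. arithmetic_genus C \<le> arithmetic_genus B \<and>
      (arithmetic_genus C = arithmetic_genus B \<longrightarrow> C \<in> curves_star l D d)"
    if C: "C \<in> curves S d" and large: "bound < real_of_int (arithmetic_genus C)" for C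
  proof -
    have cl: "closed_subscheme C" "S \<subseteq> C" and dC: "degree (HP (gr C)) = 1" and sl: "slope (gr C) = of_int d"
      using C unfolding curves_iff by auto
    note gC = sat_gr[OF cl(1)]
    have "X \<subseteq> S" using assms(10) by (simp add: is_divisor_sum_def effective_cartier_divisor_def)
    then have XC: "gr X \<le> gr C" using cl(2) by (intro gr_mono) blast
    note C' = gC(1,2) XC eq_refl[OF dC]
    have "\<exists>i\<in>{1..l}. s' i = s' 1 \<and> slope (colon_ideal (gr C) (gr (D i))) = 0"
    proof (rule ex_component_residual_degree_0[OF C' M(1) _ M(2) min a_eq])
      show "foldl (\<lambda>C i. colon_ideal C (gr (D i))) (gr C) es = hf" if "mset es = M" for es
        by (rule divisor_sum_foldl_colon[OF assms(1,10,4) cl]) (use that in \<open>simp_all add: M_def\<close>)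
      show "30 * (\<Sum>i\<in>#M. real_of_int (s' i)) ^ 7 < slope (gr C)" unfolding degS sl by (rule assms(14))
      show "(slope (gr C))\<^sup>2 / (2 * s' 1) + slope (gr C) * a 1 - slope (gr C) / (4 * s' 1) < 1 - poly (HP (gr C)) 0"
        using large unfolding bound_eq arithmetic_genus_eq[OF gC(1)] sl .
    qed
    then obtain i where i: "i \<in> {1..l}" "s' i = s' 1" and R0: "slope (colon_ideal (gr C) (gr (D i))) = 0" by blast
    define B where "B = sat (isum (gr C) (gr (D i)))"
    define R where "R = colon_ideal (gr C) (gr (D i))"
    note B = section_facts[OF C' i(1), folded B_def]
    note R = residual_facts[OF C' i(1), folded R_def]
    note split = residual_split[OF C' i(1), folded R_def B(6), folded B_def]
    have totD: "tot (gr (D i)) = D i" using gprime_gr(3) assms(5)[OF i(1)] by blast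
    have slB: "slope B = of_int d" using split(1) sl R0 by (simp add: R_def)
    have "tot B \<in> curves (D i) d"
      unfolding curves_iff gr_tot[OF B(1)]
    proof (intro conjI slB)
      show "closed_subscheme (tot B)" by (rule closed_subscheme_tot[OF B(1,2)])
      show "D i \<subseteq> tot B" using tot_mono[OF B(4)] totD by simp
      have "degree (HP B) \<noteq> 0" using slB d0 coeff_eq_0[of "HP B" 1] by force
      then show "degree (HP B) = 1" using B(5) by simp
    qed
    then have "tot B \<in> curves_star l D d" by (rule starI[OF i])
    moreover have gB: "real_of_int (arithmetic_genus (tot B)) = arithmetic_genus C + poly (HP R) 0"
      using arithmetic_genus_eq[of "tot B"] arithmetic_genus_eq[OF gC(1)] B(1) split(2) R0
      by (simp add: gr_tot[OF B(1)] R_def)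
    moreover have "0 \<le> poly (HP R) 0" by (rule HP_const_nonneg[OF R(1,5)], unfold R_def, rule R0)
    \<comment> \<open>A residual of length 0 is empty: saturation puts 1 into the quotient of
      \<open>C\<close> by \<open>D i\<close>, that is, \<open>C\<close> lies on
      \<open>D i\<close>.\<close>
    moreover have "C \<in> curves_star l D d" if "poly (HP R) 0 = 0"
    proof (rule starI[OF i])
      have "poly (HP R) x = poly 0 x" for x
        by (subst HP_linear[OF R(5)]) (simp only: that R0[folded R_def] mult_zero_left add_0 poly_0)
      then have "HP R = 0" by (intro poly_eq_poly_eq_iff[THEN iffD1] ext)
      then obtain t0 where t0: "\<And>t. t \<ge> t0 \<Longrightarrow> R t = hf t" using HP_eq_0_iff[OF R(1)] by blast
      have one: "1 \<in> R 0"
        by (rule sat_memI[OF R(1,2) hf_one, of "nat t0"]) (use t0[of "int (nat t0)"] in simp)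
      have "gr (D i) \<le> gr C"
      proof (rule le_funI, rule subsetI)
        fix e y assume "y \<in> gr (D i) e"
        then have "y * 1 \<in> gr C (e + 0)" using one unfolding R_def colon_ideal_def by blast
        then show "y \<in> gr C e" by simp
      qed
      then have "D i \<subseteq> C" using tot_mono totD gC(3) by metis
      then show "C \<in> curves (D i) d" using C by (simp add: curves_def)
    qed
    ultimately show ?thesis by (intro bexI[of _ "tot B"]) auto
  qed
  obtain C0 where C0: "C0 \<in> curves S d" "bound < real_of_int (arithmetic_genus C0)"
    using assms(15) unfolding bound_def by blast
  have "curves_star l D d \<noteq> {}" using improve[OF C0] by blast
  \<comment> \<open>A maximum on the minimal components exists because Castelnuovo's bound limits
    the genus there.\<close>
  moreover have "real_of_int (arithmetic_genus C) \<le> 1 + ((real_of_int d)\<^sup>2 / (2 * s' 1) + real_of_int d * a 1 + 2 * real_of_int (s' 1) ^ 4)"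
    if star: "C \<in> curves_star l D d" for C
  proof -
    obtain i where i: "i \<in> {1..l}" "\<forall>j\<in>{1..l}. scheme_degree (D i) \<le> scheme_degree (D j)" "C \<in> curves (D i) d"
      using star unfolding curves_star_def by blast
    have si: "s' i = s' 1" using i(2) l1 inv[OF l1] inv[OF i(1)] min[OF i(1)] by force
    have cl: "closed_subscheme C" "D i \<subseteq> C" and dC: "degree (HP (gr C)) = 1" and sl: "slope (gr C) = of_int d"
      using i(3) unfolding curves_iff by auto
    note gC = sat_gr[OF cl(1)]
    show ?thesis
      using genus_bound[OF i(1) gC(1,2) gr_mono[OF cl(2)] eq_refl[OF dC]]
      unfolding arithmetic_genus_eq[OF gC(1)] sl si a_eq[OF i(1) si] by simp
  qed
  ultimately obtain C1 where C1: "C1 \<in> curves_star l D d"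
    "\<And>C. C \<in> curves_star l D d \<Longrightarrow> arithmetic_genus C \<le> arithmetic_genus C1"
    using ex_max_genus[of "curves_star l D d"] by blast
  have C0_le: "arithmetic_genus C0 \<le> arithmetic_genus C1" using improve[OF C0] C1(2) by (meson order_trans)
  \<comment> \<open>Curves not above the bound are dominated by \<open>C0\<close>, which is above it
    and whose genus is at most that of \<open>C1\<close>.\<close>
  have le: "arithmetic_genus C \<le> arithmetic_genus C1" if "C \<in> curves S d" for C
  proof (cases "bound < real_of_int (arithmetic_genus C)")
    case True
    then show ?thesis using improve[OF that] C1(2) by (meson order_trans)
  next
    case False
    then have "real_of_int (arithmetic_genus C) \<le> real_of_int (arithmetic_genus C1)" using C0(2) C0_le by linarith
    then show ?thesis by simp
  qed
  have C1S: "C1 \<in> curves S d" using C1(1) star_sub by blast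
  note mS = max_genus_eq[OF C1S le] and mstar = max_genus_eq[OF C1]
  have "C \<in> curves_star l D d" if C: "C \<in> curves S d" "arithmetic_genus C = arithmetic_genus C1" for C
  proof -
    have "bound < real_of_int (arithmetic_genus C)" using C0(2) C0_le C(2) by linarith
    from improve[OF C(1) this] C1(2) C(2) show ?thesis by (metis order_antisym)
  qed
  then show ?thesis using mS mstar unfolding G_def G_star_def by auto
qed

end
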